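(* Let $\mathbb{G}\neq\mathbb{R}$ be a Carnot group of step $s$ which admits a ball $B$ of uniformly deformable directions, and let $N\subset\mathbb{G}$ be the fixed $G_\delta$ set described in the context. Let $f:\mathbb{G}\to\mathbb{R}$ be Lipschitz with $\mathrm{Lip}_{\mathbb{G}}(f)\le1/2$ and suppose $(x_*,E_* )\in D^f$ with $E_*\in B$. Let $M$ denote the set of pairs $(x,E)\in D^f$ such that $Ef(x)\ge E_*f(x_* )$ and for every $t\in(-1,1)$: $$\big|(f(x\exp(tE_* ))-f(x))-(f(x_*\exp(tE_* ))-f(x_* ))\big|\le 6|t|\,\big((Ef(x)-E_*f(x_* ))\,\mathrm{Lip}_{\mathbb{G}}(f)\big)^{\frac{1}{2s^2}}.$$ If $$\lim_{\delta\downarrow0}\sup\{Ef(x):(x,E)\in M\text{ and }d(x,x_* )\le\delta\}\le E_*f(x_* ),$$ then $f$ is differentiable at $x_*$ and its Pansu differential is given by $$L(x):=E_*f(x_* )\langle x,E_*(0)\rangle=E_*f(x_* )\langle p(x),p(E_* )\rangle.$$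
   Context: A Carnot group $\mathbb{G}$ of step $s$ is a simply connected Lie group whose Lie algebra $\mathfrak g$ decomposes as $\mathfrak g=V_1\oplus\cdots\oplus V_s$ with $V_i=[V_1,V_{i-1}]$ for $i=2,\dots,s$ and $[V_1,V_s]=0$. $V_1$ is the horizontal layer and $r=\dim V_1$; elements of $V_1$ are regarded as left-invariant vector fields. Fix a basis $X_1,\dots,X_n$ of $\mathfrak g$ adapted to the stratification ($X_1,\dots,X_r$ is a basis of $V_1$), and identify $\mathbb{G}$ with $\mathbb{R}^n$ by $(x_1,\dots,x_n)\leftrightarrow\exp(x_1X_1+\cdots+x_nX_n)$ (the identity is $0$). Let $\omega$ be the inner product norm on $V_1$ making $X_1,\dots,X_r$ orthonormal. Let $p(x)=(x_1,\dots,x_r)$ for $x\in\mathbb{G}$, and $p(E)=(a_1,\dots,a_r)$ for $E=\sum_{i\le r}a_iX_i\in V_1$; then $\omega(E)=|p(E)|$ and $\exp(E)=E(0)=(p(E),0)\in\mathbb{R}^n$. $\langle\cdot,\cdot\rangle$ is the Euclidean inner product in coordinates. Dilations: $\delta_\lambda(\exp(\sum_iY_i))=\exp(\sum_i\lambda^iY_i)$ for $\lambda>0$, $Y_i\in V_i$. An absolutely continuous curve $\gamma:[a,b]\to\mathbb{G}$ is horizontal if $\gamma'(t)=\sum_{j=1}^r u_j(t)X_j(\gamma(t))$ for a.e. $t$ with $u_j\in L^1[a,b]$; its length is $\int_a^b|u|$. The Carnot-Carathéodory (CC) distance $d(x,y)$ is the infimum of lengths of horizontal curves joining $x$ to $y$;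 $d(x)=d(x,0)$. Lipschitz maps and $\mathrm{Lip}_{\mathbb{G}}$ are with respect to $d$. Horizontal lines are curves $t\mapsto q\exp(tV)$ with $q\in\mathbb{G}$, $V\in V_1$. A curve is formed by joining at most $k$ horizontal lines if its domain can be divided into at most $k$ consecutive intervals on each of which it coincides with a horizontal line. Differentiability: $L:\mathbb{G}\to\mathbb{R}$ is $\mathbb{G}$-linear if $L(xy)=L(x)+L(y)$ and $L(\delta_\lambda(x))=\lambda L(x)$ for all $x,y\in\mathbb{G}$, $\lambda>0$. $f:\mathbb{G}\to\mathbb{R}$ is differentiable at $x$ with Pansu differential $L$ if $L$ is $\mathbb{G}$-linear and $\lim_{y\to x}|f(y)-f(x)-L(x^{-1}y)|/d(x,y)=0$. For $E\in V_1$, $Ef(x)=\lim_{t\to0}\frac{f(x\exp(tE))-f(x)}{t}$ when the limit exists. Deformability: $E\in V_1$ with $\omega(E)=1$ is deformable with parameters $C_E$ (a positive constant), $N_E$ (a positive integer) and $\Delta_E:(0,\infty)\to(0,\infty)$ if for every $0<\ell<1$, $\eta\in(0,\infty)$, $0<\Delta<\Delta_E(\eta)$ and $u\in\mathbb{G}$ with $d(u)\le1$, there is a Lipschitz horizontal curve $g:\mathbb{R}\to\mathbb{G}$ formed by joining at most $N_E$ horizontal lines such that: (1) $g(t)=\exp(tE)$ for $|t|\ge \ell$; (2) $g(\zeta)=\delta_{\Delta \ell}(u)$ where $\zeta:=\langle\delta_{\Delta \ell}(u),E(0)\rangle$; (3) $\mathrm{Lip}_{\mathbb{G}}(g)\le1+\eta\Delta$;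 (4) $|(p\circ g)'(t)-p(E)|\le C_E\Delta$ for all but finitely many $t\in\mathbb{R}$. $\mathbb{G}$ admits a ball of uniformly deformable directions if there is an open ball $B\subset V_1$ (with respect to $\omega$, meeting the unit sphere $\{\omega=1\}$) such that every $E\in B$ with $\omega(E)=1$ is deformable with the same parameters $C_B,N_B,\Delta_B$. Fix such a $B$. The set $N$: let $B_{\mathbb{Q}}$ be the set of $E\in B$ with $\omega(E)=1$ that are rational linear combinations of $X_1,\dots,X_r$. For each $E\in B_{\mathbb{Q}}$, each $u\in\mathbb{Q}^n$ with $d(u)\le1$ and all rationals $0<\ell<1$, $\eta>0$, $0<\Delta<\Delta_B(\eta)$, fix a Lipschitz horizontal curve $\gamma_{E,u,\ell,\Delta,\eta}:\mathbb{R}\to\mathbb{G}$, formed by joining at most $N_B$ horizontal lines, such that $\gamma_{E,u,\ell,\Delta,\eta}(t)=\exp(tE)$ for $|t|\ge\ell$; $\gamma_{E,u,\ell,\Delta,\eta}(\zeta)=\delta_{\Delta\ell}(u)$ where $\zeta:=\langle\delta_{\Delta\ell}(u),E(0)\rangle$; $\mathrm{Lip}_{\mathbb{G}}(\gamma_{E,u,\ell,\Delta,\eta})\le1+\eta\Delta$; and $|(p\circ\gamma_{E,u,\ell,\Delta,\eta})'(t)-p(E)|\le C_B\Delta$ for all but finitely many $t\in\mathbb{R}$. Let $\Lambda$ be the countable union of the images of all translated curves $x\gamma_{E,u,\ell,\Delta,\eta}$ with $x\in\mathbb{Q}^n$, $E\in B_{\mathbb{Q}}$, $u\in\mathbb{Q}^n$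 with $d(u)\le1$, and $\ell,\eta,\Delta$ rational with $0<\ell<1$, $\eta>0$, $0<\Delta<\Delta_B(\eta)$. $N\subset\mathbb{G}$ is a fixed $G_\delta$ set containing $\Lambda$ which has Hausdorff dimension one with respect to the CC metric (such a set exists). For Lipschitz $f:\mathbb{G}\to\mathbb{R}$, $D^f:=\{(x,E)\in N\times V_1:\omega(E)=1,\ Ef(x)\text{ exists}\}$. *)

theory Defs
  imports "HOL-Analysis.Analysis" "HOL-Algebra.Group"
begin

text \<open>
  A Carnot group is presented in exponential coordinates of the first kind: a Lie group structure
  on \<open>real ^ 'n\<close> with identity 0 for which every straight line through 0 is a one-parameter subgroup,
  so that the exponential map of the Lie algebra \<open>T\<^sub>0 = real ^ 'n\<close> is the identity map.
  Consequently one vector \<open>E\<close> stands for the Lie algebra element with these coordinates, for the value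
  at 0 of the corresponding left-invariant field, and for the point \<open>exp E\<close>; and \<open>t *\<^sub>R E\<close> is
  \<open>exp (t E)\<close>. The adapted basis consists of the vectors \<open>axis j 1\<close>, and the weight \<open>w j\<close> is the index
  of the layer containing the basis vector number \<open>j\<close>.
\<close>

subsection \<open>Lie group structure\<close>

primrec Ck_map :: "nat \<Rightarrow> ('a::euclidean_space \<Rightarrow> 'b::euclidean_space) \<Rightarrow> bool" where
  "Ck_map 0 f \<longleftrightarrow> continuous_on UNIV f"
| "Ck_map (Suc k) f \<longleftrightarrow>
     (\<exists>f'. (\<forall>x. (f has_derivative f' x) (at x)) \<and> (\<forall>v. Ck_map k (\<lambda>x. f' x v)))"

definition smooth_map :: "('a::euclidean_space \<Rightarrow> 'b::euclidean_space) \<Rightarrow> bool" where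
  "smooth_map f \<longleftrightarrow> (\<forall>k. Ck_map k f)"

text \<open>The left-invariant vector field with value \<open>v\<close> at the identity.\<close>
definition left_field :: "(real ^ 'n) monoid \<Rightarrow> real ^ 'n \<Rightarrow> real ^ 'n \<Rightarrow> real ^ 'n" where
  "left_field G v x = frechet_derivative (\<lambda>y. x \<otimes>\<^bsub>G\<^esub> y) (at 0) v"

definition field_bracket ::
    "(real ^ 'n \<Rightarrow> real ^ 'n) \<Rightarrow> (real ^ 'n \<Rightarrow> real ^ 'n) \<Rightarrow> real ^ 'n \<Rightarrow> real ^ 'n" where
  "field_bracket X Y x =
     frechet_derivative Y (at x) (X x) - frechet_derivative X (at x) (Y x)"

definition lie_bracket :: "(real ^ 'n) monoid \<Rightarrow> real ^ 'n \<Rightarrow> real ^ 'n \<Rightarrow> real ^ 'n" where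
  "lie_bracket G v u = field_bracket (left_field G v) (left_field G u) 0"

definition layer :: "('n \<Rightarrow> nat) \<Rightarrow> nat \<Rightarrow> (real ^ 'n) set" where
  "layer w i = span {axis j 1 | j. w j = i}"

text \<open>Since every weight lies in \<open>{1..s}\<close>, the space is the direct sum of the layers \<open>1, \<dots>, s\<close>.\<close>
definition carnot_group :: "(real ^ 'n) monoid \<Rightarrow> ('n \<Rightarrow> nat) \<Rightarrow> nat \<Rightarrow> bool" where
  "carnot_group G w s \<longleftrightarrow>
     group G \<and> carrier G = UNIV \<and> \<one>\<^bsub>G\<^esub> = 0 \<and>
     smooth_map (\<lambda>(x, y). x \<otimes>\<^bsub>G\<^esub> y) \<and> smooth_map (\<lambda>x. inv\<^bsub>G\<^esub> x) \<and>
     (\<forall>v a b. (a *\<^sub>R v) \<otimes>\<^bsub>G\<^esub> (b *\<^sub>R v) = (a + b) *\<^sub>R v) \<and>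
     1 \<le> s \<and> (\<forall>j. 1 \<le> w j \<and> w j \<le> s) \<and>
     (\<forall>i\<in>{2..s}. layer w i = span {lie_bracket G v u | v u. v \<in> layer w 1 \<and> u \<in> layer w (i - 1)}) \<and>
     (\<forall>v\<in>layer w 1. \<forall>u\<in>layer w s. lie_bracket G v u = 0)"

text \<open>
  \<open>hproj w x\<close> is the horizontal part of \<open>x\<close>; the target \<open>\<real>\<^sup>r\<close> is kept inside \<open>real ^ 'n\<close> as the
  vectors vanishing outside the coordinates of weight 1. On \<open>layer w 1\<close> the norm that makes
  the horizontal basis orthonormal is the Euclidean norm.
\<close>
definition hproj :: "('n \<Rightarrow> nat) \<Rightarrow> real ^ 'n \<Rightarrow> real ^ 'n" where
  "hproj w x = (\<chi> j. if w j = 1 then x $ j else 0)"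

definition dil :: "('n \<Rightarrow> nat) \<Rightarrow> real \<Rightarrow> real ^ 'n \<Rightarrow> real ^ 'n" where
  "dil w c x = (\<chi> j. c ^ w j * x $ j)"

subsection \<open>Horizontal curves and the Carnot--Caratheodory distance\<close>

definition abs_continuous_curve ::
    "real \<Rightarrow> real \<Rightarrow> (real \<Rightarrow> 'a::real_normed_vector) \<Rightarrow> bool" where
  "abs_continuous_curve a b \<gamma> \<longleftrightarrow>
     (\<forall>\<epsilon>>0. \<exists>\<delta>>0. \<forall>(m::nat) p q.
        (\<forall>i<m. a \<le> p i \<and> p i \<le> q i \<and> q i \<le> b) \<and>
        disjoint_family_on (\<lambda>i. {p i<..<q i}) {..<m} \<and>
        (\<Sum>i<m. q i - p i) < \<delta> \<longrightarrow>
        (\<Sum>i<m. norm (\<gamma> (q i) - \<gamma> (p i))) < \<epsilon>)"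

text \<open>The vector \<open>u t\<close> collects the controls: \<open>left_field G (u t) = \<Sum>\<^sub>j u\<^sub>j(t) X\<^sub>j\<close>, the sum
  over all \<open>j\<close> with \<open>w j = 1\<close>.\<close>
definition horizontal_with ::
    "(real ^ 'n) monoid \<Rightarrow> ('n \<Rightarrow> nat) \<Rightarrow> real \<Rightarrow> real \<Rightarrow>
     (real \<Rightarrow> real ^ 'n) \<Rightarrow> (real \<Rightarrow> real ^ 'n) \<Rightarrow> bool" where
  "horizontal_with G w a b \<gamma> u \<longleftrightarrow>
     abs_continuous_curve a b \<gamma> \<and>
     (\<forall>t. u t \<in> layer w 1) \<and> u absolutely_integrable_on {a..b} \<and>
     (AE t in lebesgue. t \<in> {a<..<b} \<longrightarrow>
        (\<gamma> has_vector_derivative left_field G (u t) (\<gamma> t)) (at t))"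

text \<open>
  The infimum is taken in the reals; the set of lengths is nonempty because the first layer
  generates the Lie algebra (Chow's theorem).
\<close>
definition cc_dist :: "(real ^ 'n) monoid \<Rightarrow> ('n \<Rightarrow> nat) \<Rightarrow> real ^ 'n \<Rightarrow> real ^ 'n \<Rightarrow> real" where
  "cc_dist G w x y =
     Inf {integral {a..b} (\<lambda>t. norm (u t)) | a b \<gamma> u.
            a \<le> b \<and> horizontal_with G w a b \<gamma> u \<and> \<gamma> a = x \<and> \<gamma> b = y}"

definition horizontal_curve ::
    "(real ^ 'n) monoid \<Rightarrow> ('n \<Rightarrow> nat) \<Rightarrow> (real \<Rightarrow> real ^ 'n) \<Rightarrow> bool" where
  "horizontal_curve G w g \<longleftrightarrow> (\<forall>a b. a \<le> b \<longrightarrow> (\<exists>u. horizontal_with G w a b g u))"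

text \<open>Some of the intervals may be empty, whence ``at most \<open>k\<close>''.\<close>
definition joins_horizontal_lines ::
    "(real ^ 'n) monoid \<Rightarrow> ('n \<Rightarrow> nat) \<Rightarrow> nat \<Rightarrow> (real \<Rightarrow> real ^ 'n) \<Rightarrow> bool" where
  "joins_horizontal_lines G w k g \<longleftrightarrow>
     (\<exists>I :: nat \<Rightarrow> real set.
        (\<forall>i<k. is_interval (I i)) \<and> disjoint_family_on I {..<k} \<and> (\<Union>i<k. I i) = UNIV \<and>
        (\<forall>i<k. \<exists>q. \<exists>V\<in>layer w 1. \<forall>t\<in>I i. g t = q \<otimes>\<^bsub>G\<^esub> (t *\<^sub>R V)))"

subsection \<open>Lipschitz maps, Hausdorff dimension\<close>

text \<open>Distances are passed explicitly, since \<open>cc_dist\<close> is not the type-class distance.\<close>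
definition lipschitz_map ::
    "('a \<Rightarrow> 'a \<Rightarrow> real) \<Rightarrow> ('b \<Rightarrow> 'b \<Rightarrow> real) \<Rightarrow> ('a \<Rightarrow> 'b) \<Rightarrow> bool" where
  "lipschitz_map d d' f \<longleftrightarrow> (\<exists>L\<ge>0. \<forall>x y. d' (f x) (f y) \<le> L * d x y)"

definition lip_const ::
    "('a \<Rightarrow> 'a \<Rightarrow> real) \<Rightarrow> ('b \<Rightarrow> 'b \<Rightarrow> real) \<Rightarrow> ('a \<Rightarrow> 'b) \<Rightarrow> real" where
  "lip_const d d' f = Inf {L. 0 \<le> L \<and> (\<forall>x y. d' (f x) (f y) \<le> L * d x y)}"

definition diam :: "('a \<Rightarrow> 'a \<Rightarrow> real) \<Rightarrow> 'a set \<Rightarrow> ennreal" where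
  "diam d U = (SUP (x, y)\<in>U \<times> U. ennreal (d x y))"

definition hausdorff_measure :: "('a \<Rightarrow> 'a \<Rightarrow> real) \<Rightarrow> real \<Rightarrow> 'a set \<Rightarrow> ennreal" where
  "hausdorff_measure d \<alpha> A =
     (SUP \<delta>\<in>{0<..}. INF U\<in>{U :: nat \<Rightarrow> 'a set. A \<subseteq> (\<Union>i. U i) \<and> (\<forall>i. diam d (U i) \<le> ennreal \<delta>)}.
        \<Sum>i. ennreal (enn2real (diam d (U i)) powr \<alpha>))"

text \<open>Only \<open>\<alpha> > 0\<close> is used, which avoids the convention \<open>0 powr 0 = 0\<close>.\<close>
definition hausdorff_dim :: "('a \<Rightarrow> 'a \<Rightarrow> real) \<Rightarrow> 'a set \<Rightarrow> ennreal" where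
  "hausdorff_dim d A = (INF \<alpha>\<in>{\<alpha>. 0 < \<alpha> \<and> hausdorff_measure d \<alpha> A = 0}. ennreal \<alpha>)"

subsection \<open>Differentiability\<close>

definition G_linear ::
    "(real ^ 'n) monoid \<Rightarrow> ('n \<Rightarrow> nat) \<Rightarrow> (real ^ 'n \<Rightarrow> real) \<Rightarrow> bool" where
  "G_linear G w L \<longleftrightarrow>
     (\<forall>x y. L (x \<otimes>\<^bsub>G\<^esub> y) = L x + L y) \<and> (\<forall>c>0. \<forall>x. L (dil w c x) = c * L x)"

text \<open>The Euclidean topology used by \<open>at x\<close> coincides with the topology of \<open>cc_dist\<close>.\<close>
definition has_pansu_differential ::
    "(real ^ 'n) monoid \<Rightarrow> ('n \<Rightarrow> nat) \<Rightarrow> (real ^ 'n \<Rightarrow> real) \<Rightarrow> real ^ 'n \<Rightarrow>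
     (real ^ 'n \<Rightarrow> real) \<Rightarrow> bool" where
  "has_pansu_differential G w f x L \<longleftrightarrow>
     G_linear G w L \<and>
     ((\<lambda>y. \<bar>f y - f x - L (inv\<^bsub>G\<^esub> x \<otimes>\<^bsub>G\<^esub> y)\<bar> / cc_dist G w x y) \<longlongrightarrow> 0) (at x)"

definition has_dir_deriv ::
    "(real ^ 'n) monoid \<Rightarrow> (real ^ 'n \<Rightarrow> real) \<Rightarrow> real ^ 'n \<Rightarrow> real ^ 'n \<Rightarrow> real \<Rightarrow> bool" where
  "has_dir_deriv G f E x D \<longleftrightarrow> ((\<lambda>t. (f (x \<otimes>\<^bsub>G\<^esub> (t *\<^sub>R E)) - f x) / t) \<longlongrightarrow> D) (at 0)"

definition dir_deriv ::
    "(real ^ 'n) monoid \<Rightarrow> (real ^ 'n \<Rightarrow> real) \<Rightarrow> real ^ 'n \<Rightarrow> real ^ 'n \<Rightarrow> real" where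
  "dir_deriv G f E x = (THE D. has_dir_deriv G f E x D)"

subsection \<open>Deformable directions\<close>

definition deforming_curve ::
    "(real ^ 'n) monoid \<Rightarrow> ('n \<Rightarrow> nat) \<Rightarrow> real \<Rightarrow> nat \<Rightarrow> real ^ 'n \<Rightarrow> real ^ 'n \<Rightarrow>
     real \<Rightarrow> real \<Rightarrow> real \<Rightarrow> (real \<Rightarrow> real ^ 'n) \<Rightarrow> bool" where
  "deforming_curve G w C K E u l \<Delta> \<eta> g \<longleftrightarrow>
     horizontal_curve G w g \<and> lipschitz_map dist (cc_dist G w) g \<and>
     joins_horizontal_lines G w K g \<and>
     (\<forall>t. l \<le> \<bar>t\<bar> \<longrightarrow> g t = t *\<^sub>R E) \<and>
     g (dil w (\<Delta> * l) u \<bullet> E) = dil w (\<Delta> * l) u \<and>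
     lip_const dist (cc_dist G w) g \<le> 1 + \<eta> * \<Delta> \<and>
     finite {t. \<not> (\<exists>D. ((hproj w \<circ> g) has_vector_derivative D) (at t) \<and>
                       norm (D - hproj w E) \<le> C * \<Delta>)}"

definition deformable ::
    "(real ^ 'n) monoid \<Rightarrow> ('n \<Rightarrow> nat) \<Rightarrow> real \<Rightarrow> nat \<Rightarrow> (real \<Rightarrow> real) \<Rightarrow> real ^ 'n \<Rightarrow> bool" where
  "deformable G w C K \<Delta>0 E \<longleftrightarrow>
     E \<in> layer w 1 \<and> norm E = 1 \<and> 0 < C \<and> 0 < K \<and> (\<forall>\<eta>>0. 0 < \<Delta>0 \<eta>) \<and>
     (\<forall>l \<eta> \<Delta> u. 0 < l \<and> l < 1 \<and> 0 < \<eta> \<and> 0 < \<Delta> \<and> \<Delta> < \<Delta>0 \<eta> \<and> cc_dist G w u 0 \<le> 1 \<longrightarrow>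
        (\<exists>g. deforming_curve G w C K E u l \<Delta> \<eta> g))"

definition uniformly_deformable_ball ::
    "(real ^ 'n) monoid \<Rightarrow> ('n \<Rightarrow> nat) \<Rightarrow> (real ^ 'n) set \<Rightarrow>
     real \<Rightarrow> nat \<Rightarrow> (real \<Rightarrow> real) \<Rightarrow> bool" where
  "uniformly_deformable_ball G w B C K \<Delta>0 \<longleftrightarrow>
     (\<exists>E0\<in>layer w 1. \<exists>\<rho>>0. B = {E \<in> layer w 1. norm (E - E0) < \<rho>}) \<and>
     (\<exists>E\<in>B. norm E = 1) \<and>
     (\<forall>E\<in>B. norm E = 1 \<longrightarrow> deformable G w C K \<Delta>0 E)"

subsection \<open>The countable union of translated curves\<close>

definition rational_point :: "real ^ 'n \<Rightarrow> bool" where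
  "rational_point x \<longleftrightarrow> (\<forall>j. x $ j \<in> \<rat>)"

definition curve_index ::
    "(real ^ 'n) monoid \<Rightarrow> ('n \<Rightarrow> nat) \<Rightarrow> (real ^ 'n) set \<Rightarrow> (real \<Rightarrow> real) \<Rightarrow>
     ((real ^ 'n) \<times> (real ^ 'n) \<times> real \<times> real \<times> real) set" where
  "curve_index G w B \<Delta>0 =
     {(E, u, l, \<Delta>, \<eta>). E \<in> B \<and> norm E = 1 \<and> rational_point E \<and>
        rational_point u \<and> cc_dist G w u 0 \<le> 1 \<and>
        l \<in> \<rat> \<and> \<Delta> \<in> \<rat> \<and> \<eta> \<in> \<rat> \<and> 0 < l \<and> l < 1 \<and> 0 < \<eta> \<and> 0 < \<Delta> \<and> \<Delta> < \<Delta>0 \<eta>}"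

definition curve_family ::
    "(real ^ 'n) monoid \<Rightarrow> ('n \<Rightarrow> nat) \<Rightarrow> (real ^ 'n) set \<Rightarrow> real \<Rightarrow> nat \<Rightarrow> (real \<Rightarrow> real) \<Rightarrow>
     ((real ^ 'n) \<times> (real ^ 'n) \<times> real \<times> real \<times> real \<Rightarrow> real \<Rightarrow> real ^ 'n) \<Rightarrow> bool" where
  "curve_family G w B C K \<Delta>0 \<gamma> \<longleftrightarrow>
     (\<forall>(E, u, l, \<Delta>, \<eta>)\<in>curve_index G w B \<Delta>0.
        deforming_curve G w C K E u l \<Delta> \<eta> (\<gamma> (E, u, l, \<Delta>, \<eta>)))"

definition curve_union ::
    "(real ^ 'n) monoid \<Rightarrow> ('n \<Rightarrow> nat) \<Rightarrow> (real ^ 'n) set \<Rightarrow> (real \<Rightarrow> real) \<Rightarrow>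
     ((real ^ 'n) \<times> (real ^ 'n) \<times> real \<times> real \<times> real \<Rightarrow> real \<Rightarrow> real ^ 'n) \<Rightarrow> (real ^ 'n) set" where
  "curve_union G w B \<Delta>0 \<gamma> =
     {x \<otimes>\<^bsub>G\<^esub> \<gamma> i t | x i t. rational_point x \<and> i \<in> curve_index G w B \<Delta>0}"

subsection \<open>Pairs of points and directions\<close>

definition dir_pairs ::
    "(real ^ 'n) monoid \<Rightarrow> ('n \<Rightarrow> nat) \<Rightarrow> (real ^ 'n) set \<Rightarrow> (real ^ 'n \<Rightarrow> real) \<Rightarrow>
     ((real ^ 'n) \<times> (real ^ 'n)) set" where
  "dir_pairs G w N f =
     {(x, E). x \<in> N \<and> E \<in> layer w 1 \<and> norm E = 1 \<and> (\<exists>D. has_dir_deriv G f E x D)}"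

definition competitor_pairs ::
    "(real ^ 'n) monoid \<Rightarrow> ('n \<Rightarrow> nat) \<Rightarrow> nat \<Rightarrow> (real ^ 'n) set \<Rightarrow> (real ^ 'n \<Rightarrow> real) \<Rightarrow>
     real ^ 'n \<Rightarrow> real ^ 'n \<Rightarrow> ((real ^ 'n) \<times> (real ^ 'n)) set" where
  "competitor_pairs G w s N f x0 E0 =
     {(x, E) \<in> dir_pairs G w N f.
        dir_deriv G f E x \<ge> dir_deriv G f E0 x0 \<and>
        (\<forall>t\<in>{-1<..<1}.
           \<bar>(f (x \<otimes>\<^bsub>G\<^esub> (t *\<^sub>R E0)) - f x) - (f (x0 \<otimes>\<^bsub>G\<^esub> (t *\<^sub>R E0)) - f x0)\<bar>
           \<le> 6 * \<bar>t\<bar> * ((dir_deriv G f E x - dir_deriv G f E0 x0)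
                        * lip_const (cc_dist G w) dist f) powr (1 / (2 * (real s)\<^sup>2)))}"

end

theory Submission
  imports Defs
begin

text \<open>
  Let \<open>m\<close> be the derivative of \<open>f\<close> at \<open>x0\<close> in the direction \<open>E0\<close>. If \<open>f\<close> is not differentiable at
  \<open>x0\<close> with the differential \<open>x \<mapsto> m * (x \<bullet> E0)\<close>, then there is a \<open>c > 0\<close> such that competing pairs
  \<open>(x, E)\<close> with \<open>dir_deriv G f E x \<ge> m + c\<close> exist arbitrarily close to \<open>x0\<close>
  (\<open>better_competitors\<close>). The suprema in the hypothesis are then at least \<open>m + c\<close>, and their limit
  cannot be at most \<open>m\<close>.

  To find the pairs, take \<open>y\<close> near \<open>x0\<close> at which the increment of \<open>f\<close> differs from the claimed
  differential by at least \<open>\<epsilon>\<close> times \<open>r\<close>, the distance from \<open>x0\<close> to \<open>y\<close>. Fix a small \<open>\<Delta>\<close>, which may depend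
  on \<open>\<epsilon>\<close> but not on how close \<open>y\<close> is to \<open>x0\<close>, and let \<open>l\<close> be comparable with \<open>r / \<Delta>\<close>.
  Deformability gives a curve \<open>g\<close> through \<open>y\<close> that leaves the line through \<open>x0\<close> in the direction
  \<open>E0\<close> only during a time interval of length \<open>2 * l\<close>, whose speed is at most \<open>1 + \<eta> * \<Delta>\<close>, and
  whose direction stays within a multiple of \<open>\<Delta>\<close> of \<open>E0\<close>. Along \<open>g\<close> the function \<open>f\<close> has average
  slope close to \<open>m\<close> over that interval, because the end points lie on the line, but deviates from
  this slope by a multiple of \<open>\<Delta> * l\<close> when \<open>g\<close> passes through \<open>y\<close>. Hence the derivative of
  \<open>f\<close> along \<open>g\<close> exceeds \<open>m\<close> by a multiple of \<open>\<Delta>\<close> at some time \<open>\<tau>\<close>, and since the speed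
  is almost 1, so does the derivative of \<open>f\<close> at \<open>g \<tau>\<close> in the direction of \<open>g\<close>. In order to
  have \<open>g \<tau>\<close> in \<open>N\<close>, the base point, the direction and the target are replaced by rational ones
  (\<open>rational_approximation\<close>), with an error that is negligible in comparison with \<open>l\<close>.

  The pair must also satisfy the inequality between increments that defines competitors. Let \<open>q\<close> be
  the excess of the slope at \<open>\<tau>\<close>. The time \<open>\<tau>\<close> can be chosen such that all difference quotients
  based at \<open>\<tau>\<close> differ from the average slope by a multiple of the square root of \<open>q\<close> only
  (\<open>mean_value_maximal\<close>): by the rising sun lemma the set of points with a large difference quotient
  is small, so such points cannot carry the positive variation of the function. This compares \<open>f\<close>
  along \<open>g\<close> with \<open>f\<close> along the line through \<open>x0\<close>. It remains to compare \<open>f\<close> along \<open>g\<close> with \<open>f\<close>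
  along the line through \<open>g \<tau>\<close> in the direction \<open>E0\<close>. Since \<open>g\<close> consists of a bounded number of
  horizontal lines with directions close to \<open>E0\<close>, the two curves have distance at most a multiple of
  \<open>\<bar>t\<bar> * \<Delta> powr (1 / s)\<close> at the time \<open>t\<close> after \<open>\<tau>\<close> (\<open>close_lines_cdist\<close>). This is where the exponent
  \<open>1 / (2 * s\<^sup>2)\<close> enters: \<open>\<Delta> powr (1 / s)\<close> is negligible in comparison with
  \<open>\<Delta> powr (1 / (2 * s\<^sup>2))\<close>, which is of the order that is permitted because \<open>q\<close> is at least of the
  order of \<open>\<Delta>\<close>. The lemma \<open>competitor_on_curve\<close> carries out these estimates.

  The facts about the group are obtained from the differential of the multiplication alone:
  dilations are automorphisms (\<open>dil_mult\<close>), the projection to the first layer is a homomorphism that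
  does not increase distances (\<open>hproj_mult\<close>, \<open>hproj_cdist\<close>), and horizontal curves reach
  every point, with a distance that is locally bounded by a power of the Euclidean distance
  (\<open>chow_local\<close>, \<open>cdist_holder_local\<close>).
\<close>

section \<open>Absolutely continuous curves and Lipschitz functions on the line\<close>

lemma lmeasurable_outer_open:
  fixes S :: "'a::euclidean_space set"
  assumes S: "S \<in> lmeasurable" and e: "e > 0"
  obtains U where "open U" "S \<subseteq> U" "U \<in> lmeasurable" "measure lebesgue U < measure lebesgue S + e"
proof -
  obtain U where U: "open U" "S \<subseteq> U" "(U - S) \<in> lmeasurable" "emeasure lebesgue (U - S) < ennreal e"
    using sets_lebesgue_outer_open[OF fmeasurableD[OF S] e] by blast
  have eq: "U = S \<union> (U - S)" using U(2) by auto
  have Um: "U \<in> lmeasurable" by (subst eq) (use S U(3) in blast)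
  have "measure lebesgue (U - S) < e"
    using U(3,4) e by (simp add: emeasure_eq_measure2 ennreal_less_iff)
  moreover have "measure lebesgue (U - S) = measure lebesgue U - measure lebesgue S"
    using measurable_measure_Diff[OF Um fmeasurableD[OF S] U(2)] .
  ultimately show thesis using that[of U] U Um by auto
qed

text \<open>
  The gauge is chosen separately at two kinds of tags. Where \<open>f\<close> is differentiable, it comes from the
  definition of the derivative. A tag in the exceptional null set is forced to have its interval inside
  an open set of small measure, and absolute continuity makes the sum of the increments of \<open>f\<close> over
  all these intervals small.
\<close>
lemma abs_continuous_curve_has_integral:
  fixes f :: "real \<Rightarrow> 'a::banach"
  assumes ab: "a \<le> b" and ac: "abs_continuous_curve a b f" and Z: "negligible Z"
    and D: "\<And>t. t \<in> {a<..<b} - Z \<Longrightarrow> (f has_vector_derivative D t) (at t)"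
  shows "(D has_integral f b - f a) {a..b}"
proof -
  define Z' where "Z' = Z \<union> {a, b}"
  define D' where "D' = (\<lambda>t. if t \<in> Z' then 0 else D t)"
  have nZ': "negligible Z'"
    unfolding Z'_def using Z by (simp add: negligible_Un)
  have "(D' has_integral f b - f a) {a..b}"
  proof (cases "a = b")
    case True
    then show ?thesis using has_integral_refl(2)[of D' b] by simp
  next
    case False
    with ab have ab': "a < b" by simp
    show ?thesis
      unfolding has_integral_factor_content_real
    proof (intro allI impI)
      fix e :: real assume e: "e > 0"
      define e2 where "e2 = e * (b - a) / 2"
      have e2: "e2 > 0" using e ab' by (simp add: e2_def)
      obtain d where d: "d > 0" and dd: "\<And>(m::nat) p q.
          (\<forall>i<m. a \<le> p i \<and> p i \<le> q i \<and> q i \<le> b) \<Longrightarrow>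
          disjoint_family_on (\<lambda>i. {p i<..<q i}) {..<m} \<Longrightarrow>
          (\<Sum>i<m. q i - p i) < d \<Longrightarrow> (\<Sum>i<m. norm (f (q i) - f (p i))) < e2"
        using ac[unfolded abs_continuous_curve_def] e2 by meson
      have "\<exists>U. open U \<and> Z' \<subseteq> U \<and> U \<in> lmeasurable \<and> measure lebesgue U < d"
      proof -
        have "Z' \<in> lmeasurable" and m0: "measure lebesgue Z' = 0"
          using nZ' by (auto simp: negligible_imp_measurable negligible_imp_measure0)
        then obtain T where "open T" "Z' \<subseteq> T" "T \<in> lmeasurable" "measure lebesgue T < measure lebesgue Z' + d"
          using lmeasurable_outer_open[of Z' d] d by (metis)
        then show ?thesis using m0 by auto
      qed
      then obtain Ou where O: "open Ou" "Z' \<subseteq> Ou" "Ou \<in> lmeasurable" "measure lebesgue Ou < d" by blast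
      have "\<exists>r>0. if x \<in> Z' then ball x r \<subseteq> Ou
              else x \<in> {a<..<b} \<longrightarrow> (\<forall>y. \<bar>y - x\<bar> < r \<longrightarrow> norm (f y - f x - (y - x) *\<^sub>R D x) \<le> e / 2 * \<bar>y - x\<bar>)" for x
      proof (cases "x \<in> Z'")
        case True
        then show ?thesis using O(1,2) by (auto simp: open_contains_ball)
      next
        case False
        show ?thesis
        proof (cases "x \<in> {a<..<b}")
          case True
          then have "(f has_vector_derivative D x) (at x)" using D False by (auto simp: Z'_def)
          then have "\<forall>e>0. \<exists>d>0. \<forall>y. norm (y - x) < d \<longrightarrow> norm (f y - f x - (y - x) *\<^sub>R D x) \<le> e * norm (y - x)"
            unfolding has_vector_derivative_def has_derivative_at_alt by simp
          then obtain r where "r > 0" "\<forall>y. norm (y - x) < r \<longrightarrow> norm (f y - f x - (y - x) *\<^sub>R D x) \<le> e / 2 * norm (y - x)"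
            using e by (meson half_gt_zero)
          then show ?thesis using False by auto
        qed (use False in \<open>auto intro: exI[of _ 1]\<close>)
      qed
      then obtain r where r0: "\<And>x. r x > 0"
        and r: "\<And>x. if x \<in> Z' then ball x (r x) \<subseteq> Ou
              else x \<in> {a<..<b} \<longrightarrow> (\<forall>y. \<bar>y - x\<bar> < r x \<longrightarrow> norm (f y - f x - (y - x) *\<^sub>R D x) \<le> e / 2 * \<bar>y - x\<bar>)"
        by metis
      show "\<exists>g. gauge g \<and> (\<forall>p. p tagged_division_of {a..b} \<and> g fine p \<longrightarrow>
          norm ((\<Sum>(x,K)\<in>p. measure lborel K *\<^sub>R D' x) - (f b - f a)) \<le> e * measure lborel {a..b})"
      proof (intro exI[of _ "\<lambda>x. ball x (r x)"] conjI allI impI)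
        show "gauge (\<lambda>x. ball x (r x))" using r0 by (auto simp: gauge_def)
        fix p assume p: "p tagged_division_of {a..b} \<and> (\<lambda>x. ball x (r x)) fine p"
        then have pt: "p tagged_division_of {a..b}" and fine: "(\<lambda>x. ball x (r x)) fine p" by auto
        have fp: "finite p" using pt by blast
        define pz where "pz = {(x,K)\<in>p. x \<in> Z'}"
        have pz: "pz \<subseteq> p" by (auto simp: pz_def)
        have Kprop: "\<exists>u v. K = {u..v} \<and> a \<le> u \<and> u \<le> x \<and> x \<le> v \<and> v \<le> b \<and> Inf K = u \<and> Sup K = v \<and> {u..v} \<subseteq> ball x (r x)"
          if xKp: "(x,K) \<in> p" for x K
        proof -
          obtain u v where K: "K = cbox u v" using tagged_division_ofD(4)[OF pt xKp] by blast
          have xK: "x \<in> K" using tagged_division_ofD(2)[OF pt] xKp by blast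
          have sub: "K \<subseteq> {a..b}" using tagged_division_ofD(3)[OF pt] xKp by blast
          have "K \<subseteq> ball x (r x)" using fine xKp by (auto simp: fine_def)
          with K xK sub show ?thesis by (intro exI[of _ u] exI[of _ v]) auto
        qed
        have sum_eq: "(\<Sum>(x,K)\<in>p. f (Sup K) - f (Inf K)) = f b - f a"
          by (rule additive_tagged_division_1[OF ab pt])
        have "(\<Sum>(x,K)\<in>p. measure lborel K *\<^sub>R D' x) - (f b - f a)
            = (\<Sum>(x,K)\<in>p. measure lborel K *\<^sub>R D' x - (f (Sup K) - f (Inf K)))"
          unfolding sum_eq[symmetric] by (simp add: sum_subtractf split_def)
        also have "\<dots> = (\<Sum>(x,K)\<in>p - pz. measure lborel K *\<^sub>R D' x - (f (Sup K) - f (Inf K)))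
             + (\<Sum>(x,K)\<in>pz. measure lborel K *\<^sub>R D' x - (f (Sup K) - f (Inf K)))"
          by (rule sum.subset_diff[OF pz fp])
        finally have split: "(\<Sum>(x,K)\<in>p. measure lborel K *\<^sub>R D' x) - (f b - f a) = \<dots>" .
        have n1: "norm (\<Sum>(x,K)\<in>p - pz. measure lborel K *\<^sub>R D' x - (f (Sup K) - f (Inf K))) \<le> e2"
        proof -
          have "norm (\<Sum>(x,K)\<in>p - pz. measure lborel K *\<^sub>R D' x - (f (Sup K) - f (Inf K)))
             \<le> (\<Sum>(x,K)\<in>p - pz. e / 2 * measure lborel K)"
          proof (rule sum_norm_le, clarify)
            fix x K assume xK: "(x,K) \<in> p" "(x,K) \<notin> pz"
            then have xZ: "x \<notin> Z'" by (auto simp: pz_def)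
            obtain u v where K: "K = {u..v}" "a \<le> u" "u \<le> x" "x \<le> v" "v \<le> b" "Inf K = u" "Sup K = v"
              and bl: "{u..v} \<subseteq> ball x (r x)" using Kprop[OF xK(1)] by blast
            have xab: "x \<in> {a<..<b}" using xZ K by (auto simp: Z'_def less_le)
            have B: "norm (f y - f x - (y - x) *\<^sub>R D x) \<le> e / 2 * \<bar>y - x\<bar>" if "y \<in> {u..v}" for y
            proof -
              have "\<bar>y - x\<bar> < r x" using bl that by (auto simp: dist_real_def abs_minus_commute subset_iff)
              then show ?thesis using r[of x] xZ xab by auto
            qed
            have "measure lborel K *\<^sub>R D' x - (f (Sup K) - f (Inf K))
              = (f u - f x - (u - x) *\<^sub>R D x) - (f v - f x - (v - x) *\<^sub>R D x)"
              using K xZ by (simp add: D'_def algebra_simps)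
            also have "norm \<dots> \<le> e/2 * \<bar>u - x\<bar> + e/2 * \<bar>v - x\<bar>"
              using B[of u] B[of v] K norm_triangle_ineq4 by (smt (verit) atLeastAtMost_iff)
            also have "\<dots> = e / 2 * measure lborel K" using K by (simp add: field_simps)
            finally show "norm (measure lborel K *\<^sub>R D' x - (f (Sup K) - f (Inf K))) \<le> e / 2 * measure lborel K" .
          qed
          also have "\<dots> \<le> (\<Sum>(x,K)\<in>p. e / 2 * measure lborel K)"
            by (rule sum_mono2[OF fp]) (use e in auto)
          also have "\<dots> = e / 2 * measure lborel {a..b}"
            using additive_content_tagged_division[of p a b] pt
            by (simp add: sum_distrib_left[symmetric] sum_divide_distrib[symmetric] split_def box_real)
          finally show ?thesis using ab by (simp add: e2_def)
        qed
        have n2: "norm (\<Sum>(x,K)\<in>pz. measure lborel K *\<^sub>R D' x - (f (Sup K) - f (Inf K))) \<le> e2"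
        proof -
          define m where "m = card pz"
          have fz: "finite pz" using fp pz finite_subset by blast
          obtain h where h: "bij_betw h {..<m} pz"
            using bij_betw_from_nat_into_finite[OF fz] unfolding m_def by blast
          define P where "P = (\<lambda>i. Inf (snd (h i)))"
          define Q where "Q = (\<lambda>i. Sup (snd (h i)))"
          have hp: "(fst (h i), snd (h i)) \<in> p" "fst (h i) \<in> Z'" if "i < m" for i
            using bij_betwE[OF h, rule_format, of i] that unfolding pz_def by (auto simp: split_def)
          have PQ: "snd (h i) = {P i..Q i} \<and> a \<le> P i \<and> P i \<le> Q i \<and> Q i \<le> b \<and> {P i..Q i} \<subseteq> Ou" if "i < m" for i
            using Kprop[OF hp(1)[OF that]] r[of "fst (h i)"] hp(2)[OF that] unfolding P_def Q_def by auto
          have disj: "disjoint_family_on (\<lambda>i. {P i<..<Q i}) {..<m}"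
            unfolding disjoint_family_on_def
          proof clarify
            fix i j assume ij: "i < m" "j < m" "i \<noteq> j"
            then have "h i \<noteq> h j" using h by (auto simp: bij_betw_def inj_on_def)
            then have "interior (snd (h i)) \<inter> interior (snd (h j)) = {}"
              using tagged_division_ofD(5)[OF pt hp(1)[OF ij(1)] hp(1)[OF ij(2)]] by (auto simp: prod_eq_iff)
            then show "{P i<..<Q i} \<inter> {P j<..<Q j} = {}"
              using PQ[OF ij(1)] PQ[OF ij(2)] by (simp add: interior_atLeastAtMost_real)
          qed
          have "(\<Sum>i<m. Q i - P i) = (\<Sum>i<m. measure lebesgue {P i<..<Q i})"
            using PQ by (intro sum.cong) auto
          also have "\<dots> = measure lebesgue (\<Union>i<m. {P i<..<Q i})"
            by (rule measure_finite_Union[symmetric]) (use disj PQ in \<open>auto simp: less_top[symmetric]\<close>)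
          also have "\<dots> \<le> measure lebesgue Ou"
            by (rule measure_mono_fmeasurable) (use PQ O in fastforce)+
          finally have "(\<Sum>i<m. Q i - P i) < d" using O(4) by simp
          then have lt: "(\<Sum>i<m. norm (f (Q i) - f (P i))) < e2"
            using dd[OF _ disj] PQ by blast
          have "norm (\<Sum>(x,K)\<in>pz. measure lborel K *\<^sub>R D' x - (f (Sup K) - f (Inf K)))
              \<le> (\<Sum>(x,K)\<in>pz. norm (f (Sup K) - f (Inf K)))"
            by (rule sum_norm_le) (auto simp: pz_def D'_def norm_minus_commute)
          also have "\<dots> = (\<Sum>i<m. norm (f (Q i) - f (P i)))"
            unfolding P_def Q_def
            by (subst sum.reindex_bij_betw[OF h, symmetric]) (simp add: split_def)
          finally show ?thesis using lt by simp
        qed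
        have "norm ((\<Sum>(x,K)\<in>p. measure lborel K *\<^sub>R D' x) - (f b - f a)) \<le> e2 + e2"
          unfolding split using n1 n2 norm_triangle_mono by blast
        also have "\<dots> = e * measure lborel {a..b}" using ab by (simp add: e2_def)
        finally show "norm ((\<Sum>(x,K)\<in>p. measure lborel K *\<^sub>R D' x) - (f b - f a)) \<le> e * measure lborel {a..b}" .
      qed
    qed
  qed
  then show ?thesis
    by (rule has_integral_spike[OF nZ', rotated]) (auto simp: D'_def)
qed

text \<open>
  Vitali's covering theorem for intervals that contain the points of \<open>S\<close> somewhere in their interior,
  not necessarily at the midpoint, as is the case for the intervals of a difference quotient that
  straddles a point.
\<close>
lemma vitali_open_intervals:
  fixes S :: "real set"
  assumes U: "open U" "S \<subseteq> U"
    and R: "\<And>x d. x \<in> S \<Longrightarrow> d > 0 \<Longrightarrow> \<exists>u v. u < x \<and> x < v \<and> v - u < d \<and> R u v"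
  obtains C where "countable C" "\<And>u v. (u, v) \<in> C \<Longrightarrow> u < v \<and> R u v \<and> {u<..<v} \<subseteq> U"
    "disjoint_family_on (\<lambda>(u, v). {u<..<v}) C" "negligible (S - (\<Union>(u, v)\<in>C. {u<..<v}))"
proof -
  define K where "K = {(u, v). u < v \<and> R u v \<and> {u<..<v} \<subseteq> U}"
  define ce where "ce = (\<lambda>(u, v). (u + v) / 2 :: real)"
  define ra where "ra = (\<lambda>(u, v). (v - u) / 2 :: real)"
  have ball: "ball (ce i) (ra i) = (case i of (u, v) \<Rightarrow> {u<..<v})" for i
  proof (cases i)
    case (Pair u v)
    have "(u + v) / 2 - (v - u) / 2 = u" "(u + v) / 2 + (v - u) / 2 = v" by argo+
    then show ?thesis by (simp add: Pair ce_def ra_def ball_eq_greaterThanLessThan)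
  qed
  have "\<exists>i. i \<in> K \<and> x \<in> ball (ce i) (ra i) \<and> ra i < d" if x: "x \<in> S" and d: "0 < d" for x d
  proof -
    obtain e where e: "e > 0" "ball x e \<subseteq> U" using U x by (meson open_contains_ball subsetD)
    obtain u v where uv: "u < x" "x < v" "v - u < min d e" "R u v"
      using R[OF x, of "min d e"] d e(1) by (meson min_less_iff_conj)
    have "{u<..<v} \<subseteq> ball x e" using uv by (auto simp: dist_real_def)
    then have "(u, v) \<in> K" using uv e by (auto simp: K_def)
    moreover have "x \<in> ball (ce (u, v)) (ra (u, v))" unfolding ball using uv by simp
    moreover have "ra (u, v) < d" using uv by (simp add: ra_def)
    ultimately show ?thesis by blast
  qed
  then obtain C where C: "countable C" "C \<subseteq> K"
    "pairwise (\<lambda>i j. disjnt (ball (ce i) (ra i)) (ball (ce j) (ra j))) C"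
    "negligible (S - (\<Union>i\<in>C. ball (ce i) (ra i)))"
    using Vitali_covering_theorem_balls[of S K ce ra] by blast
  show thesis
  proof
    show "countable C" by fact
    show "u < v \<and> R u v \<and> {u<..<v} \<subseteq> U" if "(u, v) \<in> C" for u v
      using C(2) that by (auto simp: K_def)
    show "disjoint_family_on (\<lambda>(u, v). {u<..<v}) C"
      using C(3) unfolding ball disjoint_family_on_def pairwise_def disjnt_def by blast
    show "negligible (S - (\<Union>(u, v)\<in>C. {u<..<v}))"
      using C(4) unfolding ball by simp
  qed
qed

lemma interval_measure_Ioo:
  assumes "a < b" and mono: "\<And>x y. x \<le> y \<Longrightarrow> F x \<le> F y" and cont: "continuous_on UNIV F"
  shows "emeasure (interval_measure F) {a<..<b} = F b - F a"
proof -
  have "{a..b} = insert a (insert b {a<..<b})" using assms(1) by auto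
  have pt: "emeasure (interval_measure F) {c} = 0" for c
    using emeasure_interval_measure_Icc[OF order_refl mono cont, of c] by simp
  have "{c} \<in> null_sets (interval_measure F)" for c
    by (rule null_setsI[OF pt]) simp
  then have nab: "{a, b} \<in> null_sets (interval_measure F)"
    using null_sets.Un[of "{a}" _ "{b}"] by (simp add: insert_commute)
  have "emeasure (interval_measure F) ({a..b} - {a,b}) = emeasure (interval_measure F) {a..b}"
    by (rule emeasure_Diff_null_set[OF nab]) simp
  moreover have "{a..b} - {a,b} = {a<..<b}" by auto
  ultimately show ?thesis using emeasure_interval_measure_Icc[OF less_imp_le[OF assms(1)] mono cont] by simp
qed

text \<open>
  Let \<open>\<alpha>\<close> be the outer measure of a bounded part of the set. Almost all of it is covered by disjoint
  intervals of slope at most \<open>p\<close> inside an open set \<open>U\<close> of measure close to \<open>\<alpha>\<close>, and then by disjoint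
  intervals of slope at least \<open>q\<close> inside their union. Comparing the Stieltjes measures of the two
  unions gives \<open>q * \<alpha> \<le> p * measure lebesgue U\<close>, which is impossible for \<open>\<alpha> > 0\<close> if \<open>U\<close> is
  chosen well.
\<close>
lemma mono_slope_gap_negligible:
  fixes F :: "real \<Rightarrow> real"
  assumes mono: "\<And>x y. x \<le> y \<Longrightarrow> F x \<le> F y" and cont: "continuous_on UNIV F"
    and pq: "0 < p" "p < q"
  shows "negligible {x. (\<forall>d>0. \<exists>u v. u < x \<and> x < v \<and> v - u < d \<and> F v - F u \<le> p * (v - u))
                      \<and> (\<forall>d>0. \<exists>u v. u < x \<and> x < v \<and> v - u < d \<and> F v - F u \<ge> q * (v - u))}"
    (is "negligible ?E")
proof -
  let ?M = "interval_measure F"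
  have "negligible (?E \<inter> {a<..<b})" for a b
  proof -
    define E where "E = ?E \<inter> {a<..<b}"
    define \<U> where "\<U> = {U. open U \<and> E \<subseteq> U \<and> U \<in> lmeasurable}"
    define \<alpha> where "\<alpha> = Inf (measure lebesgue ` \<U>)"
    have ne: "\<U> \<noteq> {}" unfolding \<U>_def E_def by (auto intro!: exI[of _ "{a<..<b}"])
    have \<alpha>: "\<alpha> \<le> measure lebesgue U" if "U \<in> \<U>" for U
      unfolding \<alpha>_def using that by (intro cINF_lower) (auto intro!: bdd_belowI[of _ 0])
    have approx: "\<exists>U\<in>\<U>. measure lebesgue U < c" if "\<alpha> < c" for c
      using cInf_lessD[of "measure lebesgue ` \<U>" c] ne that unfolding \<alpha>_def by auto
    have "\<alpha> \<le> 0"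
    proof (rule ccontr)
      assume "\<not> \<alpha> \<le> 0"
      then have \<alpha>0: "\<alpha> > 0" by simp
      have "\<alpha> < q / p * \<alpha>" using \<alpha>0 pq by (simp add: field_simps)
      then obtain U where U: "U \<in> \<U>" "measure lebesgue U < q / p * \<alpha>"
        using approx by blast
      have oU: "open U" "E \<subseteq> U" "U \<in> lmeasurable" using U by (auto simp: \<U>_def)
      have R1: "\<exists>u v. u < x \<and> x < v \<and> v - u < d \<and> F v - F u \<le> p * (v - u)"
        and R2: "\<exists>u v. u < x \<and> x < v \<and> v - u < d \<and> F v - F u \<ge> q * (v - u)" if "x \<in> E" "d > 0" for x d
        using that unfolding E_def by blast+
      obtain C1 where C1: "countable C1" "\<And>u v. (u, v) \<in> C1 \<Longrightarrow> u < v \<and> F v - F u \<le> p * (v - u) \<and> {u<..<v} \<subseteq> U"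
        "disjoint_family_on (\<lambda>(u, v). {u<..<v}) C1" "negligible (E - (\<Union>(u, v)\<in>C1. {u<..<v}))"
        by (rule vitali_open_intervals[OF oU(1,2), of "\<lambda>u v. F v - F u \<le> p * (v - u)"], erule (1) R1, rule that; assumption)
      define W1 where "W1 = (\<Union>(u, v)\<in>C1. {u<..<v})"
      have oW1: "open W1" unfolding W1_def by (auto intro!: open_UN)
      have W1U: "W1 \<subseteq> U" unfolding W1_def using C1(2) by auto
      obtain C2 where C2: "countable C2" "\<And>u v. (u, v) \<in> C2 \<Longrightarrow> u < v \<and> F v - F u \<ge> q * (v - u) \<and> {u<..<v} \<subseteq> W1"
        "disjoint_family_on (\<lambda>(u, v). {u<..<v}) C2" "negligible ((E \<inter> W1) - (\<Union>(u, v)\<in>C2. {u<..<v}))"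
        by (rule vitali_open_intervals[OF oW1, of "E \<inter> W1" "\<lambda>u v. F v - F u \<ge> q * (v - u)"], blast, erule (1) R2[OF IntD1], rule that; assumption)
      define W2 where "W2 = (\<Union>(u, v)\<in>C2. {u<..<v})"
      have oW2: "open W2" unfolding W2_def by (auto intro!: open_UN)
      have W21: "W2 \<subseteq> W1" unfolding W2_def using C2(2) by auto
      have sum: "emeasure N (\<Union>i\<in>C. X i) = (\<integral>\<^sup>+i. emeasure N (X i) \<partial>count_space C)"
        if "countable C" "disjoint_family_on X C" "\<And>i. i \<in> C \<Longrightarrow> open (X i)" "sets N = sets borel"
        for C :: "(real \<times> real) set" and X and N :: "real measure"
        by (rule emeasure_UN_countable) (use that in auto)
      have op: "open (case i of (u, v) \<Rightarrow> {u<..<v})" for i :: "real \<times> real"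
        by (cases i) simp
      have IC1: "emeasure ?M {u<..<v} \<le> ennreal p * emeasure lborel {u<..<v}" if "(u, v) \<in> C1" for u v
      proof -
        have uv: "u < v" "F v - F u \<le> p * (v - u)" using C1(2)[OF that] by auto
        have "emeasure ?M {u<..<v} = ennreal (F v - F u)" by (rule interval_measure_Ioo[OF uv(1) mono cont])
        also have "\<dots> \<le> ennreal (p * (v - u))" using uv(2) by (rule ennreal_leI)
        also have "\<dots> = ennreal p * ennreal (v - u)" using pq(1) uv(1) by (intro ennreal_mult) auto
        also have "\<dots> = ennreal p * emeasure lborel {u<..<v}" using uv(1) by simp
        finally show ?thesis .
      qed
      have IC2: "ennreal q * emeasure lborel {u<..<v} \<le> emeasure ?M {u<..<v}" if "(u, v) \<in> C2" for u v
      proof -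
        have uv: "u < v" "q * (v - u) \<le> F v - F u" using C2(2)[OF that] by auto
        have "ennreal q * emeasure lborel {u<..<v} = ennreal q * ennreal (v - u)" using uv(1) by simp
        also have "\<dots> = ennreal (q * (v - u))" using pq uv(1) by (intro ennreal_mult[symmetric]) auto
        also have "\<dots> \<le> ennreal (F v - F u)" using uv(2) by (rule ennreal_leI)
        also have "\<dots> = emeasure ?M {u<..<v}" by (rule interval_measure_Ioo[OF uv(1) mono cont, symmetric])
        finally show ?thesis .
      qed
      have JC1: "emeasure ?M (case i of (u, v) \<Rightarrow> {u<..<v}) \<le> ennreal p * emeasure lborel (case i of (u, v) \<Rightarrow> {u<..<v})"
        if "i \<in> C1" for i
        using that by (cases i) (simp only: prod.case IC1)
      have JC2: "ennreal q * emeasure lborel (case i of (u, v) \<Rightarrow> {u<..<v}) \<le> emeasure ?M (case i of (u, v) \<Rightarrow> {u<..<v})"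
        if "i \<in> C2" for i
        using that by (cases i) (simp only: prod.case IC2)
      have "emeasure ?M W1 \<le> ennreal p * emeasure lborel W1"
        unfolding W1_def sum[OF C1(1,3) op sets_interval_measure] sum[OF C1(1,3) op sets_lborel]
        by (subst nn_integral_cmult[symmetric], simp, rule nn_integral_mono, simp only: space_count_space, rule JC1)
      moreover have "ennreal q * emeasure lborel W2 \<le> emeasure ?M W2"
        unfolding W2_def sum[OF C2(1,3) op sets_interval_measure] sum[OF C2(1,3) op sets_lborel]
        by (subst nn_integral_cmult[symmetric], simp, rule nn_integral_mono, simp only: space_count_space, rule JC2)
      moreover have "emeasure ?M W2 \<le> emeasure ?M W1"
        using W21 oW1 by (intro emeasure_mono) auto
      ultimately have le: "ennreal q * emeasure lborel W2 \<le> ennreal p * emeasure lborel W1" by order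
      have W1m: "W1 \<in> lmeasurable" "W2 \<in> lmeasurable"
        using W1U W21 oW1 oW2 by (auto intro!: fmeasurableI2[OF oU(3)])
      have "emeasure lborel W1 = ennreal (measure lebesgue W1)" "emeasure lborel W2 = ennreal (measure lebesgue W2)"
        using emeasure_eq_measure2[OF W1m(1)] emeasure_eq_measure2[OF W1m(2)] oW1 oW2 by simp_all
      then have le2: "q * measure lebesgue W2 \<le> p * measure lebesgue W1"
        using le pq by (simp add: ennreal_mult[symmetric])
      have "\<alpha> \<le> measure lebesgue W2"
      proof (rule field_le_epsilon)
        fix e :: real assume e: "e > 0"
        have "E - W2 \<subseteq> (E - W1) \<union> (E \<inter> W1 - W2)" by auto
        then have "negligible (E - W2)"
          using C1(4) C2(4) unfolding W1_def[symmetric] W2_def[symmetric] by (meson negligible_Un negligible_subset)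
        then have n: "E - W2 \<in> lmeasurable" "measure lebesgue (E - W2) = 0"
          by (auto simp: negligible_imp_measurable negligible_imp_measure0)
        obtain T where T: "open T" "E - W2 \<subseteq> T" "T \<in> lmeasurable" "measure lebesgue T < e"
          using lmeasurable_outer_open[OF n(1) e] n(2) by auto
        have "W2 \<union> T \<in> \<U>" unfolding \<U>_def using oW2 T W1m by auto
        then have "\<alpha> \<le> measure lebesgue (W2 \<union> T)" by (rule \<alpha>)
        also have "\<dots> \<le> measure lebesgue W2 + measure lebesgue T"
          by (rule measure_Un_le) (use W1m T in auto)
        finally show "\<alpha> \<le> measure lebesgue W2 + e" using T by simp
      qed
      then have "q * \<alpha> \<le> q * measure lebesgue W2" using pq by simp
      also have "\<dots> \<le> p * measure lebesgue W1" by fact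
      also have "\<dots> \<le> p * measure lebesgue U"
        using W1U W1m oU(3) pq by (intro mult_left_mono measure_mono_fmeasurable) auto
      also have "\<dots> < q * \<alpha>" using U(2) pq by (simp add: field_simps)
      finally show False by simp
    qed
    have "negligible E"
      unfolding negligible_outer
    proof (intro allI impI)
      fix e :: real assume "e > 0"
      then have "\<alpha> < e" using \<open>\<alpha> \<le> 0\<close> by simp
      then obtain U where "U \<in> \<U>" "measure lebesgue U < e"
        using approx by blast
      then show "\<exists>T. E \<subseteq> T \<and> T \<in> lmeasurable \<and> measure lebesgue T < e" by (auto simp: \<U>_def)
    qed
    then show ?thesis by (simp add: E_def)
  qed
  then have "negligible (?E \<inter> {- real n<..<real n})" for n by blast
  then have "negligible (\<Union>n. ?E \<inter> {- real n<..<real n})"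
    by (intro negligible_countable_Union) auto
  moreover have "?E \<subseteq> (\<Union>n. ?E \<inter> {- real n<..<real n})"
  proof
    fix x assume x: "x \<in> ?E"
    obtain n where "\<bar>x\<bar> < real n" using reals_Archimedean2 by blast
    then have "x \<in> {- real n<..<real n}" by auto
    with x show "x \<in> (\<Union>n. ?E \<inter> {- real n<..<real n})" by blast
  qed
  ultimately show ?thesis using negligible_subset by blast
qed

text \<open>
  The function \<open>f x + L * x\<close> is increasing, so outside a null set there are no rationals \<open>p < q\<close> such
  that arbitrarily small intervals around \<open>x\<close> have slope at most \<open>p\<close> and others slope at least \<open>q\<close>. Hence
  the slopes over intervals that straddle \<open>x\<close> converge, and moving one end point to \<open>x\<close> gives the
  derivative.
\<close>
lemma lipschitz_real_differentiable_AE: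
  fixes f :: "real \<Rightarrow> real"
  assumes lip: "\<And>x y. \<bar>f x - f y\<bar> \<le> L * \<bar>x - y\<bar>"
  shows "negligible {x. \<not> f differentiable (at x)}"
proof -
  define F where "F = (\<lambda>x. f x + L * x)"
  have L0: "L \<ge> 0" using lip[of 0 1] by simp
  have mono: "F x \<le> F y" if "x \<le> y" for x y
    using lip[of x y] that by (simp add: F_def algebra_simps abs_if split: if_splits)
  have lipF: "\<bar>F x - F y\<bar> \<le> 2 * L * \<bar>x - y\<bar>" for x y
  proof -
    have "\<bar>F x - F y\<bar> \<le> \<bar>f x - f y\<bar> + \<bar>L * (x - y)\<bar>" unfolding F_def by (simp add: algebra_simps)
    also have "\<bar>L * (x - y)\<bar> = L * \<bar>x - y\<bar>" using L0 by (simp add: abs_mult)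
    finally show ?thesis using lip[of x y] by simp
  qed
  have cont: "continuous_on UNIV F"
    by (rule lipschitz_on_continuous_on[of "2 * L"]) (use lipF L0 in \<open>auto simp: lipschitz_on_def dist_real_def\<close>)
  define lo where "lo = (\<lambda>p x. \<forall>d>0. \<exists>u v. u < x \<and> x < v \<and> v - u < d \<and> F v - F u \<le> p * (v - u))"
  define hi where "hi = (\<lambda>q x. \<forall>d>0. \<exists>u v. u < x \<and> x < v \<and> v - u < d \<and> F v - F u \<ge> q * (v - u))"
  define Z where "Z = (\<Union>p\<in>\<rat> \<inter> {0<..}. \<Union>q\<in>\<rat> \<inter> {p<..}. {x. lo p x \<and> hi q x})"
  have Z: "negligible Z"
    unfolding Z_def
  proof (intro negligible_countable_Union countable_image ballI; (elim imageE)?; hypsubst?)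
    show "countable (\<rat> \<inter> {0<..} :: real set)" by (simp add: countable_Int1 countable_rat)
    fix p :: real assume p: "p \<in> \<rat> \<inter> {0<..}"
    show "negligible (\<Union>q\<in>\<rat> \<inter> {p<..}. {x. lo p x \<and> hi q x})"
    proof (intro negligible_countable_Union countable_image ballI; (elim imageE)?; hypsubst?)
      show "countable (\<rat> \<inter> {p<..} :: real set)" by (simp add: countable_Int1 countable_rat)
      fix q :: real assume q: "q \<in> \<rat> \<inter> {p<..}"
      show "negligible {x. lo p x \<and> hi q x}"
        unfolding lo_def hi_def
        by (rule mono_slope_gap_negligible[OF mono cont]) (use p q in auto)
    qed
  qed
  have "F differentiable (at x)" if x: "x \<notin> Z" for x
  proof -
    define s where "s = Sup {q. hi q x}"
    have h0: "hi (- 1) x"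
      unfolding hi_def
    proof (intro allI impI)
      fix d :: real assume "d > 0"
      then show "\<exists>u v. u < x \<and> x < v \<and> v - u < d \<and> - 1 * (v - u) \<le> F v - F u"
        using mono[of "x - d/3" "x + d/3"] by (intro exI[of _ "x - d/3"] exI[of _ "x + d/3"]) auto
    qed
    have hbd: "q \<le> 2 * L" if hiq: "hi q x" for q
    proof -
      obtain u v where "u < x" "x < v" "F v - F u \<ge> q * (v - u)" using hiq unfolding hi_def by (meson zero_less_one)
      moreover have "F v - F u \<le> 2 * L * (v - u)" using lipF[of v u] calculation by auto
      ultimately have "q * (v - u) \<le> 2 * L * (v - u)" "v - u > 0" by linarith+
      then show ?thesis by (metis mult_le_cancel_right_pos)
    qed
    have bdd: "bdd_above {q. hi q x}" using hbd by (auto intro!: bdd_aboveI)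
    have mh: "hi q x" if "q < s" for q
    proof -
      obtain q' where q': "hi q' x" "q < q'" using less_cSupD[of "{q. hi q x}" q] h0 \<open>q < s\<close> unfolding s_def by blast
      show ?thesis unfolding hi_def
      proof (intro allI impI)
        fix d :: real assume "d > 0"
        then obtain u v where uv: "u < x" "x < v" "v - u < d" "F v - F u \<ge> q' * (v - u)" using q' unfolding hi_def by meson
        have "q * (v - u) \<le> q' * (v - u)" using q' uv by (intro mult_right_mono) auto
        then show "\<exists>u v. u < x \<and> x < v \<and> v - u < d \<and> q * (v - u) \<le> F v - F u" using uv by (meson order_trans)
      qed
    qed
    have straddle: "\<exists>d>0. \<forall>u v. u < x \<longrightarrow> x < v \<longrightarrow> v - u < d \<longrightarrow> \<bar>F v - F u - s * (v - u)\<bar> \<le> e * (v - u)" if e: "e > 0" for e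
    proof -
      have "\<not> hi (s + e) x" using cSup_upper[of "s + e" "{q. hi q x}"] bdd e unfolding s_def[symmetric] by auto
      then obtain d1 where d1: "d1 > 0" "\<And>u v. u < x \<Longrightarrow> x < v \<Longrightarrow> v - u < d1 \<Longrightarrow> F v - F u < (s + e) * (v - u)"
        unfolding hi_def by (meson not_le)
      have "\<not> lo (s - e) x"
      proof
        assume lo: "lo (s - e) x"
        obtain u v where "u < x" "x < v" "F v - F u \<le> (s - e) * (v - u)" using lo unfolding lo_def by (meson zero_less_one)
        moreover then have "F v - F u \<ge> 0" using mono[of u v] by auto
        ultimately have se: "0 \<le> s - e" by (smt (verit) mult_less_0_iff)
        obtain p where p: "p \<in> \<rat>" "s - e < p" "p < s" using Rats_dense_in_real[of "s - e" s] e by auto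
        obtain q where q: "q \<in> \<rat>" "p < q" "q < s" using Rats_dense_in_real[of p s] p by auto
        have "lo p x" unfolding lo_def
        proof (intro allI impI)
          fix d :: real assume "d > 0"
          then obtain u v where uv: "u < x" "x < v" "v - u < d" "F v - F u \<le> (s - e) * (v - u)" using lo unfolding lo_def by meson
          have "(s - e) * (v - u) \<le> p * (v - u)" using p uv by (intro mult_right_mono) auto
          then show "\<exists>u v. u < x \<and> x < v \<and> v - u < d \<and> F v - F u \<le> p * (v - u)" using uv by (meson order_trans)
        qed
        moreover have "hi q x" using mh q by auto
        ultimately have "x \<in> Z" unfolding Z_def using p q se by auto
        with x show False ..
      qed
      then obtain d2 where d2: "d2 > 0" "\<And>u v. u < x \<Longrightarrow> x < v \<Longrightarrow> v - u < d2 \<Longrightarrow> F v - F u > (s - e) * (v - u)"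
        unfolding lo_def by (meson not_le)
      show ?thesis
      proof (intro exI[of _ "min d1 d2"] conjI allI impI)
        fix u v assume "u < x" "x < v" "v - u < min d1 d2"
        then show "\<bar>F v - F u - s * (v - u)\<bar> \<le> e * (v - u)"
          using d1(2)[of u v] d2(2)[of u v] by (simp add: abs_le_iff algebra_simps)
      qed (use d1 d2 in auto)
    qed
    have "(F has_derivative (\<lambda>h. s * h)) (at x)"
      unfolding has_derivative_at_alt
    proof (intro conjI allI impI)
      show "bounded_linear ((*) s)" by (rule bounded_linear_mult_right)
      fix e :: real assume e: "e > 0"
      obtain d where d: "d > 0" "\<And>u v. u < x \<Longrightarrow> x < v \<Longrightarrow> v - u < d \<Longrightarrow> \<bar>F v - F u - s * (v - u)\<bar> \<le> e * (v - u)"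
        using straddle[OF e] by blast
      show "\<exists>d>0. \<forall>y. norm (y - x) < d \<longrightarrow> norm (F y - F x - s * (y - x)) \<le> e * norm (y - x)"
      proof (intro exI[of _ d] conjI allI impI)
        fix y assume y: "norm (y - x) < d"
        have c: "isCont F x" using cont by (simp add: continuous_on_eq_continuous_at)
        have Fl: "(F \<longlongrightarrow> F x) (at_left x)" and Fr: "(F \<longlongrightarrow> F x) (at_right x)"
          using c by (auto simp: isCont_def filterlim_at_split)
        consider "y = x" | "x < y" | "y < x" by linarith
        then show "norm (F y - F x - s * (y - x)) \<le> e * norm (y - x)"
        proof cases
          case 2
          have lim: "((\<lambda>u. e * (y - u) - \<bar>F y - F u - s * (y - u)\<bar>) \<longlongrightarrow> e * (y - x) - \<bar>F y - F x - s * (y - x)\<bar>) (at_left x)"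
            by (intro tendsto_intros Fl)
          have "\<forall>\<^sub>F u in at_left x. 0 \<le> e * (y - u) - \<bar>F y - F u - s * (y - u)\<bar>"
            unfolding eventually_at_left_field
          proof (intro exI[of _ "y - d"] conjI allI impI)
            fix u assume "y - d < u" "u < x"
            then show "0 \<le> e * (y - u) - \<bar>F y - F u - s * (y - u)\<bar>" using d(2)[of u y] 2 by auto
          qed (use y 2 in auto)
          from tendsto_lowerbound[OF lim this trivial_limit_at_left_real] show ?thesis using 2 by simp
        next
          case 3
          have lim: "((\<lambda>u. e * (u - y) - \<bar>F u - F y - s * (u - y)\<bar>) \<longlongrightarrow> e * (x - y) - \<bar>F x - F y - s * (x - y)\<bar>) (at_right x)"
            by (intro tendsto_intros Fr)
          have "\<forall>\<^sub>F u in at_right x. 0 \<le> e * (u - y) - \<bar>F u - F y - s * (u - y)\<bar>"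
            unfolding eventually_at_right_field
          proof (intro exI[of _ "y + d"] conjI allI impI)
            fix u assume "u < y + d" "x < u"
            then show "0 \<le> e * (u - y) - \<bar>F u - F y - s * (u - y)\<bar>" using d(2)[of y u] 3 by auto
          qed (use y 3 in auto)
          from tendsto_lowerbound[OF lim this trivial_limit_at_right_real] have "\<bar>F x - F y - s * (x - y)\<bar> \<le> e * (x - y)" by simp
          moreover have "F y - F x - s * (y - x) = - (F x - F y - s * (x - y))" by (simp add: algebra_simps)
          ultimately show ?thesis using 3 by simp
        qed simp
      qed (use d in auto)
    qed
    then show ?thesis using differentiableI by blast
  qed
  moreover have "f differentiable (at x)" if "F differentiable (at x)" for x
  proof -
    have "f = (\<lambda>x. F x - L * x)" by (simp add: F_def)
    moreover have "(\<lambda>x. F x - L * x) differentiable (at x)" using that by simp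
    ultimately show ?thesis by simp
  qed
  ultimately have "{x. \<not> f differentiable (at x)} \<subseteq> Z" by blast
  with Z show ?thesis using negligible_subset by blast
qed

lemma lipschitz_abs_continuous_curve:
  assumes L: "L \<ge> 0" and lip: "\<And>x y. x \<in> {a..b} \<Longrightarrow> y \<in> {a..b} \<Longrightarrow> norm (f x - f y) \<le> L * \<bar>x - y\<bar>"
  shows "abs_continuous_curve a b f"
  unfolding abs_continuous_curve_def
proof (intro allI impI)
  fix e :: real assume e: "e > 0"
  show "\<exists>d>0. \<forall>(m::nat) p q. (\<forall>i<m. a \<le> p i \<and> p i \<le> q i \<and> q i \<le> b) \<and>
        disjoint_family_on (\<lambda>i. {p i<..<q i}) {..<m} \<and> (\<Sum>i<m. q i - p i) < d \<longrightarrow>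
        (\<Sum>i<m. norm (f (q i) - f (p i))) < e"
  proof (intro exI[of _ "e / (L + 1)"] conjI allI impI)
    show "e / (L + 1) > 0" using e L by simp
    fix m :: nat and p q assume A: "(\<forall>i<m. a \<le> p i \<and> p i \<le> q i \<and> q i \<le> b) \<and>
        disjoint_family_on (\<lambda>i. {p i<..<q i}) {..<m} \<and> (\<Sum>i<m. q i - p i) < e / (L + 1)"
    have "(\<Sum>i<m. norm (f (q i) - f (p i))) \<le> (\<Sum>i<m. (L + 1) * (q i - p i))"
    proof (rule sum_mono)
      fix i assume "i \<in> {..<m}"
      then have pq: "a \<le> p i" "p i \<le> q i" "q i \<le> b" using A by auto
      then have "norm (f (q i) - f (p i)) \<le> L * \<bar>q i - p i\<bar>" by (intro lip) auto
      also have "\<dots> \<le> (L + 1) * (q i - p i)" using pq by (simp add: algebra_simps)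
      finally show "norm (f (q i) - f (p i)) \<le> (L + 1) * (q i - p i)" .
    qed
    also have "\<dots> = (L + 1) * (\<Sum>i<m. q i - p i)" by (simp add: sum_distrib_left)
    also have "\<dots> < (L + 1) * (e / (L + 1))" using A L by (intro mult_strict_left_mono) auto
    also have "\<dots> = e" using L by simp
    finally show "(\<Sum>i<m. norm (f (q i) - f (p i))) < e" .
  qed
qed

text \<open>
  A derivative almost everywhere of a Lipschitz function, normalised to satisfy the Lipschitz bound
  also at the exceptional points, so that pointwise estimates of \<open>D\<close> can be integrated directly.
\<close>
definition lip_deriv :: "real \<Rightarrow> (real \<Rightarrow> real) \<Rightarrow> (real \<Rightarrow> real) \<Rightarrow> bool" where
  "lip_deriv L h D \<longleftrightarrow> (\<forall>x y. \<bar>h x - h y\<bar> \<le> L * \<bar>x - y\<bar>) \<and> (\<forall>x. \<bar>D x\<bar> \<le> L) \<and>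
     negligible {x. \<not> (h has_real_derivative D x) (at x)}"

lemma lipschitz_derivative_bound:
  fixes h :: "real \<Rightarrow> real"
  assumes lip: "\<And>x y. \<bar>h x - h y\<bar> \<le> L * \<bar>x - y\<bar>" and D: "(h has_real_derivative D) (at x)"
  shows "\<bar>D\<bar> \<le> L"
proof -
  have "((\<lambda>y. \<bar>(h y - h x) / (y - x)\<bar>) \<longlongrightarrow> \<bar>D\<bar>) (at x)"
    using D unfolding has_field_derivative_iff by (intro tendsto_rabs)
  moreover have "\<forall>\<^sub>F y in at x. \<bar>(h y - h x) / (y - x)\<bar> \<le> L"
    using eventually_neq_at_within[of x x UNIV]
  proof eventually_elim
    case (elim y)
    then show ?case using lip[of y x] by (simp add: abs_divide divide_le_eq)
  qed
  ultimately show ?thesis by (rule tendsto_upperbound[OF _ _ trivial_limit_at])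
qed

lemma lip_deriv_exists:
  fixes h :: "real \<Rightarrow> real"
  assumes lip: "\<And>x y. \<bar>h x - h y\<bar> \<le> L * \<bar>x - y\<bar>"
  shows "\<exists>D. lip_deriv L h D"
proof -
  define D where "D = (\<lambda>x. if h differentiable (at x) then deriv h x else 0)"
  have der: "(h has_real_derivative D x) (at x)" if "h differentiable (at x)" for x
    using that by (simp add: D_def DERIV_deriv_iff_real_differentiable)
  have L0: "L \<ge> 0" using lip[of 0 1] by simp
  have "{x. \<not> (h has_real_derivative D x) (at x)} \<subseteq> {x. \<not> h differentiable (at x)}"
    using der by blast
  then have "negligible {x. \<not> (h has_real_derivative D x) (at x)}"
    using lipschitz_real_differentiable_AE[OF lip] negligible_subset by blast
  moreover have "\<bar>D x\<bar> \<le> L" for x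
  proof (cases "h differentiable (at x)")
    case True
    then show ?thesis using lipschitz_derivative_bound[OF lip der] by simp
  qed (simp add: D_def L0)
  ultimately show ?thesis unfolding lip_deriv_def using lip by blast
qed

lemma lip_deriv_nonneg: "lip_deriv L h D \<Longrightarrow> L \<ge> 0"
  unfolding lip_deriv_def by (metis abs_ge_zero order_trans)

lemma lip_deriv_mono:
  assumes "lip_deriv L h D" "L \<le> L'" shows "lip_deriv L' h D"
proof -
  have "L * \<bar>x - y\<bar> \<le> L' * \<bar>x - y\<bar>" for x y :: real using assms(2) by (intro mult_right_mono) auto
  then show ?thesis using assms unfolding lip_deriv_def by (meson order_trans)
qed

lemma lip_deriv_continuous: "lip_deriv L h D \<Longrightarrow> continuous_on S h"
  by (rule lipschitz_on_continuous_on[of L])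
     (auto simp: lip_deriv_def lipschitz_on_def dist_real_def intro: lip_deriv_nonneg)

lemma lip_deriv_has_integral:
  assumes h: "lip_deriv L h D" and ab: "a \<le> b"
  shows "(D has_integral h b - h a) {a..b}"
proof (rule abs_continuous_curve_has_integral[OF ab])
  show "abs_continuous_curve a b h"
    by (rule lipschitz_abs_continuous_curve[of L]) (use h lip_deriv_nonneg in \<open>auto simp: lip_deriv_def\<close>)
  show "negligible {x. \<not> (h has_real_derivative D x) (at x)}" using h by (simp add: lip_deriv_def)
qed (simp add: has_real_derivative_iff_has_vector_derivative)

lemma lip_deriv_absolutely_integrable:
  assumes h: "lip_deriv L h D"
  shows "D absolutely_integrable_on {a..b}"
proof (cases "a \<le> b")
  case True
  have int: "D integrable_on {a..b}" using lip_deriv_has_integral[OF h True] by blast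
  show ?thesis
    by (rule measurable_bounded_by_integrable_imp_absolutely_integrable[of _ _ "\<lambda>_. L"])
       (use int h in \<open>auto simp: lip_deriv_def intro: integrable_imp_measurable\<close>)
qed simp

lemma lip_deriv_uminus:
  assumes "lip_deriv L h D" shows "lip_deriv L (\<lambda>x. - h x) (\<lambda>x. - D x)"
proof -
  have "{x. \<not> ((\<lambda>x. - h x) has_real_derivative - D x) (at x)} \<subseteq> {x. \<not> (h has_real_derivative D x) (at x)}"
    by (auto intro: DERIV_minus)
  then show ?thesis using assms unfolding lip_deriv_def
    by (auto intro: negligible_subset simp: abs_minus_commute)
qed

lemma lip_deriv_reflect:
  assumes "lip_deriv L h D" shows "lip_deriv L (\<lambda>x. - h (- x)) (\<lambda>x. D (- x))"
proof -
  have "{x. \<not> ((\<lambda>x. - h (- x)) has_real_derivative D (- x)) (at x)}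
      \<subseteq> uminus ` {x. \<not> (h has_real_derivative D x) (at x)}"
  proof
    fix x assume "x \<in> {x. \<not> ((\<lambda>x. - h (- x)) has_real_derivative D (- x)) (at x)}"
    then have "\<not> (h has_real_derivative D (- x)) (at (- x))"
      using DERIV_minus[of "\<lambda>x. h (- x)" "- D (- x)" x] DERIV_mirror[of h "D (-x)" x] by auto
    then show "x \<in> uminus ` {x. \<not> (h has_real_derivative D x) (at x)}" by force
  qed
  moreover have "negligible (uminus ` {x. \<not> (h has_real_derivative D x) (at x)})"
    by (rule negligible_differentiable_image_negligible)
       (use assms in \<open>auto simp: lip_deriv_def intro!: derivative_intros\<close>)
  ultimately have "negligible {x. \<not> ((\<lambda>x. - h (- x)) has_real_derivative D (- x)) (at x)}"
    using negligible_subset by blast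
  moreover have "\<bar>- h (- x) - - h (- y)\<bar> \<le> L * \<bar>x - y\<bar>" for x y
  proof -
    have "\<bar>h (- x) - h (- y)\<bar> \<le> L * \<bar>- x - - y\<bar>" using assms unfolding lip_deriv_def by blast
    then show ?thesis by (simp add: abs_minus_commute)
  qed
  ultimately show ?thesis using assms unfolding lip_deriv_def by blast
qed

lemma lip_deriv_tilt:
  assumes "lip_deriv L h D" shows "lip_deriv (L + \<bar>m\<bar>) (\<lambda>x. h x - m * x) (\<lambda>x. D x - m)"
proof -
  have "{x. \<not> ((\<lambda>x. h x - m * x) has_real_derivative D x - m) (at x)} \<subseteq> {x. \<not> (h has_real_derivative D x) (at x)}"
    by (auto intro!: derivative_eq_intros)
  moreover have "\<bar>h x - m * x - (h y - m * y)\<bar> \<le> (L + \<bar>m\<bar>) * \<bar>x - y\<bar>" for x y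
  proof -
    have "h x - m * x - (h y - m * y) = (h x - h y) - m * (x - y)" by (simp add: algebra_simps)
    also have "\<bar>\<dots>\<bar> \<le> \<bar>h x - h y\<bar> + \<bar>m * (x - y)\<bar>" by simp
    also have "\<dots> \<le> L * \<bar>x - y\<bar> + \<bar>m\<bar> * \<bar>x - y\<bar>" using assms by (simp add: lip_deriv_def abs_mult)
    finally show ?thesis by (simp add: algebra_simps)
  qed
  moreover have "\<bar>D x - m\<bar> \<le> L + \<bar>m\<bar>" for x
    using assms abs_triangle_ineq4[of "D x" m] unfolding lip_deriv_def by (meson add_right_mono order_trans)
  ultimately show ?thesis using assms unfolding lip_deriv_def
    by (auto intro: negligible_subset)
qed

section \<open>A maximal inequality and a mean value theorem\<close>

text \<open>
  F. Riesz's lemma, in integrated form. The function \<open>G t\<close>, the supremum of \<open>g\<close> over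
  \<open>{t..b}\<close>, is again Lipschitz, and \<open>e = G - g\<close> is nonnegative and vanishes at \<open>b\<close>.
  On \<open>U\<close> the function \<open>G\<close> is locally constant, so the derivative of \<open>e\<close> is \<open>- D\<close>; off \<open>U\<close> the
  function \<open>e\<close> attains its minimum 0, so its derivative vanishes. Thus the integral of \<open>D\<close> over \<open>U\<close>
  is \<open>e a - e b \<ge> 0\<close>, and the components of \<open>U\<close> need not be discussed.
\<close>
lemma rising_sun:
  assumes g: "lip_deriv L g D" and ab: "a < b"
  defines "U \<equiv> {x \<in> {a<..<b}. \<exists>y. x < y \<and> y \<le> b \<and> g y > g x}"
  shows "open U" and "0 \<le> integral U D" and "D absolutely_integrable_on U"
proof -
  have contg: "continuous_on S g" for S by (rule lip_deriv_continuous[OF g])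
  have lipg: "\<bar>g x - g y\<bar> \<le> L * \<bar>x - y\<bar>" for x y using g by (simp add: lip_deriv_def)
  have L0: "L \<ge> 0" using lip_deriv_nonneg[OF g] .
  have "U = (\<Union>y\<in>{..b}. {a<..<min y b} \<inter> {x. g x < g y})" by (auto simp: U_def)
  moreover have "open {x. g x < g y}" for y
    by (intro open_Collect_less continuous_on_const contg)
  ultimately show opU: "open U" by (auto intro!: open_UN open_Int)
  have Uab: "U \<subseteq> {a..b}" by (auto simp: U_def)
  have Um: "U \<in> sets lebesgue" using opU by auto
  show Dint: "D absolutely_integrable_on U"
    by (rule set_integrable_subset[OF lip_deriv_absolutely_integrable[OF g, of a b] Um Uab])
  define G where "G = (\<lambda>t. Sup (g ` {min t b..b}))"
  have bdd: "bdd_above (g ` {min t b..b})" for t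
    by (intro bounded_imp_bdd_above compact_imp_bounded compact_continuous_image contg) simp
  have Gup: "g y \<le> G t" if "min t b \<le> y" "y \<le> b" for t y
    unfolding G_def by (rule cSup_upper[OF _ bdd]) (use that in auto)
  have Gle: "G t \<le> c" if "\<And>y. min t b \<le> y \<Longrightarrow> y \<le> b \<Longrightarrow> g y \<le> c" for t c
    unfolding G_def by (rule cSup_least) (use that in auto)
  have Gmono: "G t \<le> G s" if "s \<le> t" for s t
    by (rule Gle) (use that in \<open>auto intro!: Gup\<close>)
  have Glip: "G s - G t \<le> L * (t - s)" if "s \<le> t" for s t
  proof -
    have "G s \<le> G t + L * (t - s)"
    proof (rule Gle)
      fix y assume y: "min s b \<le> y" "y \<le> b"
      show "g y \<le> G t + L * (t - s)"
      proof (cases "min t b \<le> y")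
        case True
        then show ?thesis using Gup[of t y] y L0 that by (simp add: add_increasing2)
      next
        case False
        have "g y \<le> g (min t b) + L * \<bar>y - min t b\<bar>" using lipg[of y "min t b"] by simp
        also have "g (min t b) \<le> G t" by (rule Gup) auto
        also have "L * \<bar>y - min t b\<bar> \<le> L * (t - s)" using False y that L0 by (intro mult_left_mono) auto
        finally show ?thesis by simp
      qed
    qed
    then show ?thesis by simp
  qed
  define e where "e = (\<lambda>t. G t - g (min t b))"
  have "\<bar>e s - e t\<bar> \<le> (2 * L) * \<bar>s - t\<bar>" for s t
  proof -
    have 1: "\<bar>e s - e t\<bar> \<le> (2 * L) * \<bar>s - t\<bar>" if "s \<le> t" for s t
    proof -
      have "\<bar>G s - G t\<bar> \<le> L * (t - s)" using Glip[OF that] Gmono[OF that] by simp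
      moreover have "\<bar>g (min s b) - g (min t b)\<bar> \<le> L * (t - s)"
      proof -
        have "\<bar>min s b - min t b\<bar> \<le> t - s" using that by auto
        then have "L * \<bar>min s b - min t b\<bar> \<le> L * (t - s)" using L0 by (rule mult_left_mono)
        then show ?thesis using lipg[of "min s b" "min t b"] by linarith
      qed
      ultimately show ?thesis using that by (simp add: e_def)
    qed
    show ?thesis using 1[of s t] 1[of t s] by (cases "s \<le> t") (auto simp: abs_minus_commute)
  qed
  then obtain De where De: "lip_deriv (2 * L) e De" using lip_deriv_exists by blast
  have e0: "e t \<ge> 0" for t unfolding e_def using Gup[of t "min t b"] by simp
  have eb: "e b = 0"
  proof -
    have "G b \<le> g b" by (rule Gle) auto
    then show ?thesis using e0[of b] by (simp add: e_def)
  qed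
  have DeU: "De x = - D x" if x: "x \<in> U" and dg: "(g has_real_derivative D x) (at x)" and de: "(e has_real_derivative De x) (at x)" for x
  proof -
    obtain y where y: "x < y" "y \<le> b" "g x < g y" and xab: "a < x" "x < b" using x by (auto simp: U_def)
    have "open ({..<y} \<inter> {z. g z < g y})"
      by (intro open_Int open_lessThan open_Collect_less continuous_on_const contg)
    then obtain r where r: "r > 0" "ball x r \<subseteq> {..<y} \<inter> {z. g z < g y}"
      using y by (metis (mono_tags, lifting) Int_Collect lessThan_iff open_contains_ball_eq)
    have Gconst: "G s \<le> G t" if "s \<in> ball x r" "t \<in> ball x r" for s t
    proof (rule Gle)
      fix z assume z: "min s b \<le> z" "z \<le> b"
      have "t < y" using that r by auto
      show "g z \<le> G t"
      proof (cases "t \<le> z")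
        case True
        then show ?thesis using z by (intro Gup) auto
      next
        case False
        then have "z \<in> ball x r" using z that y \<open>t < y\<close> r(2) by (auto simp: dist_real_def min_def split: if_splits)
        then have "g z < g y" using r by auto
        also have "g y \<le> G t" using \<open>t < y\<close> y by (intro Gup) auto
        finally show ?thesis by simp
      qed
    qed
    have ev: "\<forall>\<^sub>F z in nhds x. e z = G x - g z"
    proof (rule eventually_nhds_in_open[THEN eventually_mono])
      show "open (ball x r)" "x \<in> ball x r" using r by auto
      fix z assume z: "z \<in> ball x r"
      have "z < y" using z r by auto
      moreover have "G z = G x" using Gconst[OF z, of x] Gconst[of x z] z r(1) by auto
      ultimately show "e z = G x - g z" using y by (simp add: e_def)
    qed
    have "((\<lambda>z. G x - g z) has_real_derivative 0 - D x) (at x)"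
      by (intro derivative_intros dg)
    then have "(e has_real_derivative - D x) (at x)"
      using DERIV_cong_ev[OF refl ev refl] by simp
    then show ?thesis using de DERIV_unique by blast
  qed
  have De0: "De x = 0" if x: "x \<in> {a<..<b}" "x \<notin> U" and de: "(e has_real_derivative De x) (at x)" for x
  proof -
    have "G x \<le> g x" by (rule Gle) (use x in \<open>force simp: U_def not_less\<close>)
    then have "e x \<le> 0" using x by (simp add: e_def)
    then have "e x \<le> e y" for y using e0[of y] by simp
    then show ?thesis using DERIV_local_min[OF de, of 1] by simp
  qed
  define Z where "Z = {x. \<not> (g has_real_derivative D x) (at x)} \<union> {x. \<not> (e has_real_derivative De x) (at x)} \<union> {a, b}"
  have Z: "negligible Z" using g De unfolding Z_def lip_deriv_def by (auto intro: negligible_Un)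
  have "((\<lambda>x. if x \<in> U then - D x else 0) has_integral e b - e a) {a..b}"
    using lip_deriv_has_integral[OF De less_imp_le[OF ab]]
    by (rule has_integral_spike[OF Z, rotated]) (use DeU De0 in \<open>auto simp: Z_def\<close>)
  then have "((\<lambda>x. - D x) has_integral e b - e a) U"
    using has_integral_restrict[OF Uab, of "\<lambda>x. - D x"] by simp
  then have "integral U (\<lambda>x. - D x) = e b - e a" by (rule integral_unique)
  then show "0 \<le> integral U D" using e0[of a] eb by simp
qed

text \<open>
  The rising sun lemma for \<open>h x - \<kappa> * x\<close> says that \<open>D\<close> has average at least \<open>\<kappa>\<close> over \<open>U\<close>.
\<close>
lemma one_sided_maximal_bound:
  fixes \<kappa> :: real
  assumes h: "lip_deriv L h D" and ab: "a < b"
  defines "U \<equiv> {x \<in> {a<..<b}. \<exists>y. x < y \<and> y \<le> b \<and> h y - h x > \<kappa> * (y - x)}"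
  shows "open U" and "\<kappa> * measure lebesgue U \<le> integral {a..b} (\<lambda>x. max 0 (D x))"
proof -
  have U: "U = {x \<in> {a<..<b}. \<exists>y. x < y \<and> y \<le> b \<and> h y - \<kappa> * y > h x - \<kappa> * x}"
    unfolding U_def by (simp add: algebra_simps)
  note rs = rising_sun[OF lip_deriv_tilt[OF h, of \<kappa>] ab, folded U]
  show opU: "open U" by (rule rs)
  have Uab: "U \<subseteq> {a..b}" by (auto simp: U_def)
  have Um: "U \<in> lmeasurable"
    by (rule fmeasurableI2[OF _ Uab]) (use opU in auto)
  have Dab: "D absolutely_integrable_on {a..b}" by (rule lip_deriv_absolutely_integrable[OF h])
  have DU: "D absolutely_integrable_on U" by (rule set_integrable_subset[OF Dab _ Uab]) (use opU in auto)
  have cU: "(\<lambda>x. c) absolutely_integrable_on U" for c :: real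
    by (rule absolutely_integrable_on_const[OF Um])
  have maxab: "(\<lambda>x. max 0 (D x)) absolutely_integrable_on {a..b}"
    by (rule absolutely_integrable_max_1[OF absolutely_integrable_on_const Dab]) auto
  have maxU: "(\<lambda>x. max 0 (D x)) absolutely_integrable_on U"
    by (rule set_integrable_subset[OF maxab _ Uab]) (use opU in auto)
  note ai = set_lebesgue_integral_eq_integral(1)
  have iD: "D integrable_on U" and ic: "\<And>c::real. (\<lambda>x. c) integrable_on U"
    and iab: "(\<lambda>x. max 0 (D x)) integrable_on {a..b}" and iU: "(\<lambda>x. max 0 (D x)) integrable_on U"
    using ai[OF DU] ai[OF cU] ai[OF maxab] ai[OF maxU] by auto
  have mU: "integral U (\<lambda>x. \<kappa>) = \<kappa> * measure lebesgue U"
    using lmeasure_integral[OF Um] integral_mult_right[of U \<kappa> "\<lambda>_. 1"] by simp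
  have "\<kappa> * measure lebesgue U \<le> integral U (\<lambda>x. D x - \<kappa>) + \<kappa> * measure lebesgue U"
    using rs(2) by simp
  also have "\<dots> = integral U D" using mU iD ic by (simp add: integral_diff)
  also have "\<dots> \<le> integral U (\<lambda>x. max 0 (D x))" by (rule integral_le[OF iD iU]) simp
  also have "\<dots> \<le> integral {a..b} (\<lambda>x. max 0 (D x))"
    by (rule integral_subset_le[OF Uab iU iab]) simp
  finally show "\<kappa> * measure lebesgue U \<le> integral {a..b} (\<lambda>x. max 0 (D x))" .
qed

lemma lmeasurable_uminus_image:
  fixes U :: "real set"
  assumes op: "open U" and U: "U \<in> lmeasurable"
  shows "uminus ` U \<in> lmeasurable" "measure lebesgue (uminus ` U) = measure lebesgue U"
proof -
  have eq: "uminus ` U = uminus -` U" by (metis bij_uminus bij_vimage_eq_inv_image inv_equality minus_minus)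
  have op': "open (uminus ` U)"
    unfolding eq by (rule open_vimage[OF op]) (intro continuous_intros)
  have "emeasure lborel (uminus ` U) = emeasure (distr lborel borel uminus) U"
    unfolding eq using op by (subst emeasure_distr) auto
  then have e: "emeasure lborel (uminus ` U) = emeasure lborel U"
    by (simp add: lborel_distr_uminus)
  then show "measure lebesgue (uminus ` U) = measure lebesgue U"
    using op op' by (simp add: measure_def)
  show "uminus ` U \<in> lmeasurable"
    using U e op op' by (simp add: fmeasurable_def)
qed

text \<open>
  The four one-sided estimates for \<open>h\<close>, \<open>- h\<close> and their reflections have the same right-hand side,
  since the positive and the negative part of \<open>D\<close> have the same integral if \<open>h a = h b\<close>.
\<close>
lemma two_sided_maximal_bound:
  assumes h: "lip_deriv L h D" and ab: "a < b" and eq: "h a = h b" and kappa: "0 < \<kappa>"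
  defines "U \<equiv> {x \<in> {a<..<b}. \<exists>y\<in>{a..b}. \<bar>h y - h x\<bar> > \<kappa> * \<bar>y - x\<bar>}"
  shows "U \<in> lmeasurable" and "measure lebesgue U \<le> 4 * integral {a..b} (\<lambda>x. max 0 (D x)) / \<kappa>"
proof -
  define K where "K = integral {a..b} (\<lambda>x. max 0 (D x))"
  define B where "B = K / \<kappa>"
  have Dab: "D absolutely_integrable_on {a..b}" by (rule lip_deriv_absolutely_integrable[OF h])
  note ai = set_lebesgue_integral_eq_integral(1)
  have iD: "D integrable_on {a..b}" by (rule ai[OF Dab])
  have iK: "(\<lambda>x. max 0 (D x)) integrable_on {a..b}"
    by (rule ai[OF absolutely_integrable_max_1[OF absolutely_integrable_on_const Dab]]) auto
  have "integral {a..b} D = 0" using lip_deriv_has_integral[OF h less_imp_le[OF ab]] eq by (simp add: integral_unique)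
  moreover have "integral {a..b} (\<lambda>x. max 0 (- D x)) = integral {a..b} (\<lambda>x. max 0 (D x) - D x)"
    by (rule integral_cong) auto
  ultimately have Km: "integral {a..b} (\<lambda>x. max 0 (- D x)) = K"
    using iD iK by (simp add: integral_diff K_def)
  have Kr: "integral {- b..- a} (\<lambda>x. max 0 (D (- x))) = K" "integral {- b..- a} (\<lambda>x. max 0 (- D (- x))) = K"
    using Henstock_Kurzweil_Integration.integral_reflect_real[of b a "\<lambda>x. max 0 (D x)"]
      Henstock_Kurzweil_Integration.integral_reflect_real[of b a "\<lambda>x. max 0 (- D x)"] Km
    by (simp_all add: K_def)
  define S where "S = (\<lambda>f a b. {x \<in> {a<..<b}. \<exists>y. x < y \<and> y \<le> b \<and> f y - f x > \<kappa> * (y - x)})"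
  have S: "open (S f a b) \<and> S f a b \<in> lmeasurable \<and> measure lebesgue (S f a b) \<le> B"
    if "lip_deriv L f D'" "a < b" "integral {a..b} (\<lambda>x. max 0 (D' x)) = K" for f D' a b
  proof -
    have Sf: "S f a b = {x \<in> {a<..<b}. \<exists>y. x < y \<and> y \<le> b \<and> f y - f x > \<kappa> * (y - x)}"
      by (simp add: S_def)
    note b = one_sided_maximal_bound[OF that(1,2), of \<kappa>, folded Sf]
    have "measure lebesgue (S f a b) \<le> B"
      using b(2) kappa that(3) by (simp add: B_def pos_le_divide_eq mult.commute)
    moreover have "S f a b \<in> lmeasurable"
      by (rule fmeasurableI2[of "{a..b}"]) (use b(1) in \<open>auto simp: S_def\<close>)
    ultimately show ?thesis using b(1) by blast
  qed
  let ?m = "\<lambda>x. - h x" and ?r = "\<lambda>x. - h (- x)" and ?mr = "\<lambda>x. - (- h (- x))"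
  define S1 where "S1 = S h a b"
  define S2 where "S2 = S ?m a b"
  define S3 where "S3 = uminus ` S ?r (- b) (- a)"
  define S4 where "S4 = uminus ` S ?mr (- b) (- a)"
  have ab': "- b < - a" using ab by simp
  note r1 = S[OF h ab K_def[symmetric]]
  note r2 = S[OF lip_deriv_uminus[OF h] ab Km]
  note r3 = S[OF lip_deriv_reflect[OF h] ab' Kr(1)]
  note r4 = S[OF lip_deriv_uminus[OF lip_deriv_reflect[OF h]] ab' Kr(2)]
  have m1: "S1 \<in> lmeasurable" "measure lebesgue S1 \<le> B" using r1 by (auto simp: S1_def)
  have m2: "S2 \<in> lmeasurable" "measure lebesgue S2 \<le> B" using r2 by (auto simp: S2_def)
  have m3: "S3 \<in> lmeasurable" "measure lebesgue S3 \<le> B"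
    using r3 lmeasurable_uminus_image unfolding S3_def by auto
  have m4: "S4 \<in> lmeasurable" "measure lebesgue S4 \<le> B"
    using r4 lmeasurable_uminus_image unfolding S4_def by auto
  have refl_iff: "x \<in> uminus ` T \<longleftrightarrow> - x \<in> T" for x and T :: "real set" by force
  have x3: "x \<in> S3 \<longleftrightarrow> x \<in> {a<..<b} \<and> (\<exists>y. a \<le> y \<and> y < x \<and> h x - h y > \<kappa> * (x - y))" for x
  proof -
    have "x \<in> S3 \<longleftrightarrow> x \<in> {a<..<b} \<and> (\<exists>y. - x < y \<and> y \<le> - a \<and> h x - h (- y) > \<kappa> * (y + x))"
      unfolding S3_def refl_iff S_def by auto
    also have "(\<exists>y. - x < y \<and> y \<le> - a \<and> h x - h (- y) > \<kappa> * (y + x)) \<longleftrightarrow>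
        (\<exists>y. - x < - y \<and> - y \<le> - a \<and> h x - h (- (- y)) > \<kappa> * (- y + x))"
      by (metis minus_minus)
    finally show ?thesis by (auto simp: algebra_simps)
  qed
  have x4: "x \<in> S4 \<longleftrightarrow> x \<in> {a<..<b} \<and> (\<exists>y. a \<le> y \<and> y < x \<and> h y - h x > \<kappa> * (x - y))" for x
  proof -
    have "x \<in> S4 \<longleftrightarrow> x \<in> {a<..<b} \<and> (\<exists>y. - x < y \<and> y \<le> - a \<and> h (- y) - h x > \<kappa> * (y + x))"
      unfolding S4_def refl_iff S_def by auto
    also have "(\<exists>y. - x < y \<and> y \<le> - a \<and> h (- y) - h x > \<kappa> * (y + x)) \<longleftrightarrow>
        (\<exists>y. - x < - y \<and> - y \<le> - a \<and> h (- (- y)) - h x > \<kappa> * (- y + x))"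
      by (metis minus_minus)
    finally show ?thesis by (auto simp: algebra_simps)
  qed
  have U: "U = S1 \<union> S2 \<union> S3 \<union> S4"
  proof (intro equalityI subsetI)
    fix x assume "x \<in> U"
    then obtain y where xy: "x \<in> {a<..<b}" "y \<in> {a..b}" "\<bar>h y - h x\<bar> > \<kappa> * \<bar>y - x\<bar>" by (auto simp: U_def)
    have "y \<noteq> x" using xy by auto
    then consider "x < y" "h y - h x > \<kappa> * (y - x)" | "x < y" "h x - h y > \<kappa> * (y - x)"
      | "y < x" "h x - h y > \<kappa> * (x - y)" | "y < x" "h y - h x > \<kappa> * (x - y)"
      using xy(3) by (smt (verit))
    then show "x \<in> S1 \<union> S2 \<union> S3 \<union> S4"
    proof cases
      case 1 then show ?thesis using xy by (auto simp: S1_def S_def)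
    next
      case 2 then show ?thesis using xy by (auto simp: S2_def S_def)
    next
      case 3 then show ?thesis using xy by (auto simp: x3)
    next
      case 4 then show ?thesis using xy by (auto simp: x4)
    qed
  next
    fix x assume "x \<in> S1 \<union> S2 \<union> S3 \<union> S4"
    then consider "x \<in> S1" | "x \<in> S2" | "x \<in> S3" | "x \<in> S4" by blast
    then show "x \<in> U"
    proof cases
      case 1
      then obtain y where "x \<in> {a<..<b}" "x < y" "y \<le> b" "h y - h x > \<kappa> * (y - x)" by (auto simp: S1_def S_def)
      then show ?thesis unfolding U_def by (auto intro!: bexI[of _ y])
    next
      case 2
      then obtain y where "x \<in> {a<..<b}" "x < y" "y \<le> b" "h x - h y > \<kappa> * (y - x)" by (auto simp: S2_def S_def)
      then show ?thesis unfolding U_def by (auto intro!: bexI[of _ y])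
    next
      case 3
      then obtain y where "x \<in> {a<..<b}" "a \<le> y" "y < x" "h x - h y > \<kappa> * (x - y)" by (auto simp: x3)
      then show ?thesis unfolding U_def by (auto intro!: bexI[of _ y])
    next
      case 4
      then obtain y where "x \<in> {a<..<b}" "a \<le> y" "y < x" "h y - h x > \<kappa> * (x - y)" by (auto simp: x4)
      then show ?thesis unfolding U_def by (auto intro!: bexI[of _ y])
    qed
  qed
  show "U \<in> lmeasurable" unfolding U using m1(1) m2(1) m3(1) m4(1) by (intro fmeasurable.Un)
  have s: "measure lebesgue (P \<union> Q) \<le> measure lebesgue P + measure lebesgue Q"
    if "P \<in> lmeasurable" "Q \<in> lmeasurable" for P Q :: "real set"
    by (rule measure_Un_le) (use that in auto)
  have "measure lebesgue U \<le> measure lebesgue S1 + measure lebesgue S2 + measure lebesgue S3 + measure lebesgue S4"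
    unfolding U
    using s[OF fmeasurable.Un[OF fmeasurable.Un[OF m1(1) m2(1)] m3(1)] m4(1)]
      s[OF fmeasurable.Un[OF m1(1) m2(1)] m3(1)] s[OF m1(1) m2(1)]
    by linarith
  also have "\<dots> \<le> 4 * B" using m1 m2 m3 m4 by simp
  finally show "measure lebesgue U \<le> 4 * integral {a..b} (\<lambda>x. max 0 (D x)) / \<kappa>" by (simp add: B_def K_def)
qed

lemma sum_inverse_sqrt_le: "(\<Sum>k=1..n. 1 / sqrt (real k)) \<le> 2 * sqrt (real n)"
proof (induction n)
  case (Suc n)
  have "1 / sqrt (real (Suc n)) \<le> 2 * (sqrt (real (Suc n)) - sqrt (real n))"
  proof -
    define p q where "p = sqrt (real (Suc n))" and "q = sqrt (real n)"
    have p: "p > 0" "q \<ge> 0" "q \<le> p" "p\<^sup>2 = q\<^sup>2 + 1" by (auto simp: p_def q_def)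
    have "1 = (p - q) * (p + q)" using p by (simp add: power2_eq_square algebra_simps)
    also have "\<dots> \<le> (p - q) * (2 * p)" using p by (intro mult_left_mono) auto
    finally show ?thesis using p unfolding p_def[symmetric] q_def[symmetric] by (simp only: pos_divide_le_eq ac_simps)
  qed
  then show ?case using Suc by simp
qed simp

text \<open>
  Let \<open>K\<close> be the integral of the positive part of \<open>D\<close>. If there is no such point, then almost every
  \<open>x\<close> with \<open>D x > \<rho> x\<close> lies in the set \<open>U k\<close> where some difference quotient exceeds
  \<open>4 * sqrt (k * \<delta> * L)\<close>, for every \<open>k\<close> with \<open>k * \<delta> \<le> D x\<close>. Hence \<open>D\<close> is almost everywhere at most \<open>\<rho> + \<delta>\<close>
  plus \<open>\<delta>\<close> times the number of sets \<open>U k\<close> that contain the point. The maximal inequality bounds the measure of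
  \<open>U k\<close> by a multiple of \<open>1 / sqrt k\<close>, and \<open>\<delta>\<close> times the sum of these bounds is at most \<open>K / 2\<close>; so \<open>K\<close> is at most
  \<open>K / 2\<close> plus the integral of \<open>\<rho>\<close> in the limit \<open>\<delta> \<rightarrow> 0\<close>, against the hypothesis.
\<close>
lemma mean_value_maximal_balanced:
  assumes h: "lip_deriv L h D" and ab: "a < b" and eq: "h a = h b" and L: "L > 0"
    and rho: "\<rho> integrable_on {a..b}" "\<And>x. x \<in> {a..b} \<Longrightarrow> \<rho> x \<ge> 0"
    and small: "4 * integral {a..b} \<rho> < integral {a..b} (\<lambda>x. max 0 (D x))"
  shows "\<exists>x\<in>{a<..<b}. (h has_real_derivative D x) (at x) \<and> D x > \<rho> x \<and>
           (\<forall>y\<in>{a..b}. \<bar>h y - h x\<bar> \<le> 4 * sqrt (D x * L) * \<bar>y - x\<bar>)"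
proof (rule ccontr)
  assume neg: "\<not> ?thesis"
  define K where "K = integral {a..b} (\<lambda>x. max 0 (D x))"
  have Dab: "D absolutely_integrable_on {a..b}" by (rule lip_deriv_absolutely_integrable[OF h])
  have iK: "(\<lambda>x. max 0 (D x)) integrable_on {a..b}"
    by (rule set_lebesgue_integral_eq_integral(1)[OF absolutely_integrable_max_1[OF absolutely_integrable_on_const Dab]]) auto
  have lip: "\<bar>h x - h y\<bar> \<le> L * \<bar>x - y\<bar>" for x y using h by (simp add: lip_deriv_def)
  have DL: "D x \<le> L" for x using h unfolding lip_deriv_def by (metis abs_le_D1)
  have main: "K \<le> integral {a..b} \<rho> + L * (b - a) / 16 / real n + K / 2" if n: "n > 0" for n :: nat
  proof -
    define \<delta> where "\<delta> = L / (16 * real n)"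
    have \<delta>: "\<delta> > 0" using L n by (simp add: \<delta>_def)
    define \<kappa> where "\<kappa> = (\<lambda>k. L * sqrt (real k / real n))"
    define U where "U = (\<lambda>k. {x \<in> {a<..<b}. \<exists>y\<in>{a..b}. \<bar>h y - h x\<bar> > \<kappa> k * \<bar>y - x\<bar>})"
    have \<kappa>: "0 < \<kappa> k" if "k \<in> {1..n}" for k
      using that L n by (simp add: \<kappa>_def)
    have kap4: "\<kappa> k = 4 * sqrt (real k * \<delta> * L)" for k
    proof -
      have "real k * \<delta> * L = (L / 4)\<^sup>2 * (real k / real n)" by (simp add: \<delta>_def power2_eq_square)
      then have "sqrt (real k * \<delta> * L) = L / 4 * sqrt (real k / real n)" using L by (simp only: real_sqrt_mult) simp
      then show ?thesis by (simp add: \<kappa>_def)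
    qed
    have Um: "U k \<in> lmeasurable" "measure lebesgue (U k) \<le> 4 * K / \<kappa> k" if "k \<in> {1..n}" for k
      using two_sided_maximal_bound[OF h ab eq, of "\<kappa> k"] \<kappa>[OF that] unfolding U_def K_def by auto
    define Z where "Z = {x. \<not> (h has_real_derivative D x) (at x)} \<union> {a, b}"
    have Z: "negligible Z" using h unfolding Z_def lip_deriv_def by (auto intro: negligible_Un)
    define R where "R = (\<lambda>x. \<rho> x + \<delta> + (\<Sum>k=1..n. \<delta> * indicator (U k) x))"
    have pw: "max 0 (D x) \<le> R x" if x: "x \<in> {a..b} - Z" for x
    proof (cases "D x \<le> \<rho> x")
      case True
      then show ?thesis using rho(2)[of x] x \<delta> unfolding R_def
        by (auto intro!: add_increasing2 sum_nonneg)
    next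
      case False
      have xab: "x \<in> {a<..<b}" and der: "(h has_real_derivative D x) (at x)" using x by (auto simp: Z_def less_le)
      have Dpos: "D x > 0" using False rho(2)[of x] x by auto
      have "\<not> (\<forall>y\<in>{a..b}. \<bar>h y - h x\<bar> \<le> 4 * sqrt (D x * L) * \<bar>y - x\<bar>)"
        using neg xab der False by (simp only: not_le) blast
      then obtain y where y: "y \<in> {a..b}" "\<bar>h y - h x\<bar> > 4 * sqrt (D x * L) * \<bar>y - x\<bar>"
        by (auto simp: not_le)
      have yx: "\<bar>y - x\<bar> > 0" using y(2) by auto
      have "4 * sqrt (D x * L) * \<bar>y - x\<bar> < L * \<bar>y - x\<bar>" using y(2) lip[of y x] by linarith
      then have "4 * sqrt (D x * L) < L" using yx by (simp add: mult_less_cancel_right)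
      then have "(4 * sqrt (D x * L))\<^sup>2 < L\<^sup>2" using Dpos L by (intro power_strict_mono) auto
      then have "16 * (D x * L) < L * L" using Dpos L by (simp add: power_mult_distrib power2_eq_square)
      \<comment> \<open>The difference quotient at \<open>y\<close> is at most \<open>L\<close>, so \<open>D x < L / 16\<close> and \<open>n\<close> levels of height \<open>\<delta>\<close> suffice.\<close>
      then have D16: "D x < \<delta> * real n" using L n by (simp add: \<delta>_def)
      \<comment> \<open>The number of levels \<open>k * \<delta>\<close> below \<open>D x\<close>.\<close>
      define k0 where "k0 = nat (\<lceil>D x / \<delta>\<rceil> - 1)"
      have "D x / \<delta> > 0" using Dpos \<delta> by simp
      then have k0: "real k0 < D x / \<delta>" "D x / \<delta> \<le> real k0 + 1" unfolding k0_def by linarith+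
      have "real k0 < real n"
      proof -
        have "real k0 * \<delta> < D x" using k0(1) \<delta> by (simp only: pos_less_divide_eq)
        also have "\<dots> < real n * \<delta>" using D16 by (simp only: mult.commute)
        finally have "real k0 * \<delta> < real n * \<delta>" .
        then show ?thesis using \<delta> by (simp only: mult_less_cancel_right_pos)
      qed
      then have k0n: "k0 \<le> n" by simp
      have inU: "x \<in> U k" if "k \<in> {1..k0}" for k
      proof -
        have "real k * \<delta> \<le> real k0 * \<delta>" using that \<delta> by (intro mult_right_mono) auto
        also have "\<dots> \<le> D x" using k0(1) \<delta> by (simp add: pos_less_divide_eq)
        finally have "\<kappa> k \<le> 4 * sqrt (D x * L)" unfolding kap4 using L by (intro mult_left_mono real_sqrt_le_mono mult_right_mono) auto
        then have "\<kappa> k * \<bar>y - x\<bar> \<le> 4 * sqrt (D x * L) * \<bar>y - x\<bar>" by (intro mult_right_mono) auto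
        then have "\<bar>h y - h x\<bar> > \<kappa> k * \<bar>y - x\<bar>" using y(2) by linarith
        then show ?thesis unfolding U_def using xab y(1) by blast
      qed
      have "D x \<le> \<delta> + real k0 * \<delta>" using k0(2) \<delta> by (simp add: pos_divide_le_eq algebra_simps)
      also have "real k0 * \<delta> = (\<Sum>k=1..k0. \<delta> * indicator (U k) x)" using inU by simp
      also have "\<dots> \<le> (\<Sum>k=1..n. \<delta> * indicator (U k) x)"
        by (rule sum_mono2) (use k0n \<delta> in auto)
      finally show ?thesis using rho(2)[of x] x Dpos unfolding R_def by simp
    qed
    have ind: "((\<lambda>x. \<delta> * indicator (U k) x) has_integral \<delta> * measure lebesgue (U k)) {a..b}" if "k \<in> {1..n}" for k
    proof -
      have "((\<lambda>x. indicator (U k) x :: real) has_integral measure lebesgue (U k)) {a..b}"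
      proof (rule has_integral_on_superset)
        show "((\<lambda>x. indicator (U k) x :: real) has_integral measure lebesgue (U k)) (U k)"
          using has_integral_spike_eq[OF negligible_empty, of "U k" "\<lambda>_. 1::real" "indicator (U k)"]
            integrable_integral[OF integrable_on_const[OF Um(1)[OF that], of "1::real"]]
            lmeasure_integral[OF Um(1)[OF that]] by simp
      qed (auto simp: U_def)
      then show ?thesis by (intro has_integral_mult_right)
    qed
    have Rint: "(R has_integral integral {a..b} \<rho> + \<delta> * (b - a) + (\<Sum>k=1..n. \<delta> * measure lebesgue (U k))) {a..b}"
      unfolding R_def
    proof (intro has_integral_add has_integral_sum)
      show "(\<rho> has_integral integral {a..b} \<rho>) {a..b}" using rho(1) by (rule integrable_integral)
      show "((\<lambda>x. \<delta>) has_integral \<delta> * (b - a)) {a..b}"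
        using has_integral_const_real[of \<delta> a b] ab by (simp add: mult.commute)
    qed (use ind in auto)
    have "K \<le> integral {a..b} R"
    proof -
      have "((\<lambda>x. if x \<in> Z then R x else max 0 (D x)) has_integral K) {a..b}"
        using integrable_integral[OF iK] unfolding K_def
        by (rule has_integral_spike[OF Z, rotated]) auto
      from has_integral_le[OF this Rint] have "K \<le> integral {a..b} \<rho> + \<delta> * (b - a) + (\<Sum>k=1..n. \<delta> * measure lebesgue (U k))"
        using pw by simp
      then show ?thesis unfolding integral_unique[OF Rint] .
    qed
    also have "\<dots> = integral {a..b} \<rho> + \<delta> * (b - a) + (\<Sum>k=1..n. \<delta> * measure lebesgue (U k))"
      by (rule integral_unique[OF Rint])
    also have "(\<Sum>k=1..n. \<delta> * measure lebesgue (U k)) \<le> K / 2"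
    proof -
      have K0: "K \<ge> 0" unfolding K_def by (rule integral_nonneg[OF iK]) simp
      have "(\<Sum>k=1..n. \<delta> * measure lebesgue (U k)) \<le> (\<Sum>k=1..n. \<delta> * (4 * K / \<kappa> k))"
        using Um(2) \<delta> by (intro sum_mono mult_left_mono) auto
      also have "\<dots> = (\<Sum>k=1..n. K / 4 * (1 / sqrt (real n) * (1 / sqrt (real k))))"
      proof (rule sum.cong[OF refl])
        fix k assume k: "k \<in> {1..n}"
        have s: "sqrt (real n) * sqrt (real n) = real n" "sqrt (real n) > 0" "sqrt (real k) > 0" using n k by auto
        have "\<delta> * (4 * K / \<kappa> k) = K / 4 * (L / (real n * \<kappa> k))"
          using L n \<kappa>[OF k] unfolding \<delta>_def by (simp add: field_simps)
        also have "L / (real n * \<kappa> k) = 1 / (real n * (sqrt (real k) / sqrt (real n)))"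
          unfolding \<kappa>_def using L by (simp add: real_sqrt_divide)
        also have "\<dots> = 1 / sqrt (real n) * (1 / sqrt (real k))"
        proof -
          define v where "v = sqrt (real n)"
          have "real n = v * v" "v > 0" using n by (auto simp: v_def)
          then show ?thesis using s(3) unfolding v_def[symmetric] by (simp add: field_simps)
        qed
        finally show "\<delta> * (4 * K / \<kappa> k) = K / 4 * (1 / sqrt (real n) * (1 / sqrt (real k)))" .
      qed
      also have "\<dots> = K / 4 * (1 / sqrt (real n) * (\<Sum>k=1..n. 1 / sqrt (real k)))"
        by (simp only: sum_distrib_left[symmetric])
      also have "\<dots> \<le> K / 4 * (1 / sqrt (real n) * (2 * sqrt (real n)))"
        using K0 sum_inverse_sqrt_le[of n] by (intro mult_left_mono) auto
      also have "\<dots> = K / 2" using n by simp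
      finally show ?thesis .
    qed
    finally show ?thesis by (simp add: \<delta>_def)
  qed
  have "(\<lambda>n. integral {a..b} \<rho> + L * (b - a) / 16 / real n + K / 2) \<longlonglongrightarrow> integral {a..b} \<rho> + 0 + K / 2"
    by (intro tendsto_intros lim_const_over_n)
  moreover have "\<forall>\<^sub>F n in sequentially. K \<le> integral {a..b} \<rho> + L * (b - a) / 16 / real n + K / 2"
    using eventually_gt_at_top[of 0] by eventually_elim (rule main)
  ultimately have "K \<le> integral {a..b} \<rho> + 0 + K / 2"
    by (rule tendsto_lowerbound) simp
  moreover have "0 \<le> integral {a..b} \<rho>" by (rule integral_nonneg[OF rho])
  ultimately show False using small unfolding K_def by linarith
qed

text \<open>
  Subtracting the average slope \<open>m\<close> makes the values at the end points equal and at most doubles the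
  Lipschitz constant. The deviation at \<open>\<zeta>\<close> is a lower bound for the integral of the positive part of
  the derivative, which therefore dominates \<open>\<rho>\<close>.
\<close>
lemma mean_value_maximal:
  fixes \<phi> :: "real \<Rightarrow> real"
  assumes lip: "\<And>x y. \<bar>\<phi> x - \<phi> y\<bar> \<le> \<Lambda> * \<bar>x - y\<bar>" and ab: "a < b" and z: "\<zeta> \<in> {a..b}"
    and rho: "\<rho> integrable_on {a..b}" "\<And>x. x \<in> {a..b} \<Longrightarrow> \<rho> x \<ge> 0"
  defines "m \<equiv> (\<phi> b - \<phi> a) / (b - a)"
  assumes small: "4 * integral {a..b} \<rho> < \<bar>\<phi> \<zeta> - \<phi> a - m * (\<zeta> - a)\<bar>"
  shows "\<exists>x\<in>{a<..<b}. \<exists>q > \<rho> x. (\<phi> has_real_derivative m + q) (at x) \<and>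
           (\<forall>y\<in>{a..b}. \<bar>\<phi> y - \<phi> x - m * (y - x)\<bar> \<le> 4 * sqrt (q * (2 * \<Lambda>)) * \<bar>y - x\<bar>)"
proof -
  obtain D where D: "lip_deriv \<Lambda> \<phi> D" using lip_deriv_exists[OF lip] by blast
  have L0: "\<Lambda> \<ge> 0" using lip_deriv_nonneg[OF D] .
  have m: "\<bar>m\<bar> \<le> \<Lambda>" using lip[of b a] ab by (simp add: m_def abs_divide pos_divide_le_eq)
  define h where "h = (\<lambda>x. \<phi> x - m * x)"
  have h: "lip_deriv (2 * \<Lambda>) h (\<lambda>x. D x - m)"
    unfolding h_def by (rule lip_deriv_mono[OF lip_deriv_tilt[OF D, of m]]) (use m in simp)
  have hab: "h a = h b" using ab by (simp add: h_def m_def field_simps)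
  define K where "K = integral {a..b} (\<lambda>x. max 0 (D x - m))"
  have Dab: "(\<lambda>x. D x - m) absolutely_integrable_on {a..b}" by (rule lip_deriv_absolutely_integrable[OF h])
  have iK: "(\<lambda>x. max 0 (D x - m)) integrable_on {a..b}"
    by (rule set_lebesgue_integral_eq_integral(1)[OF absolutely_integrable_max_1[OF absolutely_integrable_on_const Dab]]) auto
  have inc: "h v - h u \<le> K" if "a \<le> u" "u \<le> v" "v \<le> b" for u v
  proof -
    have sub: "{u..v} \<subseteq> {a..b}" using that by auto
    have "h v - h u \<le> integral {u..v} (\<lambda>x. max 0 (D x - m))"
      by (rule has_integral_le[OF lip_deriv_has_integral[OF h that(2)] integrable_integral])
         (use integrable_on_subinterval[OF iK sub] in auto)
    also have "\<dots> \<le> K" unfolding K_def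
      by (rule integral_subset_le[OF sub integrable_on_subinterval[OF iK sub] iK]) simp
    finally show ?thesis .
  qed
  have "\<bar>h \<zeta> - h a\<bar> \<le> K" using inc[of a \<zeta>] inc[of \<zeta> b] z hab by auto
  moreover have "h \<zeta> - h a = \<phi> \<zeta> - \<phi> a - m * (\<zeta> - a)" by (simp add: h_def algebra_simps)
  ultimately have sm: "4 * integral {a..b} \<rho> < integral {a..b} (\<lambda>x. max 0 (D x - m))"
    using small unfolding K_def by simp
  have "\<Lambda> \<noteq> 0"
  proof
    assume "\<Lambda> = 0"
    then have "\<phi> \<zeta> = \<phi> a" "m = 0" using lip[of \<zeta> a] m by auto
    then show False using small integral_nonneg[OF rho] by simp
  qed
  then have "2 * \<Lambda> > 0" using L0 by simp
  from mean_value_maximal_balanced[OF h ab hab this rho sm]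
  obtain x where x: "x \<in> {a<..<b}" "(h has_real_derivative D x - m) (at x)" "D x - m > \<rho> x"
    "\<And>y. y \<in> {a..b} \<Longrightarrow> \<bar>h y - h x\<bar> \<le> 4 * sqrt ((D x - m) * (2 * \<Lambda>)) * \<bar>y - x\<bar>" by blast
  have "((\<lambda>x. h x + m * x) has_real_derivative (D x - m) + m) (at x)"
    by (auto intro!: derivative_eq_intros x(2))
  then have "(\<phi> has_real_derivative m + (D x - m)) (at x)" by (simp add: h_def)
  moreover have "\<bar>\<phi> y - \<phi> x - m * (y - x)\<bar> \<le> 4 * sqrt ((D x - m) * (2 * \<Lambda>)) * \<bar>y - x\<bar>" if "y \<in> {a..b}" for y
  proof -
    have "h y - h x = \<phi> y - \<phi> x - m * (y - x)" by (simp add: h_def algebra_simps)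
    then show ?thesis using x(4)[OF that] by simp
  qed
  ultimately show ?thesis using x(1,3) by blast
qed

section \<open>Left-invariant fields in exponential coordinates\<close>

lemma smooth_map_has_derivative:
  assumes "smooth_map f"
  shows "(f has_derivative frechet_derivative f (at x)) (at x)"
proof -
  have "Ck_map (Suc 0) f" using assms by (simp only: smooth_map_def)
  then obtain f' where "(f has_derivative f') (at x)" unfolding Ck_map.simps by meson
  from differentiableI[OF this] show ?thesis by (simp only: frechet_derivative_works)
qed

lemma smooth_map_frechet_derivative:
  assumes "smooth_map f"
  shows "smooth_map (\<lambda>x. frechet_derivative f (at x) v)"
  unfolding smooth_map_def
proof
  fix k
  have "Ck_map (Suc k) f" using assms by (simp only: smooth_map_def)
  then obtain f' where f': "\<And>x. (f has_derivative f' x) (at x)" "\<And>v. Ck_map k (\<lambda>x. f' x v)"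
    unfolding Ck_map.simps by meson
  have "frechet_derivative f (at x) = f' x" for x by (rule frechet_derivative_at[OF f'(1), symmetric])
  then show "Ck_map k (\<lambda>x. frechet_derivative f (at x) v)" using f'(2) by simp
qed

lemma smooth_map_differentiable: "smooth_map f \<Longrightarrow> f differentiable (at x within S)"
  by (rule differentiable_at_withinI[OF differentiableI[OF smooth_map_has_derivative]])

lemma smooth_map_continuous_on: "smooth_map f \<Longrightarrow> continuous_on S f"
  by (rule has_derivative_continuous_on[OF has_derivative_at_withinI[OF smooth_map_has_derivative]])

text \<open>
  Only the derivatives of \<open>T t e\<close> for fixed \<open>e\<close> are given; expanding the moving vector in a basis
  reduces the product rule to these.
\<close>
lemma linear_family_has_vector_derivative:
  fixes T :: "real \<Rightarrow> 'a::euclidean_space \<Rightarrow> 'b::real_normed_vector"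
  assumes lin: "\<And>t. linear (T t)"
    and T': "\<And>e. ((\<lambda>t. T t e) has_vector_derivative T' e) (at t)"
    and z: "(z has_vector_derivative z') (at t)"
  shows "((\<lambda>t. T t (z t)) has_vector_derivative T' (z t) + T t z') (at t)"
proof -
  have expand: "T r v = (\<Sum>b\<in>Basis. (v \<bullet> b) *\<^sub>R T r b)" for r v
    by (subst euclidean_representation[symmetric, of v])
       (simp only: linear_sum[OF lin] linear_cmul[OF lin])
  have "((\<lambda>r. \<Sum>b\<in>Basis. (z t \<bullet> b) *\<^sub>R T r b) has_vector_derivative (\<Sum>b\<in>Basis. (z t \<bullet> b) *\<^sub>R T' b)) (at t)"
    by (intro has_vector_derivative_sum bounded_linear.has_vector_derivative[OF bounded_linear_scaleR_right] T')
  then have "((\<lambda>r. T r (z t)) has_vector_derivative (\<Sum>b\<in>Basis. (z t \<bullet> b) *\<^sub>R T' b)) (at t)"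
    by (simp only: expand[of _ "z t"])
  from vector_derivative_unique_at[OF T'[of "z t"] this]
  have T'e: "T' (z t) = (\<Sum>b\<in>Basis. (z t \<bullet> b) *\<^sub>R T' b)" .
  have zb: "((\<lambda>r. z r \<bullet> b) has_real_derivative z' \<bullet> b) (at t)" for b
    using bounded_linear.has_vector_derivative[OF bounded_linear_inner_left z]
    by (simp add: has_real_derivative_iff_has_vector_derivative)
  have "((\<lambda>r. \<Sum>b\<in>Basis. (z r \<bullet> b) *\<^sub>R T r b) has_vector_derivative
      (\<Sum>b\<in>Basis. (z t \<bullet> b) *\<^sub>R T' b + (z' \<bullet> b) *\<^sub>R T t b)) (at t)"
    by (intro has_vector_derivative_sum has_vector_derivative_scaleR zb T')
  then have "((\<lambda>r. T r (z r)) has_vector_derivative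
      (\<Sum>b\<in>Basis. (z t \<bullet> b) *\<^sub>R T' b + (z' \<bullet> b) *\<^sub>R T t b)) (at t)"
    by (simp only: expand[of _ "z _"])
  then show ?thesis by (simp only: sum.distrib T'e expand[of t z'])
qed

lemma scaleR_continuous_has_vector_derivative:
  fixes g :: "real \<Rightarrow> 'b::real_normed_vector"
  assumes "isCont g 0"
  shows "((\<lambda>t. t *\<^sub>R g t) has_vector_derivative g 0) (at 0)"
  unfolding has_vector_derivative_def has_derivative_at_alt
proof (intro conjI allI impI)
  show "bounded_linear (\<lambda>h. h *\<^sub>R g 0)" by (rule bounded_linear_scaleR_left)
  fix e :: real assume "e > 0"
  then obtain d where d: "d > 0" "\<And>t. \<bar>t\<bar> < d \<Longrightarrow> norm (g t - g 0) < e"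
    using assms unfolding continuous_at_eps_delta dist_norm by (auto simp: real_norm_def)
  have "norm (t *\<^sub>R g t - 0 *\<^sub>R g 0 - (t - 0) *\<^sub>R g 0) \<le> e * norm (t - 0)" if "norm (t - 0) < d" for t
  proof -
    have "t *\<^sub>R g t - 0 *\<^sub>R g 0 - (t - 0) *\<^sub>R g 0 = t *\<^sub>R (g t - g 0)" by (simp add: scaleR_diff_right)
    then have "norm (t *\<^sub>R g t - 0 *\<^sub>R g 0 - (t - 0) *\<^sub>R g 0) = \<bar>t\<bar> * norm (g t - g 0)" by simp
    also have "\<dots> \<le> \<bar>t\<bar> * e" using d(2)[of t] that by (intro mult_left_mono) auto
    finally show ?thesis by (simp add: mult.commute)
  qed
  then show "\<exists>d>0. \<forall>y. norm (y - 0) < d \<longrightarrow> norm (y *\<^sub>R g y - 0 *\<^sub>R g 0 - (y - 0) *\<^sub>R g 0) \<le> e * norm (y - 0)"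
    using d(1) by blast
qed

lemma scaled_has_vector_derivative: "((\<lambda>t. t *\<^sub>R v) has_vector_derivative v) (at t within S)"
  by (auto intro!: derivative_eq_intros)

lemma shifted_has_vector_derivative: "((\<lambda>t. (t - c) *\<^sub>R v) has_vector_derivative v) (at t within S)"
proof -
  have "((\<lambda>t. t *\<^sub>R v - c *\<^sub>R v) has_vector_derivative v - 0) (at t within S)"
    by (intro has_vector_derivative_diff scaled_has_vector_derivative has_vector_derivative_const)
  then show ?thesis by (simp add: scaleR_diff_left)
qed

lemma neg_shifted_has_vector_derivative: "((\<lambda>t. (c - t) *\<^sub>R v) has_vector_derivative - v) (at t within S)"
proof -
  have "((\<lambda>t. - ((t - c) *\<^sub>R v)) has_vector_derivative - v) (at t within S)"
    by (intro has_vector_derivative_minus shifted_has_vector_derivative)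
  moreover have "- ((t - c) *\<^sub>R v) = (c - t) *\<^sub>R v" for t by (metis minus_diff_eq scaleR_minus_left)
  ultimately show ?thesis by simp
qed

lemma shift_has_vector_derivative:
  fixes f :: "real \<Rightarrow> 'b::real_normed_vector"
  assumes "(f has_vector_derivative f') (at 0)"
  shows "((\<lambda>r. f (r - t)) has_vector_derivative f') (at t)"
  unfolding has_vector_derivative_def
proof (rule has_derivative_compose[where g = f and g' = "\<lambda>r. r *\<^sub>R f'" and f' = "\<lambda>r. r"])
  show "((\<lambda>r. r - t) has_derivative (\<lambda>r. r)) (at t)"
  proof -
    have "((\<lambda>r. r - t) has_derivative (\<lambda>r. r - 0)) (at t)"
      by (intro has_derivative_diff has_derivative_ident has_derivative_const)
    then show ?thesis by simp
  qed
  show "(f has_derivative (\<lambda>r. r *\<^sub>R f')) (at (t - t))"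
    using assms by (simp add: has_vector_derivative_def)
qed

lemma span_induct_closed [consumes 1, case_names base zero add scale]:
  assumes x: "x \<in> span S" and b: "\<And>x. x \<in> S \<Longrightarrow> P x" and z: "P 0"
    and a: "\<And>x y. P x \<Longrightarrow> P y \<Longrightarrow> P (x + y)" and c: "\<And>c x. P x \<Longrightarrow> P (c *\<^sub>R x)"
  shows "P x"
proof -
  have "subspace {x. P x}" using z a c by (auto simp: subspace_def)
  from span_induct[OF x this b] show ?thesis .
qed

locale carnot =
  fixes G :: "(real ^ 'n) monoid" and w :: "'n \<Rightarrow> nat" and s :: nat
  assumes carnot: "carnot_group G w s"
begin

abbreviation mult (infixl "\<odot>" 70) where "x \<odot> y \<equiv> x \<otimes>\<^bsub>G\<^esub> y"

lemma group_G: "group G" and carrier_G [simp]: "carrier G = UNIV" and one_G [simp]: "\<one>\<^bsub>G\<^esub> = 0"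
  and smooth_mult: "smooth_map (\<lambda>(x, y). x \<odot> y)"
  and lines: "(a *\<^sub>R v) \<odot> (b *\<^sub>R v) = (a + b) *\<^sub>R v"
  and step_pos: "1 \<le> s" and weights: "1 \<le> w j" "w j \<le> s"
  and layer_Suc: "i \<in> {2..s} \<Longrightarrow> layer w i = span {lie_bracket G v u | v u. v \<in> layer w 1 \<and> u \<in> layer w (i - 1)}"
  and layer_top: "v \<in> layer w 1 \<Longrightarrow> u \<in> layer w s \<Longrightarrow> lie_bracket G v u = 0"
  using carnot unfolding carnot_group_def by blast+

lemma mult_assoc: "(x \<odot> y) \<odot> z = x \<odot> (y \<odot> z)"
  using group.is_monoid[OF group_G] monoid.m_assoc[of G x y z] by simp

lemma mult_0 [simp]: "x \<odot> 0 = x" "0 \<odot> x = x"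
  using group.is_monoid[OF group_G] monoid.r_one[of G x] monoid.l_one[of G x] by auto

lemma mult_uminus [simp]: "x \<odot> (- x) = 0" "(- x) \<odot> x = 0"
  using lines[of 1 x "-1"] lines[of "-1" x 1] by auto

lemma mult_uminus_cancel [simp]: "x \<odot> (- x \<odot> y) = y" "- x \<odot> (x \<odot> y) = y"
  by (simp_all add: mult_assoc[symmetric])

lemma inv_G: "inv\<^bsub>G\<^esub> x = - x"
  using group.inv_equality[OF group_G, of "- x" x] by simp

lemma uminus_mult: "- (x \<odot> y) = - y \<odot> - x"
  using group.inv_mult_group[OF group_G, of x y] by (simp add: inv_G)

definition dmult :: "real ^ 'n \<Rightarrow> real ^ 'n \<Rightarrow> real ^ 'n \<Rightarrow> real ^ 'n \<Rightarrow> real ^ 'n" where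
  "dmult x y h k = frechet_derivative (\<lambda>(x, y). x \<odot> y) (at (x, y)) (h, k)"

lemma mult_has_derivative: "((\<lambda>(x, y). x \<odot> y) has_derivative (\<lambda>(h, k). dmult x y h k)) (at (x, y))"
  using smooth_map_has_derivative[OF smooth_mult, of "(x, y)"] by (simp add: dmult_def split_def)

lemma linear_dmult: "linear (\<lambda>(h, k). dmult x y h k)"
  using has_derivative_linear[OF mult_has_derivative] .

lemma dmult_add: "dmult x y (h + h') (k + k') = dmult x y h k + dmult x y h' k'"
  using linear_add[OF linear_dmult, of x y "(h, k)" "(h', k')"] by simp

lemma dmult_scaleR: "dmult x y (c *\<^sub>R h) (c *\<^sub>R k) = c *\<^sub>R dmult x y h k"
  using linear_cmul[OF linear_dmult, of x y c "(h, k)"] by simp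

lemma mult_comp_has_derivative:
  assumes "(f has_derivative f') (at t within S)" "(g has_derivative g') (at t within S)"
  shows "((\<lambda>t. f t \<odot> g t) has_derivative (\<lambda>h. dmult (f t) (g t) (f' h) (g' h))) (at t within S)"
  using has_derivative_compose[OF has_derivative_Pair[OF assms] mult_has_derivative]
  by simp

lemma mult_has_vector_derivative:
  assumes "(f has_vector_derivative f') (at t within S)" "(g has_vector_derivative g') (at t within S)"
  shows "((\<lambda>t. f t \<odot> g t) has_vector_derivative dmult (f t) (g t) f' g') (at t within S)"
  using mult_comp_has_derivative[OF assms[unfolded has_vector_derivative_def]]
  by (simp add: has_vector_derivative_def dmult_scaleR)

lemma continuous_on_mult:
  assumes "continuous_on S f" "continuous_on S g"
  shows "continuous_on S (\<lambda>x. f x \<odot> g x)"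
  using continuous_on_compose2[OF smooth_map_continuous_on[OF smooth_mult, of UNIV] continuous_on_Pair[OF assms]]
  by simp

lemma left_field_dmult: "left_field G v x = dmult x 0 0 v"
proof -
  have "((\<lambda>y. x \<odot> y) has_derivative (\<lambda>h. dmult x 0 0 h)) (at 0)"
    using mult_comp_has_derivative[OF has_derivative_const has_derivative_ident, of x 0 UNIV] by simp
  from frechet_derivative_at[OF this, symmetric] show ?thesis unfolding left_field_def by (rule fun_cong)
qed

lemma dmult_right_0: "dmult x 0 h k = h + left_field G k x"
proof -
  have line: "((\<lambda>t. x + t *\<^sub>R h) has_vector_derivative h) (at 0)"
    using has_vector_derivative_add[OF has_vector_derivative_const scaled_has_vector_derivative] by simp
  have "((\<lambda>t. (x + t *\<^sub>R h) \<odot> 0) has_vector_derivative dmult (x + 0 *\<^sub>R h) 0 h 0) (at 0)"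
    by (intro mult_has_vector_derivative has_vector_derivative_const line)
  then have "((\<lambda>t. x + t *\<^sub>R h) has_vector_derivative dmult x 0 h 0) (at 0)" by simp
  then have "dmult x 0 h 0 = h" by (rule vector_derivative_unique_at) (rule line)
  then show ?thesis using dmult_add[of x 0 h 0 0 k] by (simp add: left_field_dmult)
qed

lemma left_field_0 [simp]: "left_field G v 0 = v"
proof -
  have "((\<lambda>t. 0 \<odot> (t *\<^sub>R v)) has_vector_derivative dmult 0 (0 *\<^sub>R v) 0 v) (at 0)"
    by (intro mult_has_vector_derivative has_vector_derivative_const scaled_has_vector_derivative)
  then have "((\<lambda>t. t *\<^sub>R v) has_vector_derivative dmult 0 0 0 v) (at 0)" by simp
  then have "dmult 0 0 0 v = v"
    by (rule vector_derivative_unique_at) (rule scaled_has_vector_derivative)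
  then show ?thesis by (simp add: left_field_dmult)
qed

lemma dmult_0_0: "dmult 0 0 h k = h + k"
  by (simp add: dmult_right_0)

lemma linear_left_field: "linear (\<lambda>v. left_field G v x)"
proof (rule linearI)
  show "left_field G (u + v) x = left_field G u x + left_field G v x" for u v
    using dmult_add[of x 0 0 0 u v] by (simp add: left_field_dmult)
  show "left_field G (c *\<^sub>R v) x = c *\<^sub>R left_field G v x" for c v
    using dmult_scaleR[of x 0 c 0 v] by (simp add: left_field_dmult)
qed

lemma translate_has_vector_derivative:
  assumes "(g has_vector_derivative g') (at t within S)" "g t = 0"
  shows "((\<lambda>r. x \<odot> g r) has_vector_derivative left_field G g' x) (at t within S)"
  using mult_has_vector_derivative[OF has_vector_derivative_const assms(1), of x] assms(2)
  by (simp add: left_field_dmult)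

lemma horizontal_line_has_vector_derivative:
  "((\<lambda>t. x \<odot> (t *\<^sub>R v)) has_vector_derivative left_field G v (x \<odot> (t *\<^sub>R v))) (at t within S)"
proof -
  have "((\<lambda>r. (x \<odot> (t *\<^sub>R v)) \<odot> ((r - t) *\<^sub>R v)) has_vector_derivative left_field G v (x \<odot> (t *\<^sub>R v))) (at t within S)"
    by (rule translate_has_vector_derivative[OF shifted_has_vector_derivative]) simp
  then show ?thesis by (simp add: mult_assoc lines)
qed

text \<open>
  The curve \<open>\<sigma> t \<odot> ((- t) *\<^sub>R u)\<close> is constant, since its derivative at \<open>t\<close> is that of
  \<open>r \<mapsto> (\<sigma> t \<odot> (r *\<^sub>R u)) \<odot> ((- t - r) *\<^sub>R u)\<close> at 0, a constant curve by the group law. So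
  the integral curves of a left-invariant field are the translated one-parameter subgroups, and no
  uniqueness theorem for differential equations is involved.
\<close>
lemma integral_curve_unique:
  assumes "\<And>t. (\<sigma> has_vector_derivative left_field G u (\<sigma> t)) (at t)"
  shows "\<sigma> t = \<sigma> 0 \<odot> (t *\<^sub>R u)"
proof -
  have "((\<lambda>t. \<sigma> t \<odot> ((- t) *\<^sub>R u)) has_vector_derivative 0) (at t within UNIV)" for t
  proof -
    have a: "((\<lambda>r. (\<sigma> t \<odot> (r *\<^sub>R u)) \<odot> ((- t - r) *\<^sub>R u)) has_vector_derivative
        dmult (\<sigma> t \<odot> (0 *\<^sub>R u)) ((- t - 0) *\<^sub>R u) (left_field G u (\<sigma> t)) (- u)) (at 0)"
      by (intro mult_has_vector_derivative translate_has_vector_derivative scaled_has_vector_derivative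
          neg_shifted_has_vector_derivative) simp
    have "(\<sigma> t \<odot> (r *\<^sub>R u)) \<odot> ((- t - r) *\<^sub>R u) = \<sigma> t \<odot> ((- t) *\<^sub>R u)" for r
      by (simp only: mult_assoc lines) simp
    then have "((\<lambda>r. \<sigma> t \<odot> ((- t) *\<^sub>R u)) has_vector_derivative
        dmult (\<sigma> t) ((- t) *\<^sub>R u) (left_field G u (\<sigma> t)) (- u)) (at 0)" using a by simp
    then have "dmult (\<sigma> t) ((- t) *\<^sub>R u) (left_field G u (\<sigma> t)) (- u) = 0"
      by (rule vector_derivative_unique_at) (rule has_vector_derivative_const)
    moreover have "((\<lambda>t. \<sigma> t \<odot> ((0 - t) *\<^sub>R u)) has_vector_derivative
        dmult (\<sigma> t) ((0 - t) *\<^sub>R u) (left_field G u (\<sigma> t)) (- u)) (at t)"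
      by (intro mult_has_vector_derivative assms neg_shifted_has_vector_derivative)
    ultimately show ?thesis by simp
  qed
  then obtain c where c: "\<And>t. \<sigma> t \<odot> ((- t) *\<^sub>R u) = c"
    using has_vector_derivative_zero_constant[OF convex_UNIV, of "\<lambda>t. \<sigma> t \<odot> ((- t) *\<^sub>R u)"] by auto
  have "\<sigma> t \<odot> ((- t) *\<^sub>R u) = \<sigma> 0" using c[of t] c[of 0] by simp
  then have "\<sigma> 0 \<odot> (t *\<^sub>R u) = \<sigma> t \<odot> (((- t) *\<^sub>R u) \<odot> (t *\<^sub>R u))" by (simp only: mult_assoc[symmetric])
  then show ?thesis by (simp only: lines) simp
qed

section \<open>The adjoint action and the Lie bracket\<close>

text \<open>
  Conjugation by \<open>x\<close>. In exponential coordinates it is the adjoint action of \<open>x\<close> on the Lie algebra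
  itself, as the next lemmas show.
\<close>
definition Ad :: "real ^ 'n \<Rightarrow> real ^ 'n \<Rightarrow> real ^ 'n" where
  "Ad x y = x \<odot> y \<odot> - x"

lemma Ad_0 [simp]: "Ad 0 y = y" "Ad x 0 = 0"
  by (auto simp: Ad_def)

lemma Ad_mult: "Ad x (y \<odot> z) = Ad x y \<odot> Ad x z"
  by (simp add: Ad_def mult_assoc)

lemma Ad_Ad: "Ad (x \<odot> y) z = Ad x (Ad y z)"
  by (simp add: Ad_def mult_assoc uminus_mult)

text \<open>
  Conjugation is an automorphism, so it maps one-parameter subgroups to one-parameter subgroups, which
  here are the lines through 0. Hence it agrees with its differential at 0.
\<close>
lemma linear_Ad: "linear (Ad x)"
proof -
  have der: "\<exists>A. (Ad x has_derivative A) (at 0)"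
    unfolding Ad_def
    by (rule exI, rule mult_comp_has_derivative[OF mult_comp_has_derivative[OF has_derivative_const has_derivative_ident] has_derivative_const])
  then obtain A where A: "(Ad x has_derivative A) (at 0)" by blast
  have "Ad x y = A y" for y
  proof -
    have shift: "((\<lambda>r. Ad x ((r - t) *\<^sub>R y)) has_vector_derivative A y) (at t)" for t
    proof -
      have "((\<lambda>r. Ad x ((r - t) *\<^sub>R y)) has_derivative (\<lambda>r. A (r *\<^sub>R y))) (at t)"
      proof (rule has_derivative_compose[where g = "Ad x" and g' = A and f' = "\<lambda>r. r *\<^sub>R y"])
        show "((\<lambda>r. (r - t) *\<^sub>R y) has_derivative (\<lambda>r. r *\<^sub>R y)) (at t)"
          using shifted_has_vector_derivative by (simp add: has_vector_derivative_def)
        show "(Ad x has_derivative A) (at ((t - t) *\<^sub>R y))" using A by simp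
      qed
      then show ?thesis
        using linear_cmul[OF has_derivative_linear[OF A]] by (simp add: has_vector_derivative_def)
    qed
    have "((\<lambda>t. Ad x (t *\<^sub>R y)) has_vector_derivative left_field G (A y) (Ad x (t *\<^sub>R y))) (at t)" for t
    proof -
      have "((\<lambda>r. Ad x (t *\<^sub>R y) \<odot> Ad x ((r - t) *\<^sub>R y)) has_vector_derivative left_field G (A y) (Ad x (t *\<^sub>R y))) (at t)"
        by (rule translate_has_vector_derivative[OF shift]) simp
      then show ?thesis by (simp add: Ad_mult[symmetric] lines)
    qed
    from integral_curve_unique[OF this, of 1] show ?thesis by simp
  qed
  then have "Ad x = A" by blast
  then show ?thesis using A has_derivative_linear by blast
qed

text \<open>
  The derivative at 0, in the direction \<open>v\<close>, of the left-invariant field of \<open>u\<close>: the mixed second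
  derivative of the multiplication at the identity. It vanishes for \<open>v = u\<close>, because the field of \<open>v\<close>
  is constant along the line through \<open>v\<close>; hence it is antisymmetric and equals half the Lie bracket.
\<close>
definition field_deriv :: "real ^ 'n \<Rightarrow> real ^ 'n \<Rightarrow> real ^ 'n" where
  "field_deriv v u = frechet_derivative (left_field G u) (at 0) v"

lemma left_field_differentiable: "left_field G u differentiable (at x)"
proof -
  have "left_field G u = (\<lambda>x. frechet_derivative (\<lambda>(x, y). x \<odot> y) (at (x, 0)) (0, u))"
    by (rule ext) (simp add: left_field_dmult dmult_def)
  moreover have "(\<lambda>x. frechet_derivative (\<lambda>(x, y). x \<odot> y) (at (x, 0)) (0, u)) differentiable (at x)"
    by (rule differentiable_compose[of "\<lambda>p. frechet_derivative (\<lambda>(x, y). x \<odot> y) (at p) (0, u)"])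
       (intro smooth_map_differentiable smooth_map_frechet_derivative smooth_mult,
        intro differentiable_Pair differentiable_ident differentiable_const)
  ultimately show ?thesis by simp
qed

lemma left_field_has_derivative_0: "(left_field G u has_derivative (\<lambda>v. field_deriv v u)) (at 0)"
  using left_field_differentiable[of u 0] unfolding field_deriv_def by (simp only: frechet_derivative_works)

lemma left_field_line_has_vector_derivative:
  "((\<lambda>t. left_field G u (t *\<^sub>R v)) has_vector_derivative field_deriv v u) (at 0)"
  unfolding has_vector_derivative_def
proof -
  have "((\<lambda>t. left_field G u (t *\<^sub>R v)) has_derivative (\<lambda>t. field_deriv (t *\<^sub>R v) u)) (at 0)"
  proof (rule has_derivative_compose[where g = "left_field G u" and g' = "\<lambda>v. field_deriv v u" and f' = "\<lambda>t. t *\<^sub>R v"])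
    show "((\<lambda>t. t *\<^sub>R v) has_derivative (\<lambda>t. t *\<^sub>R v)) (at 0)"
      using scaled_has_vector_derivative by (simp add: has_vector_derivative_def)
    show "(left_field G u has_derivative (\<lambda>v. field_deriv v u)) (at (0 *\<^sub>R v))"
      using left_field_has_derivative_0 by simp
  qed
  then show "((\<lambda>t. left_field G u (t *\<^sub>R v)) has_derivative (\<lambda>t. t *\<^sub>R field_deriv v u)) (at 0)"
    by (simp only: linear_cmul[OF has_derivative_linear[OF left_field_has_derivative_0]])
qed

lemma linear_field_deriv_left: "linear (\<lambda>v. field_deriv v u)"
  by (rule has_derivative_linear[OF left_field_has_derivative_0])

lemma linear_field_deriv_right: "linear (\<lambda>u. field_deriv v u)"
proof (rule linearI)
  fix a b
  have "((\<lambda>t. left_field G a (t *\<^sub>R v) + left_field G b (t *\<^sub>R v)) has_vector_derivative field_deriv v a + field_deriv v b) (at 0)"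
    by (intro has_vector_derivative_add left_field_line_has_vector_derivative)
  then have "((\<lambda>t. left_field G (a + b) (t *\<^sub>R v)) has_vector_derivative field_deriv v a + field_deriv v b) (at 0)"
    by (simp only: linear_add[OF linear_left_field])
  from vector_derivative_unique_at[OF left_field_line_has_vector_derivative this]
  show "field_deriv v (a + b) = field_deriv v a + field_deriv v b" .
next
  fix c a
  have "((\<lambda>t. c *\<^sub>R left_field G a (t *\<^sub>R v)) has_vector_derivative c *\<^sub>R field_deriv v a) (at 0)"
    by (intro bounded_linear.has_vector_derivative[OF bounded_linear_scaleR_right] left_field_line_has_vector_derivative)
  then have "((\<lambda>t. left_field G (c *\<^sub>R a) (t *\<^sub>R v)) has_vector_derivative c *\<^sub>R field_deriv v a) (at 0)"
    by (simp only: linear_cmul[OF linear_left_field])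
  from vector_derivative_unique_at[OF left_field_line_has_vector_derivative this]
  show "field_deriv v (c *\<^sub>R a) = c *\<^sub>R field_deriv v a" .
qed

lemma field_deriv_self [simp]: "field_deriv v v = 0"
proof -
  have "left_field G v (t *\<^sub>R v) = v" for t
  proof -
    have "((\<lambda>t. t *\<^sub>R v) has_vector_derivative left_field G v (t *\<^sub>R v)) (at t)"
      using horizontal_line_has_vector_derivative[of 0 v t UNIV] by simp
    from vector_derivative_unique_at[OF this scaled_has_vector_derivative] show ?thesis .
  qed
  then have "((\<lambda>t. v) has_vector_derivative field_deriv v v) (at (0::real))"
    using left_field_line_has_vector_derivative[of v v] by simp
  from vector_derivative_unique_at[OF this has_vector_derivative_const] show ?thesis .
qed

lemma field_deriv_antisym: "field_deriv u v = - field_deriv v u"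
proof -
  have "0 = field_deriv (u + v) (u + v)" by simp
  also have "\<dots> = field_deriv u v + field_deriv v u"
    by (simp add: linear_add[OF linear_field_deriv_left] linear_add[OF linear_field_deriv_right] del: field_deriv_self) simp
  finally show ?thesis by (simp add: eq_neg_iff_add_eq_0)
qed

lemma lie_bracket_field_deriv: "lie_bracket G v u = 2 *\<^sub>R field_deriv v u"
proof -
  have "lie_bracket G v u = field_deriv v u - field_deriv u v"
    by (simp add: lie_bracket_def field_bracket_def field_deriv_def)
  also have "\<dots> = 2 *\<^sub>R field_deriv v u" by (simp add: field_deriv_antisym[of u v] scaleR_2)
  finally show ?thesis .
qed

lemma bilinear_lie_bracket: "bilinear (lie_bracket G)"
  unfolding bilinear_def lie_bracket_field_deriv
  by (intro conjI allI linear_compose_scale_right linear_field_deriv_left linear_field_deriv_right)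

text \<open>
  Inversion is \<open>x \<mapsto> - x\<close>, so writing \<open>x \<odot> (e *\<^sub>R h)\<close> as the inverse of a product whose first factor
  is \<open>- x\<close> relates the left-invariant fields at \<open>x\<close> and \<open>- x\<close>. Differentiating this identity along a
  line through 0 gives the derivative of \<open>Ad\<close>.
\<close>
lemma left_field_Ad: "left_field G h x = left_field G (Ad x h) (- x)"
proof -
  have "x \<odot> (e *\<^sub>R h) = - (- x \<odot> (e *\<^sub>R (- Ad x h)))" for e
  proof -
    have "x \<odot> (e *\<^sub>R h) = Ad x (e *\<^sub>R h) \<odot> x" by (simp add: Ad_def mult_assoc)
    also have "\<dots> = - (- x \<odot> - Ad x (e *\<^sub>R h))" by (simp add: uminus_mult)
    finally show ?thesis by (simp add: linear_cmul[OF linear_Ad])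
  qed
  then have "((\<lambda>e. x \<odot> (e *\<^sub>R h)) has_vector_derivative - left_field G (- Ad x h) (- x)) (at 0)"
    by (simp only:) (intro has_vector_derivative_minus translate_has_vector_derivative scaled_has_vector_derivative, simp)
  moreover have "((\<lambda>e. x \<odot> (e *\<^sub>R h)) has_vector_derivative left_field G h x) (at 0)"
    by (intro translate_has_vector_derivative scaled_has_vector_derivative) simp
  ultimately have "left_field G h x = - left_field G (- Ad x h) (- x)" by (rule vector_derivative_unique_at[rotated])
  then show ?thesis by (simp add: linear_neg[OF linear_left_field])
qed

lemma Ad_line_has_vector_derivative_0:
  "((\<lambda>t. Ad (t *\<^sub>R x) h) has_vector_derivative lie_bracket G x h) (at 0)"
proof -
  have "((\<lambda>t. t *\<^sub>R x \<odot> h \<odot> (- t) *\<^sub>R x) has_vector_derivative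
      dmult (0 *\<^sub>R x \<odot> h) ((- 0) *\<^sub>R x) (dmult (0 *\<^sub>R x) h x 0) (- x)) (at 0)"
    using neg_shifted_has_vector_derivative[of 0 x 0 UNIV]
    by (intro mult_has_vector_derivative scaled_has_vector_derivative has_vector_derivative_const) simp
  then obtain c where c: "((\<lambda>t. Ad (t *\<^sub>R x) h) has_vector_derivative c) (at 0)"
    by (auto simp: Ad_def)
  have m: "((\<lambda>t. left_field G e (- (t *\<^sub>R x))) has_vector_derivative field_deriv (- x) e) (at 0)" for e
    using left_field_line_has_vector_derivative[of e "- x"] by simp
  have "((\<lambda>t. left_field G (Ad (t *\<^sub>R x) h) (- (t *\<^sub>R x))) has_vector_derivative
      field_deriv (- x) (Ad (0 *\<^sub>R x) h) + left_field G c (- (0 *\<^sub>R x))) (at 0)"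
    by (rule linear_family_has_vector_derivative[of "\<lambda>t v. left_field G v (- (t *\<^sub>R x))", OF linear_left_field m c])
  then have "((\<lambda>t. left_field G h (t *\<^sub>R x)) has_vector_derivative field_deriv (- x) h + c) (at 0)"
    by (simp only: left_field_Ad[symmetric]) simp
  from vector_derivative_unique_at[OF this left_field_line_has_vector_derivative]
  have "field_deriv x h = field_deriv (- x) h + c" by simp
  then have "c = lie_bracket G x h"
    by (simp add: lie_bracket_field_deriv linear_neg[OF linear_field_deriv_left] scaleR_2 algebra_simps)
  with c show ?thesis by simp
qed

lemma Ad_line_has_vector_derivative:
  "((\<lambda>t. Ad (t *\<^sub>R x) h) has_vector_derivative lie_bracket G x (Ad (t *\<^sub>R x) h)) (at t)"
proof -
  have "((\<lambda>r. Ad ((r - t) *\<^sub>R x) (Ad (t *\<^sub>R x) h)) has_vector_derivative lie_bracket G x (Ad (t *\<^sub>R x) h)) (at t)"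
    by (rule shift_has_vector_derivative[OF Ad_line_has_vector_derivative_0])
  moreover have "Ad ((r - t) *\<^sub>R x) (Ad (t *\<^sub>R x) h) = Ad (r *\<^sub>R x) h" for r
    by (simp only: Ad_Ad[symmetric] lines) simp
  ultimately show ?thesis by simp
qed

lemma hom_Ad:
  assumes T: "linear T" and hom: "\<And>a b. T (a \<odot> b) = T a \<odot> T b"
  shows "T (Ad x y) = Ad (T x) (T y)"
  by (simp add: Ad_def hom linear_neg[OF T])

lemma hom_lie_bracket:
  assumes T: "linear T" and hom: "\<And>a b. T (a \<odot> b) = T a \<odot> T b"
  shows "T (lie_bracket G v u) = lie_bracket G (T v) (T u)"
proof -
  have "((\<lambda>t. T (Ad (t *\<^sub>R v) u)) has_vector_derivative T (lie_bracket G v u)) (at 0)"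
    by (rule bounded_linear.has_vector_derivative[OF linear_conv_bounded_linear[THEN iffD1, OF T] Ad_line_has_vector_derivative_0])
  then have "((\<lambda>t. Ad (t *\<^sub>R T v) (T u)) has_vector_derivative T (lie_bracket G v u)) (at 0)"
    by (simp only: hom_Ad[OF T hom] linear_cmul[OF T])
  from vector_derivative_unique_at[OF this Ad_line_has_vector_derivative_0] show ?thesis .
qed

text \<open>
  This is the derivative at \<open>t = 0\<close> of the identity that \<open>Ad (t *\<^sub>R x)\<close> preserves brackets.
\<close>
lemma jacobi: "lie_bracket G x (lie_bracket G v u) = lie_bracket G (lie_bracket G x v) u + lie_bracket G v (lie_bracket G x u)"
proof -
  have bb: "bounded_bilinear (lie_bracket G)" using bilinear_lie_bracket by (simp add: bilinear_conv_bounded_bilinear)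
  have "((\<lambda>t. lie_bracket G (Ad (t *\<^sub>R x) v) (Ad (t *\<^sub>R x) u)) has_vector_derivative
      lie_bracket G (Ad (0 *\<^sub>R x) v) (lie_bracket G x u) + lie_bracket G (lie_bracket G x v) (Ad (0 *\<^sub>R x) u)) (at 0)"
    by (rule bounded_bilinear.has_vector_derivative[OF bb Ad_line_has_vector_derivative_0 Ad_line_has_vector_derivative_0])
  moreover have "lie_bracket G (Ad (t *\<^sub>R x) v) (Ad (t *\<^sub>R x) u) = Ad (t *\<^sub>R x) (lie_bracket G v u)" for t
    by (rule hom_lie_bracket[OF linear_Ad Ad_mult, symmetric])
  ultimately have "((\<lambda>t. Ad (t *\<^sub>R x) (lie_bracket G v u)) has_vector_derivative
      lie_bracket G v (lie_bracket G x u) + lie_bracket G (lie_bracket G x v) u) (at 0)" by simp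
  from vector_derivative_unique_at[OF Ad_line_has_vector_derivative_0 this] show ?thesis by simp
qed

section \<open>Dilations and the horizontal projection\<close>

lemma layer_eq_singleton: "w j = i \<Longrightarrow> axis j 1 \<in> layer w i"
  unfolding layer_def by (intro span_base) blast

lemma subspace_layer: "subspace (layer w i)"
  by (simp add: layer_def subspace_span)

lemma layer_above: "i > s \<Longrightarrow> layer w i = {0}"
proof -
  assume i: "i > s"
  have "w j \<noteq> i" for j using weights(2)[of j] i by linarith
  then show ?thesis by (simp add: layer_def)
qed

lemma lie_bracket_linear_left: "linear (\<lambda>x. lie_bracket G x y)"
  and lie_bracket_linear_right: "linear (lie_bracket G x)"
  using bilinear_lie_bracket by (simp_all add: bilinear_def)

lemma lie_bracket_layer_1:
  assumes v: "v \<in> layer w 1" and u: "u \<in> layer w j" and j: "1 \<le> j"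
  shows "lie_bracket G v u \<in> layer w (Suc j)"
proof -
  consider "j < s" | "j = s" | "j > s" by linarith
  then show ?thesis
  proof cases
    case 1
    then have "layer w (Suc j) = span {lie_bracket G v u | v u. v \<in> layer w 1 \<and> u \<in> layer w j}"
      using layer_Suc[of "Suc j"] j by simp
    then show ?thesis using v u by (auto intro!: span_base)
  next
    case 2
    then show ?thesis using layer_top[OF v] u subspace_0[OF subspace_layer] by simp
  next
    case 3
    then show ?thesis using u layer_above[of j] linear_0[OF lie_bracket_linear_right] subspace_0[OF subspace_layer]
      by simp
  qed
qed

text \<open>
  By induction on \<open>i\<close>: layer \<open>Suc i\<close> is spanned by brackets of layer 1 with layer \<open>i\<close>, and the Jacobi
  identity moves both factors of such a bracket to the second argument, one after the other.
\<close>
lemma lie_bracket_layer: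
  assumes "v \<in> layer w i" "u \<in> layer w j" "1 \<le> i" "1 \<le> j"
  shows "lie_bracket G v u \<in> layer w (i + j)"
  using assms(3) assms(1,2,4)
proof (induction i arbitrary: v u j rule: dec_induct)
  case base
  then show ?case using lie_bracket_layer_1 by simp
next
  case (step i)
  show ?case
  proof (cases "Suc i \<le> s")
    case False
    then have "v = 0" using step.prems layer_above[of "Suc i"] by simp
    then show ?thesis using linear_0[OF lie_bracket_linear_left] subspace_0[OF subspace_layer] by simp
  next
    case True
    have "v \<in> span {lie_bracket G a b | a b. a \<in> layer w 1 \<and> b \<in> layer w i}"
      using step layer_Suc[of "Suc i"] True by simp
    then show ?thesis
    proof (induction rule: span_induct_closed)
      case (base v)
      then obtain a b where ab: "v = lie_bracket G a b" "a \<in> layer w 1" "b \<in> layer w i" by blast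
      have "lie_bracket G v u = lie_bracket G a (lie_bracket G b u) - lie_bracket G b (lie_bracket G a u)"
        using jacobi[of a b u] ab by simp
      moreover have "lie_bracket G a (lie_bracket G b u) \<in> layer w (Suc (i + j))"
        by (rule lie_bracket_layer_1[OF ab(2) step.IH[OF ab(3)]]) (use step in auto)
      moreover have "lie_bracket G b (lie_bracket G a u) \<in> layer w (i + Suc j)"
        by (rule step.IH[OF ab(3) lie_bracket_layer_1[OF ab(2)]]) (use step in auto)
      ultimately show ?case using subspace_diff[OF subspace_layer] by simp
    qed (simp_all add: linear_0[OF lie_bracket_linear_left] linear_add[OF lie_bracket_linear_left]
        linear_cmul[OF lie_bracket_linear_left] subspace_0[OF subspace_layer] subspace_add[OF subspace_layer]
        subspace_scale[OF subspace_layer])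
  qed
qed

lemma linear_dil: "linear (dil w c)"
  by (rule linearI) (auto simp: dil_def vec_eq_iff algebra_simps)

lemma dil_layer: "v \<in> layer w i \<Longrightarrow> dil w c v = c ^ i *\<^sub>R v"
  unfolding layer_def
proof (induction rule: span_induct_closed)
  case (base v)
  then show ?case by (auto simp: dil_def vec_eq_iff axis_def)
qed (simp_all add: linear_0[OF linear_dil] linear_add[OF linear_dil] linear_cmul[OF linear_dil] scaleR_add_right mult.commute)

lemma dil_lie_bracket: "dil w c (lie_bracket G v u) = lie_bracket G (dil w c v) (dil w c u)"
proof -
  have "(\<lambda>v u. dil w c (lie_bracket G v u)) = (\<lambda>v u. lie_bracket G (dil w c v) (dil w c u))"
  proof (rule bilinear_eq_stdbasis)
    show "bilinear (\<lambda>v u. dil w c (lie_bracket G v u))"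
      unfolding bilinear_def
      using linear_compose[OF lie_bracket_linear_left linear_dil] linear_compose[OF lie_bracket_linear_right linear_dil]
      by (simp add: o_def)
    show "bilinear (\<lambda>v u. lie_bracket G (dil w c v) (dil w c u))"
      unfolding bilinear_def
      using linear_compose[OF linear_dil lie_bracket_linear_left] linear_compose[OF linear_dil lie_bracket_linear_right]
      by (simp add: o_def)
    fix a b :: "real ^ 'n" assume "a \<in> Basis" "b \<in> Basis"
    then obtain i j where ij: "a = axis i 1" "b = axis j 1" by (auto simp: Basis_vec_def)
    have m: "a \<in> layer w (w i)" "b \<in> layer w (w j)" using ij layer_eq_singleton by auto
    have "lie_bracket G a b \<in> layer w (w i + w j)"
      by (rule lie_bracket_layer[OF m]) (use weights in auto)
    then show "dil w c (lie_bracket G a b) = lie_bracket G (dil w c a) (dil w c b)"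
      by (simp add: dil_layer[OF m(1)] dil_layer[OF m(2)] dil_layer linear_cmul[OF lie_bracket_linear_left]
          linear_cmul[OF lie_bracket_linear_right] power_add)
  qed
  then show ?thesis by metis
qed

text \<open>
  The curve \<open>z t = T (Ad (t *\<^sub>R x) h)\<close> solves the equation \<open>z' = [T x, z]\<close>, and applying
  \<open>Ad (- t *\<^sub>R T x)\<close> to it gives a curve with derivative 0.
\<close>
lemma lie_hom_Ad:
  assumes T: "linear T" and br: "\<And>v u. T (lie_bracket G v u) = lie_bracket G (T v) (T u)"
  shows "T (Ad x h) = Ad (T x) (T h)"
proof -
  define z where "z = (\<lambda>t. T (Ad (t *\<^sub>R x) h))"
  have z: "(z has_vector_derivative lie_bracket G (T x) (z t)) (at t)" for t
    unfolding z_def br[symmetric]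
    by (rule bounded_linear.has_vector_derivative[OF linear_conv_bounded_linear[THEN iffD1, OF T] Ad_line_has_vector_derivative])
  have "((\<lambda>t. Ad (t *\<^sub>R - T x) (z t)) has_vector_derivative 0) (at t within UNIV)" for t
  proof -
    have "((\<lambda>t. Ad (t *\<^sub>R - T x) (z t)) has_vector_derivative
        lie_bracket G (- T x) (Ad (t *\<^sub>R - T x) (z t)) + Ad (t *\<^sub>R - T x) (lie_bracket G (T x) (z t))) (at t)"
      by (rule linear_family_has_vector_derivative[OF linear_Ad Ad_line_has_vector_derivative z])
    moreover have "Ad (t *\<^sub>R - T x) (lie_bracket G (T x) (z t)) = lie_bracket G (Ad (t *\<^sub>R - T x) (T x)) (Ad (t *\<^sub>R - T x) (z t))"
      by (rule hom_lie_bracket[OF linear_Ad Ad_mult])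
    moreover have "Ad (t *\<^sub>R - T x) (T x) = T x"
      unfolding Ad_def using lines[of "- t" "T x" 1] lines[of "1 - t" "T x" t] by simp
    ultimately show ?thesis by (simp add: linear_neg[OF lie_bracket_linear_left])
  qed
  then obtain c where c: "\<And>t. Ad (t *\<^sub>R - T x) (z t) = c"
    using has_vector_derivative_zero_constant[OF convex_UNIV, of "\<lambda>t. Ad (t *\<^sub>R - T x) (z t)"] by auto
  have "Ad (- T x) (T (Ad x h)) = T h" using c[of 1] c[of 0] by (simp add: z_def)
  then have "Ad (T x) (T h) = Ad (T x) (Ad (- T x) (T (Ad x h)))" by simp
  also have "\<dots> = T (Ad x h)" by (simp add: Ad_Ad[symmetric])
  finally show ?thesis ..
qed

text \<open>
  The left-hand side is \<open>J t\<close>, the velocity at \<open>e = 0\<close> of \<open>- (t *\<^sub>R x) \<odot> t *\<^sub>R (x + e *\<^sub>R h)\<close>. Both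
  factors are multiplicative in \<open>t\<close>, which gives the cocycle relation
  \<open>J (r + t) = Ad (- (t *\<^sub>R x)) (J r) + J t\<close>; it remains to differentiate at \<open>r = 0\<close>, where \<open>J\<close> has
  the derivative \<open>h\<close>. This is the formula for the differential of the exponential map.
\<close>
lemma Ad_cocycle_derivative:
  "((\<lambda>t. dmult (- (t *\<^sub>R x)) (t *\<^sub>R x) 0 (t *\<^sub>R h)) has_vector_derivative Ad (- (t *\<^sub>R x)) h) (at t)"
proof -
  define J where "J = (\<lambda>t. dmult (- (t *\<^sub>R x)) (t *\<^sub>R x) 0 (t *\<^sub>R h))"
  have J: "((\<lambda>e. - (t *\<^sub>R x) \<odot> t *\<^sub>R (x + e *\<^sub>R h)) has_vector_derivative J t) (at 0)" for t
  proof -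
    have "((\<lambda>e. t *\<^sub>R (x + e *\<^sub>R h)) has_vector_derivative t *\<^sub>R (0 + h)) (at 0)"
      by (intro bounded_linear.has_vector_derivative[OF bounded_linear_scaleR_right] has_vector_derivative_add
          has_vector_derivative_const scaled_has_vector_derivative)
    from mult_has_vector_derivative[OF has_vector_derivative_const this, of "- (t *\<^sub>R x)"]
    show ?thesis by (simp add: J_def)
  qed
  have cocycle: "J (r + t) = Ad (- (t *\<^sub>R x)) (J r) + J t" for r t
  proof -
    let ?y = "\<lambda>e. x + e *\<^sub>R h"
    have eq: "- ((r + t) *\<^sub>R x) \<odot> (r + t) *\<^sub>R ?y e
        = Ad (- (t *\<^sub>R x)) (- (r *\<^sub>R x) \<odot> r *\<^sub>R ?y e) \<odot> (- (t *\<^sub>R x) \<odot> t *\<^sub>R ?y e)" for e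
    proof -
      have "- ((r + t) *\<^sub>R x) = - (t *\<^sub>R x) \<odot> - (r *\<^sub>R x)"
        using lines[of "- t" x "- r"] by (simp add: algebra_simps)
      then show ?thesis by (simp add: Ad_def mult_assoc lines[symmetric, of r t "?y e"])
    qed
    have "((\<lambda>e. Ad (- (t *\<^sub>R x)) (- (r *\<^sub>R x) \<odot> r *\<^sub>R ?y e) \<odot> (- (t *\<^sub>R x) \<odot> t *\<^sub>R ?y e)) has_vector_derivative
      dmult (Ad (- (t *\<^sub>R x)) (- (r *\<^sub>R x) \<odot> r *\<^sub>R ?y 0)) (- (t *\<^sub>R x) \<odot> t *\<^sub>R ?y 0) (Ad (- (t *\<^sub>R x)) (J r)) (J t)) (at 0)"
      by (intro mult_has_vector_derivative J
          bounded_linear.has_vector_derivative[OF linear_conv_bounded_linear[THEN iffD1, OF linear_Ad]])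
    then have "((\<lambda>e. - ((r + t) *\<^sub>R x) \<odot> (r + t) *\<^sub>R ?y e) has_vector_derivative Ad (- (t *\<^sub>R x)) (J r) + J t) (at 0)"
      unfolding eq by (simp add: dmult_0_0)
    from vector_derivative_unique_at[OF J this] show ?thesis .
  qed
  have J0: "(J has_vector_derivative h) (at 0)"
  proof -
    have J_scaled: "J t = t *\<^sub>R dmult (- (t *\<^sub>R x)) (t *\<^sub>R x) 0 h" for t
      using dmult_scaleR[of "- (t *\<^sub>R x)" "t *\<^sub>R x" t 0 h] by (simp add: J_def)
    have "continuous_on UNIV (\<lambda>t::real. dmult (- (t *\<^sub>R x)) (t *\<^sub>R x) 0 h)"
      unfolding dmult_def
      by (rule continuous_on_compose2[OF smooth_map_continuous_on[OF smooth_map_frechet_derivative[OF smooth_mult], of UNIV]])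
         (auto intro!: continuous_intros)
    then have "isCont (\<lambda>t::real. dmult (- (t *\<^sub>R x)) (t *\<^sub>R x) 0 h) 0"
      using continuous_on_eq_continuous_at[OF open_UNIV] by blast
    from scaleR_continuous_has_vector_derivative[OF this] show ?thesis
      by (simp add: J_scaled[abs_def] dmult_0_0)
  qed
  have "((\<lambda>r. Ad (- (t *\<^sub>R x)) (J r) + J t) has_vector_derivative Ad (- (t *\<^sub>R x)) h + 0) (at 0)"
    by (intro has_vector_derivative_add has_vector_derivative_const J0
        bounded_linear.has_vector_derivative[OF linear_conv_bounded_linear[THEN iffD1, OF linear_Ad]])
  then have "((\<lambda>r. J (r + t)) has_vector_derivative Ad (- (t *\<^sub>R x)) h) (at 0)"
    by (simp add: cocycle)
  from shift_has_vector_derivative[OF this, of t] show ?thesis by (simp add: J_def)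
qed

text \<open>
  This takes the place of the Baker--Campbell--Hausdorff formula. A linear map \<open>T\<close> that preserves brackets
  is compatible with \<open>Ad\<close>, so by \<open>Ad_cocycle_derivative\<close> it maps the differential at \<open>x\<close> of the left
  translation by \<open>- x\<close> to that of the left translation by \<open>- T x\<close> at \<open>T x\<close>. These are the inverses of
  the left-invariant frames, so \<open>T\<close> maps the left-invariant field of \<open>v\<close> to that of \<open>T v\<close>. Hence it maps the integral curve \<open>x \<odot> (t *\<^sub>R y)\<close> to an integral curve, which starts at \<open>T x\<close>.
\<close>
lemma lie_hom_mult:
  assumes T: "linear T" and br: "\<And>v u. T (lie_bracket G v u) = lie_bracket G (T v) (T u)"
  shows "T (x \<odot> y) = T x \<odot> T y"
proof -
  have bT: "bounded_linear T" using T by (simp add: linear_conv_bounded_linear)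
  have eqv: "T (dmult (- x) x 0 h) = dmult (- T x) (T x) 0 (T h)" for x h
  proof -
    define d where "d = (\<lambda>t. T (dmult (- (t *\<^sub>R x)) (t *\<^sub>R x) 0 (t *\<^sub>R h)) - dmult (- (t *\<^sub>R T x)) (t *\<^sub>R T x) 0 (t *\<^sub>R T h))"
    have "(d has_vector_derivative 0) (at t within UNIV)" for t
    proof -
      have "(d has_vector_derivative T (Ad (- (t *\<^sub>R x)) h) - Ad (- (t *\<^sub>R T x)) (T h)) (at t)"
        unfolding d_def
        by (intro has_vector_derivative_diff bounded_linear.has_vector_derivative[OF bT] Ad_cocycle_derivative)
      then show ?thesis by (simp add: lie_hom_Ad[OF T br] linear_neg[OF T] linear_cmul[OF T])
    qed
    then obtain c where c: "\<And>t. d t = c"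
      using has_vector_derivative_zero_constant[OF convex_UNIV, of d] by auto
    have "d 1 = d 0" using c by simp
    then show ?thesis by (simp add: d_def dmult_0_0 linear_0[OF T])
  qed
  have inv1: "dmult (- x) x 0 (left_field G v x) = v" for x v
  proof -
    have "((\<lambda>r. - x \<odot> (x \<odot> (r *\<^sub>R v))) has_vector_derivative dmult (- x) (x \<odot> (0 *\<^sub>R v)) 0 (left_field G v x)) (at 0)"
      by (intro mult_has_vector_derivative has_vector_derivative_const translate_has_vector_derivative
          scaled_has_vector_derivative) simp
    then have "((\<lambda>r. r *\<^sub>R v) has_vector_derivative dmult (- x) x 0 (left_field G v x)) (at 0)" by simp
    from vector_derivative_unique_at[OF this scaled_has_vector_derivative] show ?thesis .
  qed
  have inv2: "left_field G (dmult (- x) x 0 h) x = h" for x h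
  proof -
    have line: "((\<lambda>r. x + r *\<^sub>R h) has_vector_derivative 0 + h) (at 0)"
      by (intro has_vector_derivative_add has_vector_derivative_const scaled_has_vector_derivative)
    have "((\<lambda>r. x \<odot> (- x \<odot> (x + r *\<^sub>R h))) has_vector_derivative left_field G (dmult (- x) (x + 0 *\<^sub>R h) 0 (0 + h)) x) (at 0)"
      by (intro translate_has_vector_derivative mult_has_vector_derivative has_vector_derivative_const line) simp
    then have "((\<lambda>r. x + r *\<^sub>R h) has_vector_derivative left_field G (dmult (- x) x 0 h) x) (at 0)" by simp
    from vector_derivative_unique_at[OF this line] show ?thesis by simp
  qed
  have field: "T (left_field G v x) = left_field G (T v) (T x)" for v x
  proof -
    have "left_field G (T v) (T x) = left_field G (T (dmult (- x) x 0 (left_field G v x))) (T x)" by (simp add: inv1)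
    also have "\<dots> = T (left_field G v x)" by (simp add: eqv inv2)
    finally show ?thesis ..
  qed
  have "((\<lambda>t. T (x \<odot> (t *\<^sub>R y))) has_vector_derivative left_field G (T y) (T (x \<odot> (t *\<^sub>R y)))) (at t)" for t
    unfolding field[symmetric]
    by (rule bounded_linear.has_vector_derivative[OF bT horizontal_line_has_vector_derivative])
  from integral_curve_unique[OF this, of 1] show ?thesis by simp
qed

lemma dil_mult: "dil w c (x \<odot> y) = dil w c x \<odot> dil w c y"
  by (rule lie_hom_mult[OF linear_dil dil_lie_bracket])

lemma left_field_hom:
  assumes T: "linear T" and hom: "\<And>a b. T (a \<odot> b) = T a \<odot> T b"
  shows "T (left_field G v x) = left_field G (T v) (T x)"
proof -
  have "((\<lambda>t. T (x \<odot> (t *\<^sub>R v))) has_vector_derivative T (left_field G v x)) (at 0)"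
    by (intro bounded_linear.has_vector_derivative[OF linear_conv_bounded_linear[THEN iffD1, OF T]]
        translate_has_vector_derivative scaled_has_vector_derivative) simp
  moreover have "((\<lambda>t. T (x \<odot> (t *\<^sub>R v))) has_vector_derivative left_field G (T v) (T x)) (at 0)"
    unfolding hom linear_cmul[OF T]
    by (intro translate_has_vector_derivative scaled_has_vector_derivative) simp
  ultimately show ?thesis by (rule vector_derivative_unique_at)
qed

lemma left_field_mult: "left_field G v (x \<odot> y) = dmult x y 0 (left_field G v y)"
proof -
  have "((\<lambda>t. x \<odot> (y \<odot> (t *\<^sub>R v))) has_vector_derivative dmult x (y \<odot> (0 *\<^sub>R v)) 0 (left_field G v y)) (at 0)"
    by (intro mult_has_vector_derivative has_vector_derivative_const translate_has_vector_derivative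
        scaled_has_vector_derivative) simp
  then have "((\<lambda>t. (x \<odot> y) \<odot> (t *\<^sub>R v)) has_vector_derivative dmult x y 0 (left_field G v y)) (at 0)"
    by (simp add: mult_assoc)
  moreover have "((\<lambda>t. (x \<odot> y) \<odot> (t *\<^sub>R v)) has_vector_derivative left_field G v (x \<odot> y)) (at 0)"
    by (intro translate_has_vector_derivative scaled_has_vector_derivative) simp
  ultimately show ?thesis by (rule vector_derivative_unique_at[rotated])
qed

lemma linear_hproj: "linear (hproj w)"
  by (rule linearI) (auto simp: hproj_def vec_eq_iff)

lemma hproj_layer: "v \<in> layer w 1 \<Longrightarrow> hproj w v = v"
  unfolding layer_def
proof (induction rule: span_induct_closed)
  case (base v)
  then show ?case by (auto simp: hproj_def vec_eq_iff axis_def)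
qed (simp_all add: linear_0[OF linear_hproj] linear_add[OF linear_hproj] linear_cmul[OF linear_hproj])

lemma hproj_in_layer: "hproj w x \<in> layer w 1"
proof -
  have "hproj w x = (\<Sum>j\<in>{j. w j = 1}. (x $ j) *\<^sub>R axis j 1)"
    by (auto simp: hproj_def vec_eq_iff axis_def sum.delta' if_distrib[of "\<lambda>z. _ * z"] cong: if_cong)
  also have "\<dots> \<in> layer w 1"
    by (intro subspace_sum subspace_layer subspace_scale layer_eq_singleton) auto
  finally show ?thesis .
qed

lemma norm_hproj_le: "norm (hproj w x) \<le> norm x"
  by (rule norm_le_componentwise_cart) (simp add: hproj_def)

text \<open>
  At \<open>c = 0\<close> only the coordinates of weight 1 contribute to first order.
\<close>
lemma dil_has_vector_derivative_0: "((\<lambda>c. dil w c x) has_vector_derivative hproj w x) (at 0)"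
proof -
  have c: "((\<lambda>c. c ^ w j * x $ j) has_real_derivative (if w j = 1 then x $ j else 0)) (at 0)" for j
    using weights(1)[of j] by (auto intro!: derivative_eq_intros simp: power_0_left)
  have "((\<lambda>c. \<Sum>j\<in>UNIV. (c ^ w j * x $ j) *\<^sub>R axis j (1::real)) has_vector_derivative
      (\<Sum>j\<in>UNIV. (if w j = 1 then x $ j else 0) *\<^sub>R axis j 1)) (at 0)"
    by (intro has_vector_derivative_sum bounded_linear.has_vector_derivative[OF bounded_linear_scaleR_left])
       (use c in \<open>simp add: has_real_derivative_iff_has_vector_derivative\<close>)
  moreover have "(\<Sum>j\<in>UNIV. z j *\<^sub>R axis j (1::real)) = (\<chi> j. z j)" for z :: "'n \<Rightarrow> real"
    by (auto simp: vec_eq_iff axis_def if_distrib[of "\<lambda>z. _ * z"] cong: if_cong)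
  ultimately show ?thesis by (simp add: dil_def hproj_def)
qed

text \<open>
  Differentiate \<open>dil w c (x \<odot> y) = dil w c x \<odot> dil w c y\<close> at \<open>c = 0\<close>, where the multiplication agrees
  with addition to first order.
\<close>
lemma hproj_mult: "hproj w (x \<odot> y) = hproj w x + hproj w y"
proof -
  have bl: "bounded_linear (hproj w)" using linear_hproj by (simp add: linear_conv_bounded_linear)
  have "((\<lambda>c. dil w c x \<odot> dil w c y) has_vector_derivative dmult (dil w 0 x) (dil w 0 y) (hproj w x) (hproj w y)) (at 0)"
    by (intro mult_has_vector_derivative dil_has_vector_derivative_0)
  moreover have "dil w 0 z = 0" for z
  proof -
    have "w j \<noteq> 0" for j using weights(1)[of j] by simp
    then show ?thesis by (simp add: dil_def vec_eq_iff)
  qed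
  ultimately have "((\<lambda>c. dil w c (x \<odot> y)) has_vector_derivative hproj w x + hproj w y) (at 0)"
    by (simp add: dil_mult dmult_0_0)
  from vector_derivative_unique_at[OF dil_has_vector_derivative_0 this] show ?thesis .
qed

lemma hproj_left_field: "hproj w (left_field G v x) = hproj w v"
proof -
  have bl: "bounded_linear (hproj w)" using linear_hproj by (simp add: linear_conv_bounded_linear)
  have "((\<lambda>t. hproj w (x \<odot> (t *\<^sub>R v))) has_vector_derivative hproj w (left_field G v x)) (at 0)"
    by (intro bounded_linear.has_vector_derivative[OF bl] translate_has_vector_derivative scaled_has_vector_derivative) simp
  moreover have "((\<lambda>t. hproj w x + t *\<^sub>R hproj w v) has_vector_derivative 0 + hproj w v) (at 0)"
    by (intro has_vector_derivative_add has_vector_derivative_const scaled_has_vector_derivative)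
  ultimately show ?thesis
    by (simp add: hproj_mult linear_cmul[OF linear_hproj] vector_derivative_unique_at)
qed

end

section \<open>Horizontal curves\<close>

lemma AE_lebesgue_iff_negligible:
  "(AE t in lebesgue. P t) \<longleftrightarrow> negligible {t. \<not> P t}" for P :: "'a::euclidean_space \<Rightarrow> bool"
proof
  assume "AE t in lebesgue. P t"
  then obtain N where "N \<in> null_sets lebesgue" "{t. \<not> P t} \<subseteq> N"
    unfolding eventually_ae_filter by auto
  then show "negligible {t. \<not> P t}" using negligible_iff_null_sets negligible_subset by metis
next
  assume "negligible {t. \<not> P t}"
  then show "AE t in lebesgue. P t"
    unfolding eventually_ae_filter using negligible_iff_null_sets by auto
qed

lemma negligible_reflect: "negligible S \<Longrightarrow> negligible {t :: real. - t \<in> S}"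
proof -
  assume S: "negligible S"
  have "negligible (uminus ` S)"
    by (rule negligible_differentiable_image_negligible[OF _ S]) (auto intro!: derivative_intros)
  moreover have "{t. - t \<in> S} \<subseteq> uminus ` S" by force
  ultimately show ?thesis using negligible_subset by blast
qed

lemma negligible_shift: "negligible S \<Longrightarrow> negligible {t :: real. t - c \<in> S}"
proof -
  assume "negligible S"
  then have "negligible ((+) c ` S)" by (rule negligible_translation)
  moreover have "{t. t - c \<in> S} \<subseteq> (+) c ` S" by force
  ultimately show ?thesis using negligible_subset by blast
qed

lemma abs_continuous_curve_cong:
  assumes ac: "abs_continuous_curve a b f" and eq: "\<And>t. a \<le> t \<Longrightarrow> t \<le> b \<Longrightarrow> g t = f t"
  shows "abs_continuous_curve a b g"
  unfolding abs_continuous_curve_def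
proof (intro allI impI)
  fix e :: real assume "e > 0"
  then obtain d where d: "d > 0" "\<And>(m::nat) p q. (\<forall>i<m. a \<le> p i \<and> p i \<le> q i \<and> q i \<le> b) \<and>
      disjoint_family_on (\<lambda>i. {p i<..<q i}) {..<m} \<and> (\<Sum>i<m. q i - p i) < d
      \<Longrightarrow> (\<Sum>i<m. norm (f (q i) - f (p i))) < e"
    using ac unfolding abs_continuous_curve_def by meson
  show "\<exists>d>0. \<forall>(m::nat) p q. (\<forall>i<m. a \<le> p i \<and> p i \<le> q i \<and> q i \<le> b) \<and>
      disjoint_family_on (\<lambda>i. {p i<..<q i}) {..<m} \<and> (\<Sum>i<m. q i - p i) < d
      \<longrightarrow> (\<Sum>i<m. norm (g (q i) - g (p i))) < e"
  proof (intro exI[of _ d] conjI allI impI)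
    fix m :: nat and p q
    assume A: "(\<forall>i<m. a \<le> p i \<and> p i \<le> q i \<and> q i \<le> b) \<and>
      disjoint_family_on (\<lambda>i. {p i<..<q i}) {..<m} \<and> (\<Sum>i<m. q i - p i) < d"
    have "(\<Sum>i<m. norm (g (q i) - g (p i))) = (\<Sum>i<m. norm (f (q i) - f (p i)))"
    proof (rule sum.cong[OF refl])
      fix i assume "i \<in> {..<m}"
      then have pq: "a \<le> p i" "p i \<le> q i" "q i \<le> b" using A by auto
      then show "norm (g (q i) - g (p i)) = norm (f (q i) - f (p i))" by (simp add: eq)
    qed
    with d(2)[OF A] show "(\<Sum>i<m. norm (g (q i) - g (p i))) < e" by simp
  qed (rule d)
qed

lemma abs_continuous_curve_continuous:
  assumes "abs_continuous_curve a b \<gamma>"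
  shows "continuous_on {a..b} \<gamma>"
  unfolding continuous_on_iff
proof (intro ballI allI impI)
  fix x and e :: real assume x: "x \<in> {a..b}" and e: "e > 0"
  obtain d where d: "d > 0" "\<And>(m::nat) p q. (\<forall>i<m. a \<le> p i \<and> p i \<le> q i \<and> q i \<le> b) \<and>
      disjoint_family_on (\<lambda>i. {p i<..<q i}) {..<m} \<and> (\<Sum>i<m. q i - p i) < d
      \<Longrightarrow> (\<Sum>i<m. norm (\<gamma> (q i) - \<gamma> (p i))) < e"
    using assms e unfolding abs_continuous_curve_def by meson
  have one: "norm (\<gamma> v - \<gamma> u) < e" if "a \<le> u" "u \<le> v" "v \<le> b" "v - u < d" for u v
    using d(2)[of 1 "\<lambda>_. u" "\<lambda>_. v"] that by (simp add: disjoint_family_on_def)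
  show "\<exists>d>0. \<forall>x'\<in>{a..b}. dist x' x < d \<longrightarrow> dist (\<gamma> x') (\<gamma> x) < e"
  proof (intro exI[of _ d] conjI ballI impI)
    fix x' assume x': "x' \<in> {a..b}" "dist x' x < d"
    show "dist (\<gamma> x') (\<gamma> x) < e"
    proof (cases "x' \<le> x")
      case True
      then show ?thesis using one[of x' x] x x' by (simp add: dist_norm norm_minus_commute)
    next
      case False
      then show ?thesis using one[of x x'] x x' by (simp add: dist_norm)
    qed
  qed (rule d)
qed

lemma abs_continuous_curve_compose:
  assumes ac: "abs_continuous_curve a b \<gamma>"
    and L: "\<And>x y. x \<in> \<gamma> ` {a..b} \<Longrightarrow> y \<in> \<gamma> ` {a..b} \<Longrightarrow> norm (\<Phi> x - \<Phi> y) \<le> L * norm (x - y)"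
  shows "abs_continuous_curve a b (\<lambda>t. \<Phi> (\<gamma> t))"
  unfolding abs_continuous_curve_def
proof (intro allI impI)
  fix e :: real assume e: "e > 0"
  have "e / (\<bar>L\<bar> + 1) > 0" using e by simp
  then obtain d where d: "d > 0" "\<And>(m::nat) p q. (\<forall>i<m. a \<le> p i \<and> p i \<le> q i \<and> q i \<le> b) \<and>
      disjoint_family_on (\<lambda>i. {p i<..<q i}) {..<m} \<and> (\<Sum>i<m. q i - p i) < d
      \<Longrightarrow> (\<Sum>i<m. norm (\<gamma> (q i) - \<gamma> (p i))) < e / (\<bar>L\<bar> + 1)"
    using ac unfolding abs_continuous_curve_def by meson
  show "\<exists>d>0. \<forall>(m::nat) p q. (\<forall>i<m. a \<le> p i \<and> p i \<le> q i \<and> q i \<le> b) \<and>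
      disjoint_family_on (\<lambda>i. {p i<..<q i}) {..<m} \<and> (\<Sum>i<m. q i - p i) < d
      \<longrightarrow> (\<Sum>i<m. norm (\<Phi> (\<gamma> (q i)) - \<Phi> (\<gamma> (p i)))) < e"
  proof (intro exI[of _ d] conjI allI impI)
    fix m :: nat and p q
    assume A: "(\<forall>i<m. a \<le> p i \<and> p i \<le> q i \<and> q i \<le> b) \<and>
      disjoint_family_on (\<lambda>i. {p i<..<q i}) {..<m} \<and> (\<Sum>i<m. q i - p i) < d"
    have "(\<Sum>i<m. norm (\<Phi> (\<gamma> (q i)) - \<Phi> (\<gamma> (p i)))) \<le> (\<Sum>i<m. (\<bar>L\<bar> + 1) * norm (\<gamma> (q i) - \<gamma> (p i)))"
    proof (rule sum_mono)
      fix i assume "i \<in> {..<m}"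
      then have "a \<le> p i" "p i \<le> q i" "q i \<le> b" using A by auto
      then have "norm (\<Phi> (\<gamma> (q i)) - \<Phi> (\<gamma> (p i))) \<le> L * norm (\<gamma> (q i) - \<gamma> (p i))" by (intro L) auto
      also have "\<dots> \<le> (\<bar>L\<bar> + 1) * norm (\<gamma> (q i) - \<gamma> (p i))" by (intro mult_right_mono) auto
      finally show "norm (\<Phi> (\<gamma> (q i)) - \<Phi> (\<gamma> (p i))) \<le> (\<bar>L\<bar> + 1) * norm (\<gamma> (q i) - \<gamma> (p i))" .
    qed
    also have "\<dots> = (\<bar>L\<bar> + 1) * (\<Sum>i<m. norm (\<gamma> (q i) - \<gamma> (p i)))" by (simp add: sum_distrib_left)
    also have "\<dots> < (\<bar>L\<bar> + 1) * (e / (\<bar>L\<bar> + 1))" using d(2)[OF A] by (intro mult_strict_left_mono) auto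
    also have "\<dots> = e" by simp
    finally show "(\<Sum>i<m. norm (\<Phi> (\<gamma> (q i)) - \<Phi> (\<gamma> (p i)))) < e" .
  qed (rule d)
qed

lemma abs_continuous_curve_shift:
  assumes ac: "abs_continuous_curve a b \<gamma>"
  shows "abs_continuous_curve (a + c) (b + c) (\<lambda>t. \<gamma> (t - c))"
  unfolding abs_continuous_curve_def
proof (intro allI impI)
  fix e :: real assume "e > 0"
  then obtain d where d: "d > 0" "\<And>(m::nat) p q. (\<forall>i<m. a \<le> p i \<and> p i \<le> q i \<and> q i \<le> b) \<and>
      disjoint_family_on (\<lambda>i. {p i<..<q i}) {..<m} \<and> (\<Sum>i<m. q i - p i) < d
      \<Longrightarrow> (\<Sum>i<m. norm (\<gamma> (q i) - \<gamma> (p i))) < e"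
    using ac unfolding abs_continuous_curve_def by meson
  show "\<exists>d>0. \<forall>(m::nat) p q. (\<forall>i<m. a + c \<le> p i \<and> p i \<le> q i \<and> q i \<le> b + c) \<and>
      disjoint_family_on (\<lambda>i. {p i<..<q i}) {..<m} \<and> (\<Sum>i<m. q i - p i) < d
      \<longrightarrow> (\<Sum>i<m. norm (\<gamma> (q i - c) - \<gamma> (p i - c))) < e"
  proof (intro exI[of _ d] conjI allI impI)
    fix m :: nat and p q
    assume A: "(\<forall>i<m. a + c \<le> p i \<and> p i \<le> q i \<and> q i \<le> b + c) \<and>
      disjoint_family_on (\<lambda>i. {p i<..<q i}) {..<m} \<and> (\<Sum>i<m. q i - p i) < d"
    have "disjoint_family_on (\<lambda>i. {p i - c<..<q i - c}) {..<m}"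
      unfolding disjoint_family_on_def
    proof clarify
      fix i j assume "i < m" "j < m" "i \<noteq> j"
      then have D: "{p i<..<q i} \<inter> {p j<..<q j} = {}" using A by (auto simp: disjoint_family_on_def)
      { fix x assume "x \<in> {p i - c<..<q i - c} \<inter> {p j - c<..<q j - c}"
        then have "x + c \<in> {p i<..<q i} \<inter> {p j<..<q j}" by auto
        with D have False by blast }
      then show "{p i - c<..<q i - c} \<inter> {p j - c<..<q j - c} = {}" by blast
    qed
    with A show "(\<Sum>i<m. norm (\<gamma> (q i - c) - \<gamma> (p i - c))) < e"
      by (intro d(2)) (auto simp: algebra_simps)
  qed (rule d)
qed

lemma abs_continuous_curve_reflect:
  assumes ac: "abs_continuous_curve a b \<gamma>"
  shows "abs_continuous_curve (- b) (- a) (\<lambda>t. \<gamma> (- t))"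
  unfolding abs_continuous_curve_def
proof (intro allI impI)
  fix e :: real assume "e > 0"
  then obtain d where d: "d > 0" "\<And>(m::nat) p q. (\<forall>i<m. a \<le> p i \<and> p i \<le> q i \<and> q i \<le> b) \<and>
      disjoint_family_on (\<lambda>i. {p i<..<q i}) {..<m} \<and> (\<Sum>i<m. q i - p i) < d
      \<Longrightarrow> (\<Sum>i<m. norm (\<gamma> (q i) - \<gamma> (p i))) < e"
    using ac unfolding abs_continuous_curve_def by meson
  show "\<exists>d>0. \<forall>(m::nat) p q. (\<forall>i<m. - b \<le> p i \<and> p i \<le> q i \<and> q i \<le> - a) \<and>
      disjoint_family_on (\<lambda>i. {p i<..<q i}) {..<m} \<and> (\<Sum>i<m. q i - p i) < d
      \<longrightarrow> (\<Sum>i<m. norm (\<gamma> (- q i) - \<gamma> (- p i))) < e"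
  proof (intro exI[of _ d] conjI allI impI)
    fix m :: nat and p q
    assume A: "(\<forall>i<m. - b \<le> p i \<and> p i \<le> q i \<and> q i \<le> - a) \<and>
      disjoint_family_on (\<lambda>i. {p i<..<q i}) {..<m} \<and> (\<Sum>i<m. q i - p i) < d"
    have "disjoint_family_on (\<lambda>i. {- q i<..<- p i}) {..<m}"
      unfolding disjoint_family_on_def
    proof clarify
      fix i j assume "i < m" "j < m" "i \<noteq> j"
      then have D: "{p i<..<q i} \<inter> {p j<..<q j} = {}" using A by (auto simp: disjoint_family_on_def)
      { fix x assume "x \<in> {- q i<..<- p i} \<inter> {- q j<..<- p j}"
        then have "- x \<in> {p i<..<q i} \<inter> {p j<..<q j}" by auto
        with D have False by blast }
      then show "{- q i<..<- p i} \<inter> {- q j<..<- p j} = {}" by blast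
    qed
    with A have "(\<Sum>i<m. norm (\<gamma> (- p i) - \<gamma> (- q i))) < e"
      by (intro d(2)) (auto simp: algebra_simps)
    then show "(\<Sum>i<m. norm (\<gamma> (- q i) - \<gamma> (- p i))) < e" by (simp add: norm_minus_commute)
  qed (rule d)
qed

lemma abs_continuous_curve_join:
  assumes abc: "a \<le> b \<and> b \<le> c"
    and ac1: "abs_continuous_curve a b \<gamma>" and ac2: "abs_continuous_curve b c \<gamma>"
  shows "abs_continuous_curve a c \<gamma>"
  unfolding abs_continuous_curve_def
proof (intro allI impI)
  fix e :: real assume "e > 0"
  then have e2: "e / 2 > 0" by simp
  obtain d1 where d1: "d1 > 0" "\<And>(m::nat) p q. (\<forall>i<m. a \<le> p i \<and> p i \<le> q i \<and> q i \<le> b) \<and>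
      disjoint_family_on (\<lambda>i. {p i<..<q i}) {..<m} \<and> (\<Sum>i<m. q i - p i) < d1
      \<Longrightarrow> (\<Sum>i<m. norm (\<gamma> (q i) - \<gamma> (p i))) < e / 2"
    using ac1 e2 unfolding abs_continuous_curve_def by meson
  obtain d2 where d2: "d2 > 0" "\<And>(m::nat) p q. (\<forall>i<m. b \<le> p i \<and> p i \<le> q i \<and> q i \<le> c) \<and>
      disjoint_family_on (\<lambda>i. {p i<..<q i}) {..<m} \<and> (\<Sum>i<m. q i - p i) < d2
      \<Longrightarrow> (\<Sum>i<m. norm (\<gamma> (q i) - \<gamma> (p i))) < e / 2"
    using ac2 e2 unfolding abs_continuous_curve_def by meson
  show "\<exists>d>0. \<forall>(m::nat) p q. (\<forall>i<m. a \<le> p i \<and> p i \<le> q i \<and> q i \<le> c) \<and>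
      disjoint_family_on (\<lambda>i. {p i<..<q i}) {..<m} \<and> (\<Sum>i<m. q i - p i) < d
      \<longrightarrow> (\<Sum>i<m. norm (\<gamma> (q i) - \<gamma> (p i))) < e"
  proof (intro exI[of _ "min d1 d2"] conjI allI impI)
      fix m :: nat and p q
      assume A: "(\<forall>i<m. a \<le> p i \<and> p i \<le> q i \<and> q i \<le> c) \<and>
        disjoint_family_on (\<lambda>i. {p i<..<q i}) {..<m} \<and> (\<Sum>i<m. q i - p i) < min d1 d2"
      have sub: "disjoint_family_on (\<lambda>i. {p' i<..<q' i}) {..<m}"
        if "\<And>i. {p' i<..<q' i} \<subseteq> {p i<..<q i}" for p' q'
        using A that unfolding disjoint_family_on_def by blast
      have s1: "(\<Sum>i<m. min (q i) b - min (p i) b) \<le> (\<Sum>i<m. q i - p i)"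
        using A by (intro sum_mono) (auto simp: min_def)
      have s2: "(\<Sum>i<m. max (q i) b - max (p i) b) \<le> (\<Sum>i<m. q i - p i)"
        using A by (intro sum_mono) (auto simp: max_def)
      have 1: "(\<Sum>i<m. norm (\<gamma> (min (q i) b) - \<gamma> (min (p i) b))) < e / 2"
        by (rule d1(2)) (use A s1 abc in \<open>auto intro!: sub simp: min_def split: if_splits\<close>)
      have 2: "(\<Sum>i<m. norm (\<gamma> (max (q i) b) - \<gamma> (max (p i) b))) < e / 2"
        by (rule d2(2)) (use A s2 abc in \<open>auto intro!: sub simp: max_def split: if_splits\<close>)
      have "norm (\<gamma> (q i) - \<gamma> (p i)) \<le> norm (\<gamma> (min (q i) b) - \<gamma> (min (p i) b)) + norm (\<gamma> (max (q i) b) - \<gamma> (max (p i) b))"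
        if "i < m" for i
      proof -
        have pq: "p i \<le> q i" using A that by blast
        then consider "q i \<le> b" | "b \<le> p i" | "p i < b" "b < q i" by linarith
        then show ?thesis
        proof cases
          case 3
          have "\<gamma> (q i) - \<gamma> (p i) = (\<gamma> b - \<gamma> (p i)) + (\<gamma> (q i) - \<gamma> b)" by simp
          then show ?thesis using 3 norm_triangle_ineq by (metis max.absorb1 max.absorb2 min.absorb1 min.absorb2 less_imp_le)
        qed (use pq in \<open>auto simp: min_def max_def\<close>)
      qed
      then have "(\<Sum>i<m. norm (\<gamma> (q i) - \<gamma> (p i))) \<le> (\<Sum>i<m. norm (\<gamma> (min (q i) b) - \<gamma> (min (p i) b)))
          + (\<Sum>i<m. norm (\<gamma> (max (q i) b) - \<gamma> (max (p i) b)))"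
        unfolding sum.distrib[symmetric] by (intro sum_mono) auto
      then show "(\<Sum>i<m. norm (\<gamma> (q i) - \<gamma> (p i))) < e" using 1 2 by linarith
  qed (use d1 d2 in auto)
qed

lemma smooth_map_lipschitz_on_cball:
  fixes f :: "'a::euclidean_space \<Rightarrow> 'b::euclidean_space"
  assumes f: "smooth_map f"
  shows "\<exists>L>0. \<forall>x\<in>cball 0 R. \<forall>y\<in>cball 0 R. norm (f x - f y) \<le> L * norm (x - y)"
proof -
  let ?D = "\<lambda>x. frechet_derivative f (at x)"
  have "\<exists>C. \<forall>x\<in>cball 0 R. norm (?D x b) \<le> C" for b
  proof -
    have "compact ((\<lambda>x. ?D x b) ` cball 0 R)"
      by (intro compact_continuous_image smooth_map_continuous_on smooth_map_frechet_derivative f compact_cball)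
    then have "bounded ((\<lambda>x. ?D x b) ` cball 0 R)" by (rule compact_imp_bounded)
    then show ?thesis unfolding bounded_iff by auto
  qed
  then obtain C where C: "\<And>b x. x \<in> cball 0 R \<Longrightarrow> norm (?D x b) \<le> C b" by metis
  define L where "L = (\<Sum>b\<in>Basis. \<bar>C b\<bar>) + 1"
  have L: "L > 0" unfolding L_def by (intro add_nonneg_pos sum_nonneg) auto
  have der: "(f has_derivative ?D x) (at x within cball 0 R)" for x
    by (rule has_derivative_at_withinI[OF smooth_map_has_derivative[OF f]])
  have bnd: "onorm (?D x) \<le> L" if x: "x \<in> cball 0 R" for x
  proof (rule onorm_bound)
    show "0 \<le> L" using L by simp
    fix h
    have lin: "linear (?D x)" by (rule has_derivative_linear[OF smooth_map_has_derivative[OF f]])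
    have "?D x h = ?D x (\<Sum>b\<in>Basis. (h \<bullet> b) *\<^sub>R b)" by (simp only: euclidean_representation)
    also have "\<dots> = (\<Sum>b\<in>Basis. (h \<bullet> b) *\<^sub>R ?D x b)" by (simp only: linear_sum[OF lin] linear_cmul[OF lin])
    also have "norm \<dots> \<le> (\<Sum>b\<in>Basis. \<bar>C b\<bar> * norm h)"
    proof (rule sum_norm_le)
      fix b :: 'a assume b: "b \<in> Basis"
      have "norm ((h \<bullet> b) *\<^sub>R ?D x b) = \<bar>h \<bullet> b\<bar> * norm (?D x b)" by simp
      also have "\<dots> \<le> norm h * \<bar>C b\<bar>"
        using C[OF x, of b] Basis_le_norm[OF b, of h] by (intro mult_mono) auto
      finally show "norm ((h \<bullet> b) *\<^sub>R ?D x b) \<le> \<bar>C b\<bar> * norm h" by (simp add: mult.commute)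
    qed
    also have "\<dots> = (\<Sum>b\<in>Basis. \<bar>C b\<bar>) * norm h" by (simp add: sum_distrib_right)
    also have "\<dots> \<le> L * norm h" unfolding L_def by (intro mult_right_mono) auto
    finally show "norm (?D x h) \<le> L * norm h" .
  qed
  show ?thesis
    using differentiable_bound[OF convex_cball der bnd] L by blast
qed

context carnot
begin

lemma mult_lipschitz:
  "\<exists>L>0. \<forall>x\<in>cball 0 R. \<forall>y\<in>cball 0 R. \<forall>x'\<in>cball 0 R. \<forall>y'\<in>cball 0 R.
     norm (x \<odot> y - x' \<odot> y') \<le> L * (norm (x - x') + norm (y - y'))"
proof -
  obtain L where L: "L > 0" "\<And>p q. p \<in> cball 0 (2 * R) \<Longrightarrow> q \<in> cball 0 (2 * R) \<Longrightarrow>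
      norm ((\<lambda>(x, y). x \<odot> y) p - (\<lambda>(x, y). x \<odot> y) q) \<le> L * norm (p - q)"
    using smooth_map_lipschitz_on_cball[OF smooth_mult, of "2 * R"] by blast
  have mem: "(x, y) \<in> cball 0 (2 * R)" if "x \<in> cball 0 R" "y \<in> cball 0 R" for x y :: "real ^ 'n"
    using that norm_Pair_le[of x y] by simp
  have "norm (x \<odot> y - x' \<odot> y') \<le> L * (norm (x - x') + norm (y - y'))"
    if "x \<in> cball 0 R" "y \<in> cball 0 R" "x' \<in> cball 0 R" "y' \<in> cball 0 R" for x y x' y'
  proof -
    have "norm (x \<odot> y - x' \<odot> y') \<le> L * norm ((x, y) - (x', y'))"
      using L(2)[OF mem mem, OF that(1,2) that(3,4)] by simp
    also have "\<dots> \<le> L * (norm (x - x') + norm (y - y'))"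
      using L(1) norm_Pair_le[of "x - x'" "y - y'"] by (intro mult_left_mono) auto
    finally show ?thesis .
  qed
  then show ?thesis using L(1) by blast
qed

lemma horizontal_withE:
  assumes "horizontal_with G w a b \<gamma> u"
  obtains Z where "abs_continuous_curve a b \<gamma>" "\<And>t. u t \<in> layer w 1" "u absolutely_integrable_on {a..b}"
    "negligible Z" "\<And>t. t \<in> {a<..<b} - Z \<Longrightarrow> (\<gamma> has_vector_derivative left_field G (u t) (\<gamma> t)) (at t)"
proof
  show "negligible {t. \<not> (t \<in> {a<..<b} \<longrightarrow> (\<gamma> has_vector_derivative left_field G (u t) (\<gamma> t)) (at t))}"
    using assms unfolding horizontal_with_def AE_lebesgue_iff_negligible by blast
qed (use assms in \<open>auto simp: horizontal_with_def\<close>)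

lemma horizontal_withI:
  assumes "abs_continuous_curve a b \<gamma>" "\<And>t. u t \<in> layer w 1" "u absolutely_integrable_on {a..b}"
    "negligible Z" "\<And>t. t \<in> {a<..<b} - Z \<Longrightarrow> (\<gamma> has_vector_derivative left_field G (u t) (\<gamma> t)) (at t)"
  shows "horizontal_with G w a b \<gamma> u"
  unfolding horizontal_with_def AE_lebesgue_iff_negligible
  using assms by (auto intro: negligible_subset)

text \<open>
  The lengths over which the infimum in \<open>cc_dist\<close> is taken. Statements about distances are first proved
  for individual curves, in terms of this relation, and then pass to the infimum.
\<close>
definition reach :: "real \<Rightarrow> real ^ 'n \<Rightarrow> real ^ 'n \<Rightarrow> bool" where
  "reach l x y \<longleftrightarrow> (\<exists>a b \<gamma> u. l = integral {a..b} (\<lambda>t. norm (u t)) \<and>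
            a \<le> b \<and> horizontal_with G w a b \<gamma> u \<and> \<gamma> a = x \<and> \<gamma> b = y)"

lemma cc_dist_reach: "cc_dist G w x y = Inf {l. reach l x y}"
  unfolding cc_dist_def reach_def by (rule arg_cong[where f = Inf]) auto

lemma reach_nonneg: "reach l x y \<Longrightarrow> l \<ge> 0"
proof -
  assume "reach l x y"
  then obtain a b \<gamma> u where l: "l = integral {a..b} (\<lambda>t. norm (u t))" and hw: "horizontal_with G w a b \<gamma> u"
    unfolding reach_def by blast
  have u: "u absolutely_integrable_on {a..b}" using hw by (simp add: horizontal_with_def)
  have "(\<lambda>t. norm (u t)) integrable_on {a..b}" using u by (simp add: absolutely_integrable_on_def)
  then show "l \<ge> 0" unfolding l by (rule Henstock_Kurzweil_Integration.integral_nonneg) simp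
qed

text \<open>
  Maps that carry left-invariant horizontal fields to such fields carry horizontal curves to horizontal
  curves. The lemma is applied to translations, with \<open>c = 1\<close>, and to dilations.
\<close>
lemma reach_map:
  assumes r: "reach l x y" and T: "linear T" and Tl: "\<And>v. v \<in> layer w 1 \<Longrightarrow> T v \<in> layer w 1 \<and> norm (T v) = c * norm v"
    and \<Phi>: "\<And>x. (\<Phi> has_derivative \<Phi>' x) (at x)"
    and lip: "\<And>R. \<exists>L. \<forall>x\<in>cball 0 R. \<forall>y\<in>cball 0 R. norm (\<Phi> x - \<Phi> y) \<le> L * norm (x - y)"
    and eqv: "\<And>x v. \<Phi>' x (left_field G v x) = left_field G (T v) (\<Phi> x)"
  shows "reach (c * l) (\<Phi> x) (\<Phi> y)"
proof -
  obtain a b \<gamma> u where g: "l = integral {a..b} (\<lambda>t. norm (u t))" "a \<le> b" "horizontal_with G w a b \<gamma> u" "\<gamma> a = x" "\<gamma> b = y"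
    using r unfolding reach_def by blast
  obtain Z where h: "abs_continuous_curve a b \<gamma>" "\<And>t. u t \<in> layer w 1" "u absolutely_integrable_on {a..b}"
    "negligible Z" "\<And>t. t \<in> {a<..<b} - Z \<Longrightarrow> (\<gamma> has_vector_derivative left_field G (u t) (\<gamma> t)) (at t)"
    using horizontal_withE[OF g(3)] by metis
  have "bounded (\<gamma> ` {a..b})"
    by (intro compact_imp_bounded compact_continuous_image abs_continuous_curve_continuous h compact_Icc)
  then obtain R where "\<forall>z\<in>\<gamma> ` {a..b}. norm z \<le> R" unfolding bounded_iff by blast
  then have R: "\<gamma> ` {a..b} \<subseteq> cball 0 R" by auto
  obtain L where L: "\<And>x y. x \<in> cball 0 R \<Longrightarrow> y \<in> cball 0 R \<Longrightarrow> norm (\<Phi> x - \<Phi> y) \<le> L * norm (x - y)"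
    using lip[of R] by blast
  have "horizontal_with G w a b (\<lambda>t. \<Phi> (\<gamma> t)) (\<lambda>t. T (u t))"
  proof (rule horizontal_withI)
    show "abs_continuous_curve a b (\<lambda>t. \<Phi> (\<gamma> t))"
      by (rule abs_continuous_curve_compose[OF h(1), of _ L]) (use R L in blast)
    show "T (u t) \<in> layer w 1" for t using Tl h(2) by blast
    show "(\<lambda>t. T (u t)) absolutely_integrable_on {a..b}"
      using absolutely_integrable_linear[OF h(3) linear_conv_bounded_linear[THEN iffD1, OF T]] by (simp add: o_def)
    show "negligible Z" by fact
    fix t assume t: "t \<in> {a<..<b} - Z"
    have "((\<lambda>t. \<Phi> (\<gamma> t)) has_vector_derivative \<Phi>' (\<gamma> t) (left_field G (u t) (\<gamma> t))) (at t)"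
      unfolding has_vector_derivative_def
    proof -
      have "((\<lambda>t. \<Phi> (\<gamma> t)) has_derivative (\<lambda>r. \<Phi>' (\<gamma> t) (r *\<^sub>R left_field G (u t) (\<gamma> t)))) (at t)"
        by (rule has_derivative_compose[where g = \<Phi>, OF h(5)[OF t, unfolded has_vector_derivative_def] \<Phi>])
      then show "((\<lambda>t. \<Phi> (\<gamma> t)) has_derivative (\<lambda>r. r *\<^sub>R \<Phi>' (\<gamma> t) (left_field G (u t) (\<gamma> t)))) (at t)"
        by (simp only: linear_cmul[OF has_derivative_linear[OF \<Phi>]])
    qed
    then show "((\<lambda>t. \<Phi> (\<gamma> t)) has_vector_derivative left_field G (T (u t)) (\<Phi> (\<gamma> t))) (at t)"
      by (simp only: eqv)
  qed
  moreover have "c * l = integral {a..b} (\<lambda>t. norm (T (u t)))"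
    using Tl h(2) g(1) by simp
  ultimately show ?thesis unfolding reach_def
    using g by (intro exI[of _ a] exI[of _ b] exI[of _ "\<lambda>t. \<Phi> (\<gamma> t)"] exI[of _ "\<lambda>t. T (u t)"]) auto
qed

lemma reach_reverse:
  assumes "reach l x y" shows "reach l y x"
proof -
  obtain a b \<gamma> u where g: "l = integral {a..b} (\<lambda>t. norm (u t))" "a \<le> b" "horizontal_with G w a b \<gamma> u" "\<gamma> a = x" "\<gamma> b = y"
    using assms unfolding reach_def by blast
  obtain Z where h: "abs_continuous_curve a b \<gamma>" "\<And>t. u t \<in> layer w 1" "u absolutely_integrable_on {a..b}"
    "negligible Z" "\<And>t. t \<in> {a<..<b} - Z \<Longrightarrow> (\<gamma> has_vector_derivative left_field G (u t) (\<gamma> t)) (at t)"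
    using horizontal_withE[OF g(3)] by metis
  have "horizontal_with G w (- b) (- a) (\<lambda>t. \<gamma> (- t)) (\<lambda>t. - u (- t))"
  proof (rule horizontal_withI)
    show "abs_continuous_curve (- b) (- a) (\<lambda>t. \<gamma> (- t))" by (rule abs_continuous_curve_reflect[OF h(1)])
    show "- u (- t) \<in> layer w 1" for t using h(2) by (intro subspace_neg subspace_layer)
    show "(\<lambda>t. - u (- t)) absolutely_integrable_on {- b..- a}"
    proof -
      have "(\<lambda>t. u (- t)) absolutely_integrable_on {- b..- a}" using h(3) by simp
      from absolutely_integrable_linear[OF this bounded_linear_minus[OF bounded_linear_ident]]
      show ?thesis by (simp add: o_def)
    qed
    show "negligible {t. - t \<in> Z}" by (rule negligible_reflect[OF h(4)])
    fix t assume t: "t \<in> {- b<..<- a} - {t. - t \<in> Z}"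
    then have "- t \<in> {a<..<b} - Z" by auto
    then have "(\<gamma> has_derivative (\<lambda>r. r *\<^sub>R left_field G (u (- t)) (\<gamma> (- t)))) (at (- t))"
      using h(5) by (simp add: has_vector_derivative_def)
    moreover have "((\<lambda>t::real. - t) has_derivative (\<lambda>r. - r)) (at t)" by (auto intro!: derivative_eq_intros)
    ultimately have "((\<lambda>t. \<gamma> (- t)) has_derivative (\<lambda>r. (- r) *\<^sub>R left_field G (u (- t)) (\<gamma> (- t)))) (at t)"
      by (rule has_derivative_compose[where g = \<gamma>, rotated])
    then show "((\<lambda>t. \<gamma> (- t)) has_vector_derivative left_field G (- u (- t)) (\<gamma> (- t))) (at t)"
      by (simp add: has_vector_derivative_def linear_neg[OF linear_left_field])
  qed
  moreover have "l = integral {- b..- a} (\<lambda>t. norm (- u (- t)))"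
    using g(1) Henstock_Kurzweil_Integration.integral_reflect_real[of b a "\<lambda>t. norm (u t)"] by simp
  ultimately show ?thesis unfolding reach_def
    using g by (intro exI[of _ "- b"] exI[of _ "- a"] exI[of _ "\<lambda>t. \<gamma> (- t)"] exI[of _ "\<lambda>t. - u (- t)"]) auto
qed

lemma reach_trans:
  assumes "reach l x y" "reach l' y z" shows "reach (l + l') x z"
proof -
  obtain a b \<gamma> u where g: "l = integral {a..b} (\<lambda>t. norm (u t))" "a \<le> b" "horizontal_with G w a b \<gamma> u" "\<gamma> a = x" "\<gamma> b = y"
    using assms(1) unfolding reach_def by blast
  obtain Z where h: "abs_continuous_curve a b \<gamma>" "\<And>t. u t \<in> layer w 1" "u absolutely_integrable_on {a..b}"
    "negligible Z" "\<And>t. t \<in> {a<..<b} - Z \<Longrightarrow> (\<gamma> has_vector_derivative left_field G (u t) (\<gamma> t)) (at t)"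
    using horizontal_withE[OF g(3)] by metis
  obtain a' b' \<gamma>' u' where g': "l' = integral {a'..b'} (\<lambda>t. norm (u' t))" "a' \<le> b'" "horizontal_with G w a' b' \<gamma>' u'" "\<gamma>' a' = y" "\<gamma>' b' = z"
    using assms(2) unfolding reach_def by blast
  obtain Z' where h': "abs_continuous_curve a' b' \<gamma>'" "\<And>t. u' t \<in> layer w 1" "u' absolutely_integrable_on {a'..b'}"
    "negligible Z'" "\<And>t. t \<in> {a'<..<b'} - Z' \<Longrightarrow> (\<gamma>' has_vector_derivative left_field G (u' t) (\<gamma>' t)) (at t)"
    using horizontal_withE[OF g'(3)] by metis
  define c where "c = b - a'"
  define e where "e = b' + c"
  have be: "b \<le> e" "a' + c = b" using g'(2) by (auto simp: e_def c_def)
  define \<eta> where "\<eta> = (\<lambda>t. if t \<le> b then \<gamma> t else \<gamma>' (t - c))"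
  define v where "v = (\<lambda>t. if t \<le> b then u t else u' (t - c))"
  have int': "((\<lambda>t. f (t - c)) has_integral i) {b..e}" if "(f has_integral i) {a'..b'}" for f :: "real \<Rightarrow> 'c::banach" and i
  proof -
    have "((\<lambda>t. f (1 *\<^sub>R t + - c)) has_integral i /\<^sub>R 1 ^ DIM(real)) (cbox ((a' - - c) /\<^sub>R 1) ((b' - - c) /\<^sub>R 1))"
      by (rule has_integral_affinity') (use that in simp_all)
    then have "((\<lambda>t. f (t - c)) has_integral i) {a' + c..b' + c}" by simp
    then show ?thesis by (simp only: be(2) e_def)
  qed
  have ai: "(\<lambda>t. u' (t - c)) absolutely_integrable_on {b..e}"
  proof -
    have i: "u' integrable_on {a'..b'}" "(\<lambda>t. norm (u' t)) integrable_on {a'..b'}"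
      using h'(3)[unfolded absolutely_integrable_on_def] by (rule conjunct1, rule conjunct2)
    show ?thesis unfolding absolutely_integrable_on_def
      using has_integral_integrable[OF int'[OF integrable_integral[OF i(1)]]]
        has_integral_integrable[OF int'[OF integrable_integral[OF i(2)]]] by simp
  qed
  have v2: "v absolutely_integrable_on {b..e}"
    by (rule absolutely_integrable_spike[OF ai negligible_sing[of b]]) (auto simp: v_def)
  have v1: "v absolutely_integrable_on {a..b}"
    by (rule absolutely_integrable_spike[OF h(3) negligible_empty]) (auto simp: v_def)
  have av: "v absolutely_integrable_on {a..e}"
    by (rule absolutely_integrable_on_combine[OF v1 v2 g(2) be(1)])
  have "abs_continuous_curve a b \<eta>"
    by (rule abs_continuous_curve_cong[OF h(1)]) (simp add: \<eta>_def)
  moreover have "abs_continuous_curve b e \<eta>"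
  proof -
    have sh: "abs_continuous_curve b e (\<lambda>t. \<gamma>' (t - c))"
      using abs_continuous_curve_shift[OF h'(1), of c] by (simp only: be(2) e_def)
    have "\<eta> t = \<gamma>' (t - c)" if "b \<le> t" for t
    proof (cases "t = b")
      case True
      then have "t - c = a'" by (simp add: c_def)
      then show ?thesis using True g(5) g'(4) by (simp add: \<eta>_def)
    next
      case False
      then show ?thesis using that by (simp add: \<eta>_def)
    qed
    with sh show ?thesis by (rule abs_continuous_curve_cong)
  qed
  ultimately have ac: "abs_continuous_curve a e \<eta>"
    by (rule abs_continuous_curve_join[OF conjI[OF g(2) be(1)]])
  have "horizontal_with G w a e \<eta> v"
  proof (rule horizontal_withI[OF ac _ av])
    show "v t \<in> layer w 1" for t using h(2) h'(2) by (simp add: v_def)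
    show "negligible (Z \<union> {b} \<union> {t. t - c \<in> Z'})"
      by (intro negligible_Un h(4) negligible_sing negligible_shift h'(4))
    fix t assume t: "t \<in> {a<..<e} - (Z \<union> {b} \<union> {t. t - c \<in> Z'})"
    show "(\<eta> has_vector_derivative left_field G (v t) (\<eta> t)) (at t)"
    proof (cases "t < b")
      case True
      have d: "(\<gamma> has_vector_derivative left_field G (v t) (\<eta> t)) (at t)"
        using h(5)[of t] t True by (simp add: \<eta>_def v_def)
      show ?thesis
        by (rule has_vector_derivative_transform_within_open[OF d, of "{..<b}"]) (use True in \<open>auto simp: \<eta>_def\<close>)
    next
      case False
      then have tb: "t > b" using t by auto
      have "t - c \<in> {a'<..<b'} - Z'" using t tb by (auto simp: e_def c_def)
      then have d0: "(\<gamma>' has_derivative (\<lambda>r. r *\<^sub>R left_field G (u' (t - c)) (\<gamma>' (t - c)))) (at (t - c))"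
        using h'(5) by (simp add: has_vector_derivative_def)
      have "((\<lambda>t. t - c) has_derivative (\<lambda>r. r)) (at t)" by (auto intro!: derivative_eq_intros)
      from has_derivative_compose[where g = \<gamma>', OF this d0]
      have d: "((\<lambda>t. \<gamma>' (t - c)) has_vector_derivative left_field G (v t) (\<eta> t)) (at t)"
        using tb by (simp add: has_vector_derivative_def v_def \<eta>_def)
      show ?thesis
        by (rule has_vector_derivative_transform_within_open[OF d, of "{b<..}"]) (use tb in \<open>auto simp: \<eta>_def\<close>)
    qed
  qed
  moreover have "l + l' = integral {a..e} (\<lambda>t. norm (v t))"
  proof -
    have "integral {a..e} (\<lambda>t. norm (v t)) = integral {a..b} (\<lambda>t. norm (v t)) + integral {b..e} (\<lambda>t. norm (v t))"
      using av by (intro Henstock_Kurzweil_Integration.integral_combine[symmetric] g(2) be(1)) (simp add: absolutely_integrable_on_def)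
    also have "integral {a..b} (\<lambda>t. norm (v t)) = l" unfolding g(1) by (rule integral_cong) (simp add: v_def)
    also have "integral {b..e} (\<lambda>t. norm (v t)) = integral {b..e} (\<lambda>t. norm (u' (t - c)))"
      by (rule integral_spike[OF negligible_sing[of b]]) (auto simp: v_def)
    also have "\<dots> = l'" unfolding g'(1)
      by (rule integral_unique[OF int'[OF integrable_integral]]) (use h'(3) in \<open>simp add: absolutely_integrable_on_def\<close>)
    finally show ?thesis by simp
  qed
  moreover have "\<eta> a = x" "\<eta> e = z"
  proof -
    show "\<eta> a = x" using g(2,4) by (simp add: \<eta>_def)
    show "\<eta> e = z"
    proof (cases "e = b")
      case True
      then have "b' = a'" using be by (simp add: e_def)
      then show ?thesis using True g(5) g'(4,5) by (simp add: \<eta>_def)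
    next
      case False
      then show ?thesis using be(1) g'(5) by (simp add: \<eta>_def e_def)
    qed
  qed
  ultimately show ?thesis unfolding reach_def
    using g(2) be(1) by (intro exI[of _ a] exI[of _ e] exI[of _ \<eta>] exI[of _ v]) auto
qed

lemma reach_line:
  assumes "v \<in> layer w 1" shows "reach (norm v) x (x \<odot> v)"
proof -
  have der: "((\<lambda>t. x \<odot> (t *\<^sub>R v)) has_vector_derivative left_field G v (x \<odot> (t *\<^sub>R v))) (at t)" for t
    by (rule horizontal_line_has_vector_derivative)
  have "horizontal_with G w 0 1 (\<lambda>t. x \<odot> (t *\<^sub>R v)) (\<lambda>t. v)"
  proof (rule horizontal_withI)
    obtain L where L: "L > 0" "\<And>a b c d. a \<in> cball 0 (norm x + norm v) \<Longrightarrow> b \<in> cball 0 (norm x + norm v) \<Longrightarrow>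
      c \<in> cball 0 (norm x + norm v) \<Longrightarrow> d \<in> cball 0 (norm x + norm v) \<Longrightarrow>
      norm (a \<odot> b - c \<odot> d) \<le> L * (norm (a - c) + norm (b - d))"
      using mult_lipschitz[of "norm x + norm v"] by blast
    show "abs_continuous_curve 0 1 (\<lambda>t. x \<odot> (t *\<^sub>R v))"
    proof (rule lipschitz_abs_continuous_curve[of "L * norm v"])
      show "0 \<le> L * norm v" using L by simp
      fix r t :: real assume rt: "r \<in> {0..1}" "t \<in> {0..1}"
      have n: "norm (r *\<^sub>R v) \<le> norm x + norm v" if "r \<in> {0..1}" for r
        using that mult_left_le_one_le[of "norm v" r] by (simp add: add_increasing)
      have "norm (x \<odot> (r *\<^sub>R v) - x \<odot> (t *\<^sub>R v)) \<le> L * (norm (x - x) + norm (r *\<^sub>R v - t *\<^sub>R v))"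
        by (rule L(2)) (use rt n in \<open>auto simp: add_increasing2\<close>)
      also have "\<dots> = L * norm v * \<bar>r - t\<bar>" by (simp add: scaleR_diff_left[symmetric])
      finally show "norm (x \<odot> (r *\<^sub>R v) - x \<odot> (t *\<^sub>R v)) \<le> L * norm v * \<bar>r - t\<bar>" .
    qed
    show "v \<in> layer w 1" for t :: real by fact
    show "(\<lambda>t. v) absolutely_integrable_on {0..1::real}" by (rule absolutely_integrable_on_const) simp
    show "negligible ({} :: real set)" by simp
  qed (rule der)
  moreover have "norm v = integral {0..1::real} (\<lambda>t. norm v)" by simp
  ultimately show ?thesis unfolding reach_def
    by (intro exI[of _ 0] exI[of _ 1] exI[of _ "\<lambda>t. x \<odot> (t *\<^sub>R v)"] exI[of _ "\<lambda>t. v"]) auto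
qed

lemma reach_refl: "reach 0 x x"
  using reach_line[OF subspace_0[OF subspace_layer], of x] by simp

lemma mult_lipschitz_right:
  "\<exists>L. \<forall>x\<in>cball 0 R. \<forall>y\<in>cball 0 R. norm (z \<odot> x - z \<odot> y) \<le> L * norm (x - y)"
proof -
  obtain L where L: "L > 0" "\<And>a b c d. a \<in> cball 0 (norm z + \<bar>R\<bar>) \<Longrightarrow> b \<in> cball 0 (norm z + \<bar>R\<bar>) \<Longrightarrow>
      c \<in> cball 0 (norm z + \<bar>R\<bar>) \<Longrightarrow> d \<in> cball 0 (norm z + \<bar>R\<bar>) \<Longrightarrow>
      norm (a \<odot> b - c \<odot> d) \<le> L * (norm (a - c) + norm (b - d))"
    using mult_lipschitz[of "norm z + \<bar>R\<bar>"] by blast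
  have "norm (z \<odot> x - z \<odot> y) \<le> L * norm (x - y)" if "x \<in> cball 0 R" "y \<in> cball 0 R" for x y
  proof -
    have "norm x \<le> norm z + \<bar>R\<bar>" "norm y \<le> norm z + \<bar>R\<bar>"
      using that norm_ge_zero[of z] abs_ge_self[of R] unfolding mem_cball_0 by linarith+
    then show ?thesis using L(2)[of z x z y] by simp
  qed
  then show ?thesis by blast
qed

lemma reach_translate: "reach l x y \<Longrightarrow> reach l (z \<odot> x) (z \<odot> y)"
  using reach_map[OF _ linear_id, of l x y 1 "\<lambda>y. z \<odot> y" "\<lambda>x h. dmult z x 0 h"]
    mult_comp_has_derivative[OF has_derivative_const has_derivative_ident, of z _ UNIV] mult_lipschitz_right
  by (simp add: left_field_mult)

lemma reach_dil:
  assumes "reach l x y" "c \<ge> 0" shows "reach (c * l) (dil w c x) (dil w c y)"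
proof (rule reach_map[OF assms(1) linear_dil])
  have bl: "bounded_linear (dil w c)" using linear_dil by (simp add: linear_conv_bounded_linear)
  show "dil w c v \<in> layer w 1 \<and> norm (dil w c v) = c * norm v" if "v \<in> layer w 1" for v
    using that assms(2) subspace_scale[OF subspace_layer] by (simp add: dil_layer)
  show "(dil w c has_derivative dil w c) (at x)" for x by (rule bounded_linear_imp_has_derivative[OF bl])
  obtain B where B: "\<And>x. norm (dil w c x) \<le> norm x * B" using bounded_linear.bounded[OF bl] by blast
  show "\<exists>L. \<forall>x\<in>cball 0 R. \<forall>y\<in>cball 0 R. norm (dil w c x - dil w c y) \<le> L * norm (x - y)" for R
    using B by (intro exI[of _ B]) (simp add: linear_diff[OF linear_dil, symmetric] mult.commute)
  show "dil w c (left_field G v x) = left_field G (dil w c v) (dil w c x)" for x v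
    by (rule left_field_hom[OF linear_dil dil_mult])
qed

text \<open>
  The projection maps the left-invariant field of a horizontal vector to a constant field, so the
  control of a horizontal curve is the derivative of its projection.
\<close>
lemma reach_hproj:
  assumes "reach l x y" shows "norm (hproj w y - hproj w x) \<le> l"
proof -
  obtain a b \<gamma> u where g: "l = integral {a..b} (\<lambda>t. norm (u t))" "a \<le> b" "horizontal_with G w a b \<gamma> u" "\<gamma> a = x" "\<gamma> b = y"
    using assms(1) unfolding reach_def by blast
  obtain Z where h: "abs_continuous_curve a b \<gamma>" "\<And>t. u t \<in> layer w 1" "u absolutely_integrable_on {a..b}"
    "negligible Z" "\<And>t. t \<in> {a<..<b} - Z \<Longrightarrow> (\<gamma> has_vector_derivative left_field G (u t) (\<gamma> t)) (at t)"
    using horizontal_withE[OF g(3)] by metis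
  have bl: "bounded_linear (hproj w)" using linear_hproj by (simp add: linear_conv_bounded_linear)
  have "(u has_integral hproj w (\<gamma> b) - hproj w (\<gamma> a)) {a..b}"
  proof (rule abs_continuous_curve_has_integral[OF g(2) _ h(4)])
    show "abs_continuous_curve a b (\<lambda>t. hproj w (\<gamma> t))"
      by (rule abs_continuous_curve_compose[OF h(1), of _ 1])
         (simp add: linear_diff[OF linear_hproj, symmetric] norm_hproj_le)
    fix t assume "t \<in> {a<..<b} - Z"
    from bounded_linear.has_vector_derivative[OF bl h(5)[OF this]]
    show "((\<lambda>t. hproj w (\<gamma> t)) has_vector_derivative u t) (at t)"
      by (simp add: hproj_left_field hproj_layer[OF h(2)])
  qed
  then have "hproj w y - hproj w x = integral {a..b} u" using g by (simp add: integral_unique)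
  also have "norm \<dots> \<le> l" unfolding g(1)
    by (rule integral_norm_bound_integral) (use h(3) in \<open>auto simp: absolutely_integrable_on_def\<close>)
  finally show ?thesis .
qed

end

section \<open>Reachable points\<close>

lemma subspace_contains_vector_derivative:
  fixes f :: "real \<Rightarrow> 'a::euclidean_space"
  assumes W: "subspace W" and f: "\<And>t. f t \<in> W" and d: "(f has_vector_derivative f') (at t)"
  shows "f' \<in> W"
proof -
  have "orthogonal y f'" if y: "y \<in> W\<^sup>\<bottom>" for y
  proof -
    have "((\<lambda>t. y \<bullet> f t) has_vector_derivative y \<bullet> f') (at t)"
      by (rule bounded_linear.has_vector_derivative[OF bounded_linear_inner_right d])
    moreover have "y \<bullet> f r = 0" for r
      using y f[of r] by (simp add: orthogonal_comp_def orthogonal_def inner_commute[of y])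
    ultimately have "((\<lambda>t. 0) has_vector_derivative y \<bullet> f') (at t)" by simp
    from vector_derivative_unique_at[OF this has_vector_derivative_const]
    show ?thesis by (simp add: orthogonal_def)
  qed
  then have "f' \<in> W\<^sup>\<bottom>\<^sup>\<bottom>" unfolding orthogonal_comp_def[of "W\<^sup>\<bottom>"] by simp
  then show ?thesis using orthogonal_comp_self[OF W] by simp
qed

context carnot
begin

definition reachable :: "(real ^ 'n) set" where "reachable = {x. \<exists>l. reach l 0 x}"

lemma reach_mult: "reach l 0 x \<Longrightarrow> reach l' 0 y \<Longrightarrow> reach (l + l') 0 (x \<odot> y)"
  using reach_trans[of l 0 x l' "x \<odot> y"] reach_translate[of l' 0 y x] by simp

lemma reach_uminus: "reach l 0 x \<Longrightarrow> reach l 0 (- x)"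
  using reach_reverse[OF reach_translate[of l 0 x "- x"]] by simp

lemma reach_layer: "v \<in> layer w 1 \<Longrightarrow> reach (norm v) 0 v"
  using reach_line[of v 0] by simp

text \<open>
  This subspace is invariant under \<open>Ad g\<close> for every reachable \<open>g\<close>, in particular for horizontal \<open>g\<close>. It
  is therefore closed under brackets with horizontal vectors, contains all layers, and so is the
  whole space.
\<close>
definition conj_span :: "(real ^ 'n) set" where
  "conj_span = span {Ad h v | h v. h \<in> reachable \<and> v \<in> layer w 1}"

lemma Ad_conj_span:
  assumes g: "g \<in> reachable" and x: "x \<in> conj_span"
  shows "Ad g x \<in> conj_span"
  using x unfolding conj_span_def
proof (induction rule: span_induct_closed)
  case (base x)
  then obtain h v where hv: "x = Ad h v" "h \<in> reachable" "v \<in> layer w 1" by blast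
  have "g \<odot> h \<in> reachable" using g hv(2) reach_mult unfolding reachable_def by blast
  then show ?case using hv by (auto simp: Ad_Ad[symmetric] intro!: span_base)
qed (simp_all add: linear_0[OF linear_Ad] linear_add[OF linear_Ad] linear_cmul[OF linear_Ad]
    span_zero span_add span_scale)

lemma conj_span_UNIV: "conj_span = UNIV"
proof -
  have sub: "subspace conj_span" by (simp add: conj_span_def subspace_span)
  have r0: "0 \<in> reachable" using reach_refl unfolding reachable_def by blast
  have V1: "layer w 1 \<subseteq> conj_span"
  proof
    fix v assume "v \<in> layer w 1"
    then have "Ad 0 v \<in> conj_span" unfolding conj_span_def using r0 by (intro span_base) blast
    then show "v \<in> conj_span" by simp
  qed
  have br: "lie_bracket G v x \<in> conj_span" if v: "v \<in> layer w 1" and x: "x \<in> conj_span" for v x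
  proof (rule subspace_contains_vector_derivative[OF sub _ Ad_line_has_vector_derivative_0])
    fix t
    have "t *\<^sub>R v \<in> reachable"
      using reach_layer subspace_scale[OF subspace_layer v] unfolding reachable_def by blast
    then show "Ad (t *\<^sub>R v) x \<in> conj_span" by (rule Ad_conj_span[OF _ x])
  qed
  have lay: "layer w i \<subseteq> conj_span" if "1 \<le> i" for i
    using that
  proof (induction i rule: dec_induct)
    case base
    show ?case by (rule V1)
  next
    case (step i)
    show ?case
    proof (cases "Suc i \<le> s")
      case True
      then have "layer w (Suc i) = span {lie_bracket G v u | v u. v \<in> layer w 1 \<and> u \<in> layer w i}"
        using layer_Suc[of "Suc i"] step by simp
      also have "\<dots> \<subseteq> conj_span" using br step by (intro span_minimal sub) blast
      finally show ?thesis .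
    next
      case False
      then show ?thesis using layer_above subspace_0[OF sub] by simp
    qed
  qed
  have "b \<in> conj_span" if b: "b \<in> Basis" for b
  proof -
    obtain j where j: "b = axis j 1" using b by (auto simp: Basis_vec_def)
    show ?thesis using layer_eq_singleton[of j "w j"] lay[OF weights(1), of j] j by auto
  qed
  then have "span Basis \<subseteq> conj_span" by (intro span_minimal sub) blast
  then show ?thesis by (simp add: top.extremum_unique)
qed

text \<open>
  Coordinates of the second kind: the product, in the order given by \<open>bs\<close>, of the points that the
  coordinates of \<open>x\<close> with respect to \<open>B\<close> determine on the one-parameter subgroups of the basis vectors.
\<close>
definition word :: "(real ^ 'n) set \<Rightarrow> (real ^ 'n) list \<Rightarrow> real ^ 'n \<Rightarrow> real ^ 'n" where
  "word B bs x = foldr (\<lambda>b y. (representation B x b *\<^sub>R b) \<odot> y) bs 0"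

lemma word_simps: "word B [] x = 0" "word B (b # bs) x = (representation B x b *\<^sub>R b) \<odot> word B bs x"
  by (simp_all add: word_def)

text \<open>
  There is a basis of vectors \<open>Ad h v\<close> with \<open>h\<close> reachable and \<open>v\<close> horizontal. A multiple of such a vector
  is \<open>h \<odot> (t *\<^sub>R v) \<odot> - h\<close>, which is reachable by a curve of bounded length, and so are the products
  in the coordinates of the second kind. These coordinates are a continuous map with the identity as
  derivative at 0, so their image is a neighbourhood of 0.
\<close>
lemma chow_local:
  "\<exists>r>0. \<exists>M>0. \<forall>x. norm x < r \<longrightarrow> (\<exists>l\<le>M. reach l 0 x)"
proof -
  let ?S = "{Ad h v | h v. h \<in> reachable \<and> v \<in> layer w 1}"
  obtain B where B: "B \<subseteq> ?S" "independent B" "?S \<subseteq> span B" by (rule maximal_independent_subset)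
  have spB: "span B = UNIV"
    using span_minimal[OF B(3) subspace_span] conj_span_UNIV unfolding conj_span_def by auto
  have fB: "finite B" using B(2) independent_bound by blast
  obtain bs where bs: "set bs = B" "distinct bs" using finite_distinct_list[OF fB] by blast
  have lin: "linear (\<lambda>x. representation B x b)" for b
    by (rule linearI) (simp_all add: representation_add[OF B(2)] representation_scale[OF B(2)] spB)
  then have bl: "bounded_linear (\<lambda>x. representation B x b)" for b by (simp add: linear_conv_bounded_linear)
  have cont: "continuous_on UNIV (word B cs)" for cs
  proof (induction cs)
    case Nil
    then show ?case by (simp add: word_simps[abs_def] continuous_on_const)
  next
    case (Cons c cs)
    have "continuous_on UNIV (\<lambda>x. (representation B x c *\<^sub>R c) \<odot> word B cs x)"
      by (intro continuous_on_mult Cons continuous_intros linear_continuous_on bl)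
    then show ?case by (simp add: word_simps[abs_def])
  qed
  have der: "word B cs 0 = 0 \<and> (word B cs has_derivative (\<lambda>h. \<Sum>b\<leftarrow>cs. representation B h b *\<^sub>R b)) (at 0)" for cs
  proof (induction cs)
    case Nil
    then show ?case by (simp add: word_simps[abs_def])
  next
    case (Cons c cs)
    have z: "representation B 0 c = 0" using linear_0[OF lin] .
    have "((\<lambda>x. representation B x c *\<^sub>R c) has_derivative (\<lambda>h. representation B h c *\<^sub>R c)) (at 0)"
      by (intro has_derivative_scaleR_left bounded_linear_imp_has_derivative bl)
    from mult_comp_has_derivative[OF this conjunct2[OF Cons]]
    have "((\<lambda>x. (representation B x c *\<^sub>R c) \<odot> word B cs x) has_derivative
        (\<lambda>h. representation B h c *\<^sub>R c + (\<Sum>b\<leftarrow>cs. representation B h b *\<^sub>R b))) (at 0)"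
      using Cons z by (simp add: dmult_0_0)
    then show ?case using Cons z by (simp add: word_simps[abs_def])
  qed
  have id: "(\<Sum>b\<leftarrow>bs. representation B h b *\<^sub>R b) = h" for h
  proof -
    have "(\<Sum>b\<leftarrow>bs. representation B h b *\<^sub>R b) = (\<Sum>b\<in>B. representation B h b *\<^sub>R b)"
      using bs by (simp add: sum_list_distinct_conv_sum_set)
    also have "\<dots> = h" by (rule sum_representation_eq[OF B(2)]) (use spB fB in auto)
    finally show ?thesis .
  qed
  \<comment> \<open>The open mapping theorem used here requires differentiability at the single point 0.\<close>
  have interior: "word B bs 0 \<in> interior (word B bs ` cball 0 1)"
  proof (rule sussmann_open_mapping[OF open_UNIV cont UNIV_I conjunct2[OF der] bounded_linear_ident])
    show "(\<lambda>h. \<Sum>b\<leftarrow>bs. representation B h b *\<^sub>R b) \<circ> (\<lambda>x. x) = id" using id by auto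
  qed auto
  have reach_b: "\<exists>M\<ge>0. \<forall>x. norm x \<le> 1 \<longrightarrow> (\<exists>l\<le>M. reach l 0 (representation B x b *\<^sub>R b))" if b: "b \<in> B" for b
  proof -
    obtain h v l where hv: "b = Ad h v" "reach l 0 h" "v \<in> layer w 1"
      using b B(1) unfolding reachable_def by blast
    obtain c where c: "\<And>x. norm (representation B x b) \<le> norm x * c" "c > 0"
      using bounded_linear.pos_bounded[OF bl] by blast
    show ?thesis
    proof (rule exI[of _ "l + c * norm v + l"], intro conjI allI impI)
      show "0 \<le> l + c * norm v + l" using reach_nonneg[OF hv(2)] c(2) by simp
      fix x :: "real ^ 'n" assume x: "norm x \<le> 1"
      let ?t = "representation B x b"
      have "?t *\<^sub>R b = Ad h (?t *\<^sub>R v)" by (simp only: hv(1) linear_cmul[OF linear_Ad])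
      then have "?t *\<^sub>R b = h \<odot> ?t *\<^sub>R v \<odot> - h" by (simp only: Ad_def)
      moreover have "reach (l + norm (?t *\<^sub>R v) + l) 0 (h \<odot> ?t *\<^sub>R v \<odot> - h)"
        by (intro reach_mult hv(2) reach_uminus reach_layer subspace_scale[OF subspace_layer] hv(3))
      moreover have "norm (?t *\<^sub>R v) \<le> c * norm v"
      proof -
        have "\<bar>?t\<bar> \<le> norm x * c" using c(1)[of x] by simp
        also have "\<dots> \<le> c" using x c(2) by (simp add: mult_left_le_one_le)
        finally show ?thesis by (simp add: mult_right_mono)
      qed
      ultimately show "\<exists>l'\<le>l + c * norm v + l. reach l' 0 (?t *\<^sub>R b)"
        by (metis add_left_mono add_right_mono)
    qed
  qed
  have "\<exists>M\<ge>0. \<forall>x. norm x \<le> 1 \<longrightarrow> (\<exists>l\<le>M. reach l 0 (word B cs x))" if "set cs \<subseteq> B" for cs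
    using that
  proof (induction cs)
    case Nil
    then show ?case using reach_refl by (auto simp: word_simps)
  next
    case (Cons c cs)
    obtain M where M: "M \<ge> 0" "\<And>x. norm x \<le> 1 \<Longrightarrow> \<exists>l\<le>M. reach l 0 (word B cs x)" using Cons by auto
    have cB: "c \<in> B" using Cons by simp
    obtain M' where M': "M' \<ge> 0" "\<And>x. norm x \<le> 1 \<Longrightarrow> \<exists>l\<le>M'. reach l 0 (representation B x c *\<^sub>R c)"
      using reach_b[OF cB] by blast
    show ?case
    proof (rule exI[of _ "M' + M"], intro conjI allI impI)
      show "0 \<le> M' + M" using M M' by simp
      fix x :: "real ^ 'n" assume x: "norm x \<le> 1"
      obtain l where l: "l \<le> M" "reach l 0 (word B cs x)" using M(2)[OF x] by blast
      obtain l' where l': "l' \<le> M'" "reach l' 0 (representation B x c *\<^sub>R c)" using M'(2)[OF x] by blast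
      have "reach (l' + l) 0 (word B (c # cs) x)" unfolding word_simps by (rule reach_mult[OF l'(2) l(2)])
      then show "\<exists>l\<le>M' + M. reach l 0 (word B (c # cs) x)" using l(1) l'(1) by (intro exI[of _ "l' + l"]) simp
    qed
  qed
  then obtain M where M: "M \<ge> 0" "\<And>x. norm x \<le> 1 \<Longrightarrow> \<exists>l\<le>M. reach l 0 (word B bs x)" using bs by blast
  have "word B bs 0 = 0" using der by blast
  then obtain r where r: "r > 0" "ball 0 r \<subseteq> word B bs ` cball 0 1"
    using interior unfolding mem_interior by auto
  have "\<exists>l\<le>M + 1. reach l 0 x" if "norm x < r" for x
  proof -
    from that have "x \<in> ball 0 r" by simp
    then obtain y where y: "y \<in> cball 0 1" "x = word B bs y" using r(2) by blast
    then have "norm y \<le> 1" by simp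
    from M(2)[OF this] obtain l where "l \<le> M" "reach l 0 x" using y by blast
    then show "\<exists>l\<le>M + 1. reach l 0 x" by (intro exI[of _ l]) simp
  qed
  moreover have "M + 1 > 0" using M by simp
  ultimately show ?thesis using r(1) by blast
qed

lemma norm_dil_le:
  assumes "c \<ge> 1" shows "norm (dil w c x) \<le> c ^ s * norm x"
proof -
  have "norm (dil w c x) \<le> norm (c ^ s *\<^sub>R x)"
  proof (rule norm_le_componentwise_cart)
    fix j
    have "c ^ w j \<le> c ^ s" by (rule power_increasing[OF weights(2) assms])
    then show "norm (dil w c x $ j) \<le> norm ((c ^ s *\<^sub>R x) $ j)"
      using assms by (auto simp: dil_def abs_mult intro!: mult_right_mono)
  qed
  then show ?thesis using assms by simp
qed

lemma dil_dil: "dil w a (dil w b x) = dil w (a * b) x"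
  by (simp add: dil_def vec_eq_iff power_mult_distrib)

lemma dil_1 [simp]: "dil w 1 x = x"
  by (simp add: dil_def)

lemma dil_0 [simp]: "dil w c 0 = 0"
  by (rule linear_0[OF linear_dil])

text \<open>
  A point of norm \<open>\<epsilon>\<close> can be dilated by a factor comparable with \<open>\<epsilon> powr (- 1 / s)\<close> without
  leaving the neighbourhood of \<open>chow_local\<close>, since a dilation by \<open>c \<ge> 1\<close> expands by \<open>c ^ s\<close> at most.
\<close>
lemma reach_holder:
  "\<exists>r>0. \<exists>C>0. \<forall>x. norm x \<le> r \<longrightarrow> (\<exists>l \<le> C * norm x powr (1 / real s). reach l 0 x)"
proof -
  obtain r M where r: "r > 0" "M > 0" "\<And>x. norm x < r \<Longrightarrow> \<exists>l\<le>M. reach l 0 x"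
    using chow_local by blast
  define C where "C = M * (2 / r) powr (1 / real s)"
  have s0: "real s > 0" using step_pos by simp
  have "\<exists>l \<le> C * norm x powr (1 / real s). reach l 0 x" if x: "norm x \<le> r / 2" for x
  proof -
    show "\<exists>l \<le> C * norm x powr (1 / real s). reach l 0 x"
    proof (cases "x = 0")
      case True
      then show ?thesis using reach_refl[of 0] by (intro exI[of _ 0]) simp
    next
      case False
      define c where "c = (2 * norm x / r) powr (1 / real s)"
      have p: "2 * norm x / r > 0" "2 * norm x / r \<le> 1" using False x r by (auto simp: divide_le_eq)
      have c: "c > 0" "c \<le> 1" using p s0 by (auto simp: c_def powr_le1)
      have cs: "c ^ s = 2 * norm x / r"
      proof -
        have "c ^ s = c powr real s" using c(1) by (simp add: powr_realpow)
        also have "\<dots> = (2 * norm x / r) powr (1 / real s * real s)" unfolding c_def by (rule powr_powr)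
        also have "\<dots> = 2 * norm x / r" using s0 p r(1) by simp
        finally show ?thesis .
      qed
      have "norm (dil w (1 / c) x) \<le> (1 / c) ^ s * norm x" by (rule norm_dil_le) (use c in simp)
      also have "\<dots> = r / 2" using False r by (simp add: power_one_over cs)
      finally have "norm (dil w (1 / c) x) < r" using r by simp
      from r(3)[OF this] obtain l where l: "l \<le> M" "reach l 0 (dil w (1 / c) x)" by blast
      have "reach (c * l) 0 x" using reach_dil[OF l(2), of c] c by (simp add: dil_dil)
      moreover have "c * l \<le> C * norm x powr (1 / real s)"
      proof -
        have "c = (2 / r) powr (1 / real s) * norm x powr (1 / real s)"
          unfolding c_def using r by (simp add: powr_mult[symmetric])
        then have "C * norm x powr (1 / real s) = c * M" by (simp add: C_def)
        then show ?thesis using l c by simp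
      qed
      ultimately show ?thesis by blast
    qed
  qed
  moreover have "r / 2 > 0" "C > 0" using r by (auto simp: C_def)
  ultimately show ?thesis by blast
qed

text \<open>
  Every point can be contracted into the neighbourhood of 0 in which points are known to be reachable.
\<close>
lemma reach_all: "\<exists>l. reach l x y"
proof -
  obtain r C where r: "r > 0" "\<And>x. norm x \<le> r \<Longrightarrow> \<exists>l \<le> C * norm x powr (1 / real s). reach l 0 x"
    using reach_holder by blast
  define z where "z = - x \<odot> y"
  have "\<exists>c>0. norm (dil w c z) \<le> r"
  proof -
    have "((\<lambda>c. dil w c z) has_vector_derivative hproj w z) (at 0)" by (rule dil_has_vector_derivative_0)
    then have "isCont (\<lambda>c. dil w c z) 0" by (rule has_vector_derivative_continuous)
    then obtain d where d: "d > 0" "\<And>c. \<bar>c\<bar> < d \<Longrightarrow> norm (dil w c z - dil w 0 z) < r"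
      using r(1) unfolding continuous_at_eps_delta dist_norm by (metis diff_zero real_norm_def)
    have "dil w 0 z = 0"
    proof -
      have "w j \<noteq> 0" for j using weights(1)[of j] by simp
      then show ?thesis by (simp add: dil_def vec_eq_iff)
    qed
    then show ?thesis using d(2)[of "d / 2"] d(1) by (intro exI[of _ "d / 2"]) simp
  qed
  then obtain c where c: "c > 0" "norm (dil w c z) \<le> r" by blast
  obtain l where "reach l 0 (dil w c z)" using r(2)[OF c(2)] by blast
  from reach_dil[OF this, of "1 / c"] have "reach (1 / c * l) 0 z" using c by (simp add: dil_dil)
  from reach_translate[OF this, of x] have "reach (1 / c * l) x y" by (simp add: z_def)
  then show ?thesis by blast
qed

section \<open>The Carnot--Caratheodory distance\<close>

abbreviation cdist where "cdist \<equiv> cc_dist G w"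

lemma cdist_bdd: "bdd_below {l. reach l x y}"
  by (rule bdd_belowI[of _ 0]) (use reach_nonneg in blast)

lemma cdist_le: "reach l x y \<Longrightarrow> cdist x y \<le> l"
  unfolding cc_dist_reach by (rule cInf_lower[OF _ cdist_bdd]) simp

lemma cdist_nonneg [simp]: "0 \<le> cdist x y"
  unfolding cc_dist_reach by (rule cInf_greatest) (use reach_all reach_nonneg in auto)

lemma cdist_approx:
  assumes "e > 0" obtains l where "reach l x y" "l < cdist x y + e"
proof -
  have "Inf {l. reach l x y} < cdist x y + e" unfolding cc_dist_reach using assms by simp
  moreover have "{l. reach l x y} \<noteq> {}" using reach_all by simp
  ultimately obtain l where "l \<in> {l. reach l x y}" "l < cdist x y + e" by (meson cInf_lessD)
  then show thesis using that by simp
qed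

lemma cdist_refl [simp]: "cdist x x = 0"
  using cdist_le[OF reach_refl, of x] cdist_nonneg[of x x] by linarith

lemma cdist_sym: "cdist x y = cdist y x"
  unfolding cc_dist_reach using reach_reverse by metis

lemma cdist_triangle: "cdist x z \<le> cdist x y + cdist y z"
proof (rule field_le_epsilon)
  fix e :: real assume "e > 0"
  then have e: "e / 2 > 0" by simp
  obtain l where l: "reach l x y" "l < cdist x y + e / 2" using cdist_approx[OF e] by blast
  obtain l' where l': "reach l' y z" "l' < cdist y z + e / 2" using cdist_approx[OF e] by blast
  show "cdist x z \<le> cdist x y + cdist y z + e"
    using cdist_le[OF reach_trans[OF l(1) l'(1)]] l(2) l'(2) by linarith
qed

lemma cdist_translate [simp]: "cdist (z \<odot> x) (z \<odot> y) = cdist x y"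
proof -
  have le: "cdist (z \<odot> x) (z \<odot> y) \<le> cdist x y" for x y z
  proof (rule field_le_epsilon)
    fix e :: real assume "e > 0"
    then obtain l where l: "reach l x y" "l < cdist x y + e" using cdist_approx by blast
    show "cdist (z \<odot> x) (z \<odot> y) \<le> cdist x y + e"
      using cdist_le[OF reach_translate[OF l(1), of z]] l(2) by linarith
  qed
  show ?thesis using le[of z x y] le[of "- z" "z \<odot> x" "z \<odot> y"] by simp
qed

lemma cdist_0: "cdist x y = cdist 0 (- x \<odot> y)"
  using cdist_translate[of "- x" x y] by simp

lemma cdist_dil: assumes "c > 0" shows "cdist (dil w c x) (dil w c y) = c * cdist x y"
proof -
  have le: "cdist (dil w c x) (dil w c y) \<le> c * cdist x y" if c: "c > 0" for x y c
  proof (rule field_le_epsilon)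
    fix e :: real assume "e > 0"
    then have "e / c > 0" using c by simp
    then obtain l where l: "reach l x y" "l < cdist x y + e / c" using cdist_approx by blast
    have "cdist (dil w c x) (dil w c y) \<le> c * l" using cdist_le[OF reach_dil[OF l(1)]] c by simp
    also have "\<dots> \<le> c * (cdist x y + e / c)" using l(2) c by simp
    finally show "cdist (dil w c x) (dil w c y) \<le> c * cdist x y + e" using c by (simp add: algebra_simps)
  qed
  have "cdist x y \<le> (1 / c) * cdist (dil w c x) (dil w c y)"
    using le[of "1 / c" "dil w c x" "dil w c y"] assms by (simp add: dil_dil)
  then have "c * cdist x y \<le> cdist (dil w c x) (dil w c y)" using assms by (simp add: field_simps)
  then show ?thesis using le[OF assms, of x y] by simp
qed

lemma cdist_line: "v \<in> layer w 1 \<Longrightarrow> cdist x (x \<odot> v) \<le> norm v"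
  by (rule cdist_le[OF reach_line])

lemma hproj_cdist: "norm (hproj w y - hproj w x) \<le> cdist x y"
  unfolding cc_dist_reach by (rule cInf_greatest) (use reach_all reach_hproj in auto)

lemma cdist_holder_local:
  "\<exists>r>0. \<exists>C>0. \<forall>x\<in>cball 0 R. \<forall>y\<in>cball 0 R. norm (x - y) \<le> r \<longrightarrow> cdist x y \<le> C * norm (x - y) powr (1 / real s)"
proof -
  obtain r C where r: "r > 0" "C > 0" "\<And>x. norm x \<le> r \<Longrightarrow> \<exists>l \<le> C * norm x powr (1 / real s). reach l 0 x"
    using reach_holder by blast
  obtain L where L: "L > 0" "\<And>a b c d. a \<in> cball 0 R \<Longrightarrow> b \<in> cball 0 R \<Longrightarrow> c \<in> cball 0 R \<Longrightarrow> d \<in> cball 0 R \<Longrightarrow>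
      norm (a \<odot> b - c \<odot> d) \<le> L * (norm (a - c) + norm (b - d))"
    using mult_lipschitz[of R] by blast
  have "cdist x y \<le> C * L powr (1 / real s) * norm (x - y) powr (1 / real s)"
    if xy: "x \<in> cball 0 R" "y \<in> cball 0 R" "norm (x - y) \<le> r / L" for x y
  proof -
    have "norm (- x \<odot> y - - x \<odot> x) \<le> L * (norm (- x - - x) + norm (y - x))"
      by (rule L(2)) (use xy in auto)
    then have n: "norm (- x \<odot> y) \<le> L * norm (x - y)" by (simp add: norm_minus_commute)
    also have "\<dots> \<le> r" using xy(3) L by (simp add: field_simps)
    finally obtain l where l: "l \<le> C * norm (- x \<odot> y) powr (1 / real s)" "reach l 0 (- x \<odot> y)" using r(3) by blast
    have "cdist x y \<le> l" using cdist_le[OF l(2)] cdist_0 by simp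
    also have "\<dots> \<le> C * (L * norm (x - y)) powr (1 / real s)"
      using l(1) n r(2) by (smt (verit, best) mult_left_mono norm_ge_zero powr_mono2 divide_nonneg_nonneg of_nat_0_le_iff)
    also have "\<dots> = C * L powr (1 / real s) * norm (x - y) powr (1 / real s)"
      using L by (simp add: powr_mult)
    finally show "cdist x y \<le> C * L powr (1 / real s) * norm (x - y) powr (1 / real s)" .
  qed
  moreover have "r / L > 0" "C * L powr (1 / real s) > 0" using r L by auto
  ultimately show ?thesis by blast
qed

section \<open>Curves made of horizontal lines\<close>

text \<open>
  The end point of the path that starts at 0 and follows, for each pair in turn, the line in the direction
  of its second component for a time given by its first component.
\<close>
primrec chain :: "(real \<times> (real ^ 'n)) list \<Rightarrow> real ^ 'n" where
  "chain [] = 0"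
| "chain (p # ps) = (fst p *\<^sub>R snd p) \<odot> chain ps"

text \<open>
  The constant depends on the number of segments only: each further segment costs one application of the
  Lipschitz estimate for the multiplication on a fixed ball.
\<close>
lemma chain_close:
  "\<exists>C\<ge>0. \<forall>ps E A. length ps \<le> n \<longrightarrow> norm E = 1 \<longrightarrow> 0 \<le> A \<longrightarrow> A \<le> 1 \<longrightarrow>
     (\<forall>p\<in>set ps. 0 \<le> fst p \<and> norm (snd p - E) \<le> A) \<longrightarrow> (\<Sum>p\<leftarrow>ps. fst p) \<le> 1 \<longrightarrow>
     norm (chain ps - (\<Sum>p\<leftarrow>ps. fst p) *\<^sub>R E) \<le> C * A"
proof (induction n)
  case 0
  show ?case by (rule exI[of _ 0]) simp
next
  case (Suc n)
  then obtain C where C: "C \<ge> 0" "\<And>ps E A. length ps \<le> n \<Longrightarrow> norm E = 1 \<Longrightarrow> 0 \<le> A \<Longrightarrow> A \<le> 1 \<Longrightarrow>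
     (\<And>p. p \<in> set ps \<Longrightarrow> 0 \<le> fst p \<and> norm (snd p - E) \<le> A) \<Longrightarrow> (\<Sum>p\<leftarrow>ps. fst p) \<le> 1 \<Longrightarrow>
     norm (chain ps - (\<Sum>p\<leftarrow>ps. fst p) *\<^sub>R E) \<le> C * A"
    by blast
  obtain L where L: "L > 0" "\<And>a b c d. a \<in> cball 0 (C + 2) \<Longrightarrow> b \<in> cball 0 (C + 2) \<Longrightarrow> c \<in> cball 0 (C + 2) \<Longrightarrow>
      d \<in> cball 0 (C + 2) \<Longrightarrow> norm (a \<odot> b - c \<odot> d) \<le> L * (norm (a - c) + norm (b - d))"
    using mult_lipschitz[of "C + 2"] by blast
  have "norm (chain ps - (\<Sum>p\<leftarrow>ps. fst p) *\<^sub>R E) \<le> (L * (1 + C)) * A"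
    if len: "length ps \<le> Suc n" and E: "norm E = 1" and A: "0 \<le> A" "A \<le> 1"
      and P: "\<forall>p\<in>set ps. 0 \<le> fst p \<and> norm (snd p - E) \<le> A" and S: "(\<Sum>p\<leftarrow>ps. fst p) \<le> 1" for ps E A
  proof (cases ps)
    case Nil
    then show ?thesis using L(1) C(1) A by simp
  next
    case (Cons p r)
    obtain t V where p: "p = (t, V)" by (cases p)
    define S' where "S' = (\<Sum>p\<leftarrow>r. fst p)"
    have S'0: "S' \<ge> 0" unfolding S'_def using P Cons by (intro sum_list_nonneg) auto
    have t: "0 \<le> t" "norm (V - E) \<le> A" using P Cons p by auto
    have tS: "t + S' \<le> 1" using S Cons p by (simp add: S'_def)
    have IH: "norm (chain r - S' *\<^sub>R E) \<le> C * A"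
      unfolding S'_def by (rule C(2)) (use len Cons E A P S t p in auto)
    have CA: "C * A \<le> C" using C(1) A by (simp add: mult_left_le)
    have V2: "norm V \<le> 2" using norm_triangle_ineq[of E "V - E"] E t A by simp
    have tV: "norm (t *\<^sub>R V) \<le> 2" using t(1) tS S'0 V2 mult_mono[of t 1 "norm V" 2] by simp
    have n: "norm (t *\<^sub>R E) \<le> 1" "norm (S' *\<^sub>R E) \<le> 1" using t(1) tS S'0 E by auto
    have nr: "norm (chain r) \<le> C + 1"
      using norm_triangle_ineq[of "S' *\<^sub>R E" "chain r - S' *\<^sub>R E"] IH CA n(2) by simp
    have "chain ps - (\<Sum>p\<leftarrow>ps. fst p) *\<^sub>R E = (t *\<^sub>R V) \<odot> chain r - (t *\<^sub>R E) \<odot> (S' *\<^sub>R E)"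
      by (simp add: Cons p lines S'_def)
    also have "norm \<dots> \<le> L * (norm (t *\<^sub>R V - t *\<^sub>R E) + norm (chain r - S' *\<^sub>R E))"
      by (rule L(2)) (use tV n nr C(1) in auto)
    also have "norm (t *\<^sub>R V - t *\<^sub>R E) \<le> A"
    proof -
      have "norm (t *\<^sub>R V - t *\<^sub>R E) = t * norm (V - E)" using t(1) by (simp add: scaleR_diff_right[symmetric])
      also have "\<dots> \<le> 1 * A" using t tS S'0 A by (intro mult_mono) auto
      finally show ?thesis by simp
    qed
    finally have "norm (chain ps - (\<Sum>p\<leftarrow>ps. fst p) *\<^sub>R E) \<le> L * (A + C * A)"
      using IH L(1) by (smt (verit) mult_left_mono)
    then show ?thesis by (simp add: algebra_simps)
  qed
  moreover have "L * (1 + C) \<ge> 0" using L(1) C(1) by simp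
  ultimately show ?case by blast
qed

lemma dil_chain:
  assumes "\<And>p. p \<in> set ps \<Longrightarrow> snd p \<in> layer w 1"
  shows "dil w c (chain ps) = chain (map (\<lambda>p. (c * fst p, snd p)) ps)"
  using assms
proof (induction ps)
  case (Cons p ps)
  have "dil w c (snd p) = c *\<^sub>R snd p" using dil_layer[of "snd p" 1] Cons.prems[of p] by simp
  then show ?case using Cons by (simp add: dil_mult linear_cmul[OF linear_dil] mult.commute)
qed simp

text \<open>
  The intervals \<open>I i\<close> come in no particular order and may be empty or single points. Some \<open>I i\<close> contains
  points arbitrarily close to \<open>a\<close> on its right; the curve follows its line up to the last point \<open>c\<close> of
  \<open>I i\<close>, and on the remaining interval \<open>I i\<close> is not needed, which allows induction on the number of
  intervals. Degenerate intervals are never followed, so the directions in the chain are those of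
  intervals with interior points.
\<close>
lemma piecewise_lines_chain:
  fixes g :: "real \<Rightarrow> real ^ 'n"
  assumes "finite S" and "a \<le> b" and "continuous_on {a..b} g"
    and "\<And>i. i \<in> S \<Longrightarrow> is_interval (I i)" and "{a<..b} \<subseteq> (\<Union>i\<in>S. I i)"
    and "\<And>i t. i \<in> S \<Longrightarrow> t \<in> I i \<Longrightarrow> g t = q i \<odot> (t *\<^sub>R V i)"
  shows "\<exists>ps. length ps \<le> card S \<and> g b = g a \<odot> chain ps \<and> (\<Sum>p\<leftarrow>ps. fst p) = b - a \<and>
           (\<forall>p\<in>set ps. 0 \<le> fst p \<and> (\<exists>i\<in>S. snd p = V i \<and> (\<exists>x y. x < y \<and> {x<..<y} \<subseteq> I i)))"
  using assms
proof (induction "card S" arbitrary: S a)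
  case 0
  then have "S = {}" by simp
  then have "a = b" using 0 by (auto simp: greaterThanAtMost_empty_iff)
  then show ?case by (intro exI[of _ "[]"]) simp
next
  case (Suc n)
  note prems = Suc.prems
  show ?case
  proof (cases "a = b")
    case True
    then show ?thesis by (intro exI[of _ "[]"]) simp
  next
    case False
    with prems(2) have ab: "a < b" by simp
    \<comment> \<open>A sequence decreasing to \<open>a\<close>; one of the finitely many intervals contains infinitely many of its terms.\<close>
    define x where "x = (\<lambda>k::nat. a + (b - a) / (real k + 1))"
    have xk: "a < x k \<and> x k \<le> b" for k
    proof -
      have "(b - a) / (real k + 1) \<le> (b - a) / 1" using ab by (intro divide_left_mono) auto
      then show ?thesis using ab by (simp add: x_def)
    qed
    then have "\<exists>i\<in>S. x k \<in> I i" for k using prems(5) by (auto simp: subset_iff)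
    then obtain j where j: "\<And>k. j k \<in> S \<and> x k \<in> I (j k)" by metis
    have "\<exists>k0\<in>UNIV. infinite {k \<in> UNIV. j k = j k0}"
    proof (rule pigeonhole_infinite)
      show "infinite (UNIV :: nat set)" by simp
      show "finite (range j)" by (rule finite_subset[OF _ prems(1)]) (use j in auto)
    qed
    then obtain i where i: "i \<in> S" "infinite {k. j k = i}" using j by auto
    have near: "\<exists>y\<in>I i. a < y \<and> y \<le> b \<and> y < a + e" if e: "e > 0" for e
    proof -
      obtain k0 :: nat where k0: "(b - a) / e < real k0" using reals_Archimedean2 by blast
      obtain k where k: "k > k0" "j k = i" using i(2) unfolding infinite_nat_iff_unbounded by auto
      have "(b - a) / e < real k + 1" using k0 k(1) by simp
      then have "(b - a) / (real k + 1) < e" using e by (simp add: field_simps)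
      then show ?thesis using j[of k] xk[of k] k(2) by (intro bexI[of _ "x k"]) (auto simp: x_def)
    qed
    define c where "c = Sup (I i \<inter> {a<..b})"
    have ne: "I i \<inter> {a<..b} \<noteq> {}" using near[of 1] by auto
    have bd: "bdd_above (I i \<inter> {a<..b})" by (rule bdd_aboveI[of _ b]) auto
    have cup: "y \<le> c" if "y \<in> I i" "a < y" "y \<le> b" for y
      unfolding c_def by (rule cSup_upper[OF _ bd]) (use that in auto)
    have cb: "c \<le> b" unfolding c_def by (rule cSup_least[OF ne]) auto
    have ac: "a < c" using near[of 1] cup by force
    have ivl: "{a<..<c} \<subseteq> I i"
    proof
      fix y assume y: "y \<in> {a<..<c}"
      obtain z where z: "z \<in> I i" "a < z" "z < y" using near[of "y - a"] y by auto
      obtain z' where z': "z' \<in> I i \<inter> {a<..b}" "y < z'" using less_cSupD[OF ne, of y] y by (auto simp: c_def)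
      show "y \<in> I i" using prems(4)[OF i(1)] z z' y unfolding is_interval_1 by (meson IntD1 less_imp_le)
    qed
    have gI: "g t = q i \<odot> (t *\<^sub>R V i)" if "t \<in> {a<..<c}" for t using prems(6)[OF i(1)] ivl that by blast
    have cl: "g t = q i \<odot> (t *\<^sub>R V i)" if t: "t \<in> {a..c}" for t
    proof -
      have "continuous_on {a..c} g" by (rule continuous_on_subset[OF prems(3)]) (use cb in auto)
      moreover have "continuous_on {a..c} (\<lambda>t. q i \<odot> (t *\<^sub>R V i))"
        by (intro continuous_on_mult continuous_intros)
      ultimately have "closed {t \<in> {a..c}. g t = q i \<odot> (t *\<^sub>R V i)}"
      proof -
        assume c1: "continuous_on {a..c} g" and c2: "continuous_on {a..c} (\<lambda>t. q i \<odot> (t *\<^sub>R V i))"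
        have "closed ({a..c} \<inter> (\<lambda>t. g t - q i \<odot> (t *\<^sub>R V i)) -` {0})"
          by (intro continuous_closed_preimage continuous_on_diff c1 c2) auto
        moreover have "{a..c} \<inter> (\<lambda>t. g t - q i \<odot> (t *\<^sub>R V i)) -` {0} = {t \<in> {a..c}. g t = q i \<odot> (t *\<^sub>R V i)}"
          by auto
        ultimately show ?thesis by simp
      qed
      moreover have "{a<..<c} \<subseteq> {t \<in> {a..c}. g t = q i \<odot> (t *\<^sub>R V i)}" using gI by auto
      ultimately have "closure {a<..<c} \<subseteq> {t \<in> {a..c}. g t = q i \<odot> (t *\<^sub>R V i)}"
        by (rule closure_minimal[rotated])
      then show ?thesis using t ac by (auto simp: closure_greaterThanLessThan)
    qed
    have gc: "g c = g a \<odot> ((c - a) *\<^sub>R V i)"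
      using cl[of a] cl[of c] ac by (simp add: mult_assoc lines)
    have "\<exists>ps. length ps \<le> card (S - {i}) \<and> g b = g c \<odot> chain ps \<and> (\<Sum>p\<leftarrow>ps. fst p) = b - c \<and>
           (\<forall>p\<in>set ps. 0 \<le> fst p \<and> (\<exists>i\<in>S - {i}. snd p = V i \<and> (\<exists>x y. x < y \<and> {x<..<y} \<subseteq> I i)))"
    proof (rule Suc.hyps(1))
      show "n = card (S - {i})" using Suc.hyps(2) i(1) prems(1) by simp
      show "continuous_on {c..b} g" by (rule continuous_on_subset[OF prems(3)]) (use ac in auto)
      show "{c<..b} \<subseteq> (\<Union>i\<in>S - {i}. I i)"
      proof
        fix y assume y: "y \<in> {c<..b}"
        then have "y \<notin> I i" using cup[of y] ac by auto
        moreover have "y \<in> {a<..b}" using y ac by simp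
        then have "y \<in> (\<Union>i\<in>S. I i)" using prems(5) by blast
        ultimately show "y \<in> (\<Union>i\<in>S - {i}. I i)" by blast
      qed
    qed (use prems cb in auto)
    then obtain ps where ps: "length ps \<le> card (S - {i})" "g b = g c \<odot> chain ps" "(\<Sum>p\<leftarrow>ps. fst p) = b - c"
      "\<And>p. p \<in> set ps \<Longrightarrow> 0 \<le> fst p \<and> (\<exists>i\<in>S - {i}. snd p = V i \<and> (\<exists>x y. x < y \<and> {x<..<y} \<subseteq> I i))" by blast
    show ?thesis
    proof (rule exI[of _ "(c - a, V i) # ps"], intro conjI ballI)
      show "length ((c - a, V i) # ps) \<le> card S" using ps(1) i(1) prems(1) Suc.hyps(2) by simp
      show "g b = g a \<odot> chain ((c - a, V i) # ps)" using ps(2) gc by (simp add: mult_assoc)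
      show "(\<Sum>p\<leftarrow>(c - a, V i) # ps. fst p) = b - a" using ps(3) by simp
      fix p assume p: "p \<in> set ((c - a, V i) # ps)"
      show "0 \<le> fst p" using p ps(4)[of p] ac by auto
      show "\<exists>i\<in>S. snd p = V i \<and> (\<exists>x y. x < y \<and> {x<..<y} \<subseteq> I i)"
      proof (cases "p = (c - a, V i)")
        case True
        then show ?thesis using i(1) ac ivl by (intro bexI[of _ i]) auto
      next
        case False
        then show ?thesis using p ps(4)[of p] by auto
      qed
    qed
  qed
qed

text \<open>
  Nothing is required of the direction on a degenerate interval, which is not determined by the curve.
\<close>
definition close_lines :: "nat \<Rightarrow> real ^ 'n \<Rightarrow> real \<Rightarrow> (real \<Rightarrow> real ^ 'n) \<Rightarrow> bool" where
  "close_lines k E A g \<longleftrightarrow> continuous_on UNIV g \<and> (\<exists>I q V. (\<forall>i<k. is_interval (I i)) \<and> (\<Union>i<k. I i) = UNIV \<and>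
      (\<forall>i<k. V i \<in> layer w 1 \<and> ((\<exists>x y. x < y \<and> {x<..<y} \<subseteq> I i) \<longrightarrow> norm (V i - E) \<le> A)) \<and>
      (\<forall>i<k. \<forall>t\<in>I i. g t = q i \<odot> (t *\<^sub>R V i)))"

lemma close_lines_chain:
  assumes g: "close_lines k E A g" and ab: "a \<le> b"
  shows "\<exists>ps. length ps \<le> k \<and> g b = g a \<odot> chain ps \<and> (\<Sum>p\<leftarrow>ps. fst p) = b - a \<and>
           (\<forall>p\<in>set ps. 0 \<le> fst p \<and> snd p \<in> layer w 1 \<and> norm (snd p - E) \<le> A)"
proof -
  obtain I :: "nat \<Rightarrow> real set" and q V where I: "continuous_on UNIV g" "\<forall>i<k. is_interval (I i)" "(\<Union>i<k. I i) = UNIV"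
      "\<forall>i<k. V i \<in> layer w 1 \<and> ((\<exists>x y. x < y \<and> {x<..<y} \<subseteq> I i) \<longrightarrow> norm (V i - E) \<le> A)"
      "\<forall>i<k. \<forall>t\<in>I i. g t = q i \<odot> (t *\<^sub>R V i)"
    using g unfolding close_lines_def by blast
  have "\<exists>ps. length ps \<le> card {..<k} \<and> g b = g a \<odot> chain ps \<and> (\<Sum>p\<leftarrow>ps. fst p) = b - a \<and>
           (\<forall>p\<in>set ps. 0 \<le> fst p \<and> (\<exists>i\<in>{..<k}. snd p = V i \<and> (\<exists>x y. x < y \<and> {x<..<y} \<subseteq> I i)))"
    by (rule piecewise_lines_chain[where I = I and q = q])
       (use I ab continuous_on_subset[OF I(1)] in auto)
  then show ?thesis using I(4) by (metis (no_types, lifting) card_lessThan lessThan_iff)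
qed

text \<open>
  After a left translation and a dilation by \<open>1 / \<bar>t\<bar>\<close>, the curve is a product of at most \<open>k\<close> segments of
  total duration 1, whose Euclidean distance from \<open>E\<close> is at most a multiple of \<open>A\<close>; the local Hoelder
  estimate for the distance turns this into the power of \<open>A\<close>. For negative \<open>t\<close> the chain leads from
  \<open>g (\<tau> + t)\<close> to \<open>g \<tau>\<close>, and it is \<open>chain ps \<odot> - E\<close> that has to be close to 0.
\<close>
lemma close_lines_cdist:
  "\<exists>C>0. \<exists>A0>0. \<forall>E A g \<tau> t. E \<in> layer w 1 \<longrightarrow> norm E = 1 \<longrightarrow> 0 \<le> A \<longrightarrow> A \<le> A0 \<longrightarrow> close_lines k E A g \<longrightarrow>
     cdist (g (\<tau> + t)) (g \<tau> \<odot> (t *\<^sub>R E)) \<le> C * \<bar>t\<bar> * A powr (1 / real s)"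
proof -
  obtain C where C: "C \<ge> 0" "\<And>ps E A. length ps \<le> k \<Longrightarrow> norm E = 1 \<Longrightarrow> 0 \<le> A \<Longrightarrow> A \<le> 1 \<Longrightarrow>
     \<forall>p\<in>set ps. 0 \<le> fst p \<and> norm (snd p - E) \<le> A \<Longrightarrow> (\<Sum>p\<leftarrow>ps. fst p) \<le> 1 \<Longrightarrow>
     norm (chain ps - (\<Sum>p\<leftarrow>ps. fst p) *\<^sub>R E) \<le> C * A"
    using chain_close[of k] by blast
  obtain r D where rD: "r > 0" "D > 0" "\<And>x y. x \<in> cball 0 (C + 1) \<Longrightarrow> y \<in> cball 0 (C + 1) \<Longrightarrow> norm (x - y) \<le> r \<Longrightarrow>
      cdist x y \<le> D * norm (x - y) powr (1 / real s)"
    using cdist_holder_local[of "C + 1"] by blast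
  obtain L where L: "L > 0" "\<And>a b c d. a \<in> cball 0 (C + 1) \<Longrightarrow> b \<in> cball 0 (C + 1) \<Longrightarrow> c \<in> cball 0 (C + 1) \<Longrightarrow>
      d \<in> cball 0 (C + 1) \<Longrightarrow> norm (a \<odot> b - c \<odot> d) \<le> L * (norm (a - c) + norm (b - d))"
    using mult_lipschitz[of "C + 1"] by blast
  define A0 where "A0 = min (min 1 (1 / L)) (min (r / (C + 1)) (r / (L * (C + 1))))"
  define CC where "CC = D * (C + 1) powr (1 / real s) + D * (L * (C + 1)) powr (1 / real s)"
  have C1: "C + 1 > 0" using C(1) by simp
  have base: "cdist (chain ps) E \<le> CC * A powr (1 / real s) \<and> cdist (chain ps \<odot> - E) 0 \<le> CC * A powr (1 / real s)"
    if len: "length ps \<le> k" and E: "norm E = 1" and A: "0 \<le> A" "A \<le> A0"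
      and P: "\<forall>p\<in>set ps. 0 \<le> fst p \<and> norm (snd p - E) \<le> A" and S: "(\<Sum>p\<leftarrow>ps. fst p) = 1" for ps E A
  proof -
    have A1: "A \<le> 1" "(C + 1) * A \<le> r" "L * ((C + 1) * A) \<le> r" "L * A \<le> 1"
      using A(2) C1 L(1) by (auto simp: A0_def pos_le_divide_eq mult_ac)
    have n0: "norm (chain ps - E) \<le> C * A" using C(2)[OF len E A(1) A1(1) P] S by simp
    then have n: "norm (chain ps - E) \<le> (C + 1) * A" using A(1) by (simp add: algebra_simps)
    have "C * A \<le> C" using C(1) A1(1) A(1) by (simp add: mult_left_le)
    then have m: "chain ps \<in> cball 0 (C + 1)" "E \<in> cball 0 (C + 1)" "- E \<in> cball 0 (C + 1)"
      using norm_triangle_ineq[of E "chain ps - E"] n0 E C(1) by auto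
    have pw: "D * x powr (1 / real s) \<le> CC * A powr (1 / real s)"
      if "0 \<le> x" "x \<le> (C + 1) * A \<or> x \<le> L * (C + 1) * A" for x
    proof -
      from that(2) have "x powr (1 / real s) \<le> ((C + 1) powr (1 / real s) + (L * (C + 1)) powr (1 / real s)) * A powr (1 / real s)"
      proof
        assume "x \<le> (C + 1) * A"
        then have "x powr (1 / real s) \<le> ((C + 1) * A) powr (1 / real s)" using that(1) by (intro powr_mono2) auto
        also have "\<dots> = (C + 1) powr (1 / real s) * A powr (1 / real s)" using C1 A(1) by (simp add: powr_mult)
        also have "\<dots> \<le> ((C + 1) powr (1 / real s) + (L * (C + 1)) powr (1 / real s)) * A powr (1 / real s)"
          by (intro mult_right_mono) auto
        finally show ?thesis .
      next
        assume "x \<le> L * (C + 1) * A"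
        then have "x powr (1 / real s) \<le> (L * (C + 1) * A) powr (1 / real s)" using that(1) by (intro powr_mono2) auto
        also have "\<dots> = (L * (C + 1)) powr (1 / real s) * A powr (1 / real s)" using C1 L(1) A(1) by (simp add: powr_mult)
        also have "\<dots> \<le> ((C + 1) powr (1 / real s) + (L * (C + 1)) powr (1 / real s)) * A powr (1 / real s)"
          by (intro mult_right_mono) auto
        finally show ?thesis .
      qed
      then have "D * x powr (1 / real s) \<le> D * (((C + 1) powr (1 / real s) + (L * (C + 1)) powr (1 / real s)) * A powr (1 / real s))"
        using rD(2) by (intro mult_left_mono) auto
      then show ?thesis by (simp add: CC_def algebra_simps)
    qed
    have "cdist (chain ps) E \<le> D * norm (chain ps - E) powr (1 / real s)"
      by (rule rD(3)[OF m(1,2)]) (use n A1 in linarith)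
    also have "\<dots> \<le> CC * A powr (1 / real s)" using n by (intro pw) auto
    finally have 1: "cdist (chain ps) E \<le> CC * A powr (1 / real s)" .
    have "norm (chain ps \<odot> - E - E \<odot> - E) \<le> L * (norm (chain ps - E) + norm (- E - - E))"
      by (rule L(2)) (use m in auto)
    also have "\<dots> \<le> L * ((C + 1) * A)" using n L(1) by simp
    finally have n2: "norm (chain ps \<odot> - E) \<le> L * ((C + 1) * A)" by simp
    define z where "z = chain ps \<odot> - E"
    have nz: "norm (z - 0) \<le> L * ((C + 1) * A)" using n2 by (simp add: z_def)
    have "L * ((C + 1) * A) \<le> C + 1" using mult_left_mono[OF A1(4), of "C + 1"] C1 by (simp add: mult_ac)
    then have "norm z \<le> C + 1" using nz by simp
    then have "cdist z 0 \<le> D * norm (z - 0) powr (1 / real s)"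
      using nz A1(3) C1 by (intro rD(3)) auto
    also have "\<dots> \<le> CC * A powr (1 / real s)" using nz by (intro pw) (auto simp: mult_ac)
    finally show ?thesis using 1 by (simp add: z_def)
  qed
  have scale: "\<exists>ps'. length ps' \<le> k \<and> chain ps = dil w T (chain ps') \<and> (\<Sum>p\<leftarrow>ps'. fst p) = 1 \<and>
      (\<forall>p\<in>set ps'. 0 \<le> fst p \<and> norm (snd p - E) \<le> A)"
    if T: "T > 0" and ps: "length ps \<le> k" "(\<Sum>p\<leftarrow>ps. fst p) = T"
      "\<forall>p\<in>set ps. 0 \<le> fst p \<and> snd p \<in> layer w 1 \<and> norm (snd p - E) \<le> A" for T ps E A
  proof (intro exI[of _ "map (\<lambda>p. (fst p / T, snd p)) ps"] conjI)
    let ?ps = "map (\<lambda>p. (fst p / T, snd p)) ps"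
    show "length ?ps \<le> k" using ps(1) by simp
    have "dil w T (chain ?ps) = chain (map (\<lambda>p. (T * fst p, snd p)) ?ps)"
      by (rule dil_chain) (use ps(3) in auto)
    also have "map (\<lambda>p. (T * fst p, snd p)) ?ps = ps" using T by (induction ps) auto
    finally show "chain ps = dil w T (chain ?ps)" ..
    have "(\<Sum>p\<leftarrow>?ps. fst p) = (\<Sum>p\<leftarrow>ps. fst p) / T" by (induction ps) (auto simp: add_divide_distrib)
    then show "(\<Sum>p\<leftarrow>?ps. fst p) = 1" using ps(2) T by simp
    show "\<forall>p\<in>set ?ps. 0 \<le> fst p \<and> norm (snd p - E) \<le> A" using ps(3) T by auto
  qed
  have "cdist (g (\<tau> + t)) (g \<tau> \<odot> (t *\<^sub>R E)) \<le> CC * \<bar>t\<bar> * A powr (1 / real s)"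
    if E: "E \<in> layer w 1" "norm E = 1" and A: "0 \<le> A" "A \<le> A0" and g: "close_lines k E A g" for E A g \<tau> t
  proof -
    consider "t = 0" | "t > 0" | "t < 0" by linarith
    then show ?thesis
    proof cases
      case 1
      then show ?thesis by simp
    next
      case 2
      then have "\<tau> \<le> \<tau> + t" by simp
      from close_lines_chain[OF g this] obtain ps where ps: "length ps \<le> k" "g (\<tau> + t) = g \<tau> \<odot> chain ps"
        "(\<Sum>p\<leftarrow>ps. fst p) = t" "\<forall>p\<in>set ps. 0 \<le> fst p \<and> snd p \<in> layer w 1 \<and> norm (snd p - E) \<le> A"
        by (metis add_diff_cancel_left')
      obtain ps' where ps': "length ps' \<le> k" "chain ps = dil w t (chain ps')" "(\<Sum>p\<leftarrow>ps'. fst p) = 1"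
        "\<forall>p\<in>set ps'. 0 \<le> fst p \<and> norm (snd p - E) \<le> A" using scale[OF 2 ps(1,3,4)] by blast
      have "t *\<^sub>R E = dil w t E" using E(1) by (simp add: dil_layer)
      then have "cdist (g (\<tau> + t)) (g \<tau> \<odot> (t *\<^sub>R E)) = t * cdist (chain ps') E"
        using 2 by (simp add: ps(2) ps'(2) cdist_dil)
      also have "\<dots> \<le> t * (CC * A powr (1 / real s))"
        using base[OF ps'(1) E(2) A ps'(4,3)] 2 by (intro mult_left_mono) auto
      finally show ?thesis using 2 by (simp add: mult_ac)
    next
      case 3
      define T where "T = - t"
      have T: "T > 0" using 3 by (simp add: T_def)
      have "\<tau> + t \<le> \<tau>" using 3 by simp
      from close_lines_chain[OF g this] obtain ps where ps: "length ps \<le> k" "g \<tau> = g (\<tau> + t) \<odot> chain ps"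
        "(\<Sum>p\<leftarrow>ps. fst p) = T" "\<forall>p\<in>set ps. 0 \<le> fst p \<and> snd p \<in> layer w 1 \<and> norm (snd p - E) \<le> A"
        by (auto simp: T_def)
      obtain ps' where ps': "length ps' \<le> k" "chain ps = dil w T (chain ps')" "(\<Sum>p\<leftarrow>ps'. fst p) = 1"
        "\<forall>p\<in>set ps'. 0 \<le> fst p \<and> norm (snd p - E) \<le> A" using scale[OF T ps(1,3,4)] by blast
      have "t *\<^sub>R E = dil w T (- E)" using E(1) by (simp add: dil_layer linear_neg[OF linear_dil] T_def)
      then have eq: "g \<tau> \<odot> (t *\<^sub>R E) = g (\<tau> + t) \<odot> dil w T (chain ps' \<odot> - E)"
        by (simp add: ps(2) ps'(2) dil_mult mult_assoc)
      have "cdist (g (\<tau> + t)) (g \<tau> \<odot> (t *\<^sub>R E)) = cdist 0 (dil w T (chain ps' \<odot> - E))"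
        unfolding eq using cdist_translate[of "g (\<tau> + t)" 0] by simp
      also have "\<dots> = T * cdist 0 (chain ps' \<odot> - E)" using cdist_dil[OF T, of 0] by simp
      also have "\<dots> \<le> T * (CC * A powr (1 / real s))"
        using base[OF ps'(1) E(2) A ps'(4,3)] T cdist_sym[of 0] by (intro mult_left_mono) auto
      finally show ?thesis using 3 by (simp add: T_def mult_ac)
    qed
  qed
  moreover have "CC > 0" "A0 > 0" using rD(1,2) C1 L(1) by (auto simp: CC_def A0_def intro!: add_pos_nonneg)
  ultimately show ?thesis by blast
qed

end

section \<open>A competing pair on a deformed line\<close>

text \<open>
  The lemma \<open>mean_value_maximal\<close> on \<open>{- l..l}\<close>, with a weight \<open>\<rho>\<close> that builds the further requirements
  into the condition \<open>q > \<rho> \<tau>\<close>. Here \<open>P\<close> stands for the component of the curve in the direction of the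
  line. It moves from \<open>- l\<close> to \<open>l\<close> with speed at most \<open>1 + \<mu>\<close>, so \<open>\<bar>1 - P'\<bar>\<close> has integral at most
  \<open>4 * l * \<mu>\<close>, and there is room to demand that \<open>\<bar>1 - P'\<bar>\<close> is much smaller than \<open>q\<close> at \<open>\<tau>\<close>. Values of
  \<open>\<rho>\<close> that are at least \<open>2 * \<Lambda>\<close> exclude a point altogether, as \<open>q\<close> cannot be larger; this keeps \<open>\<tau>\<close>
  away from the ends of the interval and from null sets.
\<close>
lemma steep_point_on_curve:
  fixes \<phi> P :: "real \<Rightarrow> real"
  assumes lip: "\<And>x y. \<bar>\<phi> x - \<phi> y\<bar> \<le> \<Lambda> * \<bar>x - y\<bar>" and Lam: "\<Lambda> \<le> 1"
    and P: "\<And>x y. \<bar>P x - P y\<bar> \<le> (1 + \<mu>) * \<bar>x - y\<bar>" "P l = l" "P (- l) = - l"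
    and l: "0 < l" and F: "negligible F" and z: "\<zeta> \<in> {- l..l}"
    and mu: "0 \<le> \<mu>" "\<mu> \<le> d / 10000" and d: "0 < d"
  defines "m \<equiv> (\<phi> l - \<phi> (- l)) / (2 * l)"
  assumes dev: "d * l \<le> \<bar>\<phi> \<zeta> - \<phi> (- l) - m * (\<zeta> + l)\<bar>"
  shows "\<exists>\<tau> q p. \<bar>\<tau>\<bar> \<le> l * (1 - d / 100) \<and> \<tau> \<notin> F \<and> q > d / 100 \<and> (\<phi> has_real_derivative m + q) (at \<tau>) \<and>
     (P has_real_derivative p) (at \<tau>) \<and> \<bar>1 - p\<bar> + \<mu> \<le> q / 50 \<and>
     (\<forall>y\<in>{- l..l}. \<bar>\<phi> y - \<phi> \<tau> - m * (y - \<tau>)\<bar> \<le> 4 * sqrt (q * (2 * \<Lambda>)) * \<bar>y - \<tau>\<bar>)"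
proof -
  have L0: "\<Lambda> \<ge> 0" using lip[of 0 1] by simp
  obtain DP where DP: "lip_deriv (1 + \<mu>) P DP" using lip_deriv_exists[OF P(1)] by blast
  define F' where "F' = F \<union> {x. \<not> (P has_real_derivative DP x) (at x)}"
  have F': "negligible F'" unfolding F'_def using F DP by (auto simp: lip_deriv_def intro: negligible_Un)
  have DPle: "DP x \<le> 1 + \<mu>" for x using DP unfolding lip_deriv_def by (metis abs_le_D1)
  have iDP: "DP absolutely_integrable_on {- l..l}" by (rule lip_deriv_absolutely_integrable[OF DP])
  have ll: "- l \<le> l" using l by simp
  define r1 where "r1 = (\<lambda>x. \<bar>1 - DP x\<bar>)"
  have "(\<lambda>x. 1 - DP x) absolutely_integrable_on {- l..l}"
    by (intro set_integral_diff(1) absolutely_integrable_on_const iDP) auto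
  then have ir1: "r1 integrable_on {- l..l}" unfolding r1_def by (simp add: absolutely_integrable_on_def)
  have "((\<lambda>x. 1 - DP x + 2 * \<mu>) has_integral (2 * l - (P l - P (- l)) + 2 * l * (2 * \<mu>))) {- l..l}"
  proof (intro has_integral_add has_integral_diff lip_deriv_has_integral[OF DP ll])
    show "((\<lambda>x. 1) has_integral 2 * l) {- l..l}" using has_integral_const_real[of "1::real" "- l" l] l by simp
    show "((\<lambda>x. 2 * \<mu>) has_integral 2 * l * (2 * \<mu>)) {- l..l}" using has_integral_const_real[of "2 * \<mu>" "- l" l] l by simp
  qed
  then have i2: "((\<lambda>x. 1 - DP x + 2 * \<mu>) has_integral 4 * l * \<mu>) {- l..l}" using P(2,3) by (simp add: mult.assoc)
  have r1le: "integral {- l..l} r1 \<le> 4 * l * \<mu>"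
  proof (rule has_integral_le[OF integrable_integral[OF ir1] i2])
    fix x show "r1 x \<le> 1 - DP x + 2 * \<mu>" using DPle[of x] mu by (simp add: r1_def)
  qed
  have m: "\<bar>m\<bar> \<le> \<Lambda>" using lip[of l "- l"] l by (simp add: m_def abs_divide pos_divide_le_eq)
  have "\<bar>\<phi> \<zeta> - \<phi> (- l) - m * (\<zeta> + l)\<bar> \<le> \<bar>\<phi> \<zeta> - \<phi> (- l)\<bar> + \<bar>m\<bar> * \<bar>\<zeta> + l\<bar>"
    by (metis abs_mult abs_triangle_ineq4)
  also have "\<dots> \<le> \<Lambda> * \<bar>\<zeta> + l\<bar> + \<Lambda> * \<bar>\<zeta> + l\<bar>"
    using lip[of \<zeta> "- l"] m by (intro add_mono mult_right_mono) auto
  also have "\<dots> = 2 * \<Lambda> * \<bar>\<zeta> + l\<bar>" by simp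
  also have "\<dots> \<le> 2 * 1 * (2 * l)" using Lam L0 z l by (intro mult_mono) auto
  finally have "d * l \<le> 4 * l" using dev by simp
  then have d4: "d \<le> 4" using l by simp
  define a where "a = l * (1 - d / 100)"
  have a: "0 \<le> a" "a \<le> l" "l - a = l * d / 100" using d4 d l by (auto simp: a_def algebra_simps)
  have ind: "((\<lambda>x. indicator {a..b} x :: real) has_integral (b - a)) {- l..l}" if "- l \<le> a" "a \<le> b" "b \<le> l" for a b
  proof (rule has_integral_on_superset)
    show "((\<lambda>x. indicator {a..b} x :: real) has_integral (b - a)) {a..b}"
      by (rule has_integral_eq[of _ "\<lambda>_. 1"])
         (use has_integral_const_real[of "1::real" a b] that in \<open>simp_all\<close>)
  qed (use that in auto)
  \<comment> \<open>The three summands ensure, in this order: a slope of order \<open>d\<close>, a speed close to 1, and a distance of at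
      least \<open>l * d / 100\<close> from the ends of the interval.\<close>
  define \<rho> where "\<rho> = (\<lambda>x. d / 100 + 50 * (r1 x + \<mu>) + (2 * \<Lambda> * indicator {- l..- a} x + 2 * \<Lambda> * indicator {a..l} x))"
  define c where "c = 2 * l * (d / 100) + 50 * (integral {- l..l} r1 + 2 * l * \<mu>) + (2 * \<Lambda> * (l - a) + 2 * \<Lambda> * (l - a))"
  have hi: "(\<rho> has_integral c) {- l..l}"
    unfolding \<rho>_def c_def
  proof (intro has_integral_add has_integral_mult_right integrable_integral ir1)
    show "((\<lambda>x. d / 100) has_integral 2 * l * (d / 100)) {- l..l}"
      using has_integral_const_real[of "d / 100" "- l" l] l by simp
    show "((\<lambda>x. \<mu>) has_integral 2 * l * \<mu>) {- l..l}"
      using has_integral_const_real[of \<mu> "- l" l] l by simp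
    show "(indicat_real {- l..- a} has_integral (l - a)) {- l..l}" using ind[of "- l" "- a"] a(1,2) l by simp
    show "(indicat_real {a..l} has_integral (l - a)) {- l..l}" using ind[of a l] a(1,2) l by simp
  qed
  \<comment> \<open>Changing \<open>\<rho>\<close> on a null set excludes that set.\<close>
  define \<rho>' where "\<rho>' = (\<lambda>x. if x \<in> F' then \<rho> x + 2 * \<Lambda> else \<rho> x)"
  have hi': "(\<rho>' has_integral c) {- l..l}"
    using hi by (rule has_integral_spike[OF F', rotated]) (simp add: \<rho>'_def)
  have rho0: "\<rho> x \<ge> d / 100" for x using mu(1) L0 by (simp add: \<rho>_def r1_def)
  have rho'0: "\<rho>' x \<ge> \<rho> x" for x using L0 by (simp add: \<rho>'_def)
  have c: "4 * c < d * l"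
  proof -
    have "c \<le> 2 * l * (d / 100) + 50 * (4 * l * \<mu> + 2 * l * \<mu>) + (2 * 1 * (l - a) + 2 * 1 * (l - a))"
      unfolding c_def using r1le Lam a by (intro add_mono mult_left_mono mult_right_mono) auto
    also have "\<dots> = l * d / 50 + 300 * (l * \<mu>) + 4 * (l * d / 100)" unfolding a(3) by (simp add: algebra_simps)
    also have "\<dots> \<le> l * d / 50 + 300 * (l * (d / 10000)) + 4 * (l * d / 100)"
      using mu l by (intro add_mono mult_left_mono) auto
    also have "\<dots> = 9 / 100 * (d * l)" by (simp add: algebra_simps)
    finally show ?thesis using mult_pos_pos[OF d l] by linarith
  qed
  have fold_m: "(\<phi> l - \<phi> (- l)) / (l - - l) = m" by (simp add: m_def)
  have "\<exists>x\<in>{- l<..<l}. \<exists>q>\<rho>' x. (\<phi> has_real_derivative m + q) (at x) \<and>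
           (\<forall>y\<in>{- l..l}. \<bar>\<phi> y - \<phi> x - m * (y - x)\<bar> \<le> 4 * sqrt (q * (2 * \<Lambda>)) * \<bar>y - x\<bar>)"
  proof (rule mean_value_maximal[of \<phi> \<Lambda> "- l" l \<zeta> \<rho>', unfolded fold_m])
    show "- l < l" using l by simp
    show "\<rho>' integrable_on {- l..l}" using hi' by (rule has_integral_integrable)
    show "0 \<le> \<rho>' x" for x using rho0[of x] rho'0[of x] d by simp
    show "4 * integral {- l..l} \<rho>' < \<bar>\<phi> \<zeta> - \<phi> (- l) - m * (\<zeta> - - l)\<bar>"
      using c dev integral_unique[OF hi'] by simp
  qed (use lip z in auto)
  then obtain x q where x: "x \<in> {- l<..<l}" "q > \<rho>' x" "(\<phi> has_real_derivative m + q) (at x)"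
    "\<forall>y\<in>{- l..l}. \<bar>\<phi> y - \<phi> x - m * (y - x)\<bar> \<le> 4 * sqrt (q * (2 * \<Lambda>)) * \<bar>y - x\<bar>" by blast
  have "\<bar>m + q\<bar> \<le> \<Lambda>" by (rule lipschitz_derivative_bound[OF lip x(3)])
  then have q2: "q \<le> 2 * \<Lambda>" using m by simp
  have xF: "x \<notin> F'" using x(2) q2 rho0[of x] d by (auto simp: \<rho>'_def)
  then have qr: "q > \<rho> x" using x(2) by (simp add: \<rho>'_def)
  have rn: "r1 x \<ge> 0" by (simp add: r1_def)
  have xa: "\<bar>x\<bar> \<le> a"
  proof (rule ccontr)
    assume "\<not> \<bar>x\<bar> \<le> a"
    then have "x \<in> {- l..- a} \<or> x \<in> {a..l}" using x(1) by auto
    then have "\<rho> x \<ge> 2 * \<Lambda>" using L0 d mu rn by (auto simp: \<rho>_def indicator_def)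
    then show False using qr q2 by simp
  qed
  have "2 * \<Lambda> * indicator {- l..- a} x + 2 * \<Lambda> * indicator {a..l} x \<ge> 0" using L0 by simp
  then have "50 * (r1 x + \<mu>) \<le> q" "d / 100 < q"
    using qr d rho0[of x] unfolding \<rho>_def by linarith+
  then have "\<bar>1 - DP x\<bar> + \<mu> \<le> q / 50" by (simp add: r1_def)
  moreover have "x \<notin> F" "(P has_real_derivative DP x) (at x)" using xF by (auto simp: F'_def)
  ultimately show ?thesis using xa x(3,4) \<open>d / 100 < q\<close> unfolding a_def by blast
qed

lemma abs_sum7_le:
  fixes X1 X2 X3 X4 X5 X6 X7 :: real
  assumes "\<bar>X1\<bar> \<le> e1" "\<bar>X2\<bar> \<le> e2" "\<bar>X3\<bar> \<le> e3" "\<bar>X4\<bar> \<le> e4" "\<bar>X5\<bar> \<le> e5" "\<bar>X6\<bar> \<le> e6" "\<bar>X7\<bar> \<le> e7"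
  shows "\<bar>X1 + X2 + X3 - X4 - X5 + X6 - X7\<bar> \<le> e1 + e2 + e3 + e4 + e5 + e6 + e7"
  by (rule abs_leI) (use assms[THEN abs_le_D1] assms[THEN abs_le_D2] in linarith)+

context carnot
begin

lemma inner_layer: "E \<in> layer w 1 \<Longrightarrow> x \<bullet> E = hproj w x \<bullet> E"
proof -
  assume "E \<in> layer w 1"
  then have E: "hproj w E = E" by (rule hproj_layer)
  have "x \<bullet> hproj w E = hproj w x \<bullet> hproj w E"
    unfolding inner_vec_def by (rule sum.cong) (auto simp: hproj_def)
  then show ?thesis by (simp add: E)
qed

lemma inner_mult: "E \<in> layer w 1 \<Longrightarrow> (x \<odot> y) \<bullet> E = x \<bullet> E + y \<bullet> E"
  using inner_layer[of E "x \<odot> y"] inner_layer[of E x] inner_layer[of E y] by (simp add: hproj_mult inner_add_left)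

lemma cdist_line_points:
  assumes "E \<in> layer w 1" "norm E = 1"
  shows "cdist (x \<odot> (a *\<^sub>R E)) (x \<odot> (b *\<^sub>R E)) \<le> \<bar>a - b\<bar>"
proof -
  have "cdist (a *\<^sub>R E) (a *\<^sub>R E \<odot> ((b - a) *\<^sub>R E)) \<le> norm ((b - a) *\<^sub>R E)"
    by (rule cdist_line[OF subspace_scale[OF subspace_layer assms(1)]])
  then show ?thesis using assms(2) by (simp add: lines abs_minus_commute)
qed

lemma dir_deriv_along_curve:
  fixes f :: "real ^ 'n \<Rightarrow> real"
  assumes der: "((\<lambda>t. f (z \<odot> g t)) has_real_derivative c) (at \<tau>)"
    and r: "r > 0" "\<And>h. \<bar>h\<bar> < r \<Longrightarrow> g (\<tau> + h) = g \<tau> \<odot> (h *\<^sub>R V)" and v: "norm V > 0"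
  shows "has_dir_deriv G f (V /\<^sub>R norm V) (z \<odot> g \<tau>) (c / norm V)"
proof -
  define v where "v = norm V"
  have v0: "v > 0" using v by (simp add: v_def)
  have "((\<lambda>t. \<tau> + t / v) has_real_derivative 1 / v) (at 0)"
    using v0 by (auto intro!: derivative_eq_intros)
  moreover have "((\<lambda>t. f (z \<odot> g t)) has_real_derivative c) (at (\<tau> + 0 / v))" using der by simp
  ultimately have "((\<lambda>t. f (z \<odot> g (\<tau> + t / v))) has_real_derivative c * (1 / v)) (at 0)"
    by (rule DERIV_chain2[rotated])
  then have "(\<lambda>t. (f (z \<odot> g (\<tau> + (0 + t) / v)) - f (z \<odot> g (\<tau> + 0 / v))) / t) \<midarrow>0\<rightarrow> c * (1 / v)"
    unfolding DERIV_def .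
  then have lim: "((\<lambda>t. (f (z \<odot> g (\<tau> + t / v)) - f (z \<odot> g \<tau>)) / t) \<longlongrightarrow> c / v) (at 0)" by simp
  have "\<forall>\<^sub>F t in at 0. \<bar>t\<bar> < r * v"
    unfolding eventually_at using r(1) v0 by (intro exI[of _ "r * v"]) (simp add: dist_real_def)
  then have "\<forall>\<^sub>F t in at 0. (f (z \<odot> g (\<tau> + t / v)) - f (z \<odot> g \<tau>)) / t
      = (f (z \<odot> g \<tau> \<odot> (t *\<^sub>R (V /\<^sub>R norm V))) - f (z \<odot> g \<tau>)) / t"
  proof eventually_elim
    case (elim t)
    have "\<bar>t / v\<bar> < r" using elim v0 by (simp add: abs_divide pos_divide_less_eq)
    from r(2)[OF this] have "g (\<tau> + t / v) = g \<tau> \<odot> (t *\<^sub>R (V /\<^sub>R norm V))"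
      by (simp add: v_def divide_inverse)
    then show ?case by (simp add: mult_assoc)
  qed
  from Lim_transform_eventually[OF lim this] show ?thesis
    unfolding has_dir_deriv_def v_def .
qed

lemma has_dir_deriv_bound:
  assumes f: "\<And>x y. \<bar>f x - f y\<bar> \<le> L * cdist x y" and L: "0 \<le> L" and E: "E \<in> layer w 1" "norm E = 1"
    and D: "has_dir_deriv G f E x D"
  shows "\<bar>D\<bar> \<le> L"
proof -
  have "((\<lambda>t. \<bar>(f (x \<odot> (t *\<^sub>R E)) - f x) / t\<bar>) \<longlongrightarrow> \<bar>D\<bar>) (at 0)"
    using D unfolding has_dir_deriv_def by (rule tendsto_rabs)
  moreover have "\<forall>\<^sub>F t in at (0::real). \<bar>(f (x \<odot> (t *\<^sub>R E)) - f x) / t\<bar> \<le> L"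
    using eventually_neq_at_within[of 0 0 UNIV]
  proof eventually_elim
    case (elim t)
    have "\<bar>f (x \<odot> (t *\<^sub>R E)) - f x\<bar> \<le> L * cdist (x \<odot> (t *\<^sub>R E)) x" by (rule f)
    also have "\<dots> \<le> L * \<bar>t\<bar>" using cdist_line_points[OF E, of x t 0] L by (intro mult_left_mono) auto
    finally show ?case using elim by (simp add: abs_divide divide_le_eq)
  qed
  ultimately show ?thesis by (rule tendsto_upperbound[OF _ _ trivial_limit_at])
qed

text \<open>
  The function \<open>\<phi>\<close> is \<open>f\<close> along the translated curve, and \<open>\<psi>\<close> is \<open>f\<close> along the line through \<open>x0\<close>. Outside
  \<open>{- l..l}\<close> they differ by at most \<open>\<theta>\<close>, so that the average slope \<open>mh\<close> of \<open>\<phi>\<close> over \<open>{- l..l}\<close> is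
  within \<open>2 * \<sigma>\<close> of \<open>m\<close>, and the hypothesis on \<open>\<zeta>\<close> provides a steep point \<open>\<tau>\<close> with excess slope \<open>q\<close>.
  Near \<open>\<tau>\<close> the curve is a line with direction \<open>V\<close>. Its length differs from 1 by at most \<open>q / 50\<close>, so the
  derivative \<open>D\<close> in the direction \<open>E' = V /\<^sub>R norm V\<close> still exceeds \<open>m\<close> by almost \<open>q\<close>.

  In the inequality between increments the constant 6 is spent as follows. Let \<open>B\<close> be the power of
  \<open>(D - m) * Lf\<close> on the right-hand side; it is at least \<open>\<beta>\<close>. Replacing the line through \<open>z \<odot> g \<tau>\<close> in the
  direction \<open>E0\<close> by the curve costs \<open>\<beta> / 10\<close> per unit of time, the difference quotients of \<open>\<phi>\<close> at \<open>\<tau>\<close>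
  cost \<open>58 / 10 * B\<close>, and all remaining errors together cost \<open>\<beta> / 10\<close>.
\<close>
lemma competitor_on_curve:
  fixes f :: "real ^ 'n \<Rightarrow> real" and g :: "real \<Rightarrow> real ^ 'n"
  assumes f: "\<And>x y. \<bar>f x - f y\<bar> \<le> Lf * cdist x y" and Lf: "0 < Lf" "Lf \<le> 1 / 2"
    and E: "E \<in> layer w 1" "norm E = 1" and E0: "E0 \<in> layer w 1" "norm E0 = 1" and l: "0 < l"
    and glip: "\<And>t t'. cdist (g t) (g t') \<le> (1 + \<mu>) * \<bar>t - t'\<bar>"
    and F: "negligible F"
    and slope: "\<And>\<tau>. \<tau> \<notin> F \<Longrightarrow> \<exists>V\<in>layer w 1. norm (V - E) \<le> 1 / 2 \<and> (\<exists>r>0. \<forall>h. \<bar>h\<bar> < r \<longrightarrow> g (\<tau> + h) = g \<tau> \<odot> (h *\<^sub>R V))"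
    and gout: "\<And>t. l \<le> \<bar>t\<bar> \<Longrightarrow> g t = t *\<^sub>R E"
    and gcls: "\<And>\<tau> t. Lf * cdist (g (\<tau> + t)) (g \<tau> \<odot> (t *\<^sub>R E0)) \<le> \<beta> / 10 * \<bar>t\<bar>"
    and psi: "\<And>t. \<bar>t\<bar> \<le> R \<Longrightarrow> \<bar>f (x0 \<odot> (t *\<^sub>R E0)) - f x0 - m * t\<bar> \<le> \<sigma> * \<bar>t\<bar>"
    and near: "\<And>T. \<bar>T\<bar> \<le> 2 \<Longrightarrow> cdist (z \<odot> (T *\<^sub>R E)) (x0 \<odot> (T *\<^sub>R E0)) \<le> \<theta>"
    and zeta: "\<zeta> \<in> {- l..l}" and dev: "2 * d * l \<le> \<bar>f (z \<odot> g \<zeta>) - f x0 - m * \<zeta>\<bar>"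
    and m: "\<bar>m\<bar> \<le> Lf"
    and d: "0 < d" "d \<le> 1" and mu: "0 \<le> \<mu>" "\<mu> \<le> d / 10000" and sig: "0 < \<sigma>" "\<sigma> \<le> d / 20000"
    and theta: "0 \<le> \<theta>" "\<theta> \<le> \<sigma> * (d / 100) * l" and R: "0 < R" "R \<le> 1" "4 * l \<le> R"
    and beta: "0 < \<beta>" "\<beta> \<le> (97 / 10000 * d * Lf) powr (1 / (2 * (real s)\<^sup>2))"
    and sb: "\<sigma> * (6 + 200 / d) \<le> \<beta> / 10" and lb: "120 * l \<le> \<beta> * R"
  shows "\<exists>\<tau> E' D. \<bar>\<tau>\<bar> \<le> l \<and> E' \<in> layer w 1 \<and> norm E' = 1 \<and> has_dir_deriv G f E' (z \<odot> g \<tau>) D \<and> D - m \<ge> 97 / 10000 * d \<and>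
     (\<forall>t. \<bar>t\<bar> < 1 \<longrightarrow> \<bar>(f (z \<odot> g \<tau> \<odot> (t *\<^sub>R E0)) - f (z \<odot> g \<tau>)) - (f (x0 \<odot> (t *\<^sub>R E0)) - f x0)\<bar>
        \<le> 6 * \<bar>t\<bar> * ((D - m) * Lf) powr (1 / (2 * (real s)\<^sup>2)))"
proof -
  define \<phi> where "\<phi> = (\<lambda>t. f (z \<odot> g t))"
  define \<psi> where "\<psi> = (\<lambda>t. f (x0 \<odot> (t *\<^sub>R E0)))"
  define \<Lambda> where "\<Lambda> = Lf * (1 + \<mu>)"
  have mu1: "\<mu> \<le> 1 / 10000" using mu d by linarith
  have Lam: "\<Lambda> \<le> 1"
  proof -
    have "\<Lambda> \<le> 1 / 2 * (1 + 1 / 10000)" unfolding \<Lambda>_def using Lf mu mu1 by (intro mult_mono) auto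
    then show ?thesis by simp
  qed
  have lipphi: "\<bar>\<phi> x - \<phi> y\<bar> \<le> \<Lambda> * \<bar>x - y\<bar>" for x y
  proof -
    have "\<bar>\<phi> x - \<phi> y\<bar> \<le> Lf * cdist (g x) (g y)" unfolding \<phi>_def using f[of "z \<odot> g x" "z \<odot> g y"] by simp
    also have "\<dots> \<le> Lf * ((1 + \<mu>) * \<bar>x - y\<bar>)" using Lf by (intro mult_left_mono glip) auto
    finally show ?thesis by (simp add: \<Lambda>_def)
  qed
  have lippsi: "\<bar>\<psi> a - \<psi> b\<bar> \<le> 1 / 2 * \<bar>a - b\<bar>" for a b
  proof -
    have "\<bar>\<psi> a - \<psi> b\<bar> \<le> Lf * cdist (x0 \<odot> (a *\<^sub>R E0)) (x0 \<odot> (b *\<^sub>R E0))" unfolding \<psi>_def by (rule f)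
    also have "\<dots> \<le> 1 / 2 * \<bar>a - b\<bar>" using Lf by (intro mult_mono cdist_line_points E0) auto
    finally show ?thesis .
  qed
  have psi0: "\<psi> 0 = f x0" by (simp add: \<psi>_def)
  have psi': "\<bar>\<psi> t - f x0 - m * t\<bar> \<le> \<sigma> * \<bar>t\<bar>" if "\<bar>t\<bar> \<le> R" for t using psi[OF that] by (simp add: \<psi>_def)
  have th_l: "\<theta> \<le> \<sigma> * l"
  proof -
    have "\<sigma> * (d / 100) * l \<le> \<sigma> * 1 * l" using sig d l by (intro mult_right_mono mult_left_mono) auto
    then show ?thesis using theta by simp
  qed
  have sig1: "\<sigma> \<le> 1" using sig d by linarith
  have th_l1: "\<theta> \<le> l" using th_l mult_right_mono[OF sig1 less_imp_le[OF l]] by linarith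
  have out: "\<bar>\<phi> t - \<psi> t\<bar> \<le> \<theta>" if "l \<le> \<bar>t\<bar>" "\<bar>t\<bar> \<le> 2" for t
  proof -
    have "\<bar>\<phi> t - \<psi> t\<bar> \<le> Lf * cdist (z \<odot> (t *\<^sub>R E)) (x0 \<odot> (t *\<^sub>R E0))"
      unfolding \<phi>_def \<psi>_def gout[OF that(1)] by (rule f)
    also have "\<dots> \<le> 1 * \<theta>" using Lf near[OF that(2)] by (intro mult_mono) auto
    finally show ?thesis by simp
  qed
  define mh where "mh = (\<phi> l - \<phi> (- l)) / (2 * l)"
  have lR: "\<bar>l\<bar> \<le> R" "\<bar>- l\<bar> \<le> R" "\<bar>l\<bar> \<le> 2" "\<bar>- l\<bar> \<le> 2" using l R by auto
  have outl: "\<bar>\<phi> l - \<psi> l\<bar> \<le> \<theta>" "\<bar>\<phi> (- l) - \<psi> (- l)\<bar> \<le> \<theta>" using out[of l] out[of "- l"] lR l by auto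
  have psil: "\<bar>\<psi> l - f x0 - m * l\<bar> \<le> \<sigma> * l" "\<bar>\<psi> (- l) - f x0 + m * l\<bar> \<le> \<sigma> * l"
    using psi'[OF lR(1)] psi'[OF lR(2)] l by auto
  have mhm: "\<bar>mh - m\<bar> \<le> 2 * \<sigma>"
  proof -
    have "\<bar>\<phi> l - \<phi> (- l) - 2 * (m * l)\<bar> \<le> 4 * (\<sigma> * l)" using outl psil th_l by linarith
    moreover have "mh - m = (\<phi> l - \<phi> (- l) - 2 * (m * l)) / (2 * l)" using l by (simp add: mh_def field_simps)
    ultimately show ?thesis using l by (simp add: abs_divide pos_divide_le_eq)
  qed
  define P where "P = (\<lambda>t. g t \<bullet> E)"
  have P1: "\<bar>P x - P y\<bar> \<le> (1 + \<mu>) * \<bar>x - y\<bar>" for x y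
  proof -
    have "\<bar>P x - P y\<bar> = \<bar>(hproj w (g x) - hproj w (g y)) \<bullet> E\<bar>"
      unfolding P_def using inner_layer[OF E(1), of "g x"] inner_layer[OF E(1), of "g y"] by (simp add: inner_diff_left)
    also have "\<dots> \<le> norm (hproj w (g x) - hproj w (g y)) * norm E" by (rule Cauchy_Schwarz_ineq2)
    also have "\<dots> \<le> cdist (g x) (g y)" using hproj_cdist[of "g y" "g x"] E(2) by (simp add: norm_minus_commute)
    also have "\<dots> \<le> (1 + \<mu>) * \<bar>x - y\<bar>" by (rule glip)
    finally show ?thesis .
  qed
  have EE: "E \<bullet> E = 1" using E(2) by (simp add: dot_square_norm)
  have P2: "P l = l" "P (- l) = - l" using gout[of l] gout[of "- l"] l EE by (auto simp: P_def)
  have dev': "d * l \<le> \<bar>\<phi> \<zeta> - \<phi> (- l) - mh * (\<zeta> + l)\<bar>"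
  proof -
    have "\<bar>(mh - m) * (\<zeta> + l)\<bar> \<le> 2 * \<sigma> * (2 * l)"
      unfolding abs_mult using mhm zeta sig by (intro mult_mono) auto
    moreover have "\<bar>\<phi> \<zeta> - f x0 - m * \<zeta>\<bar> \<ge> 2 * (d * l)" using dev by (simp add: \<phi>_def mult.assoc)
    moreover have "\<phi> \<zeta> - f x0 - m * \<zeta> = (\<phi> \<zeta> - \<phi> (- l) - mh * (\<zeta> + l)) + (\<phi> (- l) - \<psi> (- l)) + (\<psi> (- l) - f x0 + m * l) + (mh - m) * (\<zeta> + l)"
      by (simp add: algebra_simps)
    moreover have "6 * (\<sigma> * l) \<le> d * l" using sig d l mult_right_mono[of "6 * \<sigma>" d l] by simp
    ultimately show ?thesis using outl(2) psil(2) th_l by linarith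
  qed
  obtain \<tau> q p where tau: "\<bar>\<tau>\<bar> \<le> l * (1 - d / 100)" "\<tau> \<notin> F" and q: "q > d / 100"
    and der: "(\<phi> has_real_derivative mh + q) (at \<tau>)" and p: "(P has_real_derivative p) (at \<tau>)" "\<bar>1 - p\<bar> + \<mu> \<le> q / 50"
    and chord: "\<And>y. y \<in> {- l..l} \<Longrightarrow> \<bar>\<phi> y - \<phi> \<tau> - mh * (y - \<tau>)\<bar> \<le> 4 * sqrt (q * (2 * \<Lambda>)) * \<bar>y - \<tau>\<bar>"
    using steep_point_on_curve[OF lipphi Lam P1 P2 l F zeta mu d(1) dev'[unfolded mh_def]] unfolding mh_def by blast
  obtain V r where V: "V \<in> layer w 1" "norm (V - E) \<le> 1 / 2" and r: "r > 0" "\<And>h. \<bar>h\<bar> < r \<Longrightarrow> g (\<tau> + h) = g \<tau> \<odot> (h *\<^sub>R V)"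
    using slope[OF tau(2)] by blast
  define v where "v = norm V"
  have pV: "p = V \<bullet> E"
  proof -
    have d1: "((\<lambda>h. P \<tau> + h * (V \<bullet> E)) has_real_derivative V \<bullet> E) (at 0)" by (auto intro!: derivative_eq_intros)
    have ev: "\<forall>\<^sub>F h in nhds 0. P \<tau> + h * (V \<bullet> E) = P (\<tau> + h)"
    proof (rule eventually_nhds_in_open[THEN eventually_mono])
      show "open {- r<..<r}" "0 \<in> {- r<..<r}" using r(1) by auto
      fix h assume "h \<in> {- r<..<r}"
      then have "g (\<tau> + h) = g \<tau> \<odot> (h *\<^sub>R V)" by (intro r(2)) auto
      then show "P \<tau> + h * (V \<bullet> E) = P (\<tau> + h)" by (simp add: P_def inner_mult[OF E(1)])
    qed
    have "((\<lambda>h. P (\<tau> + h)) has_real_derivative V \<bullet> E) (at 0)"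
      using d1 unfolding DERIV_cong_ev[OF refl ev refl] .
    then have "(P has_real_derivative V \<bullet> E) (at \<tau>)" using DERIV_shift[of P "V \<bullet> E" 0 \<tau>] by (simp add: add.commute)
    then show ?thesis using p(1) DERIV_unique by blast
  qed
  \<comment> \<open>The upper bound for the length of \<open>V\<close> comes from the Lipschitz constant of the curve; the lower bound
      \<open>p \<le> v\<close> below from the component in the direction \<open>E\<close>.\<close>
  have v1: "v \<le> 1 + \<mu>"
  proof -
    have "\<bar>r / 2\<bar> < r" using r(1) by simp
    from r(2)[OF this] have "hproj w (g (\<tau> + r / 2)) - hproj w (g \<tau>) = (r / 2) *\<^sub>R V"
      using hproj_layer[OF V(1)] by (simp add: hproj_mult linear_cmul[OF linear_hproj])
    then have "r / 2 * v \<le> cdist (g \<tau>) (g (\<tau> + r / 2))" using hproj_cdist[of "g (\<tau> + r / 2)" "g \<tau>"] r(1) by (simp add: v_def)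
    also have "\<dots> \<le> (1 + \<mu>) * (r / 2)" using glip[of \<tau> "\<tau> + r / 2"] r(1) by simp
    finally show ?thesis using r(1) by simp
  qed
  have v0: "v > 0"
  proof -
    have "1 \<le> norm (E - V) + norm V" using norm_triangle_ineq[of "E - V" V] E(2) by simp
    then show ?thesis unfolding v_def using V(2) norm_minus_commute[of E V] by linarith
  qed
  have pv: "p \<le> v" using norm_cauchy_schwarz[of V E] E(2) by (simp add: pV v_def)
  have v50: "\<bar>1 - v\<bar> \<le> q / 50" using v1 pv p(2) mu by linarith
  define D where "D = (mh + q) / v"
  define E' where "E' = V /\<^sub>R v"
  have E': "E' \<in> layer w 1" "norm E' = 1"
    using subspace_scale[OF subspace_layer V(1)] v0 by (auto simp: E'_def v_def)
  have dd: "has_dir_deriv G f E' (z \<odot> g \<tau>) D"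
    unfolding E'_def D_def v_def
    by (rule dir_deriv_along_curve[OF der[unfolded \<phi>_def] r]) (use v0 in \<open>simp_all add: v_def\<close>)
  have q0: "q > 0" using q d by simp
  have Dm: "D - m \<ge> 97 / 100 * q"
  proof -
    have "\<bar>m * (1 - v)\<bar> \<le> 1 / 2 * (q / 50)" unfolding abs_mult using m Lf v50 by (intro mult_mono) auto
    moreover have "mh + q - m * v = (mh - m) + m * (1 - v) + q" by (simp add: algebra_simps)
    ultimately have N: "mh + q - m * v \<ge> 98 / 100 * q"
      using mhm sig q by linarith
    have "97 / 100 * q * v \<le> 97 / 100 * q * (1 + 1 / 10000)" using v1 mu1 q0 by (intro mult_left_mono) auto
    also have "\<dots> \<le> 98 / 100 * q" using q0 by simp
    finally have "97 / 100 * q * v \<le> mh + q - m * v" using N by simp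
    then have "97 / 100 * q \<le> (mh + q - m * v) / v" using v0 by (simp add: pos_le_divide_eq)
    also have "\<dots> = D - m" using v0 by (simp add: D_def diff_divide_distrib)
    finally show ?thesis .
  qed
  define Q where "Q = (D - m) * Lf"
  define ex where "ex = 1 / (2 * (real s)\<^sup>2)"
  have s2: "1 \<le> (real s)\<^sup>2" using step_pos by simp
  have "(real s)\<^sup>2 > 0" using s2 by linarith
  then have ex: "0 < ex" "ex \<le> 1 / 2" using s2 unfolding ex_def by (auto simp: divide_le_eq)
  have Q0: "Q \<ge> 97 / 100 * q * Lf" using Dm Lf by (simp add: Q_def)
  have Qd: "Q \<ge> 97 / 10000 * d * Lf"
  proof -
    have "97 / 10000 * d * Lf \<le> 97 / 100 * q * Lf" using q Lf by (intro mult_right_mono) auto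
    then show ?thesis using Q0 by (rule order_trans)
  qed
  have "97 / 10000 * d * Lf > 0" using d Lf by simp
  then have Qpos: "Q > 0" using Qd by (rule order.strict_trans2)
  have "\<bar>D\<bar> \<le> Lf" by (rule has_dir_deriv_bound[OF f _ E' dd]) (use Lf in simp)
  then have "D - m \<le> 1" using m Lf by linarith
  then have Q1: "Q \<le> 1" unfolding Q_def using mult_mono[of "D - m" 1 Lf 1] Lf by simp
  define B where "B = Q powr ex"
  have B0: "B > 0" using Qpos by (simp add: B_def)
  have sqB: "sqrt Q \<le> B"
  proof -
    have "sqrt Q = Q powr (1 / 2)" using Qpos by (simp add: powr_half_sqrt)
    also have "\<dots> \<le> Q powr ex" using ex(2) less_imp_le[OF Qpos] Q1 by (rule powr_mono')
    finally show ?thesis unfolding B_def .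
  qed
  have bB: "\<beta> \<le> B"
  proof -
    have "(97 / 10000 * d * Lf) powr ex \<le> Q powr ex"
      by (rule powr_mono2[OF less_imp_le[OF ex(1)] _ Qd]) (use d Lf in simp)
    with beta(2)[folded ex_def] show ?thesis unfolding B_def by (rule order_trans)
  qed
  have chordB: "\<bar>\<phi> y - \<phi> \<tau> - mh * (y - \<tau>)\<bar> \<le> 58 / 10 * B * \<bar>y - \<tau>\<bar>" if "y \<in> {- l..l}" for y
  proof -
    have "16 * (q * (2 * \<Lambda>)) \<le> (58 / 10)\<^sup>2 * Q"
    proof -
      have "16 * (q * (2 * \<Lambda>)) = 32 * (q * Lf) * (1 + \<mu>)" by (simp add: \<Lambda>_def)
      also have "\<dots> \<le> 32 * (q * Lf) * (1 + 1 / 10000)"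
        using mult_pos_pos[OF q0 Lf(1)] mu1 by (intro mult_left_mono) linarith+
      also have "\<dots> = 320032 / 10000 * (q * Lf)" by simp
      also have "\<dots> \<le> 326308 / 10000 * (q * Lf)" using mult_pos_pos[OF q0 Lf(1)] by (intro mult_right_mono) linarith+
      also have "\<dots> = (58 / 10)\<^sup>2 * (97 / 100 * q * Lf)" by (simp add: power2_eq_square)
      also have "\<dots> \<le> (58 / 10)\<^sup>2 * Q" using Q0 by (intro mult_left_mono) auto
      finally show ?thesis .
    qed
    then have le: "sqrt (16 * (q * (2 * \<Lambda>))) \<le> sqrt ((58 / 10)\<^sup>2 * Q)" by (rule real_sqrt_le_mono)
    have "sqrt 16 = (4::real)" "sqrt ((58 / 10)\<^sup>2) = (58 / 10 :: real)"
      by (rule real_sqrt_unique; simp)+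
    then have "4 * sqrt (q * (2 * \<Lambda>)) \<le> 58 / 10 * sqrt Q"
      using le unfolding real_sqrt_mult[of 16] real_sqrt_mult[of "(58 / 10)\<^sup>2"] by (simp only:)
    also have "\<dots> \<le> 58 / 10 * B" using sqB by simp
    finally have "4 * sqrt (q * (2 * \<Lambda>)) * \<bar>y - \<tau>\<bar> \<le> 58 / 10 * B * \<bar>y - \<tau>\<bar>" by (intro mult_right_mono) auto
    then show ?thesis using chord[OF that] by simp
  qed
  have d1: "1 - d / 100 \<le> 1" "0 \<le> 1 - d / 100" using d by auto
  have tl: "\<bar>\<tau>\<bar> \<le> l" using tau(1) mult_left_mono[OF d1(1) less_imp_le[OF l]] by linarith
  have tgap: "l - \<bar>\<tau>\<bar> \<ge> l * (d / 100)" using tau(1) by (simp add: algebra_simps)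
  have term2: "\<bar>\<phi> (\<tau> + t) - \<phi> \<tau> - (\<psi> t - \<psi> 0)\<bar> \<le> 58 / 10 * B * \<bar>t\<bar> + \<beta> / 10 * \<bar>t\<bar>" if t1: "\<bar>t\<bar> < 1" for t
  proof -
    \<comment> \<open>Inside \<open>{- l..l}\<close> the estimate of the difference quotients applies directly. Outside, but for small \<open>t\<close>, it is
        applied at the end point \<open>y\<close> between \<open>\<tau>\<close> and \<open>\<tau> + t\<close>, and \<open>\<phi>\<close> is followed along the line from there; the errors are small
        in comparison with \<open>\<bar>t\<bar>\<close>, which is at least \<open>l * d / 100\<close>. For large \<open>t\<close> the two increments differ by
        a multiple of \<open>l\<close>, which is negligible in comparison with \<open>\<beta> * R\<close>.\<close>
    consider (A) "\<bar>\<tau> + t\<bar> \<le> l" | (B) "\<bar>\<tau> + t\<bar> > l" "\<bar>t\<bar> \<le> R / 2" | (C) "\<bar>\<tau> + t\<bar> > l" "\<bar>t\<bar> > R / 2" by linarith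
    then show ?thesis
    proof cases
      case A
      have tR: "\<bar>t\<bar> \<le> R" using A tl R l by linarith
      have c: "\<bar>\<phi> (\<tau> + t) - \<phi> \<tau> - mh * t\<bar> \<le> 58 / 10 * B * \<bar>t\<bar>"
      proof -
        have "\<tau> + t \<in> {- l..l}" using A by auto
        from chordB[OF this] show ?thesis by simp
      qed
      have e: "\<bar>(mh - m) * t\<bar> \<le> 2 * \<sigma> * \<bar>t\<bar>" unfolding abs_mult using mhm by (intro mult_right_mono) auto
      have eq: "\<phi> (\<tau> + t) - \<phi> \<tau> - (\<psi> t - \<psi> 0) = (\<phi> (\<tau> + t) - \<phi> \<tau> - mh * t) + (mh - m) * t - (\<psi> t - f x0 - m * t)"
        by (simp add: psi0 algebra_simps)
      have "\<sigma> * 6 \<le> \<sigma> * (6 + 200 / d)" using sig d by (intro mult_left_mono) auto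
      then have "3 * \<sigma> \<le> \<beta> / 10" using sb sig by linarith
      then have "3 * \<sigma> * \<bar>t\<bar> \<le> \<beta> / 10 * \<bar>t\<bar>" by (intro mult_right_mono) auto
      then show ?thesis unfolding eq using c e psi'[OF tR] by linarith
    next
      case B
      define y where "y = (if \<tau> + t > l then l else - l)"
      have y: "\<bar>y\<bar> = l" "\<bar>y - \<tau>\<bar> \<le> \<bar>t\<bar>" "y \<in> {- l..l}" using B(1) tl l by (auto simp: y_def)
      have tt: "\<bar>t\<bar> \<ge> l * (d / 100)" using B(1) tgap by linarith
      have t\<tau>: "\<bar>\<tau> + t\<bar> \<le> R" "\<bar>\<tau> + t\<bar> \<le> 2" "\<bar>t\<bar> \<le> R" "\<bar>\<tau> + t\<bar> \<le> \<bar>t\<bar> + l" using B(2) tl R l by linarith+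
      have lt: "l \<le> 100 / d * \<bar>t\<bar>" using tt d(1) by (simp add: field_simps)
      have a1: "\<bar>\<phi> (\<tau> + t) - \<psi> (\<tau> + t)\<bar> \<le> \<theta>" using out[of "\<tau> + t"] B(1) t\<tau>(2) by simp
      have a2: "\<bar>\<psi> (\<tau> + t) - f x0 - m * (\<tau> + t)\<bar> \<le> \<sigma> * \<bar>\<tau> + t\<bar>" by (rule psi'[OF t\<tau>(1)])
      have a3: "\<bar>\<phi> y - \<phi> \<tau> - mh * (y - \<tau>)\<bar> \<le> 58 / 10 * B * \<bar>t\<bar>"
        by (rule order_trans[OF chordB[OF y(3)]], rule mult_left_mono[OF y(2)]) (use B0 in simp)
      have a4: "\<bar>\<phi> y - \<psi> y\<bar> \<le> \<theta>" using out[of y] y(1) lR by simp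
      have a5: "\<bar>\<psi> y - f x0 - m * y\<bar> \<le> \<sigma> * l" using psi'[of y] y(1) lR by simp
      have a6: "\<bar>(mh - m) * (y - \<tau>)\<bar> \<le> 2 * \<sigma> * \<bar>t\<bar>" unfolding abs_mult using mhm y(2) sig by (intro mult_mono) auto
      have a7: "\<bar>\<psi> t - f x0 - m * t\<bar> \<le> \<sigma> * \<bar>t\<bar>" by (rule psi'[OF t\<tau>(3)])
      have eq: "\<phi> (\<tau> + t) - \<phi> \<tau> - (\<psi> t - \<psi> 0) = (\<phi> (\<tau> + t) - \<psi> (\<tau> + t)) + (\<psi> (\<tau> + t) - f x0 - m * (\<tau> + t))
          + (\<phi> y - \<phi> \<tau> - mh * (y - \<tau>)) - (\<phi> y - \<psi> y) - (\<psi> y - f x0 - m * y) + (mh - m) * (y - \<tau>) - (\<psi> t - f x0 - m * t)"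
        by (simp add: psi0 algebra_simps)
      have b1: "\<theta> \<le> \<sigma> * \<bar>t\<bar>"
      proof -
        have "\<sigma> * (d / 100) * l \<le> \<sigma> * \<bar>t\<bar>" using mult_left_mono[OF tt, of \<sigma>] sig by (simp add: mult_ac)
        then show ?thesis using theta by simp
      qed
      have b2: "\<sigma> * l \<le> \<sigma> * (100 / d * \<bar>t\<bar>)" using lt sig by (intro mult_left_mono) auto
      have b3: "\<sigma> * \<bar>\<tau> + t\<bar> \<le> \<sigma> * (\<bar>t\<bar> + l)" using t\<tau>(4) sig by (intro mult_left_mono) auto
      have b4: "\<sigma> * (6 + 200 / d) * \<bar>t\<bar> \<le> \<beta> / 10 * \<bar>t\<bar>" using sb by (intro mult_right_mono) auto
      have b5: "\<sigma> * (6 + 200 / d) * \<bar>t\<bar> = 6 * (\<sigma> * \<bar>t\<bar>) + 2 * (\<sigma> * (100 / d * \<bar>t\<bar>))" by (simp add: algebra_simps)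
      have b6: "\<sigma> * (\<bar>t\<bar> + l) = \<sigma> * \<bar>t\<bar> + \<sigma> * l" by (simp add: algebra_simps)
      have "\<bar>\<phi> (\<tau> + t) - \<phi> \<tau> - (\<psi> t - \<psi> 0)\<bar>
          \<le> \<theta> + \<sigma> * \<bar>\<tau> + t\<bar> + 58 / 10 * B * \<bar>t\<bar> + \<theta> + \<sigma> * l + 2 * \<sigma> * \<bar>t\<bar> + \<sigma> * \<bar>t\<bar>"
        unfolding eq by (rule abs_sum7_le[OF a1 a2 a3 a4 a5 a6 a7])
      also have "\<dots> \<le> 58 / 10 * B * \<bar>t\<bar> + (6 * (\<sigma> * \<bar>t\<bar>) + 2 * (\<sigma> * (100 / d * \<bar>t\<bar>)))"
        using b1 b2 b3 unfolding b6 by simp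
      also have "\<dots> \<le> 58 / 10 * B * \<bar>t\<bar> + \<beta> / 10 * \<bar>t\<bar>" using b4 unfolding b5 by simp
      finally show ?thesis .
    next
      case C
      have t\<tau>: "\<bar>\<tau> + t\<bar> \<le> 2" using t1 tl R l by linarith
      have a1: "\<bar>\<phi> (\<tau> + t) - \<psi> (\<tau> + t)\<bar> \<le> \<theta>" using out[of "\<tau> + t"] C(1) t\<tau> by simp
      have a2: "\<bar>\<psi> (\<tau> + t) - \<psi> t\<bar> \<le> l / 2" using lippsi[of "\<tau> + t" t] tl by simp
      have a3: "\<bar>\<phi> \<tau> - \<phi> l\<bar> \<le> 2 * l"
      proof -
        have "\<bar>\<phi> \<tau> - \<phi> l\<bar> \<le> \<Lambda> * \<bar>\<tau> - l\<bar>" by (rule lipphi)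
        also have "\<dots> \<le> 1 * (2 * l)" using Lam tl by (intro mult_mono) auto
        finally show ?thesis by simp
      qed
      have a4: "\<bar>\<psi> l - \<psi> 0\<bar> \<le> l / 2" using lippsi[of l 0] l by simp
      have "\<bar>\<phi> (\<tau> + t) - \<phi> \<tau> - (\<psi> t - \<psi> 0)\<bar> \<le> 6 * l" using a1 a2 a3 a4 outl(1) th_l1 by linarith
      also have "\<dots> \<le> \<beta> * R / 20" using lb by simp
      also have "\<dots> \<le> \<beta> / 10 * \<bar>t\<bar>" using mult_left_mono[of "R / 2" "\<bar>t\<bar>" "\<beta> / 10"] C(2) beta(1) by simp
      also have "\<dots> \<le> 58 / 10 * B * \<bar>t\<bar> + \<beta> / 10 * \<bar>t\<bar>" using B0 by simp
      finally show ?thesis .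
    qed
  qed
  have final: "\<bar>(f (z \<odot> g \<tau> \<odot> (t *\<^sub>R E0)) - f (z \<odot> g \<tau>)) - (f (x0 \<odot> (t *\<^sub>R E0)) - f x0)\<bar> \<le> 6 * \<bar>t\<bar> * B" if t1: "\<bar>t\<bar> < 1" for t
  proof -
    have "\<bar>f (z \<odot> g \<tau> \<odot> (t *\<^sub>R E0)) - \<phi> (\<tau> + t)\<bar> \<le> Lf * cdist (z \<odot> g \<tau> \<odot> (t *\<^sub>R E0)) (z \<odot> g (\<tau> + t))"
      unfolding \<phi>_def by (rule f)
    also have "\<dots> = Lf * cdist (g (\<tau> + t)) (g \<tau> \<odot> (t *\<^sub>R E0))" by (simp add: mult_assoc cdist_sym)
    also have "\<dots> \<le> \<beta> / 10 * \<bar>t\<bar>" by (rule gcls)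
    finally have a: "\<bar>f (z \<odot> g \<tau> \<odot> (t *\<^sub>R E0)) - \<phi> (\<tau> + t)\<bar> \<le> \<beta> / 10 * \<bar>t\<bar>" .
    have b: "\<beta> / 10 * \<bar>t\<bar> \<le> B / 10 * \<bar>t\<bar>" using bB by (intro mult_right_mono) auto
    have eq: "(f (z \<odot> g \<tau> \<odot> (t *\<^sub>R E0)) - f (z \<odot> g \<tau>)) - (f (x0 \<odot> (t *\<^sub>R E0)) - f x0)
      = (f (z \<odot> g \<tau> \<odot> (t *\<^sub>R E0)) - \<phi> (\<tau> + t)) + (\<phi> (\<tau> + t) - \<phi> \<tau> - (\<psi> t - \<psi> 0))"
      by (simp add: \<phi>_def \<psi>_def)
    have "58 / 10 * B * \<bar>t\<bar> + B / 10 * \<bar>t\<bar> + B / 10 * \<bar>t\<bar> = 6 * \<bar>t\<bar> * B" by (simp add: algebra_simps)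
    then show ?thesis unfolding eq using a b term2[OF t1] by linarith
  qed
  have "D - m \<ge> 97 / 10000 * d" using Dm q by linarith
  then show ?thesis using tl E' dd final unfolding B_def Q_def ex_def by blast
qed

end

section \<open>Rational approximation and deforming curves\<close>

text \<open>
  The infimum in \<open>lip_const\<close> is attained.
\<close>
lemma lip_const_bound:
  assumes f: "lipschitz_map d d' f" and d: "\<And>x y. 0 \<le> d x y"
  shows "d' (f x) (f y) \<le> lip_const d d' f * d x y" and "0 \<le> lip_const d d' f"
proof -
  define S where "S = {L. 0 \<le> L \<and> (\<forall>x y. d' (f x) (f y) \<le> L * d x y)}"
  have L: "lip_const d d' f = Inf S" by (simp add: lip_const_def S_def)
  have ne: "S \<noteq> {}" using f unfolding lipschitz_map_def S_def by blast
  show "0 \<le> lip_const d d' f" unfolding L by (rule cInf_greatest[OF ne]) (simp add: S_def)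
  show "d' (f x) (f y) \<le> lip_const d d' f * d x y"
  proof (cases "d x y = 0")
    case True
    obtain L where "L \<in> S" using ne by blast
    then have "d' (f x) (f y) \<le> L * d x y" by (simp add: S_def)
    then show ?thesis using True by simp
  next
    case False
    then have p: "d x y > 0" using d[of x y] by simp
    have "d' (f x) (f y) / d x y \<le> Inf S"
      by (rule cInf_greatest[OF ne]) (use p in \<open>auto simp: S_def pos_divide_le_eq\<close>)
    then show ?thesis using p by (simp add: L pos_divide_le_eq)
  qed
qed

text \<open>
  The last clause makes the approximation of a horizontal vector horizontal.
\<close>
lemma rational_point_dense:
  fixes v :: "real ^ 'n"
  assumes "e > 0"
  shows "\<exists>q. rational_point q \<and> norm (q - v) < e \<and> (\<forall>j. v $ j = 0 \<longrightarrow> q $ j = 0)"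
proof -
  define e' where "e' = e / (real CARD('n) + 1)"
  have e': "e' > 0" using assms by (simp add: e'_def)
  have "\<exists>q\<in>\<rat>. \<bar>q - v $ j\<bar> < e' \<and> (v $ j = 0 \<longrightarrow> q = 0)" for j
  proof (cases "v $ j = 0")
    case True
    then show ?thesis using e' by (intro bexI[of _ 0]) auto
  next
    case False
    obtain q where "q \<in> \<rat>" "v $ j - e' < q" "q < v $ j + e'"
      using Rats_dense_in_real[of "v $ j - e'" "v $ j + e'"] e' by auto
    then show ?thesis using False by (intro bexI[of _ q]) auto
  qed
  then obtain q where q: "\<And>j. q j \<in> \<rat> \<and> \<bar>q j - v $ j\<bar> < e' \<and> (v $ j = 0 \<longrightarrow> q j = 0)" by metis
  have "norm ((\<chi> j. q j) - v) \<le> (\<Sum>j\<in>UNIV. \<bar>((\<chi> j. q j) - v) $ j\<bar>)" by (rule norm_le_l1_cart)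
  also have "\<dots> \<le> (\<Sum>j\<in>(UNIV :: 'n set). e')" using q by (intro sum_mono) (simp add: less_imp_le)
  also have "\<dots> = real CARD('n) * e'" by simp
  also have "\<dots> < e" using assms by (simp add: e'_def pos_divide_less_eq algebra_simps)
  finally show ?thesis using q by (intro exI[of _ "\<chi> j. q j"]) (simp add: rational_point_def)
qed

lemma rational_point_inner:
  assumes "rational_point a" "rational_point b" shows "a \<bullet> b \<in> \<rat>"
proof -
  have "(\<Sum>j\<in>J. a $ j * b $ j) \<in> \<rat>" if "finite J" for J
    using that by (induction J rule: finite_induct) (use assms in \<open>auto simp: rational_point_def\<close>)
  then show ?thesis by (simp add: inner_vec_def)
qed

lemma rational_sequence:
  fixes v :: "real ^ 'n"
  shows "\<exists>q. (\<forall>n::nat. rational_point (q n)) \<and> q \<longlonglongrightarrow> v"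
proof -
  have "\<exists>q. \<forall>n. rational_point (q n) \<and> norm (q n - v) < 1 / (real n + 1)"
    by (rule choice) (use rational_point_dense[of "1 / (real n + 1)" v for n] in force)
  then obtain q where q: "\<And>n. rational_point (q n) \<and> norm (q n - v) < 1 / (real n + 1)" by blast
  have "(\<lambda>n. q n - v) \<longlonglongrightarrow> 0"
  proof (rule Lim_null_comparison)
    show "\<forall>\<^sub>F n in sequentially. norm (q n - v) \<le> 1 / real (Suc n)" using q by (auto simp: less_imp_le add.commute intro!: always_eventually)
    show "(\<lambda>n. 1 / real (Suc n)) \<longlonglongrightarrow> 0" using LIMSEQ_inverse_real_of_nat by (simp add: inverse_eq_divide)
  qed
  then show ?thesis using q by (auto simp: LIM_zero_iff)
qed

text \<open>
  The reflection of \<open>a\<close> in the hyperplane orthogonal to \<open>q\<close> has rational coordinates if \<open>a\<close> and \<open>q\<close> have.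
\<close>
lemma norm_reflection:
  assumes "norm a = 1" "q \<noteq> 0"
  shows "norm (a - (2 * (a \<bullet> q) / (q \<bullet> q)) *\<^sub>R q) = 1"
proof -
  have qq: "q \<bullet> q \<noteq> 0" using assms(2) by simp
  let ?c = "2 * (a \<bullet> q) / (q \<bullet> q)"
  have "(a - ?c *\<^sub>R q) \<bullet> (a - ?c *\<^sub>R q) = a \<bullet> a - ?c * (2 * (a \<bullet> q) - ?c * (q \<bullet> q))"
    by (simp add: inner_diff_left inner_diff_right inner_commute[of q a] algebra_simps)
  also have "?c * (q \<bullet> q) = 2 * (a \<bullet> q)" using qq by simp
  finally show ?thesis using assms(1) by (simp add: norm_eq_sqrt_inner)
qed

context carnot
begin

text \<open>
  The vector \<open>E0\<close> is the reflection of a basis vector \<open>a\<close> of the first layer in the hyperplane orthogonal to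
  \<open>E0 - a\<close>. Approximating \<open>E0 - a\<close> by rational horizontal vectors gives rational unit vectors.
\<close>
lemma rational_unit_sequence:
  assumes E0: "E0 \<in> layer w 1" "norm E0 = 1"
  shows "\<exists>E. (\<forall>n::nat. rational_point (E n) \<and> E n \<in> layer w 1 \<and> norm (E n) = 1) \<and> E \<longlonglongrightarrow> E0"
proof -
  have "\<exists>j. w j = 1"
  proof (rule ccontr)
    assume "\<nexists>j. w j = 1"
    then have "layer w 1 = {0}" by (simp add: layer_def)
    then show False using E0 by simp
  qed
  then obtain j where j: "w j = 1" by blast
  define a :: "real ^ 'n" where "a = axis j 1"
  have a: "a \<in> layer w 1" "norm a = 1" "rational_point a"
  proof -
    show "a \<in> layer w 1" unfolding a_def layer_def using j by (auto intro!: span_base)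
    show "norm a = 1" by (simp add: a_def)
    show "rational_point a" by (simp add: a_def rational_point_def axis_def)
  qed
  show ?thesis
  proof (cases "E0 = a")
    case True
    then show ?thesis using a by (intro exI[of _ "\<lambda>_. a"]) auto
  next
    case False
    define v where "v = E0 - a"
    have v0: "v \<noteq> 0" using False by (simp add: v_def)
    have vl: "v \<in> layer w 1" unfolding v_def by (intro subspace_diff subspace_layer E0 a)
    have "\<exists>q. \<forall>n. rational_point (q n) \<and> norm (q n - v) < 1 / (real n + 1) \<and> (\<forall>j. v $ j = 0 \<longrightarrow> q n $ j = 0)"
      by (rule choice) (use rational_point_dense[of "1 / (real n + 1)" v for n] in force)
    then obtain q where q: "\<And>n. rational_point (q n)" "\<And>n. norm (q n - v) < 1 / (real n + 1)"
      "\<And>n j. v $ j = 0 \<Longrightarrow> q n $ j = 0" by blast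
    have ql: "q n \<in> layer w 1" for n
    proof -
      have "v $ j = 0" if "w j \<noteq> 1" for j using hproj_layer[OF vl] that by (auto simp: hproj_def vec_eq_iff dest: spec[of _ j])
      then have "hproj w (q n) = q n" using q(3) by (auto simp: hproj_def vec_eq_iff)
      then show ?thesis using hproj_in_layer[of "q n"] by simp
    qed
    have "(\<lambda>n. q n - v) \<longlonglongrightarrow> 0"
    proof (rule Lim_null_comparison)
      show "\<forall>\<^sub>F n in sequentially. norm (q n - v) \<le> 1 / real (Suc n)" using q(2) by (auto simp: less_imp_le add.commute intro!: always_eventually)
      show "(\<lambda>n. 1 / real (Suc n)) \<longlonglongrightarrow> 0" using LIMSEQ_inverse_real_of_nat by (simp add: inverse_eq_divide)
    qed
    then have qlim: "q \<longlonglongrightarrow> v" by (simp add: LIM_zero_iff)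
    define E where "E = (\<lambda>n. if q n = 0 then a else a - (2 * (a \<bullet> q n) / (q n \<bullet> q n)) *\<^sub>R q n)"
    have lim: "(\<lambda>n. a - (2 * (a \<bullet> q n) / (q n \<bullet> q n)) *\<^sub>R q n) \<longlonglongrightarrow> a - (2 * (a \<bullet> v) / (v \<bullet> v)) *\<^sub>R v"
      by (intro tendsto_intros qlim) (use v0 in simp)
    have "v \<bullet> v = - 2 * (a \<bullet> v)"
    proof -
      have "E0 \<bullet> E0 = 1" "a \<bullet> a = 1" using E0(2) a(2) by (simp_all add: norm_eq_1)
      moreover have "v \<bullet> v = E0 \<bullet> E0 - 2 * (a \<bullet> E0) + a \<bullet> a"
        by (simp only: v_def inner_diff_left inner_diff_right inner_commute[of E0 a])
      moreover have "a \<bullet> v = a \<bullet> E0 - a \<bullet> a" by (simp only: v_def inner_diff_right)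
      ultimately show ?thesis by linarith
    qed
    moreover have "v \<bullet> v \<noteq> 0" using v0 by (simp only: inner_eq_zero_iff not_False_eq_True)
    ultimately have "2 * (a \<bullet> v) / (v \<bullet> v) = - 1" by (subst divide_eq_eq) auto
    then have lim': "(\<lambda>n. a - (2 * (a \<bullet> q n) / (q n \<bullet> q n)) *\<^sub>R q n) \<longlonglongrightarrow> E0" using lim by (simp add: v_def)
    have "\<forall>\<^sub>F n in sequentially. a - (2 * (a \<bullet> q n) / (q n \<bullet> q n)) *\<^sub>R q n = E n"
      using tendsto_imp_eventually_ne[OF qlim v0] by eventually_elim (simp add: E_def)
    from Lim_transform_eventually[OF lim' this] have "E \<longlonglongrightarrow> E0" .
    moreover have "rational_point (E n) \<and> E n \<in> layer w 1 \<and> norm (E n) = 1" for n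
    proof (cases "q n = 0")
      case True
      then show ?thesis using a by (simp add: E_def)
    next
      case False
      define c where "c = 2 * (a \<bullet> q n) / (q n \<bullet> q n)"
      have c: "c \<in> \<rat>" unfolding c_def
        by (intro Rats_divide Rats_mult rational_point_inner a q) auto
      have "E n = a - c *\<^sub>R q n" using False by (simp only: E_def c_def if_False)
      then have "rational_point (E n)" using a(3) q(1)[of n] c by (simp add: rational_point_def)
      moreover have "E n \<in> layer w 1"
        using False a(1) ql[of n] by (simp add: E_def subspace_diff subspace_scale subspace_layer)
      moreover have "norm (E n) = 1" using norm_reflection[OF a(2) False] False by (simp add: E_def)
      ultimately show ?thesis by blast
    qed
    ultimately show ?thesis by blast
  qed
qed

lemma tendsto_cdist:
  assumes X: "(X \<longlongrightarrow> x) F" shows "((\<lambda>n. cdist (X n) x) \<longlongrightarrow> 0) F"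
proof -
  obtain r C where rC: "r > 0" "C > 0" "\<And>a b. a \<in> cball 0 (norm x + 1) \<Longrightarrow> b \<in> cball 0 (norm x + 1) \<Longrightarrow> norm (a - b) \<le> r \<Longrightarrow>
      cdist a b \<le> C * norm (a - b) powr (1 / real s)"
    using cdist_holder_local[of "norm x + 1"] by blast
  have s0: "0 < 1 / real s" using step_pos by simp
  have n0: "((\<lambda>n. norm (X n - x)) \<longlongrightarrow> 0) F" using X by (simp add: tendsto_norm_zero LIM_zero)
  have "((\<lambda>n. C * norm (X n - x) powr (1 / real s)) \<longlongrightarrow> C * 0 powr (1 / real s)) F"
    by (intro tendsto_intros tendsto_powr' n0) (use s0 in auto)
  then have lim: "((\<lambda>n. C * norm (X n - x) powr (1 / real s)) \<longlongrightarrow> 0) F" by simp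
  have "\<forall>\<^sub>F n in F. norm (X n - x) < min r 1" using order_tendstoD(2)[OF n0, of "min r 1"] rC(1) by simp
  then have "\<forall>\<^sub>F n in F. norm (cdist (X n) x) \<le> C * norm (X n - x) powr (1 / real s)"
  proof eventually_elim
    case (elim n)
    have "norm (X n) \<le> norm x + 1" using norm_triangle_ineq2[of "X n" x] elim by simp
    then show ?case using rC(3)[of "X n" x] elim by simp
  qed
  then show ?thesis using lim by (rule Lim_null_comparison)
qed

lemma near_lines:
  assumes "\<theta> > 0"
  shows "\<exists>\<delta>>0. \<forall>z E. norm (z - x0) < \<delta> \<longrightarrow> norm (E - E0) < \<delta> \<longrightarrow>
     (\<forall>T. \<bar>T\<bar> \<le> 2 \<longrightarrow> cdist (z \<odot> (T *\<^sub>R E)) (x0 \<odot> (T *\<^sub>R E0)) \<le> \<theta>)"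
proof -
  define R1 where "R1 = norm x0 + 2 * norm E0 + 3"
  obtain L where L: "L > 0" "\<And>a b c d. a \<in> cball 0 R1 \<Longrightarrow> b \<in> cball 0 R1 \<Longrightarrow> c \<in> cball 0 R1 \<Longrightarrow> d \<in> cball 0 R1 \<Longrightarrow>
      norm (a \<odot> b - c \<odot> d) \<le> L * (norm (a - c) + norm (b - d))"
    using mult_lipschitz[of R1] by blast
  define R2 where "R2 = L * (2 * R1)"
  obtain r C where rC: "r > 0" "C > 0" "\<And>a b. a \<in> cball 0 R2 \<Longrightarrow> b \<in> cball 0 R2 \<Longrightarrow> norm (a - b) \<le> r \<Longrightarrow>
      cdist a b \<le> C * norm (a - b) powr (1 / real s)"
    using cdist_holder_local[of R2] by blast
  have s0: "real s > 0" using step_pos by simp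
  define k where "k = min r ((\<theta> / C) powr real s)"
  have k: "k > 0" using rC assms by (simp add: k_def)
  define \<delta> where "\<delta> = min 1 (k / (3 * L))"
  have \<delta>: "\<delta> > 0" using k L(1) by (simp add: \<delta>_def)
  have "cdist (z \<odot> (T *\<^sub>R E)) (x0 \<odot> (T *\<^sub>R E0)) \<le> \<theta>"
    if z: "norm (z - x0) < \<delta>" and E: "norm (E - E0) < \<delta>" and T: "\<bar>T\<bar> \<le> 2" for z E T
  proof -
    have d1: "\<delta> \<le> 1" by (simp add: \<delta>_def)
    have nz: "norm z \<le> R1" using norm_triangle_ineq2[of z x0] z d1 norm_ge_zero[of E0] unfolding R1_def by linarith
    have nE: "norm E \<le> norm E0 + 1" using norm_triangle_ineq2[of E E0] E by (simp add: \<delta>_def)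
    have "\<bar>T\<bar> * norm E \<le> 2 * (norm E0 + 1)" using T nE by (intro mult_mono) auto
    then have nTE: "norm (T *\<^sub>R E) \<le> R1"
    proof -
      have "2 * (norm E0 + 1) = 2 * norm E0 + 2" by simp
      also have "\<dots> \<le> R1" using norm_ge_zero[of x0] unfolding R1_def by linarith
      finally have "2 * (norm E0 + 1) \<le> R1" .
      then show ?thesis using \<open>\<bar>T\<bar> * norm E \<le> 2 * (norm E0 + 1)\<close> by simp
    qed
    have "\<bar>T\<bar> * norm E0 \<le> 2 * norm E0" using T by (intro mult_right_mono) auto
    then have nTE0: "norm (T *\<^sub>R E0) \<le> R1"
    proof -
      have "2 * norm E0 \<le> R1" using norm_ge_zero[of x0] unfolding R1_def by linarith
      then show ?thesis using \<open>\<bar>T\<bar> * norm E0 \<le> 2 * norm E0\<close> by simp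
    qed
    have nx0: "norm x0 \<le> R1" using norm_ge_zero[of E0] unfolding R1_def by linarith
    have R10: "0 \<le> R1" using nx0 norm_ge_zero order_trans by blast
    have bnd: "norm (a \<odot> b) \<le> R2" if "norm a \<le> R1" "norm b \<le> R1" for a b
    proof -
      have "norm (a \<odot> b - 0 \<odot> 0) \<le> L * (norm (a - 0) + norm (b - 0))" by (rule L(2)) (use that R10 in auto)
      also have "\<dots> \<le> L * (2 * R1)" using that L(1) by (intro mult_left_mono) auto
      finally show ?thesis by (simp add: R2_def)
    qed
    have "norm (z \<odot> (T *\<^sub>R E) - x0 \<odot> (T *\<^sub>R E0)) \<le> L * (norm (z - x0) + norm (T *\<^sub>R E - T *\<^sub>R E0))"
      by (rule L(2)) (use nz nTE nTE0 nx0 in auto)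
    also have "\<dots> \<le> L * (\<delta> + 2 * \<delta>)"
    proof -
      have "norm (T *\<^sub>R E - T *\<^sub>R E0) = \<bar>T\<bar> * norm (E - E0)" by (simp add: scaleR_diff_right[symmetric])
      also have "\<dots> \<le> 2 * \<delta>" using T E by (intro mult_mono) auto
      finally show ?thesis using z L(1) by (intro mult_left_mono) auto
    qed
    also have "\<dots> = 3 * L * \<delta>" by simp
    also have "\<dots> \<le> k" using L(1) by (simp add: \<delta>_def min_def field_simps)
    finally have nk: "norm (z \<odot> (T *\<^sub>R E) - x0 \<odot> (T *\<^sub>R E0)) \<le> k" .
    then have "cdist (z \<odot> (T *\<^sub>R E)) (x0 \<odot> (T *\<^sub>R E0)) \<le> C * norm (z \<odot> (T *\<^sub>R E) - x0 \<odot> (T *\<^sub>R E0)) powr (1 / real s)"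
      by (intro rC(3)) (use bnd nz nTE nTE0 nx0 in \<open>auto simp: k_def\<close>)
    also have "\<dots> \<le> C * ((\<theta> / C) powr real s) powr (1 / real s)"
      using nk rC(2) by (intro mult_left_mono powr_mono2) (auto simp: k_def)
    also have "\<dots> = \<theta>" using s0 rC(2) assms by (simp add: powr_powr)
    finally show ?thesis .
  qed
  then show ?thesis using \<delta> by blast
qed

lemma deforming_curve_lip:
  assumes "deforming_curve G w C K E u l \<Delta> \<eta> g"
  shows "cdist (g t) (g t') \<le> (1 + \<eta> * \<Delta>) * \<bar>t - t'\<bar>"
proof -
  have lm: "lipschitz_map dist cdist g" and le: "lip_const dist cdist g \<le> 1 + \<eta> * \<Delta>"
    using assms by (auto simp: deforming_curve_def)
  have "cdist (g t) (g t') \<le> lip_const dist cdist g * dist t t'" by (rule lip_const_bound(1)[OF lm]) simp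
  also have "\<dots> \<le> (1 + \<eta> * \<Delta>) * dist t t'" using le by (intro mult_right_mono) auto
  finally show ?thesis by (simp add: dist_real_def)
qed

text \<open>
  On a nondegenerate interval the condition on the derivative of \<open>hproj w \<circ> g\<close>, which may fail at finitely
  many points only, determines the direction of the line up to \<open>C * \<Delta>\<close>.
\<close>
lemma deforming_curve_slopes:
  assumes dc: "deforming_curve G w C K E u l \<Delta> \<eta> g" and E: "E \<in> layer w 1" and C: "0 \<le> C * \<Delta>"
  shows "\<exists>F. negligible F \<and> (\<forall>\<tau>. \<tau> \<notin> F \<longrightarrow> (\<exists>V\<in>layer w 1. norm (V - E) \<le> C * \<Delta> \<and> (\<exists>r>0. \<forall>h. \<bar>h\<bar> < r \<longrightarrow> g (\<tau> + h) = g \<tau> \<odot> (h *\<^sub>R V))))"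
    and "C * \<Delta> + norm (E - E0) \<le> A \<Longrightarrow> close_lines K E0 A g"
proof -
  have hc: "horizontal_curve G w g" and jl: "joins_horizontal_lines G w K g"
    and fin: "finite {t. \<not> (\<exists>D. ((hproj w \<circ> g) has_vector_derivative D) (at t) \<and> norm (D - hproj w E) \<le> C * \<Delta>)}"
    using dc by (auto simp: deforming_curve_def)
  define bad where "bad = {t. \<not> (\<exists>D. ((hproj w \<circ> g) has_vector_derivative D) (at t) \<and> norm (D - hproj w E) \<le> C * \<Delta>)}"
  have finb: "finite bad" using fin by (simp add: bad_def)
  have cont: "continuous_on UNIV g"
  proof -
    have "isCont g t" for t
    proof -
      obtain u where "horizontal_with G w (t - 1) (t + 1) g u"
        using hc unfolding horizontal_curve_def by (meson add_increasing2 diff_le_eq le_add_same_cancel1 zero_le_one order_trans less_imp_le)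
      then have "continuous_on {t - 1..t + 1} g"
        using abs_continuous_curve_continuous unfolding horizontal_with_def by blast
      then have "continuous_on {t - 1<..<t + 1} g" by (rule continuous_on_subset) auto
      then show ?thesis by (simp add: continuous_on_eq_continuous_at)
    qed
    then show ?thesis by (simp add: continuous_on_eq_continuous_at)
  qed
  obtain I :: "nat \<Rightarrow> real set" where I: "\<forall>i<K. is_interval (I i)" "(\<Union>i<K. I i) = UNIV"
    "\<forall>i<K. \<exists>q. \<exists>V\<in>layer w 1. \<forall>t\<in>I i. g t = q \<odot> (t *\<^sub>R V)"
    using jl unfolding joins_horizontal_lines_def by blast
  then obtain q V where qV: "\<And>i. i < K \<Longrightarrow> V i \<in> layer w 1 \<and> (\<forall>t\<in>I i. g t = q i \<odot> (t *\<^sub>R V i))" by metis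
  have slope: "norm (V i - E) \<le> C * \<Delta>" if i: "i < K" and xy: "x < y" "{x<..<y} \<subseteq> I i" for i x y
  proof -
    have "infinite {x<..<y}" using xy(1) by (rule infinite_Ioo)
    then have "\<not> {x<..<y} \<subseteq> bad" using finb finite_subset by blast
    then obtain t where t: "t \<in> {x<..<y}" "t \<notin> bad" by blast
    obtain D where D: "((hproj w \<circ> g) has_vector_derivative D) (at t)" "norm (D - hproj w E) \<le> C * \<Delta>"
      using t(2) by (auto simp: bad_def)
    have "((\<lambda>t. hproj w (q i) + t *\<^sub>R V i) has_vector_derivative 0 + V i) (at t)"
      by (intro has_vector_derivative_add has_vector_derivative_const scaled_has_vector_derivative)
    then have "((hproj w \<circ> g) has_vector_derivative 0 + V i) (at t)"
    proof (rule has_vector_derivative_transform_within_open[OF _ open_greaterThanLessThan t(1)])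
      fix r assume "r \<in> {x<..<y}"
      then have "g r = q i \<odot> (r *\<^sub>R V i)" using qV[OF i] xy(2) by blast
      then show "hproj w (q i) + r *\<^sub>R V i = (hproj w \<circ> g) r"
        using hproj_layer[OF conjunct1[OF qV[OF i]]] by (simp add: hproj_mult linear_cmul[OF linear_hproj])
    qed
    from vector_derivative_unique_at[OF D(1) this] show ?thesis using D(2) hproj_layer[OF E] by simp
  qed
  show "close_lines K E0 A g" if A: "C * \<Delta> + norm (E - E0) \<le> A"
  proof -
    have "norm (V i - E0) \<le> A" if "i < K" "x < y" "{x<..<y} \<subseteq> I i" for i x y
      using slope[OF that] A norm_triangle_ineq[of "V i - E" "E - E0"] by simp
    then show ?thesis unfolding close_lines_def using cont I(1,2) qV by blast
  qed
  define F where "F = (\<Union>i<K. frontier (I i))"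
  have "negligible F"
    unfolding F_def
  proof (rule negligible_Union)
    show "finite ((\<lambda>i. frontier (I i)) ` {..<K})" by simp
    fix t assume "t \<in> (\<lambda>i. frontier (I i)) ` {..<K}"
    then show "negligible t" using I(1) by (auto intro!: negligible_convex_frontier is_interval_convex)
  qed
  moreover have "\<exists>V\<in>layer w 1. norm (V - E) \<le> C * \<Delta> \<and> (\<exists>r>0. \<forall>h. \<bar>h\<bar> < r \<longrightarrow> g (\<tau> + h) = g \<tau> \<odot> (h *\<^sub>R V))" if \<tau>: "\<tau> \<notin> F" for \<tau>
  proof -
    obtain i where i: "i < K" "\<tau> \<in> I i" using I(2) by blast
    have "\<tau> \<in> interior (I i)"
      using \<tau> i closure_subset[of "I i"] by (auto simp: F_def frontier_def)
    then obtain r where r: "r > 0" "ball \<tau> r \<subseteq> I i" by (auto simp: mem_interior)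
    have gi: "g (\<tau> + h) = g \<tau> \<odot> (h *\<^sub>R V i)" if "\<bar>h\<bar> < r" for h
    proof -
      have "\<tau> + h \<in> I i" using r(2) that by (auto simp: dist_real_def)
      then have "g (\<tau> + h) = q i \<odot> ((\<tau> + h) *\<^sub>R V i)" "g \<tau> = q i \<odot> (\<tau> *\<^sub>R V i)" using qV[OF i(1)] i(2) by auto
      then show ?thesis by (simp add: mult_assoc lines)
    qed
    have "{\<tau> - r<..<\<tau> + r} \<subseteq> I i" using r(2) by (auto simp: ball_eq_greaterThanLessThan)
    then have "norm (V i - E) \<le> C * \<Delta>" using slope[OF i(1), of "\<tau> - r" "\<tau> + r"] r(1) by simp
    then show ?thesis using qV[OF i(1)] gi r(1) by blast
  qed
  ultimately show "\<exists>F. negligible F \<and> (\<forall>\<tau>. \<tau> \<notin> F \<longrightarrow> (\<exists>V\<in>layer w 1. norm (V - E) \<le> C * \<Delta> \<and> (\<exists>r>0. \<forall>h. \<bar>h\<bar> < r \<longrightarrow> g (\<tau> + h) = g \<tau> \<odot> (h *\<^sub>R V))))"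
    by blast
qed

end

section \<open>Differentiability\<close>

lemma small_power_dominates:
  fixes a b c k e e' :: real
  assumes "0 < a" "0 < b" "0 < c" "0 < k" "e < e'"
  shows "\<exists>\<Delta>1>0. \<forall>\<Delta>. 0 < \<Delta> \<longrightarrow> \<Delta> < \<Delta>1 \<longrightarrow> a * (b * \<Delta>) powr e' \<le> c * (k * \<Delta>) powr e"
proof -
  define q where "q = c * k powr e / (a * b powr e')"
  have q: "q > 0" using assms by (simp add: q_def)
  have "a * (b * \<Delta>) powr e' \<le> c * (k * \<Delta>) powr e" if D: "0 < \<Delta>" "\<Delta> < q powr (1 / (e' - e))" for \<Delta>
  proof -
    have "\<Delta> powr (e' - e) \<le> (q powr (1 / (e' - e))) powr (e' - e)"
      using D assms(5) by (intro powr_mono2) auto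
    also have "\<dots> = q" using q assms(5) by (simp add: powr_powr)
    finally have dq: "\<Delta> powr (e' - e) \<le> q" .
    have "a * (b * \<Delta>) powr e' = (a * b powr e') * (\<Delta> powr (e' - e) * \<Delta> powr e)"
      using D assms by (simp add: powr_mult powr_add[symmetric])
    also have "\<dots> \<le> (a * b powr e') * (q * \<Delta> powr e)"
      using dq assms by (intro mult_left_mono mult_right_mono) auto
    also have "\<dots> = c * (k * \<Delta>) powr e" using assms D by (simp add: q_def powr_mult)
    finally show ?thesis .
  qed
  moreover have "q powr (1 / (e' - e)) > 0" using q by simp
  ultimately show ?thesis by blast
qed

lemma has_dir_deriv_unique:
  assumes "has_dir_deriv G f E x D" "has_dir_deriv G f E x D'" shows "D = D'"
  using tendsto_unique[OF trivial_limit_at] assms unfolding has_dir_deriv_def by blast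

lemma dir_deriv_eq: "has_dir_deriv G f E x D \<Longrightarrow> dir_deriv G f E x = D"
  unfolding dir_deriv_def by (rule the_equality) (auto intro: has_dir_deriv_unique)

context carnot
begin

lemma tendsto_lipschitz:
  assumes f: "\<And>x y. \<bar>f x - f y\<bar> \<le> Lf * cdist x y" and X: "(X \<longlongrightarrow> x) F"
  shows "((\<lambda>n. f (X n)) \<longlongrightarrow> (f x :: real)) F"
proof -
  have "((\<lambda>n. f (X n) - f x) \<longlongrightarrow> 0) F"
  proof (rule Lim_null_comparison)
    show "\<forall>\<^sub>F n in F. norm (f (X n) - f x) \<le> Lf * cdist (X n) x" using f by simp
    show "((\<lambda>n. Lf * cdist (X n) x) \<longlongrightarrow> 0) F" using tendsto_mult_right_zero[OF tendsto_cdist[OF X]] by simp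
  qed
  then show ?thesis by (simp add: LIM_zero_iff)
qed

lemma tendsto_mult_group:
  assumes "X \<longlonglongrightarrow> x" "Y \<longlonglongrightarrow> y" shows "(\<lambda>n. X n \<odot> Y n) \<longlonglongrightarrow> x \<odot> y"
proof -
  have "continuous_on UNIV (\<lambda>(x, y). x \<odot> y)" using smooth_mult by (rule smooth_map_continuous_on)
  then have "isCont (\<lambda>(x, y). x \<odot> y) (x, y)" by (simp add: continuous_on_eq_continuous_at)
  from isCont_tendsto_compose[OF this tendsto_Pair[OF assms]] show ?thesis by simp
qed

text \<open>
  The requirements hold with room to spare for \<open>x0\<close>, \<open>E0\<close> and the point \<open>u0\<close> with \<open>x0 \<odot> dil w c u0 = y\<close>.
  They depend continuously on the data, so they persist along rational sequences that converge to these.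
\<close>
lemma rational_approximation:
  fixes f :: "real ^ 'n \<Rightarrow> real"
  assumes f: "\<And>x y. \<bar>f x - f y\<bar> \<le> Lf * cdist x y"
    and E0: "E0 \<in> layer w 1" "norm E0 = 1" "norm (E0 - Ec) < \<rho>"
    and c: "cdist x0 y < c" and b: "b < \<bar>f y - f x0 - m * (y \<bullet> E0 - x0 \<bullet> E0)\<bar>"
    and e: "0 < e" and \<theta>: "0 < \<theta>"
  shows "\<exists>z E u. rational_point z \<and> rational_point E \<and> rational_point u \<and> E \<in> layer w 1 \<and> norm E = 1
     \<and> norm (E - Ec) < \<rho> \<and> norm (E - E0) < e \<and> cdist u 0 \<le> 1 \<and> \<bar>dil w c u \<bullet> E\<bar> < c
     \<and> b < \<bar>f (z \<odot> dil w c u) - f x0 - m * (dil w c u \<bullet> E)\<bar>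
     \<and> (\<forall>T. \<bar>T\<bar> \<le> 2 \<longrightarrow> cdist (z \<odot> (T *\<^sub>R E)) (x0 \<odot> (T *\<^sub>R E0)) \<le> \<theta>)"
proof -
  have c0: "c > 0" using c cdist_nonneg[of x0 y] by linarith
  define u0 where "u0 = dil w (1 / c) (- x0 \<odot> y)"
  have du0: "dil w c u0 = - x0 \<odot> y" using c0 by (simp add: u0_def dil_dil)
  then have xu0: "x0 \<odot> dil w c u0 = y" using mult_assoc[of x0 "- x0" y] by simp
  have "cdist u0 0 = 1 / c * cdist x0 y"
    using cdist_dil[of "1 / c" "- x0 \<odot> y" 0] c0 cdist_0[of x0 y] by (simp add: u0_def cdist_sym)
  then have u01: "cdist u0 0 < 1" using c c0 by simp
  have ip: "dil w c u0 \<bullet> E0 = y \<bullet> E0 - x0 \<bullet> E0"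
    using inner_mult[OF E0(1), of "- x0" y] by (simp add: du0)
  have "\<bar>y \<bullet> E0 - x0 \<bullet> E0\<bar> = \<bar>(hproj w y - hproj w x0) \<bullet> E0\<bar>"
    using inner_layer[OF E0(1), of y] inner_layer[OF E0(1), of x0] by (simp add: inner_diff_left)
  also have "\<dots> \<le> cdist x0 y" using Cauchy_Schwarz_ineq2[of "hproj w y - hproj w x0" E0] hproj_cdist[of y x0] E0(2) by simp
  finally have ipc: "\<bar>dil w c u0 \<bullet> E0\<bar> < c" using c ip by simp
  obtain z where z: "\<And>n::nat. rational_point (z n)" "z \<longlonglongrightarrow> x0" using rational_sequence[of x0] by blast
  obtain u where u: "\<And>n::nat. rational_point (u n)" "u \<longlonglongrightarrow> u0" using rational_sequence[of u0] by blast
  obtain E where E: "\<And>n::nat. rational_point (E n) \<and> E n \<in> layer w 1 \<and> norm (E n) = 1" "E \<longlonglongrightarrow> E0"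
    using rational_unit_sequence[OF E0(1,2)] by blast
  obtain \<delta> where \<delta>: "\<delta> > 0" "\<And>z E T. norm (z - x0) < \<delta> \<Longrightarrow> norm (E - E0) < \<delta> \<Longrightarrow> \<bar>T\<bar> \<le> 2 \<Longrightarrow>
      cdist (z \<odot> (T *\<^sub>R E)) (x0 \<odot> (T *\<^sub>R E0)) \<le> \<theta>"
    using near_lines[OF \<theta>, of x0 E0] by blast
  have du: "(\<lambda>n. dil w c (u n)) \<longlonglongrightarrow> dil w c u0"
    by (rule bounded_linear.tendsto[OF linear_linear[THEN iffD2, OF linear_dil] u(2)])
  have i: "(\<lambda>n. dil w c (u n) \<bullet> E n) \<longlonglongrightarrow> dil w c u0 \<bullet> E0" by (intro tendsto_intros du E(2))
  have fz: "(\<lambda>n. f (z n \<odot> dil w c (u n))) \<longlonglongrightarrow> f y"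
    using tendsto_lipschitz[OF f tendsto_mult_group[OF z(2) du]] by (simp add: xu0)
  have "(\<lambda>n. \<bar>f (z n \<odot> dil w c (u n)) - f x0 - m * (dil w c (u n) \<bullet> E n)\<bar>) \<longlonglongrightarrow> \<bar>f y - f x0 - m * (dil w c u0 \<bullet> E0)\<bar>"
    by (intro tendsto_intros fz i)
  from order_tendstoD(1)[OF this, of b] b ip
  have e1: "\<forall>\<^sub>F n in sequentially. b < \<bar>f (z n \<odot> dil w c (u n)) - f x0 - m * (dil w c (u n) \<bullet> E n)\<bar>" by simp
  have e2: "\<forall>\<^sub>F n in sequentially. \<bar>dil w c (u n) \<bullet> E n\<bar> < c"
    using order_tendstoD(2)[OF tendsto_rabs[OF i] ipc] .
  have e3: "\<forall>\<^sub>F n in sequentially. norm (E n - Ec) < \<rho>"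
    by (rule order_tendstoD(2)[OF _ E0(3)]) (intro tendsto_intros E(2))
  have e4: "\<forall>\<^sub>F n in sequentially. norm (E n - E0) < min e \<delta>"
    by (rule order_tendstoD(2)[of _ 0]) (use e \<delta>(1) E(2) in \<open>auto intro!: tendsto_norm_zero simp: LIM_zero_iff\<close>)
  have e5: "\<forall>\<^sub>F n in sequentially. norm (z n - x0) < \<delta>"
    by (rule order_tendstoD(2)[of _ 0]) (use \<delta>(1) z(2) in \<open>auto intro!: tendsto_norm_zero simp: LIM_zero_iff\<close>)
  have e6: "\<forall>\<^sub>F n in sequentially. cdist (u n) u0 < 1 - cdist u0 0"
    by (rule order_tendstoD(2)[OF tendsto_cdist[OF u(2)]]) (use u01 in simp)
  have "\<forall>\<^sub>F n in sequentially. b < \<bar>f (z n \<odot> dil w c (u n)) - f x0 - m * (dil w c (u n) \<bullet> E n)\<bar>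
     \<and> \<bar>dil w c (u n) \<bullet> E n\<bar> < c \<and> norm (E n - Ec) < \<rho> \<and> norm (E n - E0) < min e \<delta> \<and> norm (z n - x0) < \<delta>
     \<and> cdist (u n) u0 < 1 - cdist u0 0"
    by (intro eventually_conj e1 e2 e3 e4 e5 e6)
  then obtain n where n: "b < \<bar>f (z n \<odot> dil w c (u n)) - f x0 - m * (dil w c (u n) \<bullet> E n)\<bar>"
     "\<bar>dil w c (u n) \<bullet> E n\<bar> < c" "norm (E n - Ec) < \<rho>" "norm (E n - E0) < min e \<delta>" "norm (z n - x0) < \<delta>"
     "cdist (u n) u0 < 1 - cdist u0 0"
    using eventually_happens'[OF sequentially_bot] by blast
  have n4: "norm (E n - E0) < e" "norm (E n - E0) < \<delta>" using n(4) by simp_all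
  have "cdist (u n) 0 \<le> 1" using cdist_triangle[of "u n" 0 u0] n(6) by linarith
  then show ?thesis using n(1-3) n4 n(5) z(1)[of n] u(1)[of n] E(1)[of n] \<delta>(2)[OF n(5) n4(2)] by blast
qed

text \<open>
  The order in which the parameters are chosen is essential. First \<open>\<eta>\<close>, \<open>\<Delta>\<close> and with them \<open>d = \<kappa> * \<Delta>\<close>,
  \<open>\<beta>\<close> and \<open>\<sigma>\<close> are determined by \<open>\<epsilon>\<close>; then \<open>R\<close> by the derivative of \<open>f\<close> at \<open>x0\<close> in the direction \<open>E0\<close>.
  Only \<open>y\<close>, \<open>l\<close>, \<open>\<theta>\<close> and the rational data depend on \<open>\<delta>\<close>, so that the gain
  \<open>c = 97 / 10000 * d\<close> is the same for all \<open>\<delta>\<close>.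
\<close>
lemma better_competitors:
  fixes f :: "real ^ 'n \<Rightarrow> real"
  assumes f: "\<And>x y. \<bar>f x - f y\<bar> \<le> Lf * cdist x y" and Lf: "0 < Lf" "Lf \<le> 1 / 2"
    and B: "B = {E \<in> layer w 1. norm (E - Ec) < \<rho>}"
    and C: "0 < C" and \<Delta>0: "\<And>\<eta>. 0 < \<eta> \<Longrightarrow> 0 < \<Delta>0 \<eta>"
    and cf: "curve_family G w B C K \<Delta>0 \<gamma>"
    and E0: "E0 \<in> B" "norm E0 = 1" and dd: "has_dir_deriv G f E0 x0 m"
    and \<epsilon>: "0 < \<epsilon>"
    and nd: "\<exists>\<^sub>F y in at x0. \<epsilon> * cdist x0 y \<le> \<bar>f y - f x0 - m * (y \<bullet> E0 - x0 \<bullet> E0)\<bar> \<and> 0 < cdist x0 y"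
  shows "\<exists>c>0. \<forall>\<delta>>0. \<exists>x E D. x \<in> curve_union G w B \<Delta>0 \<gamma> \<and> cdist x x0 \<le> \<delta> \<and> E \<in> layer w 1 \<and> norm E = 1 \<and>
     has_dir_deriv G f E x D \<and> m + c \<le> D \<and>
     (\<forall>t. \<bar>t\<bar> < 1 \<longrightarrow> \<bar>(f (x \<odot> (t *\<^sub>R E0)) - f x) - (f (x0 \<odot> (t *\<^sub>R E0)) - f x0)\<bar>
        \<le> 6 * \<bar>t\<bar> * ((D - m) * Lf) powr (1 / (2 * (real s)\<^sup>2)))"
proof -
  have E0l: "E0 \<in> layer w 1" "norm (E0 - Ec) < \<rho>" using E0(1) B by auto
  have mL: "\<bar>m\<bar> \<le> Lf" by (rule has_dir_deriv_bound[OF f less_imp_le[OF Lf(1)] E0l(1) E0(2) dd])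
  define \<kappa> where "\<kappa> = \<epsilon> / 8"
  have \<kappa>: "\<kappa> > 0" using \<epsilon> by (simp add: \<kappa>_def)
  obtain \<eta> where \<eta>: "\<eta> \<in> \<rat>" "0 < \<eta>" "\<eta> < \<kappa> / 10000" using Rats_dense_in_real[of 0 "\<kappa> / 10000"] \<kappa> by auto
  obtain CL A0 where CL: "CL > 0" "A0 > 0"
    "\<And>E A g \<tau> t. E \<in> layer w 1 \<Longrightarrow> norm E = 1 \<Longrightarrow> 0 \<le> A \<Longrightarrow> A \<le> A0 \<Longrightarrow> close_lines K E A g \<Longrightarrow>
       cdist (g (\<tau> + t)) (g \<tau> \<odot> (t *\<^sub>R E)) \<le> CL * \<bar>t\<bar> * A powr (1 / real s)"
    using close_lines_cdist[of K] by blast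
  define e where "e = 1 / (2 * (real s)\<^sup>2)"
  have s1r: "real s \<ge> 1" using step_pos by simp
  have ee: "e < 1 / real s"
  proof -
    have "real s \<le> real s * real s" using mult_right_mono[OF s1r, of "real s"] s1r by simp
    then have "real s < 2 * (real s)\<^sup>2" using s1r unfolding power2_eq_square by linarith
    then show ?thesis unfolding e_def using s1r by (intro divide_strict_left_mono) auto
  qed
  have "0 < Lf * CL" "0 < C + 1" "0 < 97 / 10000 * \<kappa> * Lf" using Lf CL C \<kappa> by simp_all
  \<comment> \<open>Here \<open>s \<ge> 1\<close> makes \<open>1 / (2 * s\<^sup>2)\<close> smaller than \<open>1 / s\<close>.\<close>
  from small_power_dominates[OF this(1,2) _ this(3) ee, of "1 / 10"]
  obtain \<Delta>1 where \<Delta>1: "\<Delta>1 > 0" "\<And>\<Delta>. 0 < \<Delta> \<Longrightarrow> \<Delta> < \<Delta>1 \<Longrightarrow>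
      Lf * CL * ((C + 1) * \<Delta>) powr (1 / real s) \<le> 1 / 10 * (97 / 10000 * \<kappa> * Lf * \<Delta>) powr e" by auto
  define \<Delta>m where "\<Delta>m = Min {\<Delta>0 \<eta>, 1, 1 / \<kappa>, 1 / (2 * C), A0 / (C + 1), \<Delta>1}"
  have "\<Delta>m > 0" using \<Delta>0[OF \<eta>(2)] \<kappa> C CL(2) \<Delta>1(1) by (simp add: \<Delta>m_def)
  then obtain \<Delta> where \<Delta>: "\<Delta> \<in> \<rat>" "0 < \<Delta>" "\<Delta> < \<Delta>m" using Rats_dense_in_real[of 0 \<Delta>m] by auto
  have \<Delta>b: "\<Delta> < \<Delta>0 \<eta>" "\<Delta> < 1" "\<Delta> < 1 / \<kappa>" "\<Delta> < 1 / (2 * C)" "\<Delta> < A0 / (C + 1)" "\<Delta> < \<Delta>1"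
    using \<Delta>(3) by (simp_all add: \<Delta>m_def)
  define d where "d = \<kappa> * \<Delta>"
  have d: "0 < d" "d \<le> 1" using \<kappa> \<Delta>(2) \<Delta>b(3) by (simp_all add: d_def field_simps)
  define \<beta> where "\<beta> = (97 / 10000 * d * Lf) powr e"
  have \<beta>: "\<beta> > 0" using d Lf by (simp add: \<beta>_def)
  have CD: "C * \<Delta> \<le> 1 / 2" using \<Delta>b(4) C by (simp add: field_simps)
  have AD: "(C + 1) * \<Delta> \<le> A0" using \<Delta>b(5) C by (simp add: field_simps)
  have LB: "Lf * CL * ((C + 1) * \<Delta>) powr (1 / real s) \<le> \<beta> / 10"
    using \<Delta>1(2)[OF \<Delta>(2) \<Delta>b(6)] by (simp add: \<beta>_def d_def mult.assoc mult.commute mult.left_commute)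
  define \<sigma> where "\<sigma> = min (d / 20000) (\<beta> / 10 / (6 + 200 / d))"
  have p6: "6 + 200 / d > 0" using d by (simp add: add_pos_pos)
  have \<sigma>: "0 < \<sigma>" "\<sigma> \<le> d / 20000"
    using d \<beta> p6 unfolding \<sigma>_def by (simp_all only: min_less_iff_conj min.cobounded1 divide_pos_pos zero_less_numeral simp_thms)
  have "\<sigma> \<le> \<beta> / 10 / (6 + 200 / d)" by (simp add: \<sigma>_def)
  then have sb: "\<sigma> * (6 + 200 / d) \<le> \<beta> / 10" by (simp only: pos_le_divide_eq[OF p6])
  have "\<forall>\<^sub>F t in at 0. dist ((f (x0 \<odot> (t *\<^sub>R E0)) - f x0) / t) m < \<sigma>"
    using dd \<sigma>(1) unfolding has_dir_deriv_def by (rule tendstoD)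
  then obtain R0 where R0: "R0 > 0" "\<And>t. t \<noteq> 0 \<Longrightarrow> \<bar>t\<bar> < R0 \<Longrightarrow> \<bar>(f (x0 \<odot> (t *\<^sub>R E0)) - f x0) / t - m\<bar> < \<sigma>"
    unfolding eventually_at by (auto simp: dist_real_def)
  define R where "R = min 1 (R0 / 2)"
  have R: "0 < R" "R \<le> 1" "R < R0" using R0(1) by (auto simp: R_def)
  have psi: "\<bar>f (x0 \<odot> (t *\<^sub>R E0)) - f x0 - m * t\<bar> \<le> \<sigma> * \<bar>t\<bar>" if t: "\<bar>t\<bar> \<le> R" for t
  proof (cases "t = 0")
    case False
    have "f (x0 \<odot> (t *\<^sub>R E0)) - f x0 - m * t = ((f (x0 \<odot> (t *\<^sub>R E0)) - f x0) / t - m) * t"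
      using False by (simp add: field_simps)
    then have "\<bar>f (x0 \<odot> (t *\<^sub>R E0)) - f x0 - m * t\<bar> = \<bar>(f (x0 \<odot> (t *\<^sub>R E0)) - f x0) / t - m\<bar> * \<bar>t\<bar>"
      by (simp only: abs_mult)
    also have "\<dots> \<le> \<sigma> * \<bar>t\<bar>" using R0(2)[OF False] t R(3) by (intro mult_right_mono) auto
    finally show ?thesis .
  qed simp
  have "\<exists>x E D. x \<in> curve_union G w B \<Delta>0 \<gamma> \<and> cdist x x0 \<le> \<delta> \<and> E \<in> layer w 1 \<and> norm E = 1 \<and>
     has_dir_deriv G f E x D \<and> m + 97 / 10000 * d \<le> D \<and>
     (\<forall>t. \<bar>t\<bar> < 1 \<longrightarrow> \<bar>(f (x \<odot> (t *\<^sub>R E0)) - f x) - (f (x0 \<odot> (t *\<^sub>R E0)) - f x0)\<bar>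
        \<le> 6 * \<bar>t\<bar> * ((D - m) * Lf) powr (1 / (2 * (real s)\<^sup>2)))" if \<delta>: "\<delta> > 0" for \<delta>
  proof -
    \<comment> \<open>An upper bound for \<open>l\<close>; the point \<open>y\<close> is then taken so close to \<open>x0\<close> that \<open>l\<close> can be chosen between
        \<open>d0 / \<Delta>\<close> and \<open>2 * d0 / \<Delta>\<close>, where \<open>d0\<close> is the distance of \<open>y\<close> from \<open>x0\<close>.\<close>
    define l1 where "l1 = Min {R / 4, \<beta> * R / 120, \<delta> / 10}"
    have l1: "0 < l1" using R \<beta> \<delta> by (simp add: l1_def)
    have l1b: "l1 \<le> R / 4" "l1 \<le> \<beta> * R / 120" "l1 \<le> \<delta> / 10" by (simp_all add: l1_def)
    have "\<forall>\<^sub>F y in at x0. cdist y x0 < l1 * \<Delta> / 2"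
      by (rule order_tendstoD(2)[OF tendsto_cdist[OF tendsto_ident_at]]) (use l1 \<Delta> in simp)
    then have "\<exists>\<^sub>F y in at x0. (\<epsilon> * cdist x0 y \<le> \<bar>f y - f x0 - m * (y \<bullet> E0 - x0 \<bullet> E0)\<bar> \<and> 0 < cdist x0 y) \<and> cdist y x0 < l1 * \<Delta> / 2"
      by (rule frequently_eventually_frequently[OF nd])
    from frequently_ex[OF this] obtain y where y: "\<epsilon> * cdist x0 y \<le> \<bar>f y - f x0 - m * (y \<bullet> E0 - x0 \<bullet> E0)\<bar>" "0 < cdist x0 y" "cdist x0 y < l1 * \<Delta> / 2"
      by (auto simp: cdist_sym)
    define d0 where "d0 = cdist x0 y"
    have "d0 / \<Delta> < 2 * d0 / \<Delta>" using y(2) \<Delta>(2) by (simp add: d0_def divide_strict_right_mono)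
    then obtain l where l: "l \<in> \<rat>" "d0 / \<Delta> < l" "l < 2 * d0 / \<Delta>" using Rats_dense_in_real by blast
    have "0 < d0 / \<Delta>" using y(2) \<Delta>(2) by (simp add: d0_def)
    then have l0: "0 < l" using l(2) by linarith
    have "2 * d0 / \<Delta> \<le> l1" using y(3) \<Delta>(2) by (simp add: d0_def field_simps)
    then have ll1: "l < l1" using l(3) by linarith
    have lR: "4 * l \<le> R" and lb: "120 * l \<le> \<beta> * R" and ld: "10 * l \<le> \<delta>" using ll1 l1b by simp_all
    have l_1: "l < 1" using lR R(2) l0 by linarith
    have c: "cdist x0 y < \<Delta> * l" using l(2) \<Delta>(2) by (simp add: d0_def field_simps)
    have "l * \<Delta> < 2 * d0" using l(3) \<Delta>(2) by (simp add: field_simps)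
    then have "2 * \<kappa> * (l * \<Delta>) < 2 * \<kappa> * (2 * d0)" using \<kappa> by (intro mult_strict_left_mono) auto
    also have "\<dots> = \<epsilon> / 2 * d0" by (simp add: \<kappa>_def)
    also have "\<dots> \<le> \<epsilon> * d0" using \<epsilon> y(2) by (simp add: d0_def)
    finally have "2 * d * l < \<epsilon> * d0" by (simp add: d_def ac_simps)
    then have b: "2 * d * l < \<bar>f y - f x0 - m * (y \<bullet> E0 - x0 \<bullet> E0)\<bar>" using y(1) by (simp add: d0_def)
    define \<theta> where "\<theta> = \<sigma> * (d / 100) * l"
    have \<theta>: "0 < \<theta>" using \<sigma> d l0 by (simp add: \<theta>_def)
    obtain z E u where ze: "rational_point z" "rational_point E" "rational_point u" "E \<in> layer w 1" "norm E = 1"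
       "norm (E - Ec) < \<rho>" "norm (E - E0) < \<Delta>" "cdist u 0 \<le> 1" "\<bar>dil w (\<Delta> * l) u \<bullet> E\<bar> < \<Delta> * l"
       "2 * d * l < \<bar>f (z \<odot> dil w (\<Delta> * l) u) - f x0 - m * (dil w (\<Delta> * l) u \<bullet> E)\<bar>"
       "\<And>T. \<bar>T\<bar> \<le> 2 \<Longrightarrow> cdist (z \<odot> (T *\<^sub>R E)) (x0 \<odot> (T *\<^sub>R E0)) \<le> \<theta>"
      using rational_approximation[OF f E0l(1) E0(2) E0l(2) c b \<Delta>(2) \<theta>] by blast
    have idx: "(E, u, l, \<Delta>, \<eta>) \<in> curve_index G w B \<Delta>0"
      using ze(2-6,8) l(1) l0 l_1 \<Delta>(1,2) \<eta>(1,2) \<Delta>b(1) by (simp add: curve_index_def B)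
    define g where "g = \<gamma> (E, u, l, \<Delta>, \<eta>)"
    have dc: "deforming_curve G w C K E u l \<Delta> \<eta> g" using cf idx unfolding curve_family_def g_def by blast
    have CD0: "0 \<le> C * \<Delta>" using C \<Delta>(2) by simp
    define \<zeta> where "\<zeta> = dil w (\<Delta> * l) u \<bullet> E"
    have gout: "\<And>t. l \<le> \<bar>t\<bar> \<Longrightarrow> g t = t *\<^sub>R E" and g\<zeta>: "g \<zeta> = dil w (\<Delta> * l) u"
      using dc by (simp_all add: deforming_curve_def \<zeta>_def)
    have glip: "\<And>t t'. cdist (g t) (g t') \<le> (1 + \<eta> * \<Delta>) * \<bar>t - t'\<bar>" by (rule deforming_curve_lip[OF dc])
    obtain F where F: "negligible F" "\<And>\<tau>. \<tau> \<notin> F \<Longrightarrow> (\<exists>V\<in>layer w 1. norm (V - E) \<le> C * \<Delta> \<and> (\<exists>r>0. \<forall>h. \<bar>h\<bar> < r \<longrightarrow> g (\<tau> + h) = g \<tau> \<odot> (h *\<^sub>R V)))"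
      using deforming_curve_slopes(1)[OF dc ze(4) CD0] by blast
    have slope: "\<exists>V\<in>layer w 1. norm (V - E) \<le> 1 / 2 \<and> (\<exists>r>0. \<forall>h. \<bar>h\<bar> < r \<longrightarrow> g (\<tau> + h) = g \<tau> \<odot> (h *\<^sub>R V))" if "\<tau> \<notin> F" for \<tau>
      using F(2)[OF that] CD order_trans by blast
    have cl: "close_lines K E0 ((C + 1) * \<Delta>) g"
      by (rule deforming_curve_slopes(2)[OF dc ze(4) CD0]) (use ze(7) in \<open>simp add: algebra_simps\<close>)
    have A0': "0 \<le> (C + 1) * \<Delta>" using C \<Delta>(2) by simp
    have gcls: "Lf * cdist (g (\<tau> + t)) (g \<tau> \<odot> (t *\<^sub>R E0)) \<le> \<beta> / 10 * \<bar>t\<bar>" for \<tau> t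
    proof -
      have "Lf * cdist (g (\<tau> + t)) (g \<tau> \<odot> (t *\<^sub>R E0)) \<le> Lf * (CL * \<bar>t\<bar> * ((C + 1) * \<Delta>) powr (1 / real s))"
        using CL(3)[OF E0l(1) E0(2) A0' AD cl] Lf by (intro mult_left_mono) auto
      also have "\<dots> = (Lf * CL * ((C + 1) * \<Delta>) powr (1 / real s)) * \<bar>t\<bar>" by simp
      also have "\<dots> \<le> \<beta> / 10 * \<bar>t\<bar>" using LB by (intro mult_right_mono) auto
      finally show ?thesis .
    qed
    have "\<Delta> * l \<le> 1 * l" using \<Delta>b(2) l0 by (intro mult_right_mono) auto
    then have z1: "\<zeta> \<in> {- l..l}" using ze(9) unfolding \<zeta>_def[symmetric] by (simp add: abs_less_iff)
    have dev: "2 * d * l \<le> \<bar>f (z \<odot> g \<zeta>) - f x0 - m * \<zeta>\<bar>" using less_imp_le[OF ze(10)] unfolding g\<zeta> \<zeta>_def[symmetric] .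
    have mu: "0 \<le> \<eta> * \<Delta>" "\<eta> * \<Delta> \<le> d / 10000"
    proof -
      show "0 \<le> \<eta> * \<Delta>" using \<eta> \<Delta> by simp
      have "\<eta> * \<Delta> \<le> \<kappa> / 10000 * \<Delta>" using \<eta> \<Delta> by (intro mult_right_mono) auto
      then show "\<eta> * \<Delta> \<le> d / 10000" by (simp add: d_def)
    qed
    obtain \<tau> E' D where T: "\<bar>\<tau>\<bar> \<le> l" "E' \<in> layer w 1" "norm E' = 1" "has_dir_deriv G f E' (z \<odot> g \<tau>) D" "D - m \<ge> 97 / 10000 * d"
      "\<forall>t. \<bar>t\<bar> < 1 \<longrightarrow> \<bar>(f (z \<odot> g \<tau> \<odot> (t *\<^sub>R E0)) - f (z \<odot> g \<tau>)) - (f (x0 \<odot> (t *\<^sub>R E0)) - f x0)\<bar>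
        \<le> 6 * \<bar>t\<bar> * ((D - m) * Lf) powr (1 / (2 * (real s)\<^sup>2))"
      using competitor_on_curve[OF f Lf ze(4,5) E0l(1) E0(2) l0 glip F(1) slope gout gcls psi ze(11) z1 dev mL d mu \<sigma>
          less_imp_le[OF \<theta>] eq_refl[OF \<theta>_def] R(1,2) lR \<beta> eq_refl[OF \<beta>_def[unfolded e_def]] sb lb] by blast
    have "z \<odot> g \<tau> \<in> curve_union G w B \<Delta>0 \<gamma>" using ze(1) idx unfolding curve_union_def g_def by blast
    moreover have "cdist (z \<odot> g \<tau>) x0 \<le> \<delta>"
    proof -
      have gl: "g l = l *\<^sub>R E" using gout[of l] l0 by simp
      have "cdist (z \<odot> g \<tau>) (z \<odot> g l) \<le> (1 + \<eta> * \<Delta>) * \<bar>\<tau> - l\<bar>" using glip[of \<tau> l] by simp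
      also have "\<dots> \<le> 2 * (2 * l)" using T(1) mu d by (intro mult_mono) auto
      finally have "cdist (z \<odot> g \<tau>) (z \<odot> g l) \<le> 4 * l" by simp
      moreover have "cdist (z \<odot> g l) z \<le> l" using cdist_line_points[OF ze(4,5), of z l 0] l0 by (simp add: gl)
      moreover have "cdist z x0 \<le> \<theta>" using ze(11)[of 0] by simp
      moreover have "\<theta> \<le> 1 * 1 * l" unfolding \<theta>_def using \<sigma> d l0 by (intro mult_mono) auto
      ultimately show ?thesis using cdist_triangle[of "z \<odot> g \<tau>" x0 "z \<odot> g l"] cdist_triangle[of "z \<odot> g l" x0 z] ld l0 by linarith
    qed
    moreover have "m + 97 / 10000 * d \<le> D" using T(5) by linarith
    ultimately show ?thesis using T(2,3,4,6) by blast
  qed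
  moreover have "97 / 10000 * d > 0" using d by simp
  ultimately show ?thesis by blast
qed

lemma hproj_dil: "hproj w (dil w c x) = c *\<^sub>R hproj w x"
  by (simp add: hproj_def dil_def vec_eq_iff)

lemma G_linear_inner:
  assumes E: "E \<in> layer w 1"
  shows "G_linear G w (\<lambda>x. m * (x \<bullet> E))"
  unfolding G_linear_def
proof (intro conjI allI impI)
  fix x y show "m * ((x \<odot> y) \<bullet> E) = m * (x \<bullet> E) + m * (y \<bullet> E)"
    by (simp add: inner_mult[OF E] distrib_left)
next
  fix c :: real and x
  show "m * (dil w c x \<bullet> E) = c * (m * (x \<bullet> E))"
    using inner_layer[OF E, of "dil w c x"] inner_layer[OF E, of x] by (simp add: hproj_dil)
qed

end

theorem theorem6p6:
  fixes G :: "(real ^ 'n) monoid" and w :: "'n \<Rightarrow> nat" and s :: nat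
    and B :: "(real ^ 'n) set" and C :: real and K :: nat and \<Delta>0 :: "real \<Rightarrow> real"
    and \<gamma> :: "(real ^ 'n) \<times> (real ^ 'n) \<times> real \<times> real \<times> real \<Rightarrow> real \<Rightarrow> real ^ 'n"
    and N :: "(real ^ 'n) set"
    and f :: "real ^ 'n \<Rightarrow> real" and x0 E0 :: "real ^ 'n"
  assumes "carnot_group G w s"
    and "CARD('n) \<noteq> 1"
    and "uniformly_deformable_ball G w B C K \<Delta>0"
    and "curve_family G w B C K \<Delta>0 \<gamma>"
    and "gdelta N"
    and "curve_union G w B \<Delta>0 \<gamma> \<subseteq> N"
    and "hausdorff_dim (cc_dist G w) N = 1"
    and "lipschitz_map (cc_dist G w) dist f"
    and "lip_const (cc_dist G w) dist f \<le> 1 / 2"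
    and "(x0, E0) \<in> dir_pairs G w N f"
    and "E0 \<in> B"
    and "\<exists>l. ((\<lambda>\<delta>. Sup {dir_deriv G f E x | x E.
                 (x, E) \<in> competitor_pairs G w s N f x0 E0 \<and> cc_dist G w x x0 \<le> \<delta>})
               \<longlongrightarrow> l) (at_right 0) \<and> l \<le> dir_deriv G f E0 x0"
  shows "has_pansu_differential G w f x0 (\<lambda>x. dir_deriv G f E0 x0 * (x \<bullet> left_field G E0 0))
       \<and> (\<forall>x. dir_deriv G f E0 x0 * (x \<bullet> left_field G E0 0)
            = dir_deriv G f E0 x0 * (hproj w x \<bullet> hproj w E0))"
proof -
  interpret carnot G w s by unfold_locales (rule assms(1))
  define m where "m = dir_deriv G f E0 x0"
  define Lf where "Lf = lip_const (cc_dist G w) dist f"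
  have f: "\<bar>f x - f y\<bar> \<le> Lf * cc_dist G w x y" for x y
    using lip_const_bound(1)[OF assms(8), of x y] by (simp add: dist_real_def Lf_def)
  have Lf0: "0 \<le> Lf" unfolding Lf_def by (rule lip_const_bound(2)[OF assms(8)]) simp
  obtain D0 where E0: "E0 \<in> layer w 1" "norm E0 = 1" and D0: "has_dir_deriv G f E0 x0 D0"
    using assms(10) by (auto simp: dir_pairs_def)
  have dd: "has_dir_deriv G f E0 x0 m" unfolding m_def dir_deriv_eq[OF D0] by (rule D0)
  have mL: "\<bar>m\<bar> \<le> Lf" by (rule has_dir_deriv_bound[OF f Lf0 E0 dd])
  have lf: "left_field G E0 0 = E0" by (rule left_field_0)
  obtain Ec \<rho> where B: "B = {E \<in> layer w 1. norm (E - Ec) < \<rho>}"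
    using assms(3) unfolding uniformly_deformable_ball_def by blast
  have "deformable G w C K \<Delta>0 E0"
    using assms(3,11) E0(2) unfolding uniformly_deformable_ball_def by blast
  then have C: "0 < C" and \<Delta>0: "\<And>\<eta>. 0 < \<eta> \<Longrightarrow> 0 < \<Delta>0 \<eta>" by (simp_all add: deformable_def)
  have "((\<lambda>y. \<bar>f y - f x0 - m * ((inv\<^bsub>G\<^esub> x0 \<odot> y) \<bullet> E0)\<bar> / cc_dist G w x0 y) \<longlongrightarrow> 0) (at x0)"
  proof (rule ccontr)
    assume "\<not> ?thesis"
    then obtain \<epsilon> where \<epsilon>: "0 < \<epsilon>" and
      "\<not> (\<forall>\<^sub>F y in at x0. dist (\<bar>f y - f x0 - m * ((inv\<^bsub>G\<^esub> x0 \<odot> y) \<bullet> E0)\<bar> / cc_dist G w x0 y) 0 < \<epsilon>)"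
      unfolding tendsto_iff by blast
    then have fr: "\<exists>\<^sub>F y in at x0. \<not> dist (\<bar>f y - f x0 - m * ((inv\<^bsub>G\<^esub> x0 \<odot> y) \<bullet> E0)\<bar> / cc_dist G w x0 y) 0 < \<epsilon>"
      by (simp only: not_eventually)
    have nd: "\<exists>\<^sub>F y in at x0. \<epsilon> * cc_dist G w x0 y \<le> \<bar>f y - f x0 - m * (y \<bullet> E0 - x0 \<bullet> E0)\<bar> \<and> 0 < cc_dist G w x0 y"
      using fr
    proof (rule frequently_elim1)
      fix y assume y: "\<not> dist (\<bar>f y - f x0 - m * ((inv\<^bsub>G\<^esub> x0 \<odot> y) \<bullet> E0)\<bar> / cc_dist G w x0 y) 0 < \<epsilon>"
      have i: "(inv\<^bsub>G\<^esub> x0 \<odot> y) \<bullet> E0 = y \<bullet> E0 - x0 \<bullet> E0" by (simp add: inv_G inner_mult[OF E0(1)])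
      have q: "\<epsilon> \<le> \<bar>f y - f x0 - m * (y \<bullet> E0 - x0 \<bullet> E0)\<bar> / cc_dist G w x0 y"
        using y unfolding i by (simp add: dist_real_def)
      then have "cc_dist G w x0 y \<noteq> 0" using \<epsilon> by (intro notI) simp
      then have p: "0 < cc_dist G w x0 y" using cdist_nonneg[of x0 y] by linarith
      then show "\<epsilon> * cc_dist G w x0 y \<le> \<bar>f y - f x0 - m * (y \<bullet> E0 - x0 \<bullet> E0)\<bar> \<and> 0 < cc_dist G w x0 y"
        using q by (simp add: pos_le_divide_eq)
    qed
    \<comment> \<open>If \<open>f\<close> is constant, then \<open>m = 0\<close> and there is nothing to deviate from.\<close>
    have Lf: "0 < Lf"
    proof (rule ccontr)
      assume "\<not> 0 < Lf"
      then have L0: "Lf = 0" using Lf0 by linarith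
      obtain y where y: "\<epsilon> * cc_dist G w x0 y \<le> \<bar>f y - f x0 - m * (y \<bullet> E0 - x0 \<bullet> E0)\<bar>" "0 < cc_dist G w x0 y"
        using frequently_ex[OF nd] by blast
      have "\<bar>f y - f x0 - m * (y \<bullet> E0 - x0 \<bullet> E0)\<bar> = 0" using f[of y x0] mL L0 by simp
      then have "\<epsilon> * cc_dist G w x0 y \<le> 0" using y(1) by simp
      moreover have "0 < \<epsilon> * cc_dist G w x0 y" using \<epsilon> y(2) by simp
      ultimately show False by linarith
    qed
    obtain c where c: "c > 0" "\<And>\<delta>. \<delta> > 0 \<Longrightarrow> \<exists>x E D. x \<in> curve_union G w B \<Delta>0 \<gamma> \<and> cc_dist G w x x0 \<le> \<delta> \<and> E \<in> layer w 1 \<and> norm E = 1 \<and>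
     has_dir_deriv G f E x D \<and> m + c \<le> D \<and>
     (\<forall>t. \<bar>t\<bar> < 1 \<longrightarrow> \<bar>(f (x \<odot> (t *\<^sub>R E0)) - f x) - (f (x0 \<odot> (t *\<^sub>R E0)) - f x0)\<bar>
        \<le> 6 * \<bar>t\<bar> * ((D - m) * Lf) powr (1 / (2 * (real s)\<^sup>2)))"
      using better_competitors[OF f Lf _ B C \<Delta>0 assms(4,11) E0(2) dd \<epsilon> nd] assms(9) unfolding Lf_def by blast
    let ?S = "\<lambda>\<delta>. {dir_deriv G f E x | x E. (x, E) \<in> competitor_pairs G w s N f x0 E0 \<and> cc_dist G w x x0 \<le> \<delta>}"
    have low: "m + c \<le> Sup (?S \<delta>)" if \<delta>: "\<delta> > 0" for \<delta>
    proof -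
      obtain x E D where x: "x \<in> curve_union G w B \<Delta>0 \<gamma>" "cc_dist G w x x0 \<le> \<delta>" "E \<in> layer w 1" "norm E = 1"
        "has_dir_deriv G f E x D" "m + c \<le> D"
        "\<And>t. \<bar>t\<bar> < 1 \<Longrightarrow> \<bar>(f (x \<odot> (t *\<^sub>R E0)) - f x) - (f (x0 \<odot> (t *\<^sub>R E0)) - f x0)\<bar>
          \<le> 6 * \<bar>t\<bar> * ((D - m) * Lf) powr (1 / (2 * (real s)\<^sup>2))"
        using c(2)[OF \<delta>] by blast
      have "(x, E) \<in> dir_pairs G w N f" using x(1,3,4,5) assms(6) by (auto simp: dir_pairs_def)
      moreover have "m \<le> D" using x(6) c(1) by linarith
      moreover have "\<bar>t\<bar> < 1" if "t \<in> {-1<..<1}" for t :: real using that by auto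
      ultimately have "(x, E) \<in> competitor_pairs G w s N f x0 E0"
        unfolding competitor_pairs_def m_def Lf_def
        using x(7)[unfolded m_def Lf_def] by (simp add: dir_deriv_eq[OF x(5)] m_def)
      then have "D \<in> ?S \<delta>" using x(2) dir_deriv_eq[OF x(5)] by blast
      moreover have "bdd_above (?S \<delta>)"
      proof (rule bdd_aboveI)
        fix r assume "r \<in> ?S \<delta>"
        then obtain x' E' where r: "r = dir_deriv G f E' x'" and "(x', E') \<in> competitor_pairs G w s N f x0 E0" by blast
        then have "(x', E') \<in> dir_pairs G w N f" by (simp add: competitor_pairs_def)
        then obtain D' where "E' \<in> layer w 1" "norm E' = 1" and D': "has_dir_deriv G f E' x' D'"
          by (auto simp: dir_pairs_def)
        then have "\<bar>D'\<bar> \<le> Lf" by (intro has_dir_deriv_bound[OF f Lf0])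
        then show "r \<le> Lf" using r dir_deriv_eq[OF D'] by linarith
      qed
      ultimately have "D \<le> Sup (?S \<delta>)" by (rule cSup_upper)
      then show ?thesis using x(6) by linarith
    qed
    obtain l where l: "((\<lambda>\<delta>. Sup (?S \<delta>)) \<longlongrightarrow> l) (at_right 0)" "l \<le> m" using assms(12) unfolding m_def by blast
    have "\<forall>\<^sub>F \<delta> in at_right (0::real). m + c \<le> Sup (?S \<delta>)"
      by (rule eventually_at_rightI[of 0 1]) (use low in auto)
    then have "m + c \<le> l" by (rule tendsto_lowerbound[OF l(1)]) simp
    then show False using l(2) c(1) by linarith
  qed
  moreover have "m * (x \<bullet> E0) = m * (hproj w x \<bullet> hproj w E0)" for x
    using inner_layer[OF E0(1), of x] hproj_layer[OF E0(1)] by simp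
  ultimately show ?thesis
    unfolding has_pansu_differential_def lf m_def[symmetric] using G_linear_inner[OF E0(1)] by blast
qed

end
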